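(* Consider the Hill operator with potential $v(x)=ae^{-2Rix}+be^{2Six}$, where $a,b\in\mathbb{C}\setminus\{0\}$, $R,S\in\mathbb{N}$, $R\ne S$, and write $R=dr$, $S=ds$ with $r,s$ coprime. Then there are choices, for every $m$, of square roots $\sqrt{b^{rm}}$ of $b^{rm}$ and $\sqrt{a^{sm}}$ of $a^{sm}$ such that, for $n=mdsr$, $m\in\mathbb{N}$, $m\to\infty$, $$\gamma_n\sim\frac{8srd^2\sqrt{b^{rm}}\sqrt{a^{sm}}}{(2d)^{(r+s)m}s^{rm}r^{sm}(rm-1)!(sm-1)!}$$ and $$\mu_n-\lambda_n^\pm\sim-\frac12\left(\frac{2sd\sqrt{b^{rm}}}{(2sd)^{rm}(rm-1)!}\pm\frac{2rd\sqrt{a^{sm}}}{(2rd)^{sm}(sm-1)!}\right)^2.$$ Moreover, $$\mu_n-\frac12(\lambda_n^-+\lambda_n^+)\sim-\frac12\left(\frac{4s^2d^2b^{rm}}{(4s^2d^2)^{rm}[(rm-1)!]^2}+\frac{4r^2d^2a^{sm}}{(4r^2d^2)^{sm}[(sm-1)!]^2}\right).$$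
   Context: The Hill operator is $Ly=-y''+v(x)y$ on $[0,\pi]$, considered with Dirichlet conditions $y(0)=y(\pi)=0$, periodic conditions $Per^+$ or antiperiodic conditions $Per^-$: $y(\pi)=\pm y(0)$, $y'(\pi)=\pm y'(0)$. For large enough $n\in\mathbb{N}$ the disc $|\lambda-n^2|<n/4$ contains exactly one Dirichlet eigenvalue $\mu_n$ and exactly two eigenvalues $\lambda_n^-,\lambda_n^+$ (counted with multiplicity), periodic if $n$ is even and antiperiodic if $n$ is odd. $\lambda_n^+$ denotes the one with larger real part (larger imaginary part if the real parts are equal), and $\gamma_n=\lambda_n^+-\lambda_n^-$. $f\sim g$ means that the ratio $f/g$ tends to $1$ along the indicated indices. A formula with $\pm$ stands for two formulas, one with all upper signs and one with all lower signs. *)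

theory Defs
  imports "HOL-Analysis.Analysis" "HOL-Library.Function_Algebras"
    "HOL-Library.Landau_Symbols" "HOL-Library.Multiset"
begin

datatype bdry = Dirichlet | Periodic | Antiperiodic

text \<open>
  A function on \<open>[0,\<pi>]\<close> is represented by its extension by \<open>0\<close> to the real line, so that
  distinct functions on the line in the domain are distinct on the interval (this matters
  for linear independence). All derivatives are taken within \<open>[0,\<pi>]\<close>, hence are
  one-sided at the end points.
\<close>

definition deriv_0pi :: "(real \<Rightarrow> complex) \<Rightarrow> real \<Rightarrow> complex" where
  "deriv_0pi y x = (if x \<in> {0..pi} then vector_derivative y (at x within {0..pi}) else 0)"

definition C2_0pi :: "(real \<Rightarrow> complex) set" where
  "C2_0pi = {y. (\<forall>x. x \<notin> {0..pi} \<longrightarrow> y x = 0) \<and>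
                y differentiable_on {0..pi} \<and>
                deriv_0pi y differentiable_on {0..pi} \<and>
                continuous_on {0..pi} (deriv_0pi (deriv_0pi y))}"

fun bdry_cond :: "bdry \<Rightarrow> (real \<Rightarrow> complex) \<Rightarrow> bool" where
  "bdry_cond Dirichlet y \<longleftrightarrow> y 0 = 0 \<and> y pi = 0"
| "bdry_cond Periodic y \<longleftrightarrow> y pi = y 0 \<and> deriv_0pi y pi = deriv_0pi y 0"
| "bdry_cond Antiperiodic y \<longleftrightarrow> y pi = - y 0 \<and> deriv_0pi y pi = - deriv_0pi y 0"

definition hill_dom :: "bdry \<Rightarrow> (real \<Rightarrow> complex) set" where
  "hill_dom bc = {y \<in> C2_0pi. bdry_cond bc y}"

definition hill_op :: "(real \<Rightarrow> complex) \<Rightarrow> (real \<Rightarrow> complex) \<Rightarrow> real \<Rightarrow> complex" where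
  "hill_op v y = (\<lambda>x. - deriv_0pi (deriv_0pi y) x + v x * y x)"

definition hill_eigenvalue :: "bdry \<Rightarrow> (real \<Rightarrow> complex) \<Rightarrow> complex \<Rightarrow> bool" where
  "hill_eigenvalue bc v z \<longleftrightarrow>
     (\<exists>y \<in> hill_dom bc. y \<noteq> (\<lambda>_. 0) \<and> hill_op v y = (\<lambda>x. z * y x))"

text \<open>The kernel of the \<open>k\<close>-th power of the unbounded operator \<open>L - z\<close>.\<close>

primrec hill_ker :: "bdry \<Rightarrow> (real \<Rightarrow> complex) \<Rightarrow> complex \<Rightarrow> nat \<Rightarrow> (real \<Rightarrow> complex) set" where
  "hill_ker bc v z 0 = {\<lambda>_. 0}"
| "hill_ker bc v z (Suc k) =
     {y \<in> hill_dom bc. (\<lambda>x. hill_op v y x - z * y x) \<in> hill_ker bc v z k}"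

global_interpretation cfun: vector_space "\<lambda>(c::complex) (f::real \<Rightarrow> complex) x. c * f x"
  by unfold_locales (auto simp: fun_eq_iff algebra_simps)

text \<open>Algebraic multiplicity, i.e. the complex dimension of the root subspace.\<close>

definition hill_mult :: "bdry \<Rightarrow> (real \<Rightarrow> complex) \<Rightarrow> complex \<Rightarrow> nat" where
  "hill_mult bc v z = cfun.dim (\<Union>k. hill_ker bc v z k)"

definition hill_disc :: "nat \<Rightarrow> complex set" where
  "hill_disc n = {z. cmod (z - (of_nat n)\<^sup>2) < real n / 4}"

definition parity_bdry :: "nat \<Rightarrow> bdry" where
  "parity_bdry n = (if even n then Periodic else Antiperiodic)"

definition lex_le :: "complex \<Rightarrow> complex \<Rightarrow> bool" where
  "lex_le z w \<longleftrightarrow> Re z < Re w \<or> (Re z = Re w \<and> Im z \<le> Im w)"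

definition eig_pair :: "(real \<Rightarrow> complex) \<Rightarrow> nat \<Rightarrow> complex \<Rightarrow> complex \<Rightarrow> bool" where
  "eig_pair v n l u \<longleftrightarrow>
     l \<in> hill_disc n \<and> u \<in> hill_disc n \<and> lex_le l u \<and>
     (\<forall>z \<in> hill_disc n. hill_mult (parity_bdry n) v z = count {#l, u#} z)"

text \<open>
  The descriptions below are proper only when the disc contains exactly one Dirichlet
  eigenvalue and exactly two (anti)periodic ones, which is the case for all large \<open>n\<close>;
  for the remaining \<open>n\<close> the values are unspecified.
\<close>

definition hill_mu :: "(real \<Rightarrow> complex) \<Rightarrow> nat \<Rightarrow> complex" where
  "hill_mu v n = (THE z. z \<in> hill_disc n \<and> hill_eigenvalue Dirichlet v z)"

definition hill_lambda_minus :: "(real \<Rightarrow> complex) \<Rightarrow> nat \<Rightarrow> complex" where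
  "hill_lambda_minus v n = (THE l. \<exists>u. eig_pair v n l u)"

definition hill_lambda_plus :: "(real \<Rightarrow> complex) \<Rightarrow> nat \<Rightarrow> complex" where
  "hill_lambda_plus v n = (THE u. \<exists>l. eig_pair v n l u)"

definition hill_gamma :: "(real \<Rightarrow> complex) \<Rightarrow> nat \<Rightarrow> complex" where
  "hill_gamma v n = hill_lambda_plus v n - hill_lambda_minus v n"

definition two_term_potential :: "complex \<Rightarrow> complex \<Rightarrow> nat \<Rightarrow> nat \<Rightarrow> real \<Rightarrow> complex" where
  "two_term_potential a b R S x =
     a * exp (- 2 * of_nat R * \<i> * of_real x) + b * exp (2 * of_nat S * \<i> * of_real x)"

end

theory Submission
  imports Defs
begin

text \<open>
  Write the spectral parameter as \<open>n\<^sup>2 + z\<close> and expand in the modes \<open>exp (\<i> (2 j - n) x)\<close>, which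
  satisfy the (anti)periodic conditions. The eigenvalue equation becomes the recurrence
  \<open>(4 j (n - j) + z) u j = a u (j + R) + b u (j - S)\<close>, singular only near the two resonant indices
  \<open>0\<close> and \<open>n\<close>. Solving it off these indices leaves the equation \<open>(\<alpha> z - z)\<^sup>2 = p z * q z\<close>, where
  \<open>p z\<close> and \<open>q z\<close> are asymptotic to the products \<open>K\<close>, \<open>K'\<close> along the straight chains of
  \<open>b\<close>-steps from \<open>0\<close> to \<open>n\<close> and of \<open>a\<close>-steps from \<open>n\<close> to \<open>0\<close>. Hence the two eigenvalues differ
  by about \<open>2 sqrt (K K')\<close>. A Dirichlet eigenfunction is close to \<open>sin (n x)\<close>, that is, to a multiple
  of the difference of the two resonant modes; pairing it with the solutions of the recurrence
  gives \<open>z \<approx> \<alpha> z - (K + K') / 2\<close> for the Dirichlet eigenvalue. Since \<open>r \<noteq> s\<close>, one of \<open>K\<close>, \<open>K'\<close>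
  dominates the other, so no cancellation occurs in the sums.
\<close>

section \<open>The recurrence off the resonant indices\<close>

text \<open>The leading terms \<open>K\<close> and \<open>K'\<close> decrease like inverse squared
  factorials, whereas ordinary perturbation bounds only gain a power of \<open>n\<close>. Every
  estimate of an off-diagonal entry therefore has to be relative to \<open>K\<close> or
  \<open>K'\<close>. Solutions are measured against a weight that solves the chain recurrence
  exactly, and the smallness comes from the sum of the inverse gaps, which is O(n^(-1/2)). The
  diagonal entry \<open>\<alpha> z\<close> is never computed: it is common to the periodic and the
  Dirichlet equation, and a small Lipschitz constant is enough to cancel it from the differences of
  eigenvalues. Since \<open>sqrt (K K')\<close> is negligible against \<open>K + K'\<close>, the
  asymptotics of \<open>\<mu> - \<lambda>\<close> do not distinguish the two roots, so it never has
  to be decided which of them is the larger; only the gap fixes the sign of the product of the two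
  square roots. The fine estimates hold for bounded \<open>z\<close>, while the disc has radius
  \<open>n / 4\<close>; hence each kind of eigenvalue is first confined to bounded shifts.\<close>

definition gap :: "nat \<Rightarrow> int \<Rightarrow> int" where
  "gap n j = 4 * j * (int n - j)"

definition hill_V :: "complex \<Rightarrow> complex \<Rightarrow> nat \<Rightarrow> nat \<Rightarrow> (int \<Rightarrow> complex) \<Rightarrow> int \<Rightarrow> complex" where
  "hill_V a b R S u j = a * u (j + int R) + b * u (j - int S)"

text \<open>Nothing is imposed at \<open>0\<close> and \<open>n\<close>: the values there are free
  parameters, and the residuals there become the entries of the reduced matrix. The source
  \<open>f\<close> serves twice, for the defect of a straight chain and for differences in the
  spectral parameter. Boundedness is enough for uniqueness and, for \<open>f = 0\<close>, improves
  itself to rapid decay.\<close>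

definition red_sol ::
  "complex \<Rightarrow> complex \<Rightarrow> nat \<Rightarrow> nat \<Rightarrow> nat \<Rightarrow> complex \<Rightarrow> (int \<Rightarrow> complex) \<Rightarrow> (int \<Rightarrow> complex) \<Rightarrow> bool" where
  "red_sol a b R S n z f u \<longleftrightarrow> bounded (range u) \<and>
     (\<forall>j. j \<noteq> 0 \<longrightarrow> j \<noteq> int n \<longrightarrow> (of_int (gap n j) + z) * u j = hill_V a b R S u j + f j)"

lemma gap_reflect: "gap n (int n - j) = gap n j"
  by (simp add: gap_def algebra_simps)

lemma gap_pos: "0 < j \<Longrightarrow> j < int n \<Longrightarrow> gap n j \<ge> 4 * (int n - 1)"
proof -
  assume j: "0 < j" "j < int n"
  have "(j - 1) * (int n - j - 1) \<ge> 0" using j by (intro mult_nonneg_nonneg) auto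
  thus ?thesis by (simp add: gap_def algebra_simps)
qed

lemma gap_neg: assumes "j < 0 \<or> j > int n" shows "gap n j \<le> - 4 * (int n + 1)"
proof -
  have *: "gap n j \<le> - 4 * (int n + 1)" if j: "j < 0" for j
  proof -
    have "(- j - 1) * (int n - j) \<ge> 0" using j by (intro mult_nonneg_nonneg) auto
    thus ?thesis using j by (simp add: gap_def algebra_simps)
  qed
  show ?thesis
  proof (cases "j < 0")
    case False
    with assms have "int n - j < 0" by auto
    from *[OF this] show ?thesis by (simp add: gap_reflect)
  qed (rule *)
qed

lemma abs_gap_ge:
  assumes "n \<ge> 2" "j \<noteq> 0" "j \<noteq> int n"
  shows "\<bar>gap n j\<bar> \<ge> 2 * int n"
proof -
  have n2: "int n \<ge> 2" using assms(1) by simp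
  consider "0 < j \<and> j < int n" | "j < 0 \<or> j > int n" using assms by linarith
  thus ?thesis
  proof cases
    case 1
    hence "gap n j \<ge> 4 * (int n - 1)" by (intro gap_pos) auto
    with n2 show ?thesis by (simp add: abs_if)
  next
    case 2
    from gap_neg[OF this] n2 show ?thesis by (simp add: abs_if)
  qed
qed

lemma gap_plus_ge:
  assumes "n \<ge> 2" "j \<noteq> 0" "j \<noteq> int n" "cmod z \<le> real n"
  shows "cmod (of_int (gap n j) + z) \<ge> \<bar>real_of_int (gap n j)\<bar> / 2"
    and "cmod (of_int (gap n j) + z) \<ge> real n"
proof -
  have "\<bar>real_of_int (gap n j)\<bar> \<ge> 2 * real n"
  proof -
    have "real_of_int (2 * int n) \<le> real_of_int \<bar>gap n j\<bar>"
      using abs_gap_ge[OF assms(1-3)] by (simp only: of_int_le_iff)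
    thus ?thesis by simp
  qed
  moreover have "cmod (of_int (gap n j) + z) \<ge> \<bar>real_of_int (gap n j)\<bar> - cmod z"
    using norm_diff_ineq[of "of_int (gap n j) :: complex" z] by simp
  ultimately show "cmod (of_int (gap n j) + z) \<ge> \<bar>real_of_int (gap n j)\<bar> / 2"
    "cmod (of_int (gap n j) + z) \<ge> real n" using assms(4) by linarith+
qed

text \<open>A positive supersolution dominates the bounded solution: the excess of \<open>\<bar>u\<bar>\<close> over \<open>g\<close>
  is contracted by the equation.\<close>

lemma red_sol_comparison:
  assumes sol: "red_sol a b R S n z f u"
    and u0: "u 0 = 0" "u (int n) = 0"
    and n: "n \<ge> 2" "cmod z \<le> real n" "2 * (cmod a + cmod b) \<le> real n"
    and g: "\<And>j. g j \<ge> 0"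
    and super: "\<And>j. j \<noteq> 0 \<Longrightarrow> j \<noteq> int n \<Longrightarrow>
      cmod a * g (j + int R) + cmod b * g (j - int S) + cmod (f j) \<le> cmod (of_int (gap n j) + z) * g j"
  shows "cmod (u j) \<le> g j"
proof -
  define ex where "ex j = max 0 (cmod (u j) - g j)" for j
  obtain B where B: "\<And>j. cmod (u j) \<le> B"
    using sol by (auto simp: red_sol_def bounded_iff)
  have "ex j \<le> max 0 B" for j
    unfolding ex_def using B[of j] g[of j] by linarith
  hence bdd: "bdd_above (range ex)" by (rule bdd_aboveI2)
  define m where "m = Sup (range ex)"
  have exm: "ex j \<le> m" for j unfolding m_def by (rule cSUP_upper[OF _ bdd]) simp
  have m0: "m \<ge> 0" using exm[of 0] by (simp add: ex_def)
  \<comment> \<open>Off the resonant indices the denominator is at least \<open>n\<close>, while the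
    two shifts carry at most \<open>(|a| + |b|) m \<le> n m / 2\<close> of the excess.\<close>
  have step: "ex j \<le> m / 2" for j
  proof (cases "j = 0 \<or> j = int n \<or> cmod (u j) \<le> g j")
    case True
    thus ?thesis using u0 g[of j] m0 by (auto simp: ex_def)
  next
    case False
    let ?d = "cmod (of_int (gap n j) + z)"
    have d: "?d \<ge> real n" using gap_plus_ge(2)[of n j z] False n by auto
    have "?d * cmod (u j) = cmod (hill_V a b R S u j + f j)"
      using sol False by (metis norm_mult red_sol_def)
    also have "\<dots> \<le> cmod a * cmod (u (j + int R)) + cmod b * cmod (u (j - int S)) + cmod (f j)"
      unfolding hill_V_def norm_mult[symmetric]
      by (intro order_trans[OF norm_triangle_ineq] add_mono order_refl)
    also have "\<dots> \<le> cmod a * (g (j + int R) + m) + cmod b * (g (j - int S) + m) + cmod (f j)"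
      using exm[of "j + int R"] exm[of "j - int S"]
      by (intro add_mono mult_left_mono) (auto simp: ex_def)
    also have "\<dots> \<le> ?d * g j + (cmod a + cmod b) * m"
      using super[of j] False by (simp add: algebra_simps)
    finally have "?d * (cmod (u j) - g j) \<le> (cmod a + cmod b) * m" by (simp add: algebra_simps)
    also have "\<dots> \<le> real n / 2 * m" using n(3) m0 by (intro mult_right_mono) auto
    finally have "?d * (cmod (u j) - g j) \<le> real n / 2 * m" .
    moreover have "real n * (cmod (u j) - g j) \<le> ?d * (cmod (u j) - g j)"
      using False d by (intro mult_right_mono) auto
    ultimately have "real n * (cmod (u j) - g j) \<le> real n * (m / 2)" by simp
    hence "cmod (u j) - g j \<le> m / 2" using n(1) by (subst (asm) mult_le_cancel_left_pos) auto
    thus ?thesis using m0 unfolding ex_def by linarith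
  qed
  have "m \<le> m / 2" unfolding m_def by (rule cSUP_least) (use step in \<open>auto simp: m_def\<close>)
  hence "m \<le> 0" using m0 by simp
  thus ?thesis using exm[of j] by (simp add: ex_def)
qed

lemma red_sol_add:
  assumes "red_sol a b R S n z f u" "red_sol a b R S n z g w"
  shows "red_sol a b R S n z (\<lambda>j. c * f j + e * g j) (\<lambda>j. c * u j + e * w j)"
proof -
  obtain B1 B2 where "\<And>j. cmod (u j) \<le> B1" "\<And>j. cmod (w j) \<le> B2"
    using assms by (auto simp: red_sol_def bounded_iff)
  hence "cmod (c * u j + e * w j) \<le> cmod c * B1 + cmod e * B2" for j
    by (intro norm_triangle_le) (auto simp: norm_mult intro!: add_mono mult_left_mono)
  hence "bounded (range (\<lambda>j. c * u j + e * w j))" by (auto simp: bounded_iff)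
  moreover have "(of_int (gap n j) + z) * (c * u j + e * w j) =
      hill_V a b R S (\<lambda>j. c * u j + e * w j) j + (c * f j + e * g j)"
    if "j \<noteq> 0" "j \<noteq> int n" for j
  proof -
    have "(of_int (gap n j) + z) * u j = hill_V a b R S u j + f j"
      "(of_int (gap n j) + z) * w j = hill_V a b R S w j + g j"
      using assms that by (auto simp: red_sol_def)
    note eq = this
    have "(of_int (gap n j) + z) * (c * u j + e * w j) =
      c * ((of_int (gap n j) + z) * u j) + e * ((of_int (gap n j) + z) * w j)"
      by (simp add: algebra_simps)
    thus ?thesis unfolding eq by (simp add: hill_V_def algebra_simps)
  qed
  ultimately show ?thesis unfolding red_sol_def by blast
qed

lemma red_sol_zero:
  assumes "red_sol a b R S n z (\<lambda>_. 0) u" "u 0 = 0" "u (int n) = 0"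
    and "n \<ge> 2" "cmod z \<le> real n" "2 * (cmod a + cmod b) \<le> real n"
  shows "u j = 0"
  using red_sol_comparison[OF assms, of "\<lambda>_. 0"] by simp

text \<open>Dividing by the denominator and prescribing the two resonant values gives a map
  \<open>T\<close> that contracts sup-norm differences by the factor 1/2. Its iterates from
  \<open>0\<close> therefore converge pointwise with a geometric rate, and the bound and the
  equation pass to the limit.\<close>

lemma red_sol_exists:
  assumes n: "n \<ge> 2" "cmod z \<le> real n" "2 * (cmod a + cmod b) \<le> real n"
    and f: "bounded (range f)"
  shows "\<exists>u. red_sol a b R S n z f u \<and> u 0 = c \<and> u (int n) = e"
proof -
  define T :: "(int \<Rightarrow> complex) \<Rightarrow> int \<Rightarrow> complex" where
    "T u j = (if j = 0 then c else if j = int n then e else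
       (hill_V a b R S u j + f j) / (of_int (gap n j) + z))" for u j
  have npos: "real n > 0" using n by simp
  obtain B where B: "\<And>j. cmod (f j) \<le> B" using f by (auto simp: bounded_iff)
  have den: "cmod (of_int (gap n j) + z) \<ge> real n" if "j \<noteq> 0" "j \<noteq> int n" for j
    using gap_plus_ge(2)[of n j z] that n by auto
  have V: "cmod (hill_V a b R S u j) \<le> real n / 2 * C" if "\<And>j. cmod (u j) \<le> C" for u C j
  proof -
    have "cmod (hill_V a b R S u j) \<le> cmod a * C + cmod b * C"
      unfolding hill_V_def by (rule norm_triangle_le) (simp add: norm_mult add_mono mult_left_mono that)
    also have "\<dots> = (cmod a + cmod b) * C" by (simp add: algebra_simps)
    also have "\<dots> \<le> real n / 2 * C"
      using n(3) order_trans[OF norm_ge_zero that[of 0]] by (intro mult_right_mono) auto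
    finally show ?thesis .
  qed
  \<comment> \<open>Chosen so that \<open>D / 2 + B \<le> D\<close> and \<open>D\<close> bounds both
    prescribed values, which makes the ball of radius \<open>D\<close> invariant under
    \<open>T\<close>.\<close>
  define D where "D = cmod c + cmod e + 2 * B"
  have B0: "B \<ge> 0" using order_trans[OF norm_ge_zero B] by blast
  have T_bound: "cmod (T u j) \<le> D" if "\<And>j. cmod (u j) \<le> D" for u j
  proof (cases "j = 0 \<or> j = int n")
    case False
    have "cmod (T u j) = cmod (hill_V a b R S u j + f j) / cmod (of_int (gap n j) + z)"
      unfolding T_def using False by (simp add: norm_divide)
    also have "\<dots> \<le> (real n / 2 * D + B) / real n"
      using False by (intro frac_le den norm_triangle_le add_mono V that B npos) (auto simp: D_def B0)
    also have "\<dots> = D / 2 + B / real n" using npos by (simp add: field_simps)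
    also have "\<dots> \<le> D / 2 + B" using n(1) B0 by (simp add: field_simps mult_le_cancel_left1)
    also have "\<dots> \<le> D" by (simp add: D_def)
    finally show ?thesis .
  qed (auto simp: T_def D_def B0)
  have T_contr: "cmod (T x j - T y j) \<le> C / 2" if d: "\<And>j. cmod (x j - y j) \<le> C" for x y C j
  proof (cases "j = 0 \<or> j = int n")
    case False
    have "hill_V a b R S x j - hill_V a b R S y j = hill_V a b R S (\<lambda>j. x j - y j) j"
      by (simp add: hill_V_def algebra_simps)
    hence "cmod (T x j - T y j) = cmod (hill_V a b R S (\<lambda>j. x j - y j) j) / cmod (of_int (gap n j) + z)"
      unfolding T_def using False by (simp add: diff_divide_distrib[symmetric] norm_divide)
    also have "\<dots> \<le> (real n / 2 * C) / real n"
      using False order_trans[OF norm_ge_zero d] by (intro frac_le den V d npos) auto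
    finally show ?thesis using npos by simp
  qed (use order_trans[OF norm_ge_zero d] in \<open>auto simp: T_def\<close>)
  define x where "x k = (T ^^ k) (\<lambda>_. 0)" for k
  have x_Suc: "x (Suc k) = T (x k)" for k by (simp add: x_def)
  have x_bound: "cmod (x k j) \<le> D" for k j
    by (induction k arbitrary: j) (auto simp: x_Suc T_bound, simp add: x_def D_def B0)
  have x_step: "cmod (x (Suc k) j - x k j) \<le> D * (1/2) ^ k" for k j
  proof (induction k arbitrary: j)
    case 0
    show ?case using x_bound[of "Suc 0" j] by (simp add: x_def)
  next
    case (Suc k)
    show ?case using T_contr[where x = "x (Suc k)" and y = "x k" and C = "D * (1/2) ^ k" and j = j, OF Suc] by (simp add: x_Suc)
  qed
  define u where "u j = lim (\<lambda>k. x k j)" for j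
  have lim: "(\<lambda>k. x k j) \<longlonglongrightarrow> u j" for j
  proof -
    have "summable (\<lambda>k. x (Suc k) j - x k j)"
      by (rule summable_comparison_test'[of "\<lambda>k. D * (1/2) ^ k" 0])
         (auto intro!: summable_mult summable_geometric x_step)
    hence "convergent (\<lambda>N. \<Sum>k<N. x (Suc k) j - x k j)" by (simp add: summable_iff_convergent)
    moreover have "(\<Sum>k<N. x (Suc k) j - x k j) = x N j" for N
      using sum_lessThan_telescope[of "\<lambda>k. x k j" N] by (simp add: x_def[of 0])
    ultimately have "convergent (\<lambda>N. x N j)"
      by simp
    thus ?thesis by (simp add: convergent_LIMSEQ_iff u_def)
  qed
  have u_fix: "T u j = u j" for j
  proof -
    have "(\<lambda>k. T (x k) j) \<longlonglongrightarrow> T u j"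
    proof (cases "j = 0 \<or> j = int n")
      case False
      hence "of_int (gap n j) + z \<noteq> 0" using den[of j] npos by force
      thus ?thesis unfolding T_def hill_V_def using False by (auto intro!: tendsto_intros lim)
    qed (auto simp: T_def)
    moreover have "(\<lambda>k. T (x k) j) \<longlonglongrightarrow> u j"
      using LIMSEQ_Suc[OF lim[of j]] by (simp add: x_Suc)
    ultimately show ?thesis by (rule LIMSEQ_unique)
  qed
  have bu: "bounded (range u)"
    unfolding bounded_iff
    by (intro exI[of _ D]) (auto intro!: Lim_norm_ubound[OF _ lim] simp: x_bound)
  have "red_sol a b R S n z f u"
    unfolding red_sol_def
  proof (intro conjI allI impI)
    show "bounded (range u)" by (rule bu)
    fix j assume j: "j \<noteq> 0" "j \<noteq> int n"
    have "of_int (gap n j) + z \<noteq> 0" using den[OF j] npos by force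
    thus "(of_int (gap n j) + z) * u j = hill_V a b R S u j + f j"
      using u_fix[of j] j by (simp add: T_def field_simps)
  qed
  moreover have "u 0 = c" "u (int n) = e" using u_fix[of 0] u_fix[of "int n"] n by (auto simp: T_def)
  ultimately show ?thesis by blast
qed

section \<open>A weight solving the one-sided recurrence\<close>

text \<open>This is the log-convexity of \<open>Gamma\<close>: the increment of
  \<open>ln_Gamma\<close> over a fixed length is nondecreasing because \<open>Digamma\<close>
  is.\<close>

lemma Gamma_ratio_mono:
  fixes x y s :: real
  assumes "0 < x" "x \<le> y" "0 \<le> s"
  shows "Gamma (x + s) / Gamma x \<le> Gamma (y + s) / Gamma y"
proof -
  have "ln_Gamma (x + s) - ln_Gamma x \<le> ln_Gamma (y + s) - ln_Gamma y"
  proof (rule DERIV_nonneg_imp_nondecreasing[OF assms(2)])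
    fix t assume t: "x \<le> t" "t \<le> y"
    have "((\<lambda>t. ln_Gamma (t + s) - ln_Gamma t) has_field_derivative
            (Digamma (t + s) * (1 + 0) - Digamma t)) (at t)"
      using t assms by (intro derivative_intros DERIV_chain2[of ln_Gamma]) auto
    moreover have "Digamma (t + s) * (1 + 0) - Digamma t \<ge> 0"
      using Digamma_real_mono[of t "t + s"] t assms by simp
    ultimately show "\<exists>d. ((\<lambda>t. ln_Gamma (t + s) - ln_Gamma t) has_real_derivative d) (at t) \<and> 0 \<le> d"
      by blast
  qed
  hence "exp (ln_Gamma (x + s) - ln_Gamma x) \<le> exp (ln_Gamma (y + s) - ln_Gamma y)" by simp
  thus ?thesis using assms by (simp add: exp_diff Gamma_real_pos_exp)
qed

text \<open>Interpolates the moduli of the \<open>b\<close>-chain (\<open>c = |b|\<close>,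
  \<open>n = S * M\<close>) between the multiples of \<open>S\<close>.\<close>

definition hill_wt :: "real \<Rightarrow> nat \<Rightarrow> nat \<Rightarrow> int \<Rightarrow> real" where
  "hill_wt c S M j = (c / (4 * (real S)\<^sup>2)) powr (j / S) * Gamma (M - j / S) / (Gamma M * Gamma (1 + j / S))"

context
  fixes c :: real and S M :: nat
  assumes c: "c > 0" and S: "S > 0"
begin

lemma hill_wt_pos: "0 \<le> j \<Longrightarrow> j < int (S * M) \<Longrightarrow> hill_wt c S M j > 0"
proof -
  assume j: "0 \<le> j" "j < int (S * M)"
  have "real_of_int j < real S * real M" using j(2) by (metis of_int_less_iff of_int_of_nat_eq of_nat_mult)
  hence "real M - j / S > 0" "M > 0" using S j(1) by (auto simp: field_simps intro!: Nat.gr0I)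
  thus ?thesis using c S j(1) unfolding hill_wt_def
    by (intro divide_pos_pos mult_pos_pos Gamma_real_pos) (auto simp: add_pos_nonneg)
qed

lemma hill_wt_0: "M > 0 \<Longrightarrow> hill_wt c S M 0 = 1"
proof -
  assume "M > 0"
  hence "Gamma (real M) > 0" by (intro Gamma_real_pos) simp
  thus ?thesis using c S by (simp add: hill_wt_def)
qed

text \<open>With \<open>x = j / S\<close> the gap is \<open>4 S^2 x (M - x)\<close>, and the
  functional equation of \<open>Gamma\<close> supplies the factors \<open>x\<close> and
  \<open>M - x\<close>.\<close>

lemma hill_wt_step:
  assumes "int S \<le> j" "j < int (S * M)"
  shows "real_of_int (gap (S * M) j) * hill_wt c S M j = c * hill_wt c S M (j - int S)"
proof -
  define x where "x = real_of_int j / real S"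
  have j: "real_of_int j = x * real S" using S by (simp add: x_def)
  have "real_of_int j < real S * real M" using assms(2) by (metis of_int_less_iff of_int_of_nat_eq of_nat_mult)
  hence xM: "x < real M" using S by (simp add: x_def field_simps)
  have "real S \<le> real_of_int j" using assms(1) by linarith
  hence x1: "x \<ge> 1" using S by (simp add: x_def)
  define k where "k = c / (4 * (real S)\<^sup>2)"
  have k: "k > 0" "c = 4 * (real S)\<^sup>2 * k" using c S by (auto simp: k_def)
  have xm: "real_of_int (j - int S) / real S = x - 1" using S by (simp add: x_def diff_divide_distrib)
  have G1: "Gamma (1 + x) = x * Gamma x" using x1 by (subst add.commute, subst Gamma_plus1) (auto elim!: nonpos_Ints_cases)
  have G2: "Gamma (real M - (x - 1)) = (real M - x) * Gamma (real M - x)"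
    using Gamma_plus1[of "real M - x"] xM by (force elim!: nonpos_Ints_cases simp: algebra_simps)
  have gap: "real_of_int (gap (S * M) j) = 4 * (real S)\<^sup>2 * (x * (real M - x))"
    by (simp add: gap_def j power2_eq_square algebra_simps)
  have pw: "k powr x = k powr (x - 1) * k" using k by (simp add: powr_diff)
  have pos: "Gamma x > 0" "Gamma (real M) > 0" using x1 xM by (auto intro!: Gamma_real_pos)
  show ?thesis
    unfolding hill_wt_def xm x_def[symmetric] k_def[symmetric] gap G2 pw
    using pos x1 by (simp add: k(2) G1 divide_simps)
qed

text \<open>A shift by \<open>i\<close> costs a factor independent of \<open>j\<close> and
  \<open>M\<close>: both quotients of \<open>Gamma\<close> values that arise in the denominator grow
  with their base point, so each is smallest at its end of the range,
  \<open>M - x - s = 1 / S\<close> or \<open>x = 0\<close>.\<close>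

lemma hill_wt_ratio:
  assumes "0 \<le> j" "0 \<le> i" "j + i < int (S * M)"
  shows "hill_wt c S M (j + i) \<le>
    (c / (4 * (real S)\<^sup>2)) powr (i / S) /
      (Gamma (1 / S + i / S) / Gamma (1 / S) * (Gamma (1 + i / S) / Gamma 1)) * hill_wt c S M j"
proof -
  define x s where "x = real_of_int j / real S" and "s = real_of_int i / real S"
  define k where "k = c / (4 * (real S)\<^sup>2)"
  have k: "k > 0" using c S by (auto simp: k_def)
  have xs: "real_of_int (j + i) / real S = x + s" by (simp add: x_def s_def add_divide_distrib)
  \<comment> \<open>Integrality of the indices keeps the argument \<open>M - x - s\<close> at
    distance at least \<open>1 / S\<close> from the pole of \<open>Gamma\<close>.\<close>
  have "real_of_int (j + i + 1) \<le> real S * real M" using assms(3) by (metis of_int_le_iff of_int_of_nat_eq of_nat_mult zless_imp_add1_zle)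
  hence "(1 + real_of_int i + real_of_int j) / real S \<le> real M"
    using S by (simp add: pos_divide_le_eq algebra_simps)
  hence M: "real M - x - s \<ge> 1 / S" by (simp add: x_def s_def add_divide_distrib)
  have x0: "x \<ge> 0" "s \<ge> 0" using assms S by (auto simp: x_def s_def)
  have S0: "1 / real S > 0" using S by simp
  define A where "A = Gamma (1 / real S + s) / Gamma (1 / real S)"
  define B where "B = Gamma (1 + s) / (Gamma 1 :: real)"
  define A' where "A' = Gamma (real M - x) / Gamma (real M - x - s)"
  define B' where "B' = Gamma (1 + x + s) / Gamma (1 + x)"
  have Apos: "A > 0" "B > 0" unfolding A_def B_def using x0 S0
    by (auto intro!: divide_pos_pos Gamma_real_pos add_pos_nonneg)
  have A: "A \<le> A'" unfolding A_def A'_def using Gamma_ratio_mono[OF S0 M x0(2)] by simp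
  have B: "B \<le> B'" unfolding B_def B'_def using Gamma_ratio_mono[of 1 "1 + x" s] x0 by simp
  have pos: "Gamma (real M - x) > 0" "Gamma (real M - x - s) > 0" "Gamma (1 + x) > 0"
     "Gamma (1 + x + s) > 0" "Gamma (real M) > 0"
    using M x0 S0 by (intro Gamma_real_pos; linarith)+
  have wj: "hill_wt c S M j = k powr x * Gamma (real M - x) / (Gamma M * Gamma (1 + x))"
    unfolding hill_wt_def x_def[symmetric] k_def[symmetric] ..
  have "hill_wt c S M (j + i) = k powr (x + s) * Gamma (real M - x - s) / (Gamma M * Gamma (1 + x + s))"
    unfolding hill_wt_def xs k_def[symmetric] by (simp add: algebra_simps)
  also have "\<dots> = k powr s / (A' * B') * hill_wt c S M j"
    unfolding wj A'_def B'_def using pos by (simp add: field_simps powr_add)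
  also have "\<dots> \<le> k powr s / (A * B) * hill_wt c S M j"
  proof (intro mult_right_mono divide_left_mono mult_mono A B)
    show "hill_wt c S M j \<ge> 0" using hill_wt_pos[of j] assms by simp
    show "0 < A' * B' * (A * B)" using A B Apos by (auto intro!: mult_pos_pos)
  qed (use Apos A in auto)
  finally show ?thesis by (simp add: A_def B_def s_def k_def)
qed

end

lemma hill_wt_ratio_uniform:
  assumes "c > 0" "S > 0"
  shows "\<exists>C\<ge>1. \<forall>M j i. 0 \<le> j \<longrightarrow> 0 \<le> i \<longrightarrow> i \<le> int L \<longrightarrow> j + i < int (S * M) \<longrightarrow>
           hill_wt c S M (j + i) \<le> C * hill_wt c S M j"
proof -
  define C0 where "C0 i = (c / (4 * (real S)\<^sup>2)) powr (real_of_int i / S) /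
      (Gamma (1 / S + real_of_int i / S) / Gamma (1 / S) * (Gamma (1 + real_of_int i / S) / Gamma 1))" for i
  define C where "C = Max (insert 1 (C0 ` {0..int L}))"
  have "C \<ge> 1" unfolding C_def by (rule Max_ge) auto
  moreover have "hill_wt c S M (j + i) \<le> C * hill_wt c S M j"
    if "0 \<le> j" "0 \<le> i" "i \<le> int L" "j + i < int (S * M)" for M j i
  proof -
    have "C0 i \<le> C" unfolding C_def using that by (intro Max_ge) auto
    moreover have "hill_wt c S M j \<ge> 0" using hill_wt_pos[OF assms, of j M] that by simp
    ultimately show ?thesis
      using hill_wt_ratio[OF assms that(1,2,4)] unfolding C0_def[symmetric]
      by (meson mult_right_mono order_trans)
  qed
  ultimately show ?thesis by blast
qed

section \<open>Sums of inverse gaps\<close>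

lemma inverse_gap_le:
  assumes "n \<ge> 1" "j \<noteq> 0" "j \<noteq> int n"
  shows "1 / \<bar>real_of_int (gap n j)\<bar> \<le>
    (\<bar>real_of_int j\<bar> powr (-3/2) + \<bar>real_of_int (j - int n)\<bar> powr (-3/2)) / sqrt (real n)"
proof -
  \<comment> \<open>The larger factor \<open>y\<close> is at least \<open>n / 2\<close>. One factor
    \<open>sqrt y\<close> yields the decay in \<open>n\<close>, the other dominates
    \<open>sqrt x\<close>, and what remains is \<open>x^(-3/2)\<close>, which is summable over the
    nonzero integers independently of \<open>n\<close>.\<close>
  have *: "1 / (4 * (x * y)) \<le> (x powr (-3/2) + y powr (-3/2)) / sqrt (real n)"
    if xy: "x \<ge> 1" "y \<ge> x" "x + y \<ge> real n" for x y :: real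
  proof -
    have "real n \<le> 2 * y" using xy by simp
    hence "sqrt (real n) \<le> sqrt (4 * y)" using xy by simp
    also have "\<dots> = 2 * sqrt y" by (simp add: real_sqrt_mult)
    finally have n: "sqrt (real n) \<le> 2 * sqrt y" .
    have "x powr (1/2) \<le> y powr (1/2)" using xy by (intro powr_mono2) auto
    hence "x powr (1/2) \<le> sqrt y" using xy by (simp add: powr_half_sqrt)
    have "x powr (3/2) * sqrt (real n) \<le> x powr (3/2) * (2 * sqrt y)"
      by (intro mult_left_mono n) auto
    also have "\<dots> = x * x powr (1/2) * (2 * sqrt y)" using xy powr_add[of x 1 "1/2"] by simp
    also have "x * x powr (1/2) * (2 * sqrt y) \<le> x * sqrt y * (2 * sqrt y)"
      using xy \<open>x powr (1/2) \<le> sqrt y\<close> by (intro mult_mono) auto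
    also have "\<dots> \<le> 4 * (x * y)" using xy by simp
    finally have "x powr (3/2) * sqrt (real n) \<le> 4 * (x * y)" .
    hence "1 / (4 * (x * y)) \<le> 1 / (x powr (3/2) * sqrt (real n))"
      using xy assms(1) by (intro divide_left_mono mult_pos_pos) auto
    also have "\<dots> = x powr (-3/2) / sqrt (real n)"
      using powr_minus[of x "3/2"] by (simp add: divide_simps)
    also have "\<dots> \<le> (x powr (-3/2) + y powr (-3/2)) / sqrt (real n)"
      by (intro divide_right_mono) auto
    finally show ?thesis .
  qed
  define x y where "x = \<bar>real_of_int j\<bar>" and "y = \<bar>real_of_int (j - int n)\<bar>"
  have "\<bar>j\<bar> \<ge> 1" "\<bar>j - int n\<bar> \<ge> 1" "\<bar>j\<bar> + \<bar>j - int n\<bar> \<ge> int n" using assms by linarith+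
  hence xy: "x \<ge> 1" "y \<ge> 1" "x + y \<ge> real n" unfolding x_def y_def by linarith+
  have g: "\<bar>real_of_int (gap n j)\<bar> = 4 * (x * y)"
    by (simp add: gap_def x_def y_def abs_mult abs_minus_commute)
  show ?thesis unfolding g x_def[symmetric] y_def[symmetric]
  proof (cases "x \<le> y")
    case True
    thus "1 / (4 * (x * y)) \<le> (x powr (-3/2) + y powr (-3/2)) / sqrt (real n)"
      using *[of x y] xy by simp
  next
    case False
    thus "1 / (4 * (x * y)) \<le> (x powr (-3/2) + y powr (-3/2)) / sqrt (real n)"
      using *[of y x] xy by (simp add: mult.commute add.commute)
  qed
qed

lemma summable_on_int_iff_nat:
  fixes f :: "int \<Rightarrow> real"
  assumes "summable (\<lambda>k. f (int k))" "summable (\<lambda>k. f (- int k))" "\<And>j. f j \<ge> 0"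
  shows "f summable_on UNIV"
proof -
  have "(\<lambda>k. f (int k)) summable_on UNIV" "(\<lambda>k. f (- int k)) summable_on UNIV"
    using assms by (auto intro!: summable_nonneg_imp_summable_on)
  hence "f summable_on range int" "f summable_on range (\<lambda>k. - int k)"
    by (subst summable_on_reindex; auto simp: o_def inj_on_def)+
  hence "f summable_on (range int \<union> range (\<lambda>k. - int k))" by (rule summable_on_union)
  moreover have "range int \<union> range (\<lambda>k. - int k) = UNIV"
  proof -
    have "j \<in> range int \<union> range (\<lambda>k. - int k)" for j by (cases j rule: int_cases2) auto
    thus ?thesis by blast
  qed
  ultimately show ?thesis by simp
qed

lemma summable_abs_powr_int: "(\<lambda>j::int. \<bar>real_of_int j\<bar> powr (-3/2)) summable_on UNIV"
  by (rule summable_on_int_iff_nat) (auto simp: summable_real_powr_iff)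

text \<open>The two halves of the pointwise bound are translates of one summable family, so the
  bound is uniform in \<open>n\<close> and in the finite set. It is the source of smallness both in
  the weighted comparison and in the evaluation of the series at \<open>0\<close>.\<close>

lemma sum_inverse_gap_bound:
  "\<exists>T>0. \<forall>n\<ge>1. \<forall>A. finite A \<longrightarrow> 0 \<notin> A \<longrightarrow> int n \<notin> A \<longrightarrow>
     (\<Sum>j\<in>A. 1 / \<bar>real_of_int (gap n j)\<bar>) \<le> T / sqrt (real n)"
proof -
  let ?p = "\<lambda>j::int. \<bar>real_of_int j\<bar> powr (-3/2)"
  define T where "T = infsum ?p UNIV"
  have T: "sum ?p A \<le> T" if "finite A" for A
    unfolding T_def using that by (intro finite_sum_le_infsum summable_abs_powr_int) auto
  show ?thesis
  proof (intro exI[of _ "2 * T"] conjI allI impI)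
    show "2 * T > 0" using T[of "{1}"] by simp
    fix n A assume n: "(1::nat) \<le> n" and A: "finite A" "0 \<notin> A" "int n \<notin> A"
    have "(\<Sum>j\<in>A. 1 / \<bar>real_of_int (gap n j)\<bar>) \<le> (\<Sum>j\<in>A. (?p j + ?p (j - int n)) / sqrt (real n))"
      using A n by (intro sum_mono inverse_gap_le) auto
    also have "\<dots> = (sum ?p A + (\<Sum>j\<in>A. ?p (j - int n))) / sqrt (real n)"
      by (simp add: sum_divide_distrib[symmetric] sum.distrib)
    also have "(\<Sum>j\<in>A. ?p (j - int n)) = sum ?p ((\<lambda>j. j - int n) ` A)"
      by (subst sum.reindex) (auto simp: inj_on_def)
    also have "(sum ?p A + sum ?p ((\<lambda>j. j - int n) ` A)) / sqrt (real n) \<le> (T + T) / sqrt (real n)"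
      using A by (intro divide_right_mono add_mono T) auto
    finally show "(\<Sum>j\<in>A. 1 / \<bar>real_of_int (gap n j)\<bar>) \<le> 2 * T / sqrt (real n)" by simp
  qed
qed

text \<open>The supersolution is the weight times the partial sums of the inverse gaps: the weight solves
  the \<open>b\<close>-chain exactly, and the increments of the partial sums absorb all other terms.\<close>

lemma red_sol_weighted_bound:
  fixes W :: "int \<Rightarrow> real"
  assumes sol: "red_sol a b R S n z f u" and u0: "u 0 = 0" "u (int n) = 0"
    and b: "b \<noteq> 0" and RS: "R > 0" "S > 0" "2 * S \<le> n" "R < n"
    and Wpos: "\<And>j. 0 \<le> j \<Longrightarrow> j < int n \<Longrightarrow> W j > 0" and W0: "W 0 = 1"
    and Wstep: "\<And>j. int S \<le> j \<Longrightarrow> j < int n \<Longrightarrow> real_of_int (gap n j) * W j = cmod b * W (j - int S)"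
    and C: "C \<ge> 1"
    and Wratio: "\<And>j i. 0 \<le> j \<Longrightarrow> 0 \<le> i \<Longrightarrow> i \<le> int (R + S) \<Longrightarrow> j + i < int n \<Longrightarrow> W (j + i) \<le> C * W j"
    and z: "cmod z \<le> Z" "Z \<le> real n" and n: "2 * (cmod a + cmod b) \<le> real n"
    and K: "K = 1 + Z + cmod a * (C * (1 + 4 * real S / cmod b)) + 4 * real S * C"
    and \<delta>: "\<delta> = K * (\<Sum>i\<in>{0<..<int n}. 1 / real_of_int (gap n i))"
      "\<delta> \<le> 1" "cmod a * C * \<delta> \<le> 1" "cmod b * C * \<delta> \<le> 1"
    and f: "\<And>j. 0 < j \<Longrightarrow> j < int n \<Longrightarrow> cmod (f j) \<le> W j"
      "\<And>j. j < 0 \<Longrightarrow> cmod (f j) \<le> 1" "\<And>j. j > int n \<Longrightarrow> cmod (f j) \<le> W (int n - int S)"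
  shows "0 < j \<Longrightarrow> j < int n \<Longrightarrow> cmod (u j) \<le> \<delta> * W j"
    and "j < 0 \<Longrightarrow> cmod (u j) \<le> 1 / real n"
    and "j > int n \<Longrightarrow> cmod (u j) \<le> W (int n - int S) / real n"
proof -
  define w where "w = W (int n - int S)"
  have w: "w > 0" unfolding w_def using RS by (intro Wpos) auto
  have n2: "n \<ge> 2" using RS by linarith
  have Z0: "Z \<ge> 0" using z(1) norm_ge_zero[of z] by linarith
  have K0: "K \<ge> 1" unfolding K using Z0 C by (auto intro!: add_nonneg_nonneg mult_nonneg_nonneg)
  have gpos: "real_of_int (gap n j) > 0" if "0 < j" "j < int n" for j
  proof -
    have "4 * (int n - 1) > 0" using that by simp
    hence "gap n j > 0" using gap_pos[OF that] by (rule less_le_trans)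
    thus ?thesis by simp
  qed
  have gge: "1 / real_of_int (gap n j) \<ge> 0" if "0 < j" "j < int n" for j
    using gpos[OF that] by simp
  \<comment> \<open>Each step raises \<open>gap n j * s j\<close> by at least \<open>K\<close>. The
    four summands of \<open>K\<close> pay for the source, for the shift \<open>z\<close>, for the
    backward \<open>a\<close>-term (which may come from beyond \<open>n\<close>, whence the part
    with \<open>4 S / |b|\<close>), and for a \<open>b\<close>-term coming from a negative
    index.\<close>
  define s where "s j = K * (\<Sum>i\<in>{0<..j}. 1 / real_of_int (gap n i))" for j
  have s_le: "s j \<le> \<delta>" if "j < int n" for j
    unfolding s_def \<delta>(1) using that K0 gge by (intro mult_left_mono sum_mono2) (auto simp del: zero_le_divide_1_iff)
  have s_ge: "s j \<ge> 0" if "j < int n" for j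
    unfolding s_def using that K0 gge by (intro mult_nonneg_nonneg sum_nonneg) (auto simp del: zero_le_divide_1_iff)
  have s_inc: "real_of_int (gap n j) * s j \<ge> real_of_int (gap n j) * s (j - int S) + K"
    if "0 < j" "j < int n" for j
  proof -
    have "(\<Sum>i\<in>insert j {0<..j - int S}. 1 / real_of_int (gap n i)) \<le> (\<Sum>i\<in>{0<..j}. 1 / real_of_int (gap n i))"
      using that RS gge by (intro sum_mono2) (auto simp del: zero_le_divide_1_iff)
    moreover have "(\<Sum>i\<in>insert j {0<..j - int S}. 1 / real_of_int (gap n i)) =
        1 / real_of_int (gap n j) + (\<Sum>i\<in>{0<..j - int S}. 1 / real_of_int (gap n i))"
      using RS by (subst sum.insert) auto
    ultimately have "K * (1 / real_of_int (gap n j) + (\<Sum>i\<in>{0<..j - int S}. 1 / real_of_int (gap n i)))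
        \<le> s j" unfolding s_def using K0 by (intro mult_left_mono) auto
    hence "real_of_int (gap n j) * (K / real_of_int (gap n j) + s (j - int S)) \<le> real_of_int (gap n j) * s j"
      unfolding s_def using gpos[OF that] by (intro mult_left_mono) (auto simp: algebra_simps)
    thus ?thesis using gpos[OF that] by (simp add: distrib_left)
  qed
  \<comment> \<open>For \<open>0 < j < S\<close> the \<open>b\<close>-term comes from a negative
    index, where the supersolution is \<open>1 / n\<close>. The weight is comparable with it, since
    \<open>W S = |b| / gap n S\<close> and \<open>gap n S \<le> 4 S n\<close>.\<close>
  have WS: "1 / real n \<le> 4 * real S * C / cmod b * W j" if "0 < j" "j < int S" for j
  proof -
    have "cmod b = real_of_int (gap n (int S)) * W (int S)"
      using Wstep[of "int S"] RS W0 by simp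
    also have "\<dots> \<le> real_of_int (gap n (int S)) * (C * W j)"
      using Wratio[of j "int S - j"] that RS gpos[of "int S"] by (intro mult_left_mono) auto
    also have "\<dots> \<le> (4 * real S * real n) * (C * W j)"
      using Wpos[of j] that RS C by (intro mult_right_mono) (auto simp: gap_def intro!: mult_left_mono)
    finally show ?thesis using b RS by (simp add: field_simps)
  qed
  \<comment> \<open>Here the neighbour \<open>j + R\<close> lies beyond \<open>n\<close>. For the
    last \<open>S\<close> indices the chain relation is used backwards: there
    \<open>gap n j \<le> 4 n S\<close>, and the factor \<open>1 / n\<close> compensates the
    growth.\<close>
  have WR: "w / real n \<le> C * (1 + 4 * real S / cmod b) * W j" if "0 < j" "j < int n" "int n < j + int R" for j
  proof (cases "j \<le> int n - int S")
    case True
    have "w / real n \<le> w" using w n2 by (simp add: field_simps)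
    also have "\<dots> \<le> C * W j" unfolding w_def
      using Wratio[of j "int n - int S - j"] that True RS by auto
    also have "\<dots> \<le> C * (1 + 4 * real S / cmod b) * W j"
      using C Wpos[of j] that by (intro mult_right_mono) (auto simp: mult_le_cancel_left1)
    finally show ?thesis .
  next
    case False
    hence True: "int S \<le> j" using RS by linarith
    have "w \<le> C * W (j - int S)" unfolding w_def
      using Wratio[of "j - int S" "int n - j"] that True False RS by auto
    also have "W (j - int S) = real_of_int (gap n j) * W j / cmod b"
      using Wstep[of j] True that b by (simp add: field_simps)
    also have "C * (real_of_int (gap n j) * W j / cmod b) \<le> C * ((4 * real n * real S) * W j / cmod b)"
    proof (intro mult_left_mono divide_right_mono mult_right_mono)
      have "j * (int n - j) \<le> int n * int S" using that False by (intro mult_mono) auto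
      hence "real_of_int (j * (int n - j)) \<le> real_of_int (int n * int S)" by (simp only: of_int_le_iff)
      thus "real_of_int (gap n j) \<le> 4 * real n * real S" by (simp add: gap_def)
    qed (use C Wpos[of j] that in auto)
    finally have "w / real n \<le> C * (4 * real S / cmod b) * W j"
      using n2 by (simp add: field_simps)
    also have "\<dots> \<le> C * (1 + 4 * real S / cmod b) * W j"
      using C Wpos[of j] that by (intro mult_right_mono mult_left_mono) auto
    finally show ?thesis .
  qed
  \<comment> \<open>Outside \<open>[0, n]\<close> constants suffice, because the denominators there
    are at least \<open>3 n\<close>; the scale on the right is the weight \<open>w\<close> of the
    last chain site. At the resonant indices the value \<open>0\<close> is allowed since
    \<open>u\<close> vanishes there.\<close>
  define g where "g j = (if j < 0 then 1 / real n else if j > int n then w / real n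
    else if j = 0 \<or> j = int n then 0 else s j * W j)" for j
  have g_in: "g j = s j * W j" if "0 < j" "j < int n" for j using that by (simp add: g_def)
  have g0: "g j \<ge> 0" for j
    using w s_ge[of j] Wpos[of j] by (auto simp: g_def intro!: mult_nonneg_nonneg)
  have outer: "cmod (of_int (gap n j) + z) \<ge> 3 * real n" if "j < 0 \<or> j > int n" for j
  proof -
    have "real_of_int (gap n j) \<le> real_of_int (- 4 * (int n + 1))"
      using gap_neg[OF that] by (simp only: of_int_le_iff)
    hence "\<bar>real_of_int (gap n j)\<bar> \<ge> 4 * real n" by simp
    moreover have "cmod (of_int (gap n j) + z) \<ge> \<bar>real_of_int (gap n j)\<bar> - cmod z"
      using norm_diff_ineq[of "of_int (gap n j) :: complex" z] by simp
    ultimately show ?thesis using z by linarith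
  qed
  have "cmod (u j) \<le> g j" for j
  proof (rule red_sol_comparison[OF sol u0 n2 _ n g0])
    show "cmod z \<le> real n" using z by simp
    fix j assume j: "j \<noteq> 0" "j \<noteq> int n"
    consider "j < 0" | "j > int n" | "0 < j" "j < int n" using j by linarith
    thus "cmod a * g (j + int R) + cmod b * g (j - int S) + cmod (f j) \<le> cmod (of_int (gap n j) + z) * g j"
    proof cases
      case 1
      have "g (j + int R) \<le> 1 / real n + C * \<delta>"
      proof (cases "0 < j + int R")
        case True
        have "j + int R < int n" using 1 RS by linarith
        hence "g (j + int R) \<le> \<delta> * (C * W 0)"
          using Wratio[of 0 "j + int R"] True 1 Wpos[of "j + int R"] s_ge[of "j + int R"]
            s_le[of "j + int R"] by (subst g_in) (auto intro!: mult_mono)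
        thus ?thesis using W0 by (simp add: mult.commute add_increasing)
      next
        case False
        thus ?thesis using C s_ge[of 0] s_le[of 0] n2 by (auto simp: g_def)
      qed
      hence "cmod a * g (j + int R) \<le> cmod a * (1 / real n + C * \<delta>)" by (intro mult_left_mono) auto
      also have "\<dots> \<le> cmod a / real n + 1" using \<delta>(3) by (simp add: algebra_simps)
      finally have "cmod a * g (j + int R) + cmod b * g (j - int S) + cmod (f j)
          \<le> (cmod a + cmod b) / real n + 2"
        using f(2)[OF 1] 1 by (simp add: g_def add_divide_distrib)
      also have "(cmod a + cmod b) / real n \<le> 1" using n n2 by (simp add: field_simps)
      finally have "cmod a * g (j + int R) + cmod b * g (j - int S) + cmod (f j) \<le> 3 * real n * g j"
        using 1 n2 by (simp add: g_def)
      also have "\<dots> \<le> cmod (of_int (gap n j) + z) * g j" using outer[of j] 1 g0 by (intro mult_right_mono) auto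
      finally show ?thesis .
    next
      case 2
      have "g (j - int S) \<le> (1 / real n + C * \<delta>) * w"
      proof (cases "j - int S < int n")
        case True
        have pos: "0 < j - int S" using 2 RS by linarith
        have "W (j - int S) \<le> C * w" unfolding w_def
          using Wratio[of "int n - int S" "j - int n"] True 2 RS by auto
        hence "g (j - int S) \<le> \<delta> * (C * w)"
          using True pos Wpos[of "j - int S"] s_ge[of "j - int S"]
            s_le[of "j - int S"] by (subst g_in) (auto intro!: mult_mono)
        also have "\<dots> \<le> (1 / real n + C * \<delta>) * w" using w by (simp add: algebra_simps)
        finally show ?thesis .
      next
        case False
        have "g (j - int S) \<le> (1 / real n) * w" using False w by (auto simp: g_def)
        also have "\<dots> \<le> (1 / real n + C * \<delta>) * w"
          using C w s_ge[of 0] s_le[of 0] n2 by (intro mult_right_mono) auto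
        finally show ?thesis .
      qed
      hence "cmod b * g (j - int S) \<le> cmod b * ((1 / real n + C * \<delta>) * w)" by (intro mult_left_mono) auto
      also have "\<dots> = (cmod b / real n + cmod b * C * \<delta>) * w" by (simp add: algebra_simps)
      also have "\<dots> \<le> (cmod b / real n + 1) * w" using \<delta>(4) w by (intro mult_right_mono) auto
      finally have "cmod a * g (j + int R) + cmod b * g (j - int S) + cmod (f j)
          \<le> ((cmod a + cmod b) / real n + 2) * w"
        using f(3)[OF 2] 2 RS by (simp add: g_def w_def add_divide_distrib algebra_simps)
      also have "(cmod a + cmod b) / real n \<le> 1" using n n2 by (simp add: field_simps)
      hence "((cmod a + cmod b) / real n + 2) * w \<le> 3 * w" using w by (intro mult_right_mono) auto
      also have "3 * w = 3 * real n * g j"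
        using 2 n2 by (simp add: g_def)
      also have "\<dots> \<le> cmod (of_int (gap n j) + z) * g j" using outer[of j] 2 g0 by (intro mult_right_mono) auto
      finally show ?thesis .
    next
      case 3
      note Wj = Wpos[of j]
      have sj: "0 \<le> s j" "s j \<le> 1" using s_ge s_le \<delta>(2) 3 by (auto intro: order_trans)
      have A: "cmod a * g (j + int R) \<le> cmod a * (C * (1 + 4 * real S / cmod b)) * W j"
      proof -
        have "g (j + int R) \<le> C * (1 + 4 * real S / cmod b) * W j"
        proof -
          consider "j + int R < int n" | "j + int R = int n" | "j + int R > int n" by linarith
          thus ?thesis
          proof cases
            case 1
            have "g (j + int R) = s (j + int R) * W (j + int R)" using 1 3 by (intro g_in) auto
            also have "\<dots> \<le> 1 * (C * W j)"
              using Wratio[of j "int R"] 1 3 Wpos[of "j + int R"] s_le[of "j + int R"] \<delta>(2)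
              by (intro mult_mono) auto
            also have "\<dots> \<le> C * (1 + 4 * real S / cmod b) * W j"
              using C Wj 3 by (simp add: mult_right_mono mult_le_cancel_left1)
            finally show ?thesis .
          next
            case 2
            have "C * (1 + 4 * real S / cmod b) * W j \<ge> 0"
              using C Wj 3 by (intro mult_nonneg_nonneg) auto
            thus ?thesis using 2 3 by (simp add: g_def)
          next
            case 3: 3
            thus ?thesis using WR[of j] \<open>0 < j\<close> \<open>j < int n\<close> by (simp add: g_def)
          qed
        qed
        thus ?thesis by (simp add: mult_left_mono mult.assoc)
      qed
      have B: "cmod b * g (j - int S) + K * W j \<le>
          real_of_int (gap n j) * s j * W j + 4 * real S * C * W j"
      proof -
        consider "j < int S" | "j = int S" | "j > int S" by linarith
        thus ?thesis
        proof cases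
          case 1
          have "cmod b * g (j - int S) \<le> cmod b * (4 * real S * C / cmod b * W j)"
            using WS[of j] 1 3 by (intro mult_left_mono) (auto simp: g_def)
          also have "\<dots> = 4 * real S * C * W j" using b by simp
          finally have *: "cmod b * g (j - int S) \<le> 4 * real S * C * W j" .
          have "K \<le> real_of_int (gap n j) * s j"
            using s_inc[of j] 3 1 by (simp add: s_def)
          hence "K * W j \<le> real_of_int (gap n j) * s j * W j" using Wj 3 by (intro mult_right_mono) auto
          with * show ?thesis by linarith
        next
          case 2
          have "K \<le> real_of_int (gap n j) * s j"
            using s_inc[of j] 3 2 by (simp add: s_def)
          hence "K * W j \<le> real_of_int (gap n j) * s j * W j" using Wj 3 by (intro mult_right_mono) auto
          moreover have "4 * real S * C * W j \<ge> 0" using C Wj 3 by (intro mult_nonneg_nonneg) auto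
          moreover have "cmod b * g (j - int S) = 0" using 2 RS by (simp add: g_def)
          ultimately show ?thesis by linarith
        next
          case gt: 3
          have "cmod b * g (j - int S) = s (j - int S) * (cmod b * W (j - int S))"
            using gt 3 by (subst g_in) auto
          also have "cmod b * W (j - int S) = real_of_int (gap n j) * W j"
            using Wstep[of j] gt 3 by simp
          finally have "cmod b * g (j - int S) + K * W j = (real_of_int (gap n j) * s (j - int S) + K) * W j"
            by (simp add: algebra_simps)
          also have "\<dots> \<le> real_of_int (gap n j) * s j * W j"
            using s_inc[of j] 3 Wj by (intro mult_right_mono) auto
          also have "\<dots> \<le> real_of_int (gap n j) * s j * W j + 4 * real S * C * W j"
            using C Wj 3 by simp
          finally show ?thesis .
        qed
      qed
      have "cmod (of_int (gap n j) + z) \<ge> \<bar>real_of_int (gap n j)\<bar> - cmod z"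
        using norm_diff_ineq[of "of_int (gap n j) :: complex" z] by simp
      hence "real_of_int (gap n j) - Z \<le> cmod (of_int (gap n j) + z)" using z by linarith
      hence "(real_of_int (gap n j) - Z) * (s j * W j) \<le> cmod (of_int (gap n j) + z) * (s j * W j)"
        using sj Wj 3 by (intro mult_right_mono) auto
      moreover have "Z * (s j * W j) \<le> Z * (1 * W j)"
        using sj Wj 3 Z0 by (intro mult_left_mono mult_right_mono) auto
      ultimately have D: "real_of_int (gap n j) * s j * W j - Z * W j \<le> cmod (of_int (gap n j) + z) * g j"
        using 3 by (simp add: g_in algebra_simps)
      have "K * W j = W j + Z * W j + cmod a * (C * (1 + 4 * real S / cmod b)) * W j + 4 * real S * C * W j"
        unfolding K by (simp add: distrib_right)
      with A B D f(1)[OF 3] show ?thesis by linarith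
    qed
  qed
  note main = this
  show "0 < j \<Longrightarrow> j < int n \<Longrightarrow> cmod (u j) \<le> \<delta> * W j"
  proof -
    assume j: "0 < j" "j < int n"
    have "cmod (u j) \<le> s j * W j" using main[of j] g_in[OF j] by simp
    also have "\<dots> \<le> \<delta> * W j" using s_le j Wpos[of j] by (intro mult_right_mono) auto
    finally show ?thesis .
  qed
  show "j < 0 \<Longrightarrow> cmod (u j) \<le> 1 / real n"
    and "j > int n \<Longrightarrow> cmod (u j) \<le> W (int n - int S) / real n"
    using main[of j] by (auto simp: g_def w_def)
qed

section \<open>Straight chains\<close>

definition chain :: "complex \<Rightarrow> nat \<Rightarrow> nat \<Rightarrow> int \<Rightarrow> complex" where
  "chain b S n j = (if 0 \<le> j \<and> j < int n \<and> int S dvd j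
     then \<Prod>i\<in>{1..nat (j div int S)}. b / of_int (gap n (int S * int i)) else 0)"

definition hill_K :: "complex \<Rightarrow> nat \<Rightarrow> nat \<Rightarrow> complex" where
  "hill_K b S M = b ^ M / ((4 * (of_nat S)\<^sup>2) ^ (M - 1) * (fact (M - 1))\<^sup>2)"

lemma chain_0: "n > 0 \<Longrightarrow> chain b S n 0 = 1"
  by (simp add: chain_def)

text \<open>Because \<open>S\<close> divides \<open>n = S * M\<close>, no multiple of
  \<open>S\<close> beyond \<open>n\<close> is fed by one below it, so cutting the chain off at
  \<open>n\<close> violates the recurrence at \<open>n\<close> only. That violation is the leading
  term \<open>hill_K\<close>.\<close>

lemma chain_step:
  assumes S: "S > 0" and j: "j \<noteq> 0" "j \<noteq> int (S * M)"
  shows "of_int (gap (S * M) j) * chain b S (S * M) j = b * chain b S (S * M) (j - int S)"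
proof (cases "int S dvd j \<and> 0 \<le> j \<and> j < int (S * M)")
  case True
  then obtain k where k: "j = int S * k" by (auto elim: dvdE)
  have "0 < j" using True j(1) by linarith
  hence kpos: "k > 0" using S by (simp add: k zero_less_mult_iff)
  define l where "l = nat (k - 1)"
  have kl: "k = int (Suc l)" using kpos by (simp add: l_def)
  have jl: "j - int S = int S * int l" by (simp add: k kl algebra_simps)
  have "int S * int l < int S * int M" using True S by (simp flip: jl)
  hence "l < M" using S by simp
  with jl have c1: "chain b S (S * M) (j - int S) = (\<Prod>i\<in>{1..l}. b / of_int (gap (S * M) (int S * int i)))"
    using True S by (simp add: chain_def)
  have "j div int S = int (Suc l)" using S unfolding k kl by (subst nonzero_mult_div_cancel_left) auto
  hence "nat (j div int S) = Suc l" by simp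
  hence "chain b S (S * M) j = (\<Prod>i\<in>{1..Suc l}. b / of_int (gap (S * M) (int S * int i)))"
    using True by (simp add: chain_def del: prod.cl_ivl_Suc)
  also have "\<dots> = (\<Prod>i\<in>{1..l}. b / of_int (gap (S * M) (int S * int i))) * (b / of_int (gap (S * M) j))"
    by (simp add: k kl)
  finally have c2: "chain b S (S * M) j = chain b S (S * M) (j - int S) * (b / of_int (gap (S * M) j))"
    by (simp add: c1)
  have "gap (S * M) j \<noteq> 0" using j by (simp add: gap_def)
  thus ?thesis by (simp add: c2)
next
  case False
  have "chain b S (S * M) (j - int S) = 0"
  proof (rule ccontr)
    assume "chain b S (S * M) (j - int S) \<noteq> 0"
    hence *: "0 \<le> j - int S" "j - int S < int (S * M)" "int S dvd j - int S"
      by (auto simp: chain_def split: if_splits)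
    then obtain k where k: "j - int S = int S * k" by (auto elim: dvdE)
    hence jk: "j = int S * (k + 1)" by (simp add: algebra_simps)
    have "int S * k < int S * int M" using * k by simp
    hence "k < int M" using S by (simp add: mult_less_cancel_left_pos)
    hence "int S * (k + 1) \<le> int S * int M" using S by (intro mult_left_mono) auto
    hence "j < int (S * M)" using j(2) jk by simp
    with * False jk show False by (auto simp: dvd_mult2)
  qed
  moreover have "chain b S (S * M) j = 0" using False by (auto simp: chain_def)
  ultimately show ?thesis by simp
qed

text \<open>Chain and weight obey the same recurrence with step \<open>S\<close> and both equal
  \<open>1\<close> at \<open>0\<close>, so their moduli agree at the multiples of \<open>S\<close>;
  between them the chain vanishes and the weight is positive.\<close>

lemma norm_chain_le:
  assumes b: "b \<noteq> 0" and S: "S > 0" and M: "M > 0" and j: "0 \<le> j" "j < int (S * M)"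
  shows "int S dvd j \<Longrightarrow> cmod (chain b S (S * M) j) = hill_wt (cmod b) S M j"
    and "cmod (chain b S (S * M) j) \<le> hill_wt (cmod b) S M j"
proof -
  have *: "cmod (chain b S (S * M) (int S * int l)) = hill_wt (cmod b) S M (int S * int l)"
    if "l < M" for l using that
  proof (induction l)
    case 0
    thus ?case using b S M by (simp add: chain_0 hill_wt_0)
  next
    case (Suc l)
    let ?j = "int S * int (Suc l)"
    have lt: "?j < int (S * M)" using Suc.prems S by (simp only: of_nat_mult) (simp only: mult_less_cancel_left_pos of_nat_less_iff of_nat_0_less_iff)
    have jS: "?j - int S = int S * int l" by (simp add: algebra_simps)
    have ge: "int S \<le> ?j" by (simp add: algebra_simps)
    have "0 < ?j" using S ge by linarith
    have gap_pos': "gap (S * M) j > 0" if "0 < j" "j < int (S * M)" for j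
      using that by (simp add: gap_def)
    have gp: "real_of_int (gap (S * M) ?j) > 0"
      using gap_pos'[OF \<open>0 < ?j\<close> lt] by (simp only: of_int_0_less_iff)
    have "real_of_int (gap (S * M) ?j) * cmod (chain b S (S * M) ?j) =
        cmod (of_int (gap (S * M) ?j) * chain b S (S * M) ?j)"
      using gp by (simp add: norm_mult)
    also have "\<dots> = cmod b * cmod (chain b S (S * M) (?j - int S))"
      using chain_step[of S ?j M b] S lt \<open>0 < ?j\<close> by (simp add: norm_mult)
    also have "\<dots> = cmod b * hill_wt (cmod b) S M (?j - int S)"
      unfolding jS using Suc by simp
    also have "\<dots> = real_of_int (gap (S * M) ?j) * hill_wt (cmod b) S M ?j"
      using hill_wt_step[of "cmod b" S ?j M] b S ge lt by simp
    finally show ?case using gp by (metis less_irrefl mult_cancel_left)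
  qed
  show eq: "cmod (chain b S (S * M) j) = hill_wt (cmod b) S M j" if dvd: "int S dvd j"
  proof -
    obtain k where k: "j = int S * k" using dvd by (auto elim: dvdE)
    have "k \<ge> 0" using j(1) S by (simp add: k zero_le_mult_iff)
    moreover have "k < int M" using j(2) S by (simp add: k)
    ultimately show ?thesis using *[of "nat k"] by (simp add: k)
  qed
  show "cmod (chain b S (S * M) j) \<le> hill_wt (cmod b) S M j"
  proof (cases "int S dvd j")
    case False
    thus ?thesis using hill_wt_pos[of "cmod b" S j M] b S j by (simp add: chain_def)
  qed (simp add: eq)
qed

text \<open>The interior gaps are \<open>4 S^2 i (M - i)\<close>, and reversing the index turns the
  product of the factors \<open>M - i\<close> into a second copy of the same factorial. The last
  step \<open>b\<close> carries no denominator, since it ends at the resonant index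
  \<open>n\<close>.\<close>

lemma chain_last:
  assumes S: "S > 0" and M: "M > 0"
  shows "b * chain b S (S * M) (int (S * M) - int S) = hill_K b S M"
proof -
  have *: "int (S * M) - int S = int S * int (M - 1)" using M by (simp add: of_nat_diff algebra_simps)
  have lt: "int S * int (M - 1) < int (S * M)" using S M
    by (simp only: of_nat_mult) (simp only: mult_less_cancel_left_pos of_nat_less_iff of_nat_0_less_iff diff_less zero_less_one)
  have "chain b S (S * M) (int S * int (M - 1)) =
      (\<Prod>i\<in>{1..M-1}. b / of_int (gap (S * M) (int S * int i)))"
  proof -
    have "nat (int S * int (M - 1) div int S) = M - 1"
      using S by (simp only: nonzero_mult_div_cancel_left of_nat_eq_0_iff neq0_conv nat_int)
    thus ?thesis using S lt by (simp only: chain_def) simp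
  qed
  also have "\<dots> = (\<Prod>i\<in>{1..M-1}. b / (4 * (of_nat S)\<^sup>2 * of_nat i * of_nat (M - i)))"
  proof (rule prod.cong[OF refl])
    fix i assume "i \<in> {1..M-1}"
    hence "of_nat M = (of_nat i + of_nat (M - i) :: complex)" by (metis add_diff_inverse_nat atLeastAtMost_iff diff_le_self leD le_trans of_nat_add)
    hence "of_int (gap (S * M) (int S * int i)) = (4 * (of_nat S)\<^sup>2 * of_nat i * of_nat (M - i) :: complex)"
      by (simp add: gap_def power2_eq_square algebra_simps)
    thus "b / of_int (gap (S * M) (int S * int i)) = b / (4 * (of_nat S)\<^sup>2 * of_nat i * of_nat (M - i))" by simp
  qed
  also have "\<dots> = b ^ (M - 1) / ((4 * (of_nat S)\<^sup>2) ^ (M - 1) * (\<Prod>i\<in>{1..M-1}. of_nat i) * (\<Prod>i\<in>{1..M-1}. of_nat (M - i)))"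
    by (simp add: prod_dividef prod.distrib)
  also have "(\<Prod>i\<in>{1..M-1}. of_nat (M - i) :: complex) = (\<Prod>i\<in>{1..M-1}. of_nat i)"
    by (rule prod.reindex_bij_witness[of _ "\<lambda>i. M - i" "\<lambda>i. M - i"]) auto
  also have "(\<Prod>i\<in>{1..M-1}. of_nat i :: complex) = fact (M - 1)" by (simp add: fact_prod)
  finally have "b * chain b S (S * M) (int S * int (M - 1)) =
      b * b ^ (M - 1) / ((4 * (of_nat S)\<^sup>2) ^ (M - 1) * fact (M - 1) * fact (M - 1))" by simp
  also have "b * b ^ (M - 1) = b ^ M" using M by (cases M) auto
  finally show ?thesis by (subst *) (simp add: hill_K_def power2_eq_square mult.assoc)
qed

text \<open>The straight chain of \<open>b\<close>-steps gives the main term of the off-diagonal entry. The solutions with source \<open>u\<close> are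
  (minus) the divided differences of \<open>u\<close> in the spectral parameter.\<close>

lemma left_solution_bounds:
  assumes b: "b \<noteq> 0" and RS: "R > 0" "S > 0" and Z0: "Z \<ge> 0" and e: "e > 0"
  shows "\<forall>\<^sub>F M in sequentially. \<forall>z u. cmod z \<le> Z \<longrightarrow> red_sol a b R S (S * M) z (\<lambda>_. 0) u \<longrightarrow>
     u 0 = 1 \<longrightarrow> u (int (S * M)) = 0 \<longrightarrow>
     cmod (hill_V a b R S u 0) \<le> e \<and>
     cmod (hill_V a b R S u (int (S * M)) - hill_K b S M) \<le> e * cmod (hill_K b S M) \<and>
     (\<forall>z' w. cmod z' \<le> Z \<longrightarrow> red_sol a b R S (S * M) z' u w \<longrightarrow> w 0 = 0 \<longrightarrow> w (int (S * M)) = 0 \<longrightarrow>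
        cmod (hill_V a b R S w 0) \<le> e \<and>
        cmod (hill_V a b R S w (int (S * M))) \<le> e * cmod (hill_K b S M))"
proof -
  obtain C where C: "C \<ge> 1" and Cr: "\<And>M j i. 0 \<le> j \<Longrightarrow> 0 \<le> i \<Longrightarrow> i \<le> int (R + S) \<Longrightarrow> j + i < int (S * M) \<Longrightarrow>
           hill_wt (cmod b) S M (j + i) \<le> C * hill_wt (cmod b) S M j"
    using hill_wt_ratio_uniform[of "cmod b" S "R + S"] b RS by auto
  obtain T where T: "T > 0" "\<And>n A. n \<ge> 1 \<Longrightarrow> finite A \<Longrightarrow> 0 \<notin> A \<Longrightarrow> int n \<notin> A \<Longrightarrow>
     (\<Sum>j\<in>A. 1 / \<bar>real_of_int (gap n j)\<bar>) \<le> T / sqrt (real n)"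
    using sum_inverse_gap_bound by blast
  define K where "K = 1 + Z + cmod a * (C * (1 + 4 * real S / cmod b)) + 4 * real S * C"
  have K1: "K \<ge> 1" unfolding K_def using Z0 C by (auto intro!: add_nonneg_nonneg mult_nonneg_nonneg)
  \<comment> \<open>\<open>F\<close> bounds, relative to the weight, the defect that the
    \<open>a\<close>-steps and the shift leave when the straight chain is inserted into the full
    recurrence; \<open>1 + F\<close> then bounds the solution itself.\<close>
  define F where "F = cmod a * C + Z + 1"
  have F1: "F \<ge> 1" unfolding F_def using Z0 C by auto
  \<comment> \<open>\<open>Q\<close> collects the coefficients of all final estimates, so that each
    of them reduces to \<open>Q * (\<delta> + 1 / n) \<le> e\<close>.\<close>
  define Q where "Q = cmod a * cmod b * C + cmod a * C * (1 + F) + cmod b * (1 + F) + cmod a / cmod b * (1 + F) + (1 + F)"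
  have Q: "Q > 0" unfolding Q_def using F1 C by (auto intro!: add_nonneg_pos add_nonneg_nonneg mult_nonneg_nonneg)
  define x where "x M = K * (T / sqrt (real (S * M))) + 1 / real (S * M)" for M
  have nlim: "filterlim (\<lambda>M. real (S * M)) at_top sequentially"
    using RS by (auto intro!: filterlim_tendsto_pos_mult_at_top[OF tendsto_const] filterlim_real_sequentially)
  have xlim: "x \<longlonglongrightarrow> K * 0 + 0" unfolding x_def
    by (intro tendsto_add tendsto_mult tendsto_const tendsto_divide_0[OF tendsto_const]
        filterlim_at_top_imp_at_infinity nlim filterlim_compose[OF sqrt_at_top nlim])
  \<comment> \<open>The first minimum gives \<open>\<delta> \<le> 1\<close> and the required
    accuracy, the second the two hypotheses on \<open>\<delta>\<close> of the weighted
    comparison.\<close>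
  define \<eta> where "\<eta> = min (min 1 (e / Q)) (min (1 / (1 + cmod a * C)) (1 / (1 + cmod b * C)))"
  have \<eta>: "\<eta> > 0" unfolding \<eta>_def using e Q C by (auto intro!: divide_pos_pos add_pos_nonneg)
  have ev1: "\<forall>\<^sub>F M in sequentially. x M \<le> \<eta>"
    using order_tendstoD(2)[OF xlim, of \<eta>] \<eta> by (auto elim: eventually_mono)
  have ev2: "\<forall>\<^sub>F M in sequentially. real (S * M) \<ge> 2 * real S + real R + 1 + Z + 2 * (cmod a + cmod b)"
    using nlim by (auto simp: filterlim_at_top)
  show ?thesis using ev1 ev2
  proof eventually_elim
    case (elim M)
    define n where "n = S * M"
    let ?W = "hill_wt (cmod b) S M"
    have big: "real n \<ge> 2 * real S + real R + 1 + Z + 2 * (cmod a + cmod b)" using elim(2) by (simp add: n_def)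
    have "real n \<ge> 2 * real S" "real n > real R" using big Z0 norm_ge_zero[of a] norm_ge_zero[of b]
        of_nat_0_le_iff[of R, where 'a = real] of_nat_0_le_iff[of S, where 'a = real] by (smt (verit))+
    hence nSR: "2 * S \<le> n" "R < n" by simp_all
    have n_ab: "2 * (cmod a + cmod b) \<le> real n" "Z \<le> real n" using big Z0 norm_ge_zero[of a] norm_ge_zero[of b]
        of_nat_0_le_iff[of R, where 'a = real] of_nat_0_le_iff[of S, where 'a = real] by (smt (verit))+
    have n2: "n \<ge> 2" using nSR RS by linarith
    have M: "M > 0" using n2 by (auto simp: n_def intro!: Nat.gr0I)
    have Wpos: "?W j > 0" if "0 \<le> j" "j < int n" for j using hill_wt_pos[of "cmod b" S j M] b RS that by (simp add: n_def)
    have W0: "?W 0 = 1" using hill_wt_0[of "cmod b" S M] b RS M by simp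
    have Wstep: "real_of_int (gap n j) * ?W j = cmod b * ?W (j - int S)" if "int S \<le> j" "j < int n" for j
      using hill_wt_step[of "cmod b" S j M] b RS that by (simp add: n_def)
    have Wratio: "?W (j + i) \<le> C * ?W j" if "0 \<le> j" "0 \<le> i" "i \<le> int (R + S)" "j + i < int n" for j i
      using Cr[of j i M] that by (simp add: n_def)
    define w where "w = ?W (int n - int S)"
    have w: "w > 0" unfolding w_def using nSR RS by (intro Wpos) auto
    have chain_last': "b * chain b S n (int n - int S) = hill_K b S M"
      using chain_last[of S M b] RS M by (simp add: n_def)
    have Kw: "cmod (hill_K b S M) = cmod b * w"
    proof -
      have "int S dvd int n - int S" by (simp add: n_def)
      hence "cmod (chain b S n (int n - int S)) = w"
        using norm_chain_le(1)[of b S M "int n - int S"] b RS M nSR by (simp add: n_def w_def)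
      thus ?thesis by (simp add: chain_last'[symmetric] norm_mult)
    qed
    define \<delta> where "\<delta> = K * (\<Sum>i\<in>{0<..<int n}. 1 / real_of_int (gap n i))"
    have "(\<Sum>i\<in>{0<..<int n}. 1 / real_of_int (gap n i)) = (\<Sum>i\<in>{0<..<int n}. 1 / \<bar>real_of_int (gap n i)\<bar>)"
      by (rule sum.cong) (auto simp: gap_def)
    also have "\<dots> \<le> T / sqrt (real n)" using n2 by (intro T) auto
    finally have "\<delta> \<le> K * (T / sqrt (real n))" unfolding \<delta>_def using K1 by (intro mult_left_mono) auto
    hence \<delta>x: "\<delta> + 1 / real n \<le> x M" by (simp add: x_def n_def)
    have \<delta>0: "\<delta> \<ge> 0" unfolding \<delta>_def using K1 by (intro mult_nonneg_nonneg sum_nonneg) (auto simp: gap_def)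
    have inv_n: "1 / real n > 0" using n2 by simp
    have \<delta>\<eta>: "\<delta> \<le> \<eta>" using \<delta>x elim(1) inv_n by linarith
    have \<delta>1: "\<delta> \<le> 1" using \<delta>\<eta> by (simp add: \<eta>_def)
    have \<delta>a: "cmod c * C * \<delta> \<le> 1" if "\<delta> \<le> 1 / (1 + cmod c * C)" for c
    proof -
      have "cmod c * C \<ge> 0" using C by (intro mult_nonneg_nonneg) auto
      thus ?thesis using that \<delta>0 by (simp add: pos_le_divide_eq algebra_simps add_pos_nonneg)
    qed
    have \<delta>ab: "cmod a * C * \<delta> \<le> 1" "cmod b * C * \<delta> \<le> 1" using \<delta>\<eta> by (auto intro!: \<delta>a simp: \<eta>_def)
    have Qx: "Q * (\<delta> + 1 / real n) \<le> e"
    proof -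
      have "Q * (\<delta> + 1 / real n) \<le> Q * (e / Q)"
        using \<delta>x elim(1) Q by (intro mult_left_mono) (auto simp: \<eta>_def)
      thus ?thesis using Q by simp
    qed
    \<comment> \<open>The weighted comparison is normalised to sources of size one; linearity gives
      it for a source of size \<open>G\<close>.\<close>
    have scaled: "(0 < j \<longrightarrow> j < int n \<longrightarrow> cmod (u j) \<le> G * (\<delta> * ?W j)) \<and> (j < 0 \<longrightarrow> cmod (u j) \<le> G * (1 / real n)) \<and>
        (j > int n \<longrightarrow> cmod (u j) \<le> G * (w / real n))"
      if sol: "red_sol a b R S n z f u" "u 0 = 0" "u (int n) = 0" and z: "cmod z \<le> Z" and G: "G > 0"
        and f: "\<And>j. 0 < j \<Longrightarrow> j < int n \<Longrightarrow> cmod (f j) \<le> G * ?W j"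
      "\<And>j. j < 0 \<Longrightarrow> cmod (f j) \<le> G" "\<And>j. j > int n \<Longrightarrow> cmod (f j) \<le> G * w" for z f u G j
    proof -
      have sol': "red_sol a b R S n z (\<lambda>j. f j / of_real G) (\<lambda>j. u j / of_real G)"
        using red_sol_add[OF sol(1) sol(1), of "1 / of_real G" 0] by simp
      have f': "cmod (f j / of_real G) \<le> y" if "cmod (f j) \<le> G * y" for j y
        using that G by (simp add: norm_divide pos_divide_le_eq mult.commute)
      note bd = red_sol_weighted_bound[OF sol' _ _ b RS nSR Wpos W0 Wstep C Wratio z n_ab(2,1) K_def \<delta>_def \<delta>1 \<delta>ab,
          unfolded w_def[symmetric]]
      have "0 < j \<Longrightarrow> j < int n \<Longrightarrow> cmod (u j / of_real G) \<le> \<delta> * ?W j" for j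
        by (rule bd(1)) (use sol f G in \<open>auto intro!: f'\<close>)
      moreover have "j < 0 \<Longrightarrow> cmod (u j / of_real G) \<le> 1 / real n" for j
        by (rule bd(2)) (use sol f G in \<open>auto intro!: f'\<close>)
      moreover have "j > int n \<Longrightarrow> cmod (u j / of_real G) \<le> w / real n" for j
        by (rule bd(3)) (use sol f G in \<open>auto intro!: f'\<close>)
      ultimately show ?thesis using G by (simp add: norm_divide pos_divide_le_eq mult.commute)
    qed
    \<comment> \<open>The extra summand \<open>|a| |b| C / n\<close> reserves room for the
      contribution of the straight chain itself at the index \<open>0\<close>.\<close>
    have V_bounds: "cmod (hill_V a b R S h 0) + cmod a * cmod b * C / real n \<le> e \<and>
        cmod (hill_V a b R S h (int n)) \<le> e * cmod (hill_K b S M)"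
      if h: "\<And>j. (0 < j \<longrightarrow> j < int n \<longrightarrow> cmod (h j) \<le> G * (\<delta> * ?W j)) \<and> (j < 0 \<longrightarrow> cmod (h j) \<le> G * (1 / real n)) \<and>
        (j > int n \<longrightarrow> cmod (h j) \<le> G * (w / real n))" and G: "0 < G" "G \<le> 1 + F" for h G
    proof
      have WR: "?W (int R) \<le> C" using Wratio[of 0 "int R"] W0 nSR by simp
      have "cmod (hill_V a b R S h 0) \<le> cmod a * cmod (h (int R)) + cmod b * cmod (h (- int S))"
        unfolding hill_V_def by (simp flip: norm_mult add: norm_triangle_ineq)
      also have "\<dots> \<le> cmod a * ((1 + F) * (\<delta> * C)) + cmod b * ((1 + F) * (1 / real n))"
      proof (intro add_mono mult_left_mono)
        have "cmod (h (int R)) \<le> G * (\<delta> * ?W (int R))" using h[of "int R"] RS nSR by simp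
        also have "\<dots> \<le> (1 + F) * (\<delta> * C)" using G \<delta>0 WR F1 Wpos[of "int R"] nSR by (intro mult_mono) auto
        finally show "cmod (h (int R)) \<le> (1 + F) * (\<delta> * C)" .
        have "cmod (h (- int S)) \<le> G * (1 / real n)" using h[of "- int S"] RS by simp
        also have "\<dots> \<le> (1 + F) * (1 / real n)" using G by (intro mult_right_mono) auto
        finally show "cmod (h (- int S)) \<le> (1 + F) * (1 / real n)" .
      qed auto
      finally have "cmod (hill_V a b R S h 0) + cmod a * cmod b * C / real n \<le>
        cmod a * C * (1 + F) * \<delta> + cmod b * (1 + F) * (1 / real n) + cmod a * cmod b * C * (1 / real n)"
        by (simp add: algebra_simps add_divide_distrib)
      also have "\<dots> \<le> cmod a * C * (1 + F) * (\<delta> + 1 / real n) + cmod b * (1 + F) * (\<delta> + 1 / real n) +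
           cmod a * cmod b * C * (\<delta> + 1 / real n)"
        using \<delta>0 C F1 by (intro add_mono mult_left_mono) auto
      also have "\<dots> \<le> Q * (\<delta> + 1 / real n)"
      proof -
        define t where "t = \<delta> + 1 / real n"
        have t0: "t \<ge> 0" using \<delta>0 by (simp add: t_def)
        have "Q * t = cmod a * C * (1 + F) * t + cmod b * (1 + F) * t + cmod a * cmod b * C * t +
            (cmod a / cmod b * (1 + F) * t + (1 + F) * t)" by (simp add: Q_def algebra_simps)
        moreover have "cmod a / cmod b * (1 + F) * t \<ge> 0" "(1 + F) * t \<ge> 0"
          using t0 F1 by (intro mult_nonneg_nonneg; simp)+
        ultimately show ?thesis unfolding t_def by linarith
      qed
      finally show "cmod (hill_V a b R S h 0) + cmod a * cmod b * C / real n \<le> e" using Qx by linarith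
      have "cmod (hill_V a b R S h (int n)) \<le> cmod a * cmod (h (int n + int R)) + cmod b * cmod (h (int n - int S))"
        unfolding hill_V_def by (simp flip: norm_mult add: norm_triangle_ineq)
      also have "\<dots> \<le> cmod a * ((1 + F) * (w / real n)) + cmod b * ((1 + F) * (\<delta> * w))"
      proof (intro add_mono mult_left_mono)
        have "cmod (h (int n + int R)) \<le> G * (w / real n)" using h[of "int n + int R"] RS by simp
        also have "\<dots> \<le> (1 + F) * (w / real n)" using G w by (intro mult_right_mono) auto
        finally show "cmod (h (int n + int R)) \<le> (1 + F) * (w / real n)" .
        have "cmod (h (int n - int S)) \<le> G * (\<delta> * w)" using h[of "int n - int S"] RS nSR by (simp add: w_def)
        also have "\<dots> \<le> (1 + F) * (\<delta> * w)" using G w \<delta>0 by (intro mult_right_mono) auto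
        finally show "cmod (h (int n - int S)) \<le> (1 + F) * (\<delta> * w)" .
      qed auto
      also have "\<dots> = (cmod a / cmod b * (1 + F) * (1 / real n) + (1 + F) * \<delta>) * (cmod b * w)"
      proof -
        have "cmod a / cmod b * (1 + F) * (1 / real n) * (cmod b * w) = cmod a * ((1 + F) * (w / real n))"
          using b by simp
        thus ?thesis by (simp add: distrib_right[of _ _ "cmod b * w"] algebra_simps)
      qed
      also have "\<dots> \<le> (cmod a / cmod b * (1 + F) * (\<delta> + 1 / real n) + (1 + F) * (\<delta> + 1 / real n)) * (cmod b * w)"
        using \<delta>0 F1 w by (intro mult_right_mono add_mono mult_left_mono) auto
      also have "\<dots> \<le> (Q * (\<delta> + 1 / real n)) * (cmod b * w)"
      proof (intro mult_right_mono)
        define t where "t = \<delta> + 1 / real n"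
        have t0: "t \<ge> 0" using \<delta>0 by (simp add: t_def)
        have "Q * t = cmod a / cmod b * (1 + F) * t + (1 + F) * t +
            (cmod a * C * (1 + F) * t + cmod b * (1 + F) * t + cmod a * cmod b * C * t)"
          by (simp add: Q_def algebra_simps)
        moreover have "cmod a * C * (1 + F) * t \<ge> 0" "cmod b * (1 + F) * t \<ge> 0" "cmod a * cmod b * C * t \<ge> 0"
          using t0 F1 C by (intro mult_nonneg_nonneg; simp)+
        ultimately show "cmod a / cmod b * (1 + F) * (\<delta> + 1 / real n) + (1 + F) * (\<delta> + 1 / real n)
            \<le> Q * (\<delta> + 1 / real n)" unfolding t_def by linarith
      qed (use w in auto)
      also have "\<dots> \<le> e * (cmod b * w)" using Qx w by (intro mult_right_mono) auto
      finally show "cmod (hill_V a b R S h (int n)) \<le> e * cmod (hill_K b S M)" by (simp add: Kw)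
    qed
    let ?P = "chain b S n"
    have P_in: "cmod (?P j) \<le> ?W j" if "0 \<le> j" "j < int n" for j
      using norm_chain_le(2)[of b S M j] b RS M that by (simp add: n_def)
    have P_out: "?P j = 0" if "j < 0 \<or> j \<ge> int n" for j using that by (auto simp: chain_def)
    have P_step: "of_int (gap n j) * ?P j = b * ?P (j - int S)" if "j \<noteq> 0" "j \<noteq> int n" for j
      using chain_step[of S j M b] RS that by (simp add: n_def)
    show ?case unfolding n_def[symmetric]
    proof (intro allI impI)
      fix z u assume z: "cmod z \<le> Z" and u: "red_sol a b R S n z (\<lambda>_. 0) u" "u 0 = 1" "u (int n) = 0"
      \<comment> \<open>Subtracting the straight chain leaves a remainder that vanishes at both
        resonant indices and whose source consists of the \<open>a\<close>-steps and the shift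
        only.\<close>
      define h where "h j = u j - ?P j" for j
      have "red_sol a b R S n z (\<lambda>j. a * ?P (j + int R) - z * ?P j) h"
        unfolding red_sol_def
      proof (intro conjI allI impI)
        obtain B where B: "\<And>j. cmod (u j) \<le> B" using u(1) by (auto simp: red_sol_def bounded_iff)
        have "bounded (?P ` {0..<int n})" by (intro finite_imp_bounded) auto
        then obtain B' where B': "\<And>j. j \<in> {0..<int n} \<Longrightarrow> cmod (?P j) \<le> B'"
          unfolding bounded_iff by blast
        have "cmod (h j) \<le> B + max B' 0" for j
          unfolding h_def using B[of j] B'[of j] P_out[of j]
          by (intro order_trans[OF norm_triangle_ineq4] add_mono) (cases "0 \<le> j \<and> j < int n"; auto)+
        thus "bounded (range h)" by (auto simp: bounded_iff)
        fix j assume j: "j \<noteq> 0" "j \<noteq> int n"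
        have "(of_int (gap n j) + z) * h j = (of_int (gap n j) + z) * u j - of_int (gap n j) * ?P j - z * ?P j"
          by (simp add: h_def algebra_simps)
        also have "\<dots> = hill_V a b R S u j - b * ?P (j - int S) - z * ?P j"
          using u(1) j P_step[OF j] by (simp add: red_sol_def)
        also have "\<dots> = hill_V a b R S h j + (a * ?P (j + int R) - z * ?P j)"
          by (simp add: hill_V_def h_def algebra_simps)
        finally show "(of_int (gap n j) + z) * h j = hill_V a b R S h j + (a * ?P (j + int R) - z * ?P j)" .
      qed
      moreover have "h 0 = 0" "h (int n) = 0" using u n2 P_out[of "int n"] by (auto simp: h_def chain_0)
      moreover have "cmod (a * ?P (j + int R) - z * ?P j) \<le> F * ?W j" if j: "0 < j" "j < int n" for j
      proof -
        have "cmod (?P (j + int R)) \<le> C * ?W j"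
        proof (cases "j + int R < int n")
          case True
          thus ?thesis using P_in[of "j + int R"] Wratio[of j "int R"] j by simp
        next
          case False
          thus ?thesis using P_out[of "j + int R"] Wpos[of j] C j by simp
        qed
        hence "cmod (a * ?P (j + int R) - z * ?P j) \<le> cmod a * (C * ?W j) + Z * ?W j"
          using P_in[of j] j z Z0
          by (intro order_trans[OF norm_triangle_ineq4] add_mono) (auto simp: norm_mult intro!: mult_left_mono mult_mono)
        also have "\<dots> \<le> F * ?W j" using Wpos[of j] j by (simp add: F_def algebra_simps)
        finally show ?thesis .
      qed
      moreover have "cmod (a * ?P (j + int R) - z * ?P j) \<le> F" if j: "j < 0" for j
      proof -
        have "cmod (?P (j + int R)) \<le> C"
        proof (cases "0 \<le> j + int R")
          case True
          thus ?thesis using P_in[of "j + int R"] Wratio[of 0 "j + int R"] j W0 nSR by simp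
        next
          case False
          thus ?thesis using P_out[of "j + int R"] C by simp
        qed
        hence "cmod a * cmod (?P (j + int R)) \<le> cmod a * C" by (intro mult_left_mono) auto
        thus ?thesis using P_out[of j] j Z0 by (simp add: norm_mult F_def)
      qed
      moreover have "cmod (a * ?P (j + int R) - z * ?P j) \<le> F * w" if j: "j > int n" for j
        using P_out[of j] P_out[of "j + int R"] j F1 w by simp
      moreover have F0: "F > 0" using F1 by simp
      ultimately have h: "(0 < j \<longrightarrow> j < int n \<longrightarrow> cmod (h j) \<le> F * (\<delta> * ?W j)) \<and> (j < 0 \<longrightarrow> cmod (h j) \<le> F * (1 / real n)) \<and>
        (j > int n \<longrightarrow> cmod (h j) \<le> F * (w / real n))" for j
        using z by (intro scaled)
      note Vh = V_bounds[OF h F0]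
      have uPh: "hill_V a b R S u j = hill_V a b R S ?P j + hill_V a b R S h j" for j
        by (simp add: hill_V_def h_def algebra_simps)
      have VPn: "hill_V a b R S ?P (int n) = hill_K b S M"
        using P_out[of "int n + int R"] chain_last' by (simp add: hill_V_def)
      \<comment> \<open>A straight chain returns to \<open>0\<close> by a single
        \<open>a\<close>-step from the site \<open>R\<close>. This happens only if \<open>S\<close>
        divides \<open>R\<close>, and then the last denominator of that site already gives
        \<open>1 / n\<close>.\<close>
      have VP0: "cmod (hill_V a b R S ?P 0) \<le> cmod a * cmod b * C / real n"
      proof -
        have "cmod (?P (int R)) \<le> cmod b * C / real n"
        proof (cases "int S dvd int R")
          case False
          thus ?thesis using C by (simp add: chain_def)
        next
          case True
          hence SR: "S \<le> R" using RS by (auto dest: dvd_imp_le)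
          have "4 * (int n - 1) \<le> gap n (int R)" using RS nSR by (intro gap_pos) auto
          hence "real_of_int (4 * (int n - 1)) \<le> real_of_int (gap n (int R))" by (simp only: of_int_le_iff)
          hence g: "real_of_int (gap n (int R)) \<ge> real n" using n2 by simp
          have "cmod (?P (int R)) \<le> ?W (int R)" using P_in nSR by simp
          also have "?W (int R) = cmod b * ?W (int R - int S) / real_of_int (gap n (int R))"
            using Wstep[of "int R"] SR nSR g n2 by (simp add: field_simps)
          also have "\<dots> \<le> cmod b * C / real n"
            using Wratio[of 0 "int R - int S"] W0 SR nSR g n2 C
            by (intro frac_le mult_left_mono mult_nonneg_nonneg) auto
          finally show ?thesis .
        qed
        hence "cmod a * cmod (?P (int R)) \<le> cmod a * (cmod b * C / real n)" by (intro mult_left_mono) auto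
        thus ?thesis using P_out[of "- int S"] RS by (simp add: hill_V_def norm_mult)
      qed
      have u_in: "cmod (u j) \<le> (1 + F) * ?W j" if j: "0 < j" "j < int n" for j
      proof -
        have "cmod (u j) \<le> cmod (?P j) + cmod (h j)" using norm_triangle_ineq[of "?P j" "h j"] by (simp add: h_def)
        also have "\<dots> \<le> ?W j + F * (1 * ?W j)"
        proof (rule add_mono)
          have "F * (\<delta> * ?W j) \<le> F * (1 * ?W j)"
            using \<delta>1 F1 Wpos[of j] j by (intro mult_left_mono mult_right_mono) auto
          thus "cmod (h j) \<le> F * (1 * ?W j)" using h[of j] j by auto
        qed (use P_in j in auto)
        finally show ?thesis by (simp add: algebra_simps)
      qed
      have F_n: "F * (1 / real n) \<le> 1 + F" "F * (w / real n) \<le> (1 + F) * w"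
      proof -
        have "F * (1 / real n) \<le> F * 1" using F1 n2 by (intro mult_left_mono) auto
        thus *: "F * (1 / real n) \<le> 1 + F" by simp
        have "F * (w / real n) = F * (1 / real n) * w" by simp
        also have "\<dots> \<le> (1 + F) * w" using * w by (intro mult_right_mono) auto
        finally show "F * (w / real n) \<le> (1 + F) * w" .
      qed
      have u_left: "cmod (u j) \<le> 1 + F" if "j < 0" for j
        using h[of j] that P_out[of j] F_n(1) by (auto simp: h_def)
      have u_right: "cmod (u j) \<le> (1 + F) * w" if "j > int n" for j
        using h[of j] that P_out[of j] F_n(2) by (auto simp: h_def)
      show "cmod (hill_V a b R S u 0) \<le> e \<and>
        cmod (hill_V a b R S u (int n) - hill_K b S M) \<le> e * cmod (hill_K b S M) \<and>
        (\<forall>z' w. cmod z' \<le> Z \<longrightarrow> red_sol a b R S n z' u w \<longrightarrow> w 0 = 0 \<longrightarrow> w (int n) = 0 \<longrightarrow>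
          cmod (hill_V a b R S w 0) \<le> e \<and> cmod (hill_V a b R S w (int n)) \<le> e * cmod (hill_K b S M))"
      proof (intro conjI allI impI)
        have "cmod (hill_V a b R S u 0) \<le> cmod (hill_V a b R S ?P 0) + cmod (hill_V a b R S h 0)"
          unfolding uPh by (rule norm_triangle_ineq)
        thus "cmod (hill_V a b R S u 0) \<le> e" using VP0 Vh by linarith
        show "cmod (hill_V a b R S u (int n) - hill_K b S M) \<le> e * cmod (hill_K b S M)"
          unfolding uPh VPn using Vh by simp
      next
        \<comment> \<open>As a source, \<open>u\<close> has size \<open>1 + F\<close> relative to
          the weight, so the solution it generates gains another factor \<open>\<delta>\<close>. The
          parameter \<open>z'\<close> is independent of \<open>z\<close>, as differences of
          solutions at two parameters require.\<close>
        fix z' q assume "cmod z' \<le> Z" "red_sol a b R S n z' u q" "q 0 = 0" "q (int n) = 0"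
        hence "(0 < j \<longrightarrow> j < int n \<longrightarrow> cmod (q j) \<le> (1 + F) * (\<delta> * ?W j)) \<and> (j < 0 \<longrightarrow> cmod (q j) \<le> (1 + F) * (1 / real n)) \<and>
            (j > int n \<longrightarrow> cmod (q j) \<le> (1 + F) * (w / real n))" for j
          using F0 u_in u_left u_right by (intro scaled) auto
        note Vq = V_bounds[OF this]
        have "cmod a * cmod b * C / real n \<ge> 0" using C by simp
        thus "cmod (hill_V a b R S q 0) \<le> e" "cmod (hill_V a b R S q (int n)) \<le> e * cmod (hill_K b S M)"
          using Vq F0 by auto
      qed
    qed
  qed
qed

section \<open>Fourier coefficients\<close>

lemma C2_0piD:
  assumes "y \<in> C2_0pi"
  shows "x \<in> {0..pi} \<Longrightarrow> (y has_vector_derivative deriv_0pi y x) (at x within {0..pi})"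
    and "x \<in> {0..pi} \<Longrightarrow> (deriv_0pi y has_vector_derivative deriv_0pi (deriv_0pi y) x) (at x within {0..pi})"
    and "continuous_on {0..pi} y" "continuous_on {0..pi} (deriv_0pi y)"
    and "continuous_on {0..pi} (deriv_0pi (deriv_0pi y))"
    and "x \<notin> {0..pi} \<Longrightarrow> y x = 0"
proof -
  have d: "y differentiable_on {0..pi}" "deriv_0pi y differentiable_on {0..pi}"
    using assms by (auto simp: C2_0pi_def)
  show "x \<in> {0..pi} \<Longrightarrow> (y has_vector_derivative deriv_0pi y x) (at x within {0..pi})"
    and "x \<in> {0..pi} \<Longrightarrow> (deriv_0pi y has_vector_derivative deriv_0pi (deriv_0pi y) x) (at x within {0..pi})"
    using d by (auto simp: deriv_0pi_def differentiable_on_def vector_derivative_works[symmetric])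
  show "continuous_on {0..pi} y" "continuous_on {0..pi} (deriv_0pi y)"
    using d by (auto intro: differentiable_imp_continuous_on)
qed (use assms in \<open>auto simp: C2_0pi_def\<close>)

lemma deriv_0pi_eq:
  assumes "x \<in> {0..pi}" "(y has_vector_derivative y') (at x within {0..pi})"
  shows "deriv_0pi y x = y'"
  using assms vector_derivative_within_cbox[of 0 pi x y y'] by (simp add: deriv_0pi_def)

lemma C2_0piI:
  assumes y: "\<And>x. x \<in> {0..pi} \<Longrightarrow> (y has_vector_derivative y1 x) (at x within {0..pi})"
    and y1: "\<And>x. x \<in> {0..pi} \<Longrightarrow> (y1 has_vector_derivative y2 x) (at x within {0..pi})"
    and y2: "continuous_on {0..pi} y2" and 0: "\<And>x. x \<notin> {0..pi} \<Longrightarrow> y x = 0"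
  shows "y \<in> C2_0pi"
    and "x \<in> {0..pi} \<Longrightarrow> deriv_0pi y x = y1 x"
    and "x \<in> {0..pi} \<Longrightarrow> deriv_0pi (deriv_0pi y) x = y2 x"
proof -
  show d1: "deriv_0pi y x = y1 x" if "x \<in> {0..pi}" for x
    using deriv_0pi_eq[OF that y[OF that]] .
  have hd: "(deriv_0pi y has_vector_derivative y2 x) (at x within {0..pi})" if "x \<in> {0..pi}" for x
    by (rule has_vector_derivative_transform[OF that _ y1[OF that]]) (simp add: d1)
  show d2: "deriv_0pi (deriv_0pi y) x = y2 x" if "x \<in> {0..pi}" for x
    using deriv_0pi_eq[OF that hd[OF that]] .
  show "y \<in> C2_0pi"
    unfolding C2_0pi_def mem_Collect_eq
  proof (intro conjI allI impI)
    show "continuous_on {0..pi} (deriv_0pi (deriv_0pi y))"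
      by (rule continuous_on_eq[OF y2]) (simp add: d2)
    show "y differentiable_on {0..pi}" "deriv_0pi y differentiable_on {0..pi}"
      unfolding differentiable_on_def using y hd by (blast intro: differentiableI_vector)+
  qed (use 0 in auto)
qed

lemma Green_identity:
  fixes y y1 y2 g g1 g2 :: "real \<Rightarrow> complex"
  assumes "\<And>x. x \<in> {0..pi} \<Longrightarrow> (y has_vector_derivative y1 x) (at x within {0..pi})"
    and "\<And>x. x \<in> {0..pi} \<Longrightarrow> (y1 has_vector_derivative y2 x) (at x within {0..pi})"
    and "\<And>x. x \<in> {0..pi} \<Longrightarrow> (g has_vector_derivative g1 x) (at x within {0..pi})"
    and "\<And>x. x \<in> {0..pi} \<Longrightarrow> (g1 has_vector_derivative g2 x) (at x within {0..pi})"
  shows "((\<lambda>x. y2 x * g x - y x * g2 x) has_integral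
     (y1 pi * g pi - y pi * g1 pi) - (y1 0 * g 0 - y 0 * g1 0)) {0..pi}"
proof (rule fundamental_theorem_of_calculus)
  fix x assume x: "x \<in> {0..pi}"
  have "((\<lambda>x. y1 x * g x - y x * g1 x) has_vector_derivative
      (y1 x * g1 x + y2 x * g x) - (y x * g2 x + y1 x * g1 x)) (at x within {0..pi})"
    using assms[OF x] by (intro has_vector_derivative_diff has_vector_derivative_mult)
  thus "((\<lambda>x. y1 x * g x - y x * g1 x) has_vector_derivative y2 x * g x - y x * g2 x) (at x within {0..pi})"
    by simp
qed simp

section \<open>The modes and their orthogonality relations\<close>

definition hmode :: "nat \<Rightarrow> int \<Rightarrow> real \<Rightarrow> complex" where
  "hmode n j x = exp (\<i> * of_int (2 * j - int n) * of_real x)"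

lemma hmode_0: "hmode n j 0 = 1"
  by (simp add: hmode_def)

lemma norm_hmode: "cmod (hmode n j x) = 1"
proof -
  have "hmode n j x = exp (\<i> * of_real (real_of_int (2 * j - int n) * x))"
    unfolding hmode_def by (simp add: mult.assoc)
  thus ?thesis by (simp only: norm_exp_i_times)
qed

lemma hmode_pi: "hmode n j pi = (-1) ^ n"
proof -
  have "hmode n j pi = exp (2 * of_int j * of_real pi * \<i>) * exp (- (of_nat n * (\<i> * of_real pi)))"
    unfolding hmode_def exp_add[symmetric] by (rule arg_cong[where f = exp]) (simp add: algebra_simps)
  also have "exp (2 * of_int j * of_real pi * \<i>) = 1"
    unfolding exp_eq_1 by (auto intro!: exI[of _ j])
  also have "exp (- (of_nat n * (\<i> * of_real pi))) = inverse ((exp (\<i> * of_real pi)) ^ n)"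
    by (simp only: exp_minus exp_of_nat_mult)
  finally show ?thesis by (cases "even n") (simp_all add: exp_pi_i')
qed

lemma hmode_deriv:
  "(hmode n j has_vector_derivative (\<i> * of_int (2 * j - int n)) * hmode n j x) (at x within A)"
proof -
  let ?c = "\<i> * of_int (2 * j - int n) :: complex"
  have "((\<lambda>z. exp (?c * z)) has_field_derivative ?c * exp (?c * of_real x)) (at (of_real x))"
    by (rule DERIV_cong, rule DERIV_chain2, rule DERIV_exp, rule DERIV_cmult_Id) simp
  from has_vector_derivative_real_field[OF this, of A] show ?thesis unfolding hmode_def .
qed

lemma hmode_deriv2:
  "((\<lambda>x. (\<i> * of_int (2 * j - int n)) * hmode n j x) has_vector_derivative
     - (of_int (2 * j - int n))\<^sup>2 * hmode n j x) (at x within A)"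
proof -
  let ?c = "\<i> * of_int (2 * j - int n) :: complex"
  have "((\<lambda>x. ?c * hmode n j x) has_vector_derivative ?c * (?c * hmode n j x)) (at x within A)"
    by (intro has_vector_derivative_mult_right hmode_deriv)
  also have "?c * (?c * hmode n j x) = (\<i> * \<i>) * (of_int (2 * j - int n))\<^sup>2 * hmode n j x"
    by (simp only: power2_eq_square mult_ac)
  finally show ?thesis by simp
qed

lemma continuous_on_hmode [continuous_intros]: "continuous_on A (hmode n j)"
  unfolding hmode_def by (intro continuous_intros)

lemma potential_times_hmode:
  "two_term_potential a b R S x * hmode n j x = a * hmode n (j - int R) x + b * hmode n (j + int S) x"
proof -
  have "exp (- 2 * of_nat R * \<i> * of_real x) * hmode n j x = hmode n (j - int R) x"
    "exp (2 * of_nat S * \<i> * of_real x) * hmode n j x = hmode n (j + int S) x"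
    unfolding hmode_def by (simp_all add: exp_add[symmetric] algebra_simps)
  thus ?thesis by (simp add: two_term_potential_def distrib_right mult.assoc)
qed

lemma hmode_mult: "hmode n i x * hmode n (int n - j) x = exp (\<i> * of_int (2 * (i - j)) * of_real x)"
  unfolding hmode_def by (simp add: exp_add[symmetric] algebra_simps)

lemma has_integral_hmode_mult:
  "((\<lambda>x. hmode n i x * hmode n (int n - j) x) has_integral (if i = j then of_real pi else 0)) {0..pi}"
proof (cases "i = j")
  case True
  have "((\<lambda>x. 1::complex) has_integral (pi *\<^sub>R 1)) {0..pi}"
    using has_integral_const_real[of "1::complex" 0 pi] by simp
  thus ?thesis using True by (simp add: hmode_mult scaleR_conv_of_real)
next
  case False
  define k where "k = 2 * (i - j)"
  have k: "k \<noteq> 0" using False by (simp add: k_def)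
  have "((\<lambda>x. exp (\<i> * of_int k * of_real x)) has_integral
      exp (\<i> * of_int k * of_real pi) / (\<i> * of_int k) - exp (\<i> * of_int k * of_real 0) / (\<i> * of_int k)) {0..pi}"
  proof (rule fundamental_theorem_of_calculus)
    fix x :: real
    show "((\<lambda>x. exp (\<i> * of_int k * of_real x) / (\<i> * of_int k)) has_vector_derivative exp (\<i> * of_int k * of_real x)) (at x within {0..pi})"
    proof -
      let ?c = "\<i> * of_int k :: complex"
      have "((\<lambda>z. exp (?c * z) / ?c) has_field_derivative exp (?c * of_real x) * ?c / ?c) (at (of_real x))"
        by (rule DERIV_cdivide, rule DERIV_chain2, rule DERIV_exp, rule DERIV_cmult_Id)
      hence "((\<lambda>z. exp (?c * z) / ?c) has_field_derivative exp (?c * of_real x)) (at (of_real x))"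
        using k by simp
      from has_vector_derivative_real_field[OF this] show ?thesis .
    qed
  qed simp
  moreover have "exp (\<i> * of_int k * of_real pi) = 1"
  proof -
    have "exp (2 * of_int (i - j) * of_real pi * \<i>) = 1"
      unfolding exp_eq_1 by (auto intro!: exI[of _ "i - j"])
    thus ?thesis by (simp add: k_def algebra_simps)
  qed
  ultimately show ?thesis using False by (simp add: hmode_mult k_def)
qed

text \<open>The mode with index \<open>n - j\<close> is the complex conjugate of the mode with index
  \<open>j\<close>, so this is the usual Fourier coefficient, written as a bilinear pairing that
  fits Green's identity for complex potentials.\<close>

definition fc :: "nat \<Rightarrow> (real \<Rightarrow> complex) \<Rightarrow> int \<Rightarrow> complex" where
  "fc n y j = integral {0..pi} (\<lambda>x. y x * hmode n (int n - j) x) / of_real pi"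

lemma fc_integrable:
  "continuous_on {0..pi} y \<Longrightarrow> (\<lambda>x. y x * hmode n j x) integrable_on {0..pi}"
  by (intro integrable_continuous_real continuous_intros)

lemma fc_diff_scale:
  assumes "continuous_on {0..pi} y" "continuous_on {0..pi} w"
  shows "fc n (\<lambda>x. y x - c * w x) j = fc n y j - c * fc n w j"
proof -
  have "integral {0..pi} (\<lambda>x. (y x - c * w x) * hmode n (int n - j) x) =
      integral {0..pi} (\<lambda>x. y x * hmode n (int n - j) x - c * (w x * hmode n (int n - j) x))"
    by (simp add: algebra_simps)
  also have "\<dots> = integral {0..pi} (\<lambda>x. y x * hmode n (int n - j) x) -
      c * integral {0..pi} (\<lambda>x. w x * hmode n (int n - j) x)"
    using assms by (subst integral_diff) (auto intro!: fc_integrable integrable_on_mult_right)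
  finally show ?thesis by (simp add: fc_def diff_divide_distrib)
qed

lemma bounded_fc:
  assumes "continuous_on {0..pi} y"
  shows "bounded (range (fc n y))"
proof -
  have "compact (y ` {0..pi})" using assms by (intro compact_continuous_image) auto
  then obtain B where B: "\<And>x. x \<in> {0..pi} \<Longrightarrow> cmod (y x) \<le> B"
    by (meson bounded_iff compact_imp_bounded imageI)
  have "cmod (fc n y j) \<le> B" for j
  proof -
    have "cmod (integral {0..pi} (\<lambda>x. y x * hmode n (int n - j) x)) \<le> B * (pi - 0)"
      using assms B by (intro integral_bound) (auto intro!: continuous_intros simp: norm_mult norm_hmode)
    thus ?thesis by (simp add: fc_def norm_divide field_simps)
  qed
  thus ?thesis by (auto simp: bounded_iff)
qed

lemma continuous_on_potential [continuous_intros]: "continuous_on A (two_term_potential a b R S)"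
  unfolding two_term_potential_def by (intro continuous_intros)

lemma parity_bdry_iff: "bdry_cond (parity_bdry n) y \<longleftrightarrow>
   y pi = (-1) ^ n * y 0 \<and> deriv_0pi y pi = (-1) ^ n * deriv_0pi y 0"
  by (cases "even n") (auto simp: parity_bdry_def)

text \<open>Integrating by parts twice is Green's identity against a mode. The boundary terms cancel
  because function and mode pick up the same sign \<open>(-1)^n\<close> at
  \<open>pi\<close>.\<close>

lemma fc_hill_op:
  assumes y: "y \<in> hill_dom (parity_bdry n)"
  shows "fc n (\<lambda>x. hill_op (two_term_potential a b R S) y x - ((of_nat n)\<^sup>2 + z) * y x) j =
    hill_V a b R S (fc n y) j - (of_int (gap n j) + z) * fc n y j"
proof -
  let ?v = "two_term_potential a b R S" and ?e = "hmode n (int n - j)"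
  have C2: "y \<in> C2_0pi" and bc: "y pi = (-1) ^ n * y 0" "deriv_0pi y pi = (-1) ^ n * deriv_0pi y 0"
    using y by (auto simp: hill_dom_def parity_bdry_iff)
  note D = C2_0piD[OF C2]
  let ?k = "of_int (2 * (int n - j) - int n) :: complex"
  have "((\<lambda>x. deriv_0pi (deriv_0pi y) x * ?e x - y x * (- (?k\<^sup>2) * ?e x)) has_integral
     (deriv_0pi y pi * ?e pi - y pi * (\<i> * ?k * ?e pi)) - (deriv_0pi y 0 * ?e 0 - y 0 * (\<i> * ?k * ?e 0))) {0..pi}"
    using hmode_deriv2[of "int n - j" n] by (intro Green_identity D hmode_deriv) auto
  moreover have "(-1) ^ n * ((-1) ^ n * w) = (w::complex)" for w
    by (simp add: mult.assoc[symmetric] power_mult_distrib[symmetric])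
  ultimately have G: "((\<lambda>x. deriv_0pi (deriv_0pi y) x * ?e x - y x * (- (?k\<^sup>2) * ?e x)) has_integral 0) {0..pi}"
    unfolding hmode_pi hmode_0 bc by (simp add: mult.assoc mult.left_commute[of "(-1)^n"])
  have I: "((\<lambda>x. y x * hmode n (int n - i) x) has_integral (of_real pi * fc n y i)) {0..pi}" for i
    using fc_integrable[OF D(3), of n "int n - i"] by (simp add: fc_def has_integral_integral)
  have "((\<lambda>x. (?k\<^sup>2 - (of_nat n)\<^sup>2 - z) * (y x * ?e x) + a * (y x * hmode n (int n - (j + int R)) x)
      + b * (y x * hmode n (int n - (j - int S)) x) - (deriv_0pi (deriv_0pi y) x * ?e x - y x * (- (?k\<^sup>2) * ?e x))) has_integral
      ((?k\<^sup>2 - (of_nat n)\<^sup>2 - z) * (of_real pi * fc n y j) + a * (of_real pi * fc n y (j + int R))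
      + b * (of_real pi * fc n y (j - int S)) - 0)) {0..pi}"
    by (intro has_integral_diff has_integral_add has_integral_mult_right I G)
  moreover have "(?k\<^sup>2 - (of_nat n)\<^sup>2 - z) * (y x * ?e x) + a * (y x * hmode n (int n - (j + int R)) x)
      + b * (y x * hmode n (int n - (j - int S)) x) - (deriv_0pi (deriv_0pi y) x * ?e x - y x * (- (?k\<^sup>2) * ?e x)) =
     (hill_op ?v y x - ((of_nat n)\<^sup>2 + z) * y x) * ?e x" for x
  proof -
    have "?v x * ?e x = a * hmode n (int n - (j + int R)) x + b * hmode n (int n - (j - int S)) x"
      unfolding potential_times_hmode by (simp add: algebra_simps)
    hence "y x * (?v x * ?e x) = y x * (a * hmode n (int n - (j + int R)) x + b * hmode n (int n - (j - int S)) x)" by simp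
    thus ?thesis unfolding hill_op_def by (simp add: algebra_simps)
  qed
  ultimately have "((\<lambda>x. (hill_op ?v y x - ((of_nat n)\<^sup>2 + z) * y x) * ?e x) has_integral
      ((?k\<^sup>2 - (of_nat n)\<^sup>2 - z) * (of_real pi * fc n y j) + a * (of_real pi * fc n y (j + int R))
      + b * (of_real pi * fc n y (j - int S)) - 0)) {0..pi}" by simp
  hence "fc n (\<lambda>x. hill_op ?v y x - ((of_nat n)\<^sup>2 + z) * y x) j =
      (of_real pi * ((?k\<^sup>2 - (of_nat n)\<^sup>2 - z) * fc n y j + a * fc n y (j + int R) + b * fc n y (j - int S))) / of_real pi"
    unfolding fc_def[of n "\<lambda>x. hill_op ?v y x - _ * y x"]
    by (subst integral_unique) (auto simp: algebra_simps)
  also have "\<dots> = (?k\<^sup>2 - (of_nat n)\<^sup>2 - z) * fc n y j + a * fc n y (j + int R) + b * fc n y (j - int S)"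
    by (rule nonzero_mult_div_cancel_left) simp
  also have "\<dots> = hill_V a b R S (fc n y) j - (of_int (gap n j) + z) * fc n y j"
    by (simp add: hill_V_def gap_def power2_eq_square algebra_simps)
  finally show ?thesis .
qed

section \<open>Completeness of the trigonometric system\<close>

lemma circle_lift:
  fixes g :: "real \<Rightarrow> complex"
  assumes g: "continuous_on {0..pi} g" "g pi = g 0"
  obtains G where "continuous_on (sphere 0 1) G" "\<And>x. x \<in> {0..pi} \<Longrightarrow> G (cis (2 * x)) = g x"
proof -
  define G where "G w = g (Arg2pi w / 2)" for w
  have G: "G (cis (2 * x)) = g x" if x: "x \<in> {0..pi}" for x
  proof (cases "x = pi")
    case True
    thus ?thesis using g(2) by (simp add: G_def Arg2pi_of_real[of 1, simplified])
  next
    case False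
    have "Arg2pi (cis (2 * x)) = 2 * x"
      by (rule Arg2pi_unique[of 1]) (use False x in \<open>auto simp: cis_conv_exp\<close>)
    thus ?thesis by (simp add: G_def)
  qed
  have surj: "\<exists>x\<in>{0..pi}. w = cis (2 * x)" if "w \<in> sphere 0 1" for w
  proof (rule bexI[of _ "Arg2pi w / 2"])
    show "w = cis (2 * (Arg2pi w / 2))" using Arg2pi_eq[of w] that by (simp add: cis_conv_exp)
    show "Arg2pi w / 2 \<in> {0..pi}" using Arg2pi_ge_0[of w] Arg2pi_lt_2pi[of w] by simp
  qed
  \<comment> \<open>Although \<open>Arg2pi\<close> jumps at \<open>1\<close>, the map from
    \<open>x\<close> to \<open>cis (2 * x)\<close> sends compact sets to closed ones; preimages of
    closed sets under \<open>G\<close> are images of compact sets and hence closed.\<close>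
  have "continuous_on (sphere 0 1) G"
    unfolding continuous_on_closed_invariant
  proof (intro allI impI)
    fix B :: "complex set" assume B: "closed B"
    have "closed ((\<lambda>x. cis (2 * x)) ` ({0..pi} \<inter> g -` B))"
    proof (intro compact_imp_closed compact_continuous_image)
      show "continuous_on ({0..pi} \<inter> g -` B) (\<lambda>x. cis (2 * x))" by (intro continuous_intros)
      have "closed ({0..pi} \<inter> g -` B)"
        by (rule continuous_closed_preimage[OF g(1)]) (use B in auto)
      thus "compact ({0..pi} \<inter> g -` B)"
        by (meson bounded_closed_interval bounded_subset compact_eq_bounded_closed inf_le1)
    qed
    moreover have "(\<lambda>x. cis (2 * x)) ` ({0..pi} \<inter> g -` B) \<inter> sphere 0 1 = G -` B \<inter> sphere 0 1"
    proof (intro set_eqI iffI)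
      fix w assume "w \<in> G -` B \<inter> sphere 0 1"
      moreover from this obtain x where "x \<in> {0..pi}" "w = cis (2 * x)" using surj by blast
      ultimately show "w \<in> (\<lambda>x. cis (2 * x)) ` ({0..pi} \<inter> g -` B) \<inter> sphere 0 1" using G by auto
    qed (use G in auto)
    ultimately show "\<exists>A. closed A \<and> A \<inter> sphere 0 1 = G -` B \<inter> sphere 0 1" by blast
  qed
  thus ?thesis using G that by blast
qed

text \<open>The inductive form lets closure under products and orthogonality to \<open>g\<close>
  both be shown by induction on the generation.\<close>

inductive trig_poly :: "(real \<Rightarrow> complex) \<Rightarrow> bool" where
  trig_poly_cis: "trig_poly (\<lambda>x. cis (2 * (of_int j * x)))"
| trig_poly_scale: "trig_poly p \<Longrightarrow> trig_poly (\<lambda>x. c * p x)"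
| trig_poly_add: "trig_poly p \<Longrightarrow> trig_poly q \<Longrightarrow> trig_poly (\<lambda>x. p x + q x)"

lemma trig_poly_const: "trig_poly (\<lambda>x. c)"
  using trig_poly_scale[OF trig_poly_cis[of 0], of c] by simp

lemma trig_poly_mult:
  assumes "trig_poly p" "trig_poly q"
  shows "trig_poly (\<lambda>x. p x * q x)"
  using assms(2)
proof induction
  case (trig_poly_cis j)
  show ?case using assms(1)
  proof induction
    case (trig_poly_cis i)
    have "cis (2 * (of_int i * x)) * cis (2 * (of_int j * x)) = cis (2 * (of_int (i + j) * x))" for x
      by (simp add: cis_mult algebra_simps)
    thus ?case by (simp only: trig_poly.trig_poly_cis)
  next
    case (trig_poly_scale p c)
    thus ?case using trig_poly.trig_poly_scale by (simp add: mult.assoc)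
  next
    case (trig_poly_add p q)
    thus ?case using trig_poly.trig_poly_add by (simp add: distrib_right)
  qed
next
  case (trig_poly_scale q c)
  thus ?case using trig_poly.trig_poly_scale[of "\<lambda>x. p x * q x" c] by (simp add: mult.left_commute)
next
  case (trig_poly_add q r)
  thus ?case using trig_poly.trig_poly_add by (simp add: distrib_left)
qed

text \<open>The real Stone-Weierstrass theorem is applied to the algebra of real functions on the
  circle that become trigonometric polynomials in \<open>x\<close>; the coordinates
  \<open>Re\<close> and \<open>Im\<close> belong to it and separate points.\<close>

lemma trig_poly_approx:
  assumes "continuous_on (sphere (0::complex) 1) h" "e > 0"
  shows "\<exists>p k. trig_poly p \<and> (\<forall>x. of_real (k (cis (2 * x))) = p x) \<and> (\<forall>w\<in>sphere 0 1. \<bar>h w - k w\<bar> < e)"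
proof -
  let ?P = "\<lambda>k. continuous_on (sphere (0::complex) 1) k \<and>
     (\<exists>p. trig_poly p \<and> (\<forall>x. complex_of_real (k (cis (2 * x))) = p x))"
  have "\<exists>k. ?P k \<and> (\<forall>w\<in>sphere 0 1. \<bar>h w - k w\<bar> < e)"
  proof (rule Stone_Weierstrass_HOL)
    show "?P (\<lambda>x. c)" for c using trig_poly_const[of "of_real c"] by auto
    show "?P (\<lambda>x. f x + g x)" if "?P f \<and> ?P g" for f g
    proof -
      obtain p q where "trig_poly p" "\<And>x. complex_of_real (f (cis (2 * x))) = p x"
        "trig_poly q" "\<And>x. complex_of_real (g (cis (2 * x))) = q x" using \<open>?P f \<and> ?P g\<close> by blast
      thus ?thesis using that by (auto intro!: continuous_intros exI[of _ "\<lambda>x. p x + q x"] trig_poly_add)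
    qed
    show "?P (\<lambda>x. f x * g x)" if "?P f \<and> ?P g" for f g
    proof -
      obtain p q where "trig_poly p" "\<And>x. complex_of_real (f (cis (2 * x))) = p x"
        "trig_poly q" "\<And>x. complex_of_real (g (cis (2 * x))) = q x" using \<open>?P f \<and> ?P g\<close> by blast
      thus ?thesis using that by (auto intro!: continuous_intros exI[of _ "\<lambda>x. p x * q x"] trig_poly_mult)
    qed
    fix x y :: complex assume xy: "x \<in> sphere 0 1 \<and> y \<in> sphere 0 1 \<and> x \<noteq> y"
    have c1: "trig_poly (\<lambda>x. cis (2 * x))" "trig_poly (\<lambda>x. cis (- (2 * x)))"
      using trig_poly_cis[of 1] trig_poly_cis[of "-1"] by simp_all
    have "?P Re"
    proof (intro conjI exI allI)
      show "trig_poly (\<lambda>x. 1/2 * (cis (2 * x) + cis (- (2 * x))))"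
        by (intro trig_poly_scale trig_poly_add c1)
      show "complex_of_real (Re (cis (2 * x))) = 1/2 * (cis (2 * x) + cis (- (2 * x)))" for x
        by (simp add: complex_eq_iff)
    qed (intro continuous_intros)
    moreover have "?P Im"
    proof (intro conjI exI allI)
      show "trig_poly (\<lambda>x. (- \<i> / 2) * (cis (2 * x) + (-1) * cis (- (2 * x))))"
        by (intro trig_poly_scale trig_poly_add c1)
      show "complex_of_real (Im (cis (2 * x))) = (- \<i> / 2) * (cis (2 * x) + (-1) * cis (- (2 * x)))" for x
        by (simp add: complex_eq_iff)
    qed (intro continuous_intros)
    moreover have "Re x \<noteq> Re y \<or> Im x \<noteq> Im y" using xy by (auto simp: complex_eq_iff)
    ultimately show "\<exists>f. ?P f \<and> f x \<noteq> f y" by blast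
  qed (use assms in auto)
  thus ?thesis by blast
qed

text \<open>Approximation extends the orthogonality from trigonometric polynomials to all real
  continuous functions on the circle. Taking the lifts of \<open>Re g\<close> and
  \<open>Im g\<close> and combining them as \<open>g Re g - \<i> g Im g\<close> gives a vanishing
  integral of \<open>|g|^2\<close>.\<close>

lemma trig_complete:
  fixes g :: "real \<Rightarrow> complex"
  assumes g: "continuous_on {0..pi} g" "g pi = g 0"
    and orth: "\<And>j::int. ((\<lambda>x. g x * cis (2 * (of_int j * x))) has_integral 0) {0..pi}"
    and x: "x \<in> {0..pi}"
  shows "g x = 0"
proof -
  obtain G where G: "continuous_on (sphere 0 1) G" "\<And>x. x \<in> {0..pi} \<Longrightarrow> G (cis (2 * x)) = g x"
    using circle_lift[OF g] by blast
  have trig: "((\<lambda>x. g x * p x) has_integral 0) {0..pi}" if "trig_poly p" for p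
    using that
  proof induction
    case (trig_poly_cis j)
    show ?case by (rule orth)
  next
    case (trig_poly_scale p c)
    show ?case using has_integral_mult_right[OF trig_poly_scale.IH, of c] by (simp add: mult.left_commute)
  next
    case (trig_poly_add p q)
    show ?case using has_integral_add[OF trig_poly_add.IH] by (simp add: distrib_left)
  qed
  have "compact (g ` {0..pi})" using g(1) by (intro compact_continuous_image) auto
  then obtain B where B: "\<And>x. x \<in> {0..pi} \<Longrightarrow> cmod (g x) \<le> B"
    by (meson bounded_iff compact_imp_bounded imageI)
  have B0: "B \<ge> 0" using B[of 0] norm_ge_zero[of "g 0"] by (auto simp del: norm_ge_zero)
  have zero: "integral {0..pi} (\<lambda>x. g x * of_real (h (cis (2 * x)))) = 0"
    if h: "continuous_on (sphere (0::complex) 1) h" for h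
  proof -
    have ch: "continuous_on {0..pi} (\<lambda>x. h (cis (2 * x)))"
      by (intro continuous_on_compose2[OF h] continuous_intros) auto
    have "cmod (integral {0..pi} (\<lambda>x. g x * of_real (h (cis (2 * x))))) \<le> 0 + e" if e: "e > 0" for e
    proof -
      \<comment> \<open>The \<open>+ 1\<close> keeps the denominator positive when
        \<open>B = 0\<close>; the total error is then \<open>B * pi * e' \<le> e\<close>.\<close>
      define e' where "e' = e / (B * pi + 1)"
      have Bp: "B * pi + 1 > 0" using B0 by (intro add_nonneg_pos mult_nonneg_nonneg) auto
      have e': "e' > 0" using e Bp by (simp add: e'_def)
      obtain p k where p: "trig_poly p" "\<And>x. of_real (k (cis (2 * x))) = p x"
        and k: "\<And>w. w \<in> sphere 0 1 \<Longrightarrow> \<bar>h w - k w\<bar> < e'"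
        using trig_poly_approx[OF h e'] by blast
      have i1: "(\<lambda>x. g x * of_real (h (cis (2 * x)))) integrable_on {0..pi}"
        by (intro integrable_continuous_real continuous_intros g ch)
      have "((\<lambda>x. g x * of_real (h (cis (2 * x))) - g x * p x) has_integral
          integral {0..pi} (\<lambda>x. g x * of_real (h (cis (2 * x)))) - 0) {0..pi}"
        by (intro has_integral_diff integrable_integral i1 trig p)
      hence "cmod (integral {0..pi} (\<lambda>x. g x * of_real (h (cis (2 * x)))) - 0) \<le> (B * e') * measure lborel {0..pi}"
      proof (rule has_integral_bound_real[rotated 2])
        show "cmod (g x * of_real (h (cis (2 * x))) - g x * p x) \<le> B * e'" if "x \<in> {0..pi} - {}" for x
        proof -
          have x: "x \<in> {0..pi}" using that by simp
          have "cmod (g x * of_real (h (cis (2 * x))) - g x * p x) =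
             cmod (g x) * \<bar>h (cis (2 * x)) - k (cis (2 * x))\<bar>"
            by (simp flip: p(2) of_real_diff add: right_diff_distrib[symmetric] norm_mult)
          also have "\<dots> \<le> B * e'" using B[OF x] k[of "cis (2 * x)"] B0 by (intro mult_mono) auto
          finally show "cmod (g x * of_real (h (cis (2 * x))) - g x * p x) \<le> B * e'" .
        qed
      qed (use B0 e' in auto)
      also have "\<dots> = e * (B * pi / (B * pi + 1))" by (simp add: e'_def)
      also have "\<dots> \<le> e * 1" using e Bp by (intro mult_left_mono) (auto simp: divide_le_eq_1)
      finally show ?thesis by simp
    qed
    hence "cmod (integral {0..pi} (\<lambda>x. g x * of_real (h (cis (2 * x))))) \<le> 0" by (rule field_le_epsilon)
    thus ?thesis by simp
  qed
  have r: "((\<lambda>x. g x * of_real (Re (g x))) has_integral 0) {0..pi}"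
    "((\<lambda>x. g x * of_real (Im (g x))) has_integral 0) {0..pi}"
  proof -
    have i: "(\<lambda>x. g x * of_real (Re (g x))) integrable_on {0..pi}" "(\<lambda>x. g x * of_real (Im (g x))) integrable_on {0..pi}"
      by (intro integrable_continuous_real continuous_intros g)+
    have "integral {0..pi} (\<lambda>x. g x * of_real (Re (g x))) = 0"
    proof -
      have "integral {0..pi} (\<lambda>x. g x * of_real (Re (g x))) = integral {0..pi} (\<lambda>x. g x * of_real (Re (G (cis (2 * x)))))"
        by (rule integral_cong) (simp add: G)
      also have "\<dots> = 0" by (rule zero) (intro continuous_intros G)
      finally show ?thesis .
    qed
    moreover have "integral {0..pi} (\<lambda>x. g x * of_real (Im (g x))) = 0"
    proof -
      have "integral {0..pi} (\<lambda>x. g x * of_real (Im (g x))) = integral {0..pi} (\<lambda>x. g x * of_real (Im (G (cis (2 * x)))))"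
        by (rule integral_cong) (simp add: G)
      also have "\<dots> = 0" by (rule zero) (intro continuous_intros G)
      finally show ?thesis .
    qed
    ultimately show "((\<lambda>x. g x * of_real (Re (g x))) has_integral 0) {0..pi}"
      "((\<lambda>x. g x * of_real (Im (g x))) has_integral 0) {0..pi}"
      using i by (simp_all add: has_integral_iff)
  qed
  have "((\<lambda>x. g x * of_real (Re (g x)) - \<i> * (g x * of_real (Im (g x)))) has_integral 0 - \<i> * 0) {0..pi}"
    by (intro has_integral_diff has_integral_mult_right r)
  moreover have "g x * of_real (Re (g x)) - \<i> * (g x * of_real (Im (g x))) = of_real ((cmod (g x))\<^sup>2)" for x
    by (simp add: complex_eq_iff cmod_power2) (simp add: power2_eq_square)
  ultimately have "((\<lambda>x. of_real ((cmod (g x))\<^sup>2) :: complex) has_integral 0) {0..pi}" by simp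
  from has_integral_linear[OF this bounded_linear_Re]
  have "((\<lambda>x. (cmod (g x))\<^sup>2) has_integral 0) {0..pi}" by (simp add: o_def)
  hence "integral {0..pi} (\<lambda>x. (cmod (g x))\<^sup>2) = 0" by (rule integral_unique)
  hence "\<forall>x\<in>{0..pi}. (cmod (g x))\<^sup>2 = 0"
    by (subst (asm) integral_eq_0_iff) (auto intro!: continuous_intros g)
  thus ?thesis using x by auto
qed

text \<open>Multiplying by the mode with index \<open>n\<close>, that is by
  \<open>exp (\<i> n x)\<close>, makes a function with sign \<open>(-1)^n\<close> periodic and turns
  its coefficients \<open>fc\<close> into ordinary ones.\<close>

lemma fc_complete:
  assumes f: "continuous_on {0..pi} f" "f pi = (-1) ^ n * f 0"
    and fc: "\<And>j. fc n f j = 0" and x: "x \<in> {0..pi}"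
  shows "f x = 0"
proof -
  let ?g = "\<lambda>x. f x * hmode n (int n) x"
  have "?g x = 0"
  proof (rule trig_complete[OF _ _ _ x])
    show "continuous_on {0..pi} ?g" by (intro continuous_intros f)
    show "?g pi = ?g 0" unfolding hmode_pi hmode_0 f(2)
      by (simp add: mult.commute[of _ "f 0"] mult.assoc power_mult_distrib[symmetric])
    fix j :: int
    have "hmode n (int n) x * cis (2 * (of_int j * x)) = hmode n (int n - (- j)) x" for x
      by (simp add: hmode_def cis_conv_exp exp_add[symmetric] algebra_simps)
    hence "(\<lambda>x. ?g x * cis (2 * (of_int j * x))) = (\<lambda>x. f x * hmode n (int n - (- j)) x)"
      by (simp add: mult.assoc)
    moreover have "((\<lambda>x. f x * hmode n (int n - (- j)) x) has_integral 0) {0..pi}"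
      using fc[of "-j"] fc_integrable[OF f(1), of n "int n - (- j)"] by (simp add: fc_def has_integral_iff)
    ultimately show "((\<lambda>x. ?g x * cis (2 * (of_int j * x))) has_integral 0) {0..pi}" by simp
  qed
  thus ?thesis using norm_hmode[of n "int n" x] by auto
qed

section \<open>Fourier series\<close>

definition hsum :: "nat \<Rightarrow> (int \<Rightarrow> complex) \<Rightarrow> real \<Rightarrow> complex" where
  "hsum n c x = (\<Sum>\<^sub>\<infinity>j. c j * hmode n j x)"

lemma hsum_has_sum:
  assumes "(\<lambda>j. cmod (c j)) summable_on UNIV"
  shows "((\<lambda>j. c j * hmode n j x) has_sum hsum n c x) UNIV"
proof -
  have "(\<lambda>j. cmod (c j * hmode n j x)) summable_on UNIV"
    using assms by (simp add: norm_mult norm_hmode)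
  hence "(\<lambda>j. c j * hmode n j x) summable_on UNIV" by (rule abs_summable_summable)
  thus ?thesis unfolding hsum_def by (rule has_sum_infsum)
qed

text \<open>Enumerating the integers by \<open>int_decode\<close> turns the unordered sum into a
  series, to which sequential results on uniform limits and termwise differentiation apply.\<close>

lemma hsum_sums:
  assumes "(\<lambda>j. cmod (c j)) summable_on UNIV"
  shows "(\<lambda>k. c (int_decode k) * hmode n (int_decode k) x) sums hsum n c x"
proof (rule has_sum_imp_sums)
  show "((\<lambda>k. c (int_decode k) * hmode n (int_decode k) x) has_sum hsum n c x) UNIV"
    using hsum_has_sum[OF assms, of n x]
    by (subst has_sum_reindex_bij_betw[OF bij_int_decode, of "\<lambda>j. c j * hmode n j x"])
qed

lemma summable_int_decode:
  fixes M :: "int \<Rightarrow> real"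
  assumes "M summable_on UNIV"
  shows "summable (\<lambda>k. M (int_decode k))"
  using assms
  by (intro summable_on_imp_summable) (subst summable_on_reindex_bij_betw[OF bij_int_decode])

lemma hsum_uniform_limit:
  assumes "(\<lambda>j. cmod (c j)) summable_on UNIV"
  shows "uniform_limit A (\<lambda>N x. \<Sum>k<N. c (int_decode k) * hmode n (int_decode k) x) (hsum n c) sequentially"
proof -
  have "uniform_limit A (\<lambda>N x. \<Sum>k<N. c (int_decode k) * hmode n (int_decode k) x)
      (\<lambda>x. \<Sum>k. c (int_decode k) * hmode n (int_decode k) x) sequentially"
    by (rule Weierstrass_m_test[OF _ summable_int_decode[OF assms]]) (simp add: norm_mult norm_hmode)
  moreover have "(\<lambda>x. \<Sum>k. c (int_decode k) * hmode n (int_decode k) x) = hsum n c"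
    using hsum_sums[OF assms] by (auto simp: sums_iff)
  ultimately show ?thesis by simp
qed

lemma continuous_on_hsum:
  assumes "(\<lambda>j. cmod (c j)) summable_on UNIV"
  shows "continuous_on A (hsum n c)"
  by (rule uniform_limit_theorem[OF _ hsum_uniform_limit[OF assms]]) (auto intro!: continuous_intros always_eventually)

lemma hsum_deriv:
  assumes c: "(\<lambda>j. cmod (c j)) summable_on UNIV"
    and c': "(\<lambda>j. cmod (\<i> * of_int (2 * j - int n) * c j)) summable_on UNIV"
    and x: "x \<in> {0..pi}"
  shows "(hsum n c has_vector_derivative hsum n (\<lambda>j. \<i> * of_int (2 * j - int n) * c j) x) (at x within {0..pi})"
proof -
  let ?c = "\<lambda>j. \<i> * of_int (2 * j - int n) * c j"
  have "\<exists>g. \<forall>x\<in>{0..pi}. (\<lambda>k. c (int_decode k) * hmode n (int_decode k) x) sums g x \<and>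
     (g has_derivative (\<lambda>h. h *\<^sub>R hsum n ?c x)) (at x within {0..pi})"
  proof (rule has_derivative_series)
    show "convex {0..pi}" by simp
    show "((\<lambda>x. c (int_decode k) * hmode n (int_decode k) x) has_derivative
        (\<lambda>h. h *\<^sub>R (?c (int_decode k) * hmode n (int_decode k) x))) (at x within {0..pi})" for k x
    proof -
      have "((\<lambda>x. c (int_decode k) * hmode n (int_decode k) x) has_vector_derivative
          c (int_decode k) * ((\<i> * of_int (2 * int_decode k - int n)) * hmode n (int_decode k) x)) (at x within {0..pi})"
        by (intro has_vector_derivative_mult_right hmode_deriv)
      thus ?thesis by (simp add: has_vector_derivative_def mult_ac)
    qed
    fix e :: real assume e: "e > 0"
    show "\<forall>\<^sub>F N in sequentially. \<forall>x\<in>{0..pi}. \<forall>h.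
        norm ((\<Sum>k<N. h *\<^sub>R (?c (int_decode k) * hmode n (int_decode k) x)) - h *\<^sub>R hsum n ?c x) \<le> e * norm h"
      using uniform_limitD[OF hsum_uniform_limit[OF c', where A = "{0..pi}" and n = n] e]
    proof eventually_elim
      case (elim N)
      show ?case
      proof (intro ballI allI)
        fix x h :: real assume "x \<in> {0..pi}"
        hence Y: "norm ((\<Sum>k<N. ?c (int_decode k) * hmode n (int_decode k) x) - hsum n ?c x) \<le> e"
          using elim by (auto simp: dist_norm intro: less_imp_le)
        have "(\<Sum>k<N. h *\<^sub>R (?c (int_decode k) * hmode n (int_decode k) x)) - h *\<^sub>R hsum n ?c x =
            h *\<^sub>R ((\<Sum>k<N. ?c (int_decode k) * hmode n (int_decode k) x) - hsum n ?c x)"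
          by (simp only: scaleR_right.sum scaleR_diff_right)
        hence "norm ((\<Sum>k<N. h *\<^sub>R (?c (int_decode k) * hmode n (int_decode k) x)) - h *\<^sub>R hsum n ?c x) =
            \<bar>h\<bar> * norm ((\<Sum>k<N. ?c (int_decode k) * hmode n (int_decode k) x) - hsum n ?c x)"
          by (simp only: norm_scaleR)
        also have "\<dots> \<le> \<bar>h\<bar> * e" by (intro mult_left_mono Y) auto
        finally show "norm ((\<Sum>k<N. h *\<^sub>R (?c (int_decode k) * hmode n (int_decode k) x)) - h *\<^sub>R hsum n ?c x) \<le> e * norm h"
          by (simp only: real_norm_def mult.commute)
      qed
    qed
  next
    show "(\<lambda>k. c (int_decode k) * hmode n (int_decode k) x) sums hsum n c x" by (rule hsum_sums[OF c])
  qed (use x in auto)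
  then obtain g where g: "\<And>x. x \<in> {0..pi} \<Longrightarrow> (\<lambda>k. c (int_decode k) * hmode n (int_decode k) x) sums g x"
     "\<And>x. x \<in> {0..pi} \<Longrightarrow> (g has_vector_derivative hsum n ?c x) (at x within {0..pi})"
    unfolding has_vector_derivative_def by blast
  have "hsum n c x = g x" if "x \<in> {0..pi}" for x using g(1)[OF that] hsum_sums[OF c] by (rule sums_unique2[symmetric])
  thus ?thesis by (intro has_vector_derivative_transform[OF x _ g(2)[OF x]]) auto
qed

text \<open>Finite partial sums converge uniformly along the net of finite index sets, so the
  integral may be taken termwise; by orthogonality it is constant as soon as the set contains
  \<open>j\<close>.\<close>

lemma fc_hsum:
  assumes c: "(\<lambda>j. cmod (c j)) summable_on UNIV" and y: "\<And>x. x \<in> {0..pi} \<Longrightarrow> y x = hsum n c x"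
  shows "fc n y j = c j"
proof -
  have "uniform_limit {0..pi} (\<lambda>X x. \<Sum>i\<in>X. c i * hmode n i x * hmode n (int n - j) x)
     (\<lambda>x. \<Sum>\<^sub>\<infinity>i. c i * hmode n i x * hmode n (int n - j) x) (finite_subsets_at_top UNIV)"
    by (rule Weierstrass_m_test_general[OF _ c]) (simp add: norm_mult norm_hmode)
  moreover have "(\<lambda>x. \<Sum>\<^sub>\<infinity>i. c i * hmode n i x * hmode n (int n - j) x) = (\<lambda>x. hsum n c x * hmode n (int n - j) x)"
  proof
    fix x show "(\<Sum>\<^sub>\<infinity>i. c i * hmode n i x * hmode n (int n - j) x) = hsum n c x * hmode n (int n - j) x"
      using has_sum_cmult_left[OF hsum_has_sum[OF c]] by (rule infsumI)
  qed
  ultimately have ul: "uniform_limit {0..pi} (\<lambda>X x. \<Sum>i\<in>X. c i * hmode n i x * hmode n (int n - j) x)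
     (\<lambda>x. hsum n c x * hmode n (int n - j) x) (finite_subsets_at_top UNIV)" by simp
  have "continuous_on {0..pi} (\<lambda>x. \<Sum>i\<in>X. c i * hmode n i x * hmode n (int n - j) x)" for X
    by (intro continuous_intros)
  from uniform_limit_integral[OF ul this finite_subsets_at_top_neq_bot] obtain I J where
    I: "\<And>X. ((\<lambda>x. \<Sum>i\<in>X. c i * hmode n i x * hmode n (int n - j) x) has_integral I X) {0..pi}"
    and J: "((\<lambda>x. hsum n c x * hmode n (int n - j) x) has_integral J) {0..pi}"
    and lim: "(I \<longlongrightarrow> J) (finite_subsets_at_top UNIV)" by blast
  have "eventually (\<lambda>X. I X = c j * of_real pi) (finite_subsets_at_top UNIV)"
    unfolding eventually_finite_subsets_at_top
  proof (intro exI[of _ "{j}"] conjI allI impI)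
    fix X :: "int set" assume X: "finite X \<and> {j} \<subseteq> X \<and> X \<subseteq> UNIV"
    have "((\<lambda>x. \<Sum>i\<in>X. c i * (hmode n i x * hmode n (int n - j) x)) has_integral
        (\<Sum>i\<in>X. c i * (if i = j then of_real pi else 0))) {0..pi}"
      using X by (intro has_integral_sum has_integral_mult_right has_integral_hmode_mult) auto
    moreover have "(\<Sum>i\<in>X. c i * (if i = j then of_real pi else 0)) = c j * of_real pi"
      using X by (simp add: if_distrib sum.delta cong: if_cong)
    ultimately show "I X = c j * of_real pi" using I[of X] by (simp add: mult.assoc has_integral_unique)
  qed auto
  hence "(I \<longlongrightarrow> c j * of_real pi) (finite_subsets_at_top UNIV)" by (rule tendsto_eventually)
  hence "J = c j * of_real pi" using lim tendsto_unique finite_subsets_at_top_neq_bot by blast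
  moreover have "integral {0..pi} (\<lambda>x. y x * hmode n (int n - j) x) = J"
    unfolding integral_unique[OF J, symmetric] by (rule integral_cong) (simp add: y)
  ultimately show ?thesis by (simp add: fc_def)
qed

section \<open>Rapid decay and the return from sequences to functions\<close>

definition rapid :: "(int \<Rightarrow> complex) \<Rightarrow> bool" where
  "rapid u \<longleftrightarrow> (\<exists>C. \<forall>j. cmod (u j) * (1 + (real_of_int j)\<^sup>2)\<^sup>2 \<le> C)"

lemma summable_inverse_squares_int: "(\<lambda>j. 1 / (1 + (real_of_int j)\<^sup>2)) summable_on UNIV"
proof (rule summable_on_int_iff_nat)
  have "summable (\<lambda>k. 1 / (1 + (real k)\<^sup>2))"
  proof (rule summable_comparison_test'[OF inverse_power_summable[of 2], of 1])
    fix k :: nat assume "k \<ge> 1"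
    thus "norm (1 / (1 + (real k)\<^sup>2)) \<le> inverse (real k ^ 2)"
      by (simp add: divide_simps add_pos_nonneg)
  qed simp
  thus "summable (\<lambda>k. 1 / (1 + (real_of_int (int k))\<^sup>2))" "summable (\<lambda>k. 1 / (1 + (real_of_int (- int k))\<^sup>2))" by simp_all
qed simp

text \<open>Coefficients of order \<open>j^(-4)\<close> may be multiplied by the quadratic factor of
  two derivatives and still leave the summable order \<open>j^(-2)\<close>.\<close>

lemma rapid_summable:
  assumes "rapid u" and k: "\<And>j. cmod (k j) \<le> D * (1 + (real_of_int j)\<^sup>2)"
  shows "(\<lambda>j. cmod (k j * u j)) summable_on UNIV"
proof -
  obtain C where C: "\<And>j. cmod (u j) * (1 + (real_of_int j)\<^sup>2)\<^sup>2 \<le> C" using assms by (auto simp: rapid_def)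
  show ?thesis
  proof (rule summable_on_comparison_test[of "\<lambda>j. (D * C) * (1 / (1 + (real_of_int j)\<^sup>2))"])
    fix j :: int
    define q where "q = 1 + (real_of_int j)\<^sup>2"
    have q: "q \<ge> 1" by (simp add: q_def)
    have D: "D \<ge> 0" using k[of 0] norm_ge_zero[of "k 0"] by (simp del: norm_ge_zero)
    have "cmod (k j * u j) * q \<le> (D * q) * cmod (u j) * q"
      unfolding norm_mult using q k[of j] by (intro mult_right_mono) (auto simp: q_def)
    also have "\<dots> = D * (cmod (u j) * q\<^sup>2)" by (simp add: power2_eq_square)
    also have "\<dots> \<le> D * C" using C[of j] D by (intro mult_left_mono) (auto simp: q_def)
    finally show "cmod (k j * u j) \<le> (D * C) * (1 / (1 + (real_of_int j)\<^sup>2))"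
      using q by (simp add: q_def[symmetric] field_simps)
  qed (rule summable_on_cmult_right[OF summable_inverse_squares_int], simp)
qed

lemma one_plus_square_shift:
  fixes x h :: real
  shows "1 + (x + h)\<^sup>2 \<le> (2 + 2 * h\<^sup>2) * (1 + x\<^sup>2)"
proof -
  have "0 \<le> (x - h)\<^sup>2 + 2 * h\<^sup>2 * x\<^sup>2 + 1" by simp
  thus ?thesis by (simp add: power2_eq_square algebra_simps)
qed

lemma gap_ge_square:
  assumes "j \<noteq> 0" "j \<noteq> int n"
  shows "1 + (real_of_int j)\<^sup>2 \<le> (real n + 1) * \<bar>real_of_int (gap n j)\<bar>"
proof -
  have "\<bar>j\<bar> \<le> (int n + 1) * \<bar>int n - j\<bar>"
  proof (cases "\<bar>j\<bar> \<le> int n + 1")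
    case True
    have "int n + 1 \<le> (int n + 1) * \<bar>int n - j\<bar>" using assms by (simp add: mult_le_cancel_left1)
    with True show ?thesis by linarith
  next
    case False
    show ?thesis
    proof (cases "j < 0")
      case True
      have "\<bar>j\<bar> \<le> 1 * \<bar>int n - j\<bar>" using True by simp
      also have "\<dots> \<le> (int n + 1) * \<bar>int n - j\<bar>" by (intro mult_right_mono) auto
      finally show ?thesis .
    next
      case nn: False
      have "0 \<le> int n * (j - (int n + 1))" using False nn by (intro mult_nonneg_nonneg) auto
      thus ?thesis using False nn by (simp add: algebra_simps)
    qed
  qed
  hence "\<bar>j\<bar> * \<bar>j\<bar> \<le> \<bar>j\<bar> * ((int n + 1) * \<bar>int n - j\<bar>)" by (intro mult_left_mono) auto
  moreover have "1 * 1 \<le> \<bar>j\<bar> * \<bar>j\<bar>" using assms(1) by (intro mult_mono) auto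
  ultimately have "1 + \<bar>j\<bar> * \<bar>j\<bar> \<le> (int n + 1) * (4 * \<bar>j\<bar> * \<bar>int n - j\<bar>)" by (simp add: algebra_simps)
  hence "real_of_int (1 + \<bar>j\<bar> * \<bar>j\<bar>) \<le> real_of_int ((int n + 1) * (4 * \<bar>j\<bar> * \<bar>int n - j\<bar>))"
    by (simp only: of_int_le_iff)
  thus ?thesis by (simp add: gap_def abs_mult power2_eq_square)
qed

text \<open>For fixed \<open>n\<close> the gap grows like \<open>j^2\<close>. Dividing the
  recurrence by it gains one power of \<open>1 + j^2\<close>, while the shifts by \<open>R\<close>
  and \<open>S\<close> change such powers only by a constant factor.\<close>

lemma red_sol_decay_step:
  assumes sol: "red_sol a b R S n z f u" and n: "n \<ge> 2" "cmod z \<le> real n"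
    and f: "\<And>j. cmod (f j) * (1 + (real_of_int j)\<^sup>2) ^ p \<le> F"
    and u: "\<And>j. cmod (u j) * (1 + (real_of_int j)\<^sup>2) ^ p \<le> C"
  shows "\<exists>C'. \<forall>j. cmod (u j) * (1 + (real_of_int j)\<^sup>2) ^ Suc p \<le> C'"
proof -
  let ?q = "\<lambda>j. 1 + (real_of_int j)\<^sup>2"
  define A where "A = cmod a * ((2 + 2 * (real R)\<^sup>2) ^ p * C) + cmod b * ((2 + 2 * (real S)\<^sup>2) ^ p * C) + F"
  have shift: "cmod (u (j + i)) * ?q j ^ p \<le> (2 + 2 * (real_of_int i)\<^sup>2) ^ p * C" for i j
  proof -
    have "?q j \<le> (2 + 2 * (real_of_int i)\<^sup>2) * ?q (j + i)"
      using one_plus_square_shift[of "real_of_int (j + i)" "- real_of_int i"] by simp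
    hence "?q j ^ p \<le> ((2 + 2 * (real_of_int i)\<^sup>2) * ?q (j + i)) ^ p"
      by (intro power_mono) auto
    hence "cmod (u (j + i)) * ?q j ^ p \<le> cmod (u (j + i)) * ((2 + 2 * (real_of_int i)\<^sup>2) * ?q (j + i)) ^ p"
      by (intro mult_left_mono) auto
    also have "\<dots> = (2 + 2 * (real_of_int i)\<^sup>2) ^ p * (cmod (u (j + i)) * ?q (j + i) ^ p)"
      by (simp add: power_mult_distrib)
    also have "\<dots> \<le> (2 + 2 * (real_of_int i)\<^sup>2) ^ p * C" by (intro mult_left_mono u) auto
    finally show ?thesis .
  qed
  define C' where "C' = max (2 * (real n + 1) * A) (cmod (u 0) + cmod (u (int n)) * ?q (int n) ^ Suc p)"
  have "cmod (u j) * ?q j ^ Suc p \<le> C'" for j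
  proof (cases "j = 0 \<or> j = int n")
    case True
    thus ?thesis by (auto simp: C'_def le_max_iff_disj)
  next
    case False
    have "?q j \<le> (real n + 1) * \<bar>real_of_int (gap n j)\<bar>" using gap_ge_square[of j n] False by auto
    also have "\<dots> \<le> (real n + 1) * (2 * cmod (of_int (gap n j) + z))"
      using gap_plus_ge(1)[of n j z] False n by (intro mult_left_mono) auto
    finally have "?q j \<le> (real n + 1) * (2 * cmod (of_int (gap n j) + z))" .
    hence "(cmod (u j) * ?q j ^ p) * ?q j \<le> (cmod (u j) * ?q j ^ p) * ((real n + 1) * (2 * cmod (of_int (gap n j) + z)))"
      by (intro mult_left_mono) auto
    also have "\<dots> = 2 * (real n + 1) * (cmod ((of_int (gap n j) + z) * u j) * ?q j ^ p)" by (simp add: norm_mult)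
    also have "(of_int (gap n j) + z) * u j = a * u (j + int R) + b * u (j - int S) + f j"
      using sol False by (simp add: red_sol_def hill_V_def)
    also have "cmod (a * u (j + int R) + b * u (j - int S) + f j) * ?q j ^ p \<le>
        (cmod a * cmod (u (j + int R)) + cmod b * cmod (u (j - int S)) + cmod (f j)) * ?q j ^ p"
      unfolding norm_mult[symmetric]
      by (intro mult_right_mono order_trans[OF norm_triangle_ineq] add_mono order_refl) auto
    also have "\<dots> \<le> A"
      unfolding A_def distrib_right mult.assoc using shift[of j "int R"] shift[of j "- int S"]
      by (intro add_mono mult_left_mono f) auto
    finally have "cmod (u j) * ?q j ^ Suc p \<le> 2 * (real n + 1) * A" by (simp add: mult_ac)
    thus ?thesis by (simp add: C'_def)
  qed
  thus ?thesis by blast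
qed

lemma red_sol_rapid:
  assumes "red_sol a b R S n z (\<lambda>_. 0) u" "n \<ge> 2" "cmod z \<le> real n"
  shows "rapid u"
proof -
  obtain C where C: "\<And>j. cmod (u j) \<le> C" using assms(1) by (auto simp: red_sol_def bounded_iff)
  obtain C1 where C1: "\<And>j. cmod (u j) * (1 + (real_of_int j)\<^sup>2) ^ Suc 0 \<le> C1"
    using red_sol_decay_step[OF assms, of 0 0 C] C by auto
  obtain C2 where "\<And>j. cmod (u j) * (1 + (real_of_int j)\<^sup>2) ^ Suc (Suc 0) \<le> C2"
    using red_sol_decay_step[OF assms _ C1, of 0] by auto
  thus ?thesis unfolding rapid_def numeral_2_eq_2 by blast
qed

text \<open>Second derivative and potential act on the coefficients exactly as in the recurrence, so
  the defect of the resulting function lies in the span of the two resonant modes. This is what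
  allows Green's identity to be applied to solutions of the recurrence.\<close>

lemma hsum_solution:
  assumes u: "rapid u"
    and eq0: "\<forall>j. j \<noteq> 0 \<longrightarrow> j \<noteq> int n \<longrightarrow> (of_int (gap n j) + z) * u j = hill_V a b R S u j"
    and n: "n > 0"
  defines "y \<equiv> (\<lambda>x. if x \<in> {0..pi} then hsum n u x else 0)"
  shows "y \<in> hill_dom (parity_bdry n)"
    and "x \<in> {0..pi} \<Longrightarrow> hill_op (two_term_potential a b R S) y x - ((of_nat n)\<^sup>2 + z) * y x =
      (hill_V a b R S u 0 - z * u 0) * hmode n 0 x + (hill_V a b R S u (int n) - z * u (int n)) * hmode n (int n) x"
    and "fc n y j = u j"
proof -
  have eq: "(of_int (gap n j) + z) * u j = hill_V a b R S u j" if "j \<noteq> 0" "j \<noteq> int n" for j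
    using eq0 that by simp
  let ?k = "\<lambda>j. of_int (2 * j - int n) :: complex"
  let ?u1 = "\<lambda>j. \<i> * ?k j * u j" and ?u2 = "\<lambda>j. \<i> * ?k j * (\<i> * ?k j * u j)"
  have kb: "(real_of_int (2 * j - int n))\<^sup>2 \<le> (8 + 2 * (real n)\<^sup>2) * (1 + (real_of_int j)\<^sup>2)" for j
  proof -
    have "0 \<le> (2 * real_of_int j + real n)\<^sup>2 + 8 + 2 * (real n)\<^sup>2 * (real_of_int j)\<^sup>2" by (intro add_nonneg_nonneg mult_nonneg_nonneg) auto
    thus ?thesis by (simp add: power2_eq_square algebra_simps)
  qed
  have kb1: "\<bar>real_of_int (2 * j - int n)\<bar> \<le> (8 + 2 * (real n)\<^sup>2) * (1 + (real_of_int j)\<^sup>2)" for j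
  proof -
    have "\<bar>k\<bar> \<le> k\<^sup>2" for k :: int
    proof (cases "k = 0")
      case False
      hence "\<bar>k\<bar> * 1 \<le> \<bar>k\<bar> * \<bar>k\<bar>" by (intro mult_left_mono) auto
      thus ?thesis by (simp add: power2_eq_square)
    qed simp
    hence "\<bar>2 * j - int n\<bar> \<le> (2 * j - int n)\<^sup>2" .
    hence "real_of_int \<bar>2 * j - int n\<bar> \<le> real_of_int ((2 * j - int n)\<^sup>2)" by (simp only: of_int_le_iff)
    thus ?thesis using kb[of j] by simp
  qed
  have s0: "(\<lambda>j. cmod (u j)) summable_on UNIV"
    using rapid_summable[OF u, of "\<lambda>_. 1" 1] by simp
  have s1: "(\<lambda>j. cmod (?u1 j)) summable_on UNIV"
  proof (rule rapid_summable[OF u])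
    show "cmod (\<i> * ?k j) \<le> (8 + 2 * (real n)\<^sup>2) * (1 + (real_of_int j)\<^sup>2)" for j
      using kb1[of j] by (simp only: norm_mult norm_ii norm_of_int mult_1)
  qed
  have s2: "(\<lambda>j. cmod (?u2 j)) summable_on UNIV"
  proof -
    have "(\<lambda>j. cmod ((- (?k j)\<^sup>2) * u j)) summable_on UNIV"
    proof (rule rapid_summable[OF u])
      show "cmod (- (?k j)\<^sup>2) \<le> (8 + 2 * (real n)\<^sup>2) * (1 + (real_of_int j)\<^sup>2)" for j
        using kb[of j] by (simp only: norm_minus_cancel norm_power norm_of_int power2_abs)
    qed
    thus ?thesis by (simp add: norm_mult power2_eq_square mult.assoc)
  qed
  have d1: "(hsum n u has_vector_derivative hsum n ?u1 x) (at x within {0..pi})" if "x \<in> {0..pi}" for x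
    by (rule hsum_deriv[OF s0 s1 that])
  have d2: "(hsum n ?u1 has_vector_derivative hsum n ?u2 x) (at x within {0..pi})" if "x \<in> {0..pi}" for x
    by (rule hsum_deriv[OF s1 s2 that])
  have dy: "(y has_vector_derivative hsum n ?u1 x) (at x within {0..pi})" if "x \<in> {0..pi}" for x
    by (rule has_vector_derivative_transform[OF that _ d1[OF that]]) (simp add: y_def)
  have y0: "y x = 0" if "x \<notin> {0..pi}" for x using that by (auto simp: y_def)
  note C2I = C2_0piI[OF dy d2 continuous_on_hsum[OF s2] y0]
  have C2: "y \<in> C2_0pi" by (rule C2I(1))
  have y1: "deriv_0pi y x = hsum n ?u1 x" if "x \<in> {0..pi}" for x by (rule C2I(2)[OF _ _ _ that])
  have y2: "deriv_0pi (deriv_0pi y) x = hsum n ?u2 x" if "x \<in> {0..pi}" for x by (rule C2I(3)[OF _ _ _ that])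
  have per: "hsum n c pi = (-1) ^ n * hsum n c 0" if "(\<lambda>j. cmod (c j)) summable_on UNIV" for c
  proof -
    have "((\<lambda>j. (-1) ^ n * (c j * hmode n j 0)) has_sum (-1) ^ n * hsum n c 0) UNIV"
      by (intro has_sum_cmult_right hsum_has_sum that)
    moreover have "(\<lambda>j. (-1) ^ n * (c j * hmode n j 0)) = (\<lambda>j. c j * hmode n j pi)"
      by (simp add: hmode_0 hmode_pi mult.commute)
    ultimately show ?thesis using hsum_has_sum[OF that, of n pi] has_sum_unique by metis
  qed
  show "y \<in> hill_dom (parity_bdry n)"
    using C2 per[OF s0] per[OF s1] y1[of 0] y1[of pi] by (simp add: hill_dom_def parity_bdry_iff y_def)
  show "fc n y j = u j" by (rule fc_hsum[OF s0]) (simp add: y_def)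
  assume x: "x \<in> {0..pi}"
  note hs = hsum_has_sum[OF s0, of n x]
  define A where "A i = (\<Sum>\<^sub>\<infinity>j. u j * hmode n (j - i) x)" for i
  have A: "((\<lambda>j. u j * hmode n (j - i) x) has_sum A i) UNIV" for i
  proof -
    have "(\<lambda>j. cmod (u j * hmode n (j - i) x)) summable_on UNIV"
      using s0 by (simp add: norm_mult norm_hmode)
    hence "(\<lambda>j. u j * hmode n (j - i) x) summable_on UNIV" by (rule abs_summable_summable)
    thus ?thesis unfolding A_def by (rule has_sum_infsum)
  qed
  \<comment> \<open>The potential shifts the modes; a translation of the summation index moves the
    shift to the coefficients.\<close>
  have A': "((\<lambda>j. u (j + i) * hmode n j x) has_sum A i) UNIV" for i
  proof -
    have "bij (\<lambda>j. j + i)" by (rule bij_plus_right)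
    thus ?thesis
      using has_sum_reindex_bij_betw[of "\<lambda>j. j + i" UNIV UNIV "\<lambda>j. u j * hmode n (j - i) x"] A[of i] by simp
  qed
  have V1: "((\<lambda>j. a * (u j * hmode n (j - int R) x) + b * (u j * hmode n (j - - int S) x)) has_sum
      a * A (int R) + b * A (- int S)) UNIV"
    by (intro has_sum_add has_sum_cmult_right A)
  have V2: "((\<lambda>j. two_term_potential a b R S x * (u j * hmode n j x)) has_sum
      two_term_potential a b R S x * hsum n u x) UNIV"
    by (intro has_sum_cmult_right hs)
  have V3: "two_term_potential a b R S x * (u j * hmode n j x) =
      a * (u j * hmode n (j - int R) x) + b * (u j * hmode n (j - - int S) x)" for j
    using arg_cong[OF potential_times_hmode[of a b R S x n j], of "\<lambda>w. u j * w"] by (simp add: algebra_simps)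
  have V: "two_term_potential a b R S x * hsum n u x = a * A (int R) + b * A (- int S)"
    by (rule has_sum_unique[OF V2[unfolded V3] V1])
  have H1: "((\<lambda>j. a * (u (j + int R) * hmode n j x) + b * (u (j + - int S) * hmode n j x) + (-1) * (?u2 j * hmode n j x)
      + (- ((of_nat n)\<^sup>2 + z)) * (u j * hmode n j x)) has_sum
      a * A (int R) + b * A (- int S) + (-1) * hsum n ?u2 x + (- ((of_nat n)\<^sup>2 + z)) * hsum n u x) UNIV"
    by (intro has_sum_add has_sum_cmult_right A' hs hsum_has_sum s2)
  have H2: "a * (u (j + int R) * hmode n j x) + b * (u (j + - int S) * hmode n j x) + (-1) * (?u2 j * hmode n j x)
      + (- ((of_nat n)\<^sup>2 + z)) * (u j * hmode n j x) =
      (hill_V a b R S u j - (of_int (gap n j) + z) * u j) * hmode n j x" for j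
  proof -
    have "?u2 j = (\<i> * \<i>) * ((?k j)\<^sup>2 * u j)"
      by (simp only: power2_eq_square mult_ac)
    hence k2: "?u2 j = - ((?k j)\<^sup>2 * u j)" by simp
    have k3: "(?k j)\<^sup>2 = (of_nat n)\<^sup>2 - of_int (gap n j)"
      by (simp add: gap_def power2_eq_square algebra_simps)
    show ?thesis unfolding k2 k3 by (simp add: hill_V_def algebra_simps)
  qed
  have H: "((\<lambda>j. (hill_V a b R S u j - (of_int (gap n j) + z) * u j) * hmode n j x) has_sum
      two_term_potential a b R S x * hsum n u x - hsum n ?u2 x - ((of_nat n)\<^sup>2 + z) * hsum n u x) UNIV"
    unfolding V using H1[unfolded H2] by (simp add: algebra_simps)
  have "((\<lambda>j. (hill_V a b R S u j - (of_int (gap n j) + z) * u j) * hmode n j x) has_sum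
      (\<Sum>j\<in>{0, int n}. (hill_V a b R S u j - (of_int (gap n j) + z) * u j) * hmode n j x)) {0, int n}"
    by (rule has_sum_finite) simp
  hence "((\<lambda>j. (hill_V a b R S u j - (of_int (gap n j) + z) * u j) * hmode n j x) has_sum
      (\<Sum>j\<in>{0, int n}. (hill_V a b R S u j - (of_int (gap n j) + z) * u j) * hmode n j x)) UNIV"
    by (rule has_sum_cong_neutral[THEN iffD1, rotated -1]) (auto simp: eq)
  from has_sum_unique[OF H this]
  show "hill_op (two_term_potential a b R S) y x - ((of_nat n)\<^sup>2 + z) * y x =
      (hill_V a b R S u 0 - z * u 0) * hmode n 0 x + (hill_V a b R S u (int n) - z * u (int n)) * hmode n (int n) x"
    using n x y2[OF x] by (simp add: hill_op_def y_def gap_def)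
qed

section \<open>Localization of Dirichlet eigenvalues\<close>

lemma norm_sin_le_exp: "cmod (sin w) \<le> exp \<bar>Im w\<bar>"
proof -
  have "cmod (sin w) = cmod (exp (\<i> * w) - exp (- (\<i> * w))) / 2"
    unfolding sin_exp_eq by (simp add: norm_divide norm_mult)
  also have "\<dots> \<le> (cmod (exp (\<i> * w)) + cmod (exp (- (\<i> * w)))) / 2"
    by (intro divide_right_mono norm_triangle_ineq4) auto
  also have "\<dots> = (exp (- Im w) + exp (Im w)) / 2" by simp
  also have "\<dots> \<le> (exp \<bar>Im w\<bar> + exp \<bar>Im w\<bar>) / 2" by (intro divide_right_mono add_mono) auto
  finally show ?thesis by simp
qed

text \<open>In the third-order Taylor formula the remainder is at most \<open>|w| / 2\<close>, by
  \<open>exp 1 \<le> 3\<close>, and the cubic term at most \<open>|w| / 6\<close>, so at least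
  \<open>|w| / 3\<close> remains.\<close>

lemma norm_sin_ge:
  assumes "cmod w \<le> 1"
  shows "cmod w / 5 \<le> cmod (sin w)"
proof -
  have "(\<Sum>k\<le>3. complex_of_real (sin_coeff k) * w ^ k) = w - w ^ 3 / 6"
  proof -
    have "{..3::nat} = {0, 1, 2, 3}" by auto
    thus ?thesis by (simp add: sin_coeff_def fact_numeral)
  qed
  hence "cmod (sin w - (w - w ^ 3 / 6)) \<le> exp \<bar>Im w\<bar> * cmod w ^ 4 / 6"
    using Taylor_sin[of w 3] by (simp add: eval_nat_numeral)
  also have "\<dots> \<le> 3 * cmod w ^ 4 / 6"
  proof -
    have "exp \<bar>Im w\<bar> \<le> exp 1" using abs_Im_le_cmod[of w] assms by simp
    hence "exp \<bar>Im w\<bar> \<le> 3" using exp_le by linarith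
    thus ?thesis by (intro divide_right_mono mult_right_mono) auto
  qed
  also have "cmod w ^ 4 \<le> cmod w"
    using power_decreasing[of 1 4 "cmod w"] assms by simp
  finally have "cmod (sin w - (w - w ^ 3 / 6)) \<le> cmod w / 2" by simp
  moreover have "cmod (w ^ 3 / 6) \<le> cmod w / 6"
    using power_decreasing[of 1 3 "cmod w"] assms by (simp add: norm_divide norm_power)
  moreover have "cmod w \<le> cmod (sin w) + cmod (sin w - (w - w ^ 3 / 6)) + cmod (w ^ 3 / 6)"
    using norm_triangle_ineq4[of "sin w" "sin w - (w - w ^ 3 / 6)"] norm_triangle_ineq[of "w - w ^ 3 / 6" "w ^ 3 / 6"] by simp
  ultimately show ?thesis using norm_ge_zero[of w] by linarith
qed

text \<open>The integrand is the derivative in \<open>t\<close> of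
  \<open>y' sin (\<nu> (x - t)) + \<nu> y cos (\<nu> (x - t))\<close>: the terms with
  \<open>y' cos\<close> cancel, and the differential equation removes
  \<open>\<nu>^2\<close>.\<close>

lemma variation_of_constants:
  fixes y y1 y2 q :: "real \<Rightarrow> complex" and \<nu> :: complex
  assumes y: "\<And>x. x \<in> {0..pi} \<Longrightarrow> (y has_vector_derivative y1 x) (at x within {0..pi})"
    and y1: "\<And>x. x \<in> {0..pi} \<Longrightarrow> (y1 has_vector_derivative y2 x) (at x within {0..pi})"
    and ode: "\<And>x. x \<in> {0..pi} \<Longrightarrow> y2 x = (q x - \<nu>\<^sup>2) * y x"
    and y0: "y 0 = 0" and x: "x \<in> {0..pi}"
  shows "((\<lambda>t. sin (\<nu> * of_real (x - t)) * (q t * y t)) has_integral (\<nu> * y x - y1 0 * sin (\<nu> * of_real x))) {0..x}"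
proof -
  define F where "F t = y1 t * sin (\<nu> * of_real (x - t)) + \<nu> * (y t * cos (\<nu> * of_real (x - t)))" for t
  have "((\<lambda>t. sin (\<nu> * of_real (x - t)) * (q t * y t)) has_integral F x - F 0) {0..x}"
  proof (rule fundamental_theorem_of_calculus)
    fix t assume t: "t \<in> {0..x}"
    have t': "t \<in> {0..pi}" "{0..x} \<subseteq> {0..pi}" using t x by auto
    have s: "((\<lambda>t. sin (\<nu> * of_real (x - t))) has_vector_derivative (- \<nu> * cos (\<nu> * of_real (x - t)))) (at t within {0..x})"
    proof -
      have "((\<lambda>s. sin (\<nu> * (of_real x - s))) has_field_derivative (- \<nu> * cos (\<nu> * (of_real x - of_real t)))) (at (of_real t))"
        by (auto intro!: derivative_eq_intros)
      from has_vector_derivative_real_field[OF this] show ?thesis by simp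
    qed
    have c: "((\<lambda>t. cos (\<nu> * of_real (x - t))) has_vector_derivative (\<nu> * sin (\<nu> * of_real (x - t)))) (at t within {0..x})"
    proof -
      have "((\<lambda>s. cos (\<nu> * (of_real x - s))) has_field_derivative (\<nu> * sin (\<nu> * (of_real x - of_real t)))) (at (of_real t))"
        by (auto intro!: derivative_eq_intros)
      from has_vector_derivative_real_field[OF this] show ?thesis by simp
    qed
    note yd = has_vector_derivative_within_subset[OF y[OF t'(1)] t'(2)]
    note y1d = has_vector_derivative_within_subset[OF y1[OF t'(1)] t'(2)]
    have "(F has_vector_derivative
       ((y1 t * (- \<nu> * cos (\<nu> * of_real (x - t))) + y2 t * sin (\<nu> * of_real (x - t))) +
       \<nu> * (y t * (\<nu> * sin (\<nu> * of_real (x - t))) + y1 t * cos (\<nu> * of_real (x - t))))) (at t within {0..x})"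
      unfolding F_def
      by (intro has_vector_derivative_add has_vector_derivative_mult_right has_vector_derivative_mult yd y1d s c)
    also have "(y1 t * (- \<nu> * cos (\<nu> * of_real (x - t))) + y2 t * sin (\<nu> * of_real (x - t))) +
       \<nu> * (y t * (\<nu> * sin (\<nu> * of_real (x - t))) + y1 t * cos (\<nu> * of_real (x - t))) =
       sin (\<nu> * of_real (x - t)) * (q t * y t)"
      by (simp add: ode[OF t'(1)] power2_eq_square algebra_simps)
    finally show "(F has_vector_derivative sin (\<nu> * of_real (x - t)) * (q t * y t)) (at t within {0..x})" .
  qed (use x in auto)
  thus ?thesis by (simp add: F_def y0)
qed

lemma Dirichlet_eigenD:
  assumes "y \<in> hill_dom Dirichlet" "hill_op v y = (\<lambda>x. l * y x)"
  shows "y 0 = 0" "y pi = 0" "y \<in> C2_0pi"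
    and "x \<in> {0..pi} \<Longrightarrow> deriv_0pi (deriv_0pi y) x = (v x - l) * y x"
  using assms(1) fun_cong[OF assms(2), of x] by (auto simp: hill_dom_def hill_op_def algebra_simps)

text \<open>With \<open>\<nu>^2 = n^2 + z\<close>, variation of constants shows that
  \<open>\<nu> y\<close> differs from \<open>y'(0) sin (\<nu> x)\<close> by at most
  \<open>3 pi B max |y|\<close>, and \<open>n \<ge> 12 pi B\<close> makes this a small part of
  \<open>n max |y|\<close>. So \<open>y'(0)\<close> controls \<open>max |y|\<close>, and
  \<open>y pi = 0\<close> forces \<open>sin (\<nu> pi)\<close>, hence \<open>\<nu> - n\<close>, to
  be O(B / n), which gives \<open>z = O(B)\<close>. The last two conclusions prepare the
  normalisation in the uniqueness proof.\<close>

lemma Dirichlet_localization: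
  fixes v :: "real \<Rightarrow> complex"
  assumes v: "continuous_on {0..pi} v" "\<forall>x\<in>{0..pi}. cmod (v x) \<le> B" and B: "B \<ge> 0"
    and n: "real n \<ge> 1 + 12 * pi * B"
    and z: "cmod z < real n / 4"
    and y: "y \<in> hill_dom Dirichlet" "hill_op v y = (\<lambda>x. ((of_nat n)\<^sup>2 + z) * y x)" "y \<noteq> (\<lambda>_. 0)"
  shows "cmod z \<le> 270 * B" and "deriv_0pi y 0 \<noteq> 0"
    and "x \<in> {0..pi} \<Longrightarrow> real n * cmod (y x) \<le> 6 * cmod (deriv_0pi y 0)"
proof -
  note D = Dirichlet_eigenD[OF y(1,2)]
  note C = C2_0piD[OF D(3)]
  have pB: "12 * pi * B \<ge> 0" using B by simp
  have n1: "real n \<ge> 1" using n pB by linarith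
  define \<nu> where "\<nu> = csqrt ((of_nat n)\<^sup>2 + z)"
  have \<nu>2: "\<nu>\<^sup>2 = (of_nat n)\<^sup>2 + z" by (simp add: \<nu>_def)
  \<comment> \<open>The principal root lies in the right half plane, so
    \<open>|\<nu> + n| \<ge> n\<close>, and the bound on \<open>z\<close> becomes one on
    \<open>\<nu> - n\<close>.\<close>
  have Re: "Re \<nu> \<ge> 0" unfolding \<nu>_def using csqrt_principal[of "(of_nat n)\<^sup>2 + z"] by auto
  have sum_ge: "cmod (\<nu> + of_nat n) \<ge> real n"
    using complex_Re_le_cmod[of "\<nu> + of_nat n"] Re by simp
  have prod: "cmod (\<nu> - of_nat n) * cmod (\<nu> + of_nat n) = cmod z"
    by (simp flip: norm_mult) (simp add: algebra_simps power2_eq_square[symmetric] \<nu>2)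
  have "cmod (\<nu> - of_nat n) * real n \<le> cmod z"
    unfolding prod[symmetric] using sum_ge by (intro mult_left_mono) auto
  also have "\<dots> \<le> 1/4 * real n" using z by simp
  finally have \<nu>n: "cmod (\<nu> - of_nat n) \<le> 1/4" using n1 by simp
  have Im: "\<bar>Im \<nu>\<bar> \<le> 1/4" using abs_Im_le_cmod[of "\<nu> - of_nat n"] \<nu>n by simp
  have \<nu>_ge: "cmod \<nu> \<ge> 3/4 * real n"
    using norm_triangle_ineq2[of "of_nat n" "of_nat n - \<nu>"] \<nu>n n1 by (simp add: norm_minus_commute)
  have \<nu>_le: "cmod (\<nu> + of_nat n) \<le> 3 * real n"
    using norm_triangle_ineq[of "\<nu> - of_nat n" "2 * of_nat n"] \<nu>n n1 by (simp add: norm_mult add.commute)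
  have sin3: "cmod (sin (\<nu> * of_real t)) \<le> 3" if "t \<in> {0..pi}" for t
  proof -
    have "\<bar>Im (\<nu> * of_real t)\<bar> = \<bar>Im \<nu>\<bar> * t" using that by (simp add: abs_mult)
    also have "\<dots> \<le> 1/4 * 4" using Im that pi_less_4 by (intro mult_mono) auto
    finally have "exp \<bar>Im (\<nu> * of_real t)\<bar> \<le> exp 1" by simp
    thus ?thesis using norm_sin_le_exp[of "\<nu> * of_real t"] exp_le by linarith
  qed
  have "continuous_on {0..pi} (\<lambda>x. cmod (y x))" by (intro continuous_intros C)
  then obtain x0 where x0: "x0 \<in> {0..pi}" "\<And>x. x \<in> {0..pi} \<Longrightarrow> cmod (y x) \<le> cmod (y x0)"
    using continuous_attains_sup[of "{0..pi}" "\<lambda>x. cmod (y x)"] by auto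
  define Y where "Y = cmod (y x0)"
  have Y0: "Y > 0"
  proof (rule ccontr)
    assume "\<not> Y > 0"
    hence "y x = 0" for x using x0(2)[of x] C(6)[of x] by (cases "x \<in> {0..pi}") (auto simp: Y_def)
    thus False using y(3) by auto
  qed
  have ode: "deriv_0pi (deriv_0pi y) x = (v x - \<nu>\<^sup>2) * y x" if "x \<in> {0..pi}" for x
    using D(4)[OF that] by (simp add: \<nu>2)
  have I: "cmod (\<nu> * y x - deriv_0pi y 0 * sin (\<nu> * of_real x)) \<le> 3 * pi * B * Y" if x: "x \<in> {0..pi}" for x
  proof -
    have "cmod (\<nu> * y x - deriv_0pi y 0 * sin (\<nu> * of_real x)) \<le> (3 * (B * Y)) * measure lborel {0..x}"
    proof (rule has_integral_bound_real[OF _ _ variation_of_constants[OF C(1,2) ode D(1) x]])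
      fix t assume "t \<in> {0..x} - {}"
      hence t: "t \<in> {0..pi}" "x - t \<in> {0..pi}" using x by auto
      show "cmod (sin (\<nu> * of_real (x - t)) * (v t * y t)) \<le> 3 * (B * Y)"
        unfolding norm_mult using sin3[OF t(2)] v(2)[rule_format, OF t(1)] x0(2)[OF t(1)] B
        by (intro mult_mono) (auto simp: Y_def)
    qed (use B Y0 in auto)
    also have "\<dots> = (3 * (B * Y)) * x" using x by simp
    also have "\<dots> \<le> (3 * (B * Y)) * pi" using x B Y0 by (intro mult_left_mono) auto
    finally show ?thesis by (simp add: mult_ac)
  qed
  have "cmod (\<nu> * y x0) \<le> cmod (\<nu> * y x0 - deriv_0pi y 0 * sin (\<nu> * of_real x0)) + cmod (deriv_0pi y 0 * sin (\<nu> * of_real x0))"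
    using norm_triangle_ineq[of "\<nu> * y x0 - deriv_0pi y 0 * sin (\<nu> * of_real x0)" "deriv_0pi y 0 * sin (\<nu> * of_real x0)"] by simp
  also have "\<dots> \<le> 3 * pi * B * Y + cmod (deriv_0pi y 0) * 3"
    unfolding norm_mult[of "deriv_0pi y 0"] using sin3[OF x0(1)] by (intro add_mono I x0 mult_left_mono) auto
  finally have "cmod \<nu> * Y \<le> 3 * pi * B * Y + cmod (deriv_0pi y 0) * 3" by (simp add: norm_mult Y_def)
  moreover have "3/4 * real n * Y \<le> cmod \<nu> * Y" using \<nu>_ge Y0 by (intro mult_right_mono) auto
  moreover have "3 * pi * B * Y \<le> 1/4 * real n * Y" using n Y0 by (intro mult_right_mono) auto
  ultimately have nY: "real n * Y \<le> 6 * cmod (deriv_0pi y 0)" by linarith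
  show d0: "deriv_0pi y 0 \<noteq> 0"
  proof
    assume "deriv_0pi y 0 = 0"
    hence "real n * Y \<le> 0" using nY by simp
    moreover have "real n * Y > 0" using n1 Y0 by (intro mult_pos_pos) auto
    ultimately show False by simp
  qed
  show "real n * cmod (y x) \<le> 6 * cmod (deriv_0pi y 0)" if "x \<in> {0..pi}" for x
  proof -
    have "real n * cmod (y x) \<le> real n * Y" using x0(2)[OF that] by (intro mult_left_mono) (auto simp: Y_def)
    thus ?thesis using nY by linarith
  qed
  \<comment> \<open>Removing \<open>n pi\<close> brings the argument into the unit disc, where
    \<open>|sin w| \<ge> |w| / 5\<close>. Thus \<open>18 pi B\<close> becomes \<open>90 B\<close> as
    a bound for \<open>n |\<nu> - n|\<close>, and \<open>|\<nu> + n| \<le> 3 n\<close> turns it into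
    \<open>270 B\<close>.\<close>
  let ?w = "(\<nu> - of_nat n) * of_real pi"
  have "sin (\<nu> * of_real pi) = sin (?w + of_real (real n * pi))" by (simp add: algebra_simps)
  also have "\<dots> = sin ?w * cos (of_real (real n * pi)) + cos ?w * sin (of_real (real n * pi))" by (rule sin_add)
  also have "\<dots> = sin ?w * of_real ((-1) ^ n)"
    by (simp only: cos_of_real sin_of_real cos_npi sin_npi) simp
  finally have sinw: "cmod (sin (\<nu> * of_real pi)) = cmod (sin ?w)" by (simp add: norm_mult norm_power)
  have "cmod (deriv_0pi y 0) * cmod (sin ?w) \<le> 3 * pi * B * Y"
    using I[of pi] D(2) by (simp add: norm_mult sinw)
  hence "real n * (cmod (deriv_0pi y 0) * cmod (sin ?w)) \<le> real n * (3 * pi * B * Y)" by (intro mult_left_mono) auto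
  also have "\<dots> = 3 * pi * B * (real n * Y)" by simp
  also have "\<dots> \<le> 3 * pi * B * (6 * cmod (deriv_0pi y 0))" using nY B by (intro mult_left_mono) auto
  finally have "cmod (deriv_0pi y 0) * (real n * cmod (sin ?w)) \<le> cmod (deriv_0pi y 0) * (18 * pi * B)" by (simp add: mult_ac)
  hence sw: "real n * cmod (sin ?w) \<le> 18 * pi * B" using d0 by simp
  have nw: "cmod ?w = cmod (\<nu> - of_nat n) * pi" by (simp add: norm_mult)
  also have "\<dots> \<le> 1/4 * 4" using \<nu>n pi_less_4 by (intro mult_mono) auto
  finally have "cmod ?w / 5 \<le> cmod (sin ?w)" by (intro norm_sin_ge) simp
  hence "real n * (cmod (\<nu> - of_nat n) * pi / 5) \<le> real n * cmod (sin ?w)"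
    unfolding nw by (intro mult_left_mono) auto
  moreover have "real n * (cmod (\<nu> - of_nat n) * pi / 5) = (real n * cmod (\<nu> - of_nat n)) * pi / 5" by simp
  ultimately have "(real n * cmod (\<nu> - of_nat n)) * pi \<le> 90 * pi * B" using sw by linarith
  also have "90 * pi * B = (90 * B) * pi" by simp
  finally have "real n * cmod (\<nu> - of_nat n) \<le> 90 * B" by (rule mult_right_le_imp_le) simp
  moreover have "cmod z \<le> cmod (\<nu> - of_nat n) * (3 * real n)"
    unfolding prod[symmetric] by (intro mult_left_mono \<nu>_le) auto
  moreover have "cmod (\<nu> - of_nat n) * (3 * real n) = 3 * (real n * cmod (\<nu> - of_nat n))" by simp
  ultimately show "cmod z \<le> 270 * B" by linarith
qed

section \<open>Dirichlet eigenfunctions\<close>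

definition sn :: "nat \<Rightarrow> real \<Rightarrow> complex" where "sn n x = of_real (sin (real n * x))"

lemma norm_sn_le: "cmod (sn n x) \<le> 1" by (simp add: sn_def)

lemma continuous_on_sn [continuous_intros]:
  fixes f :: "real \<Rightarrow> real"
  shows "continuous_on A f \<Longrightarrow> continuous_on A (\<lambda>x. sn n (f x))"
  unfolding sn_def by (auto intro!: continuous_intros)

lemma sn_0: "sn n 0 = 0" by (simp add: sn_def)

lemma sn_pi_minus: "sn n (pi - t) = - ((-1) ^ n) * sn n t"
proof -
  have "sin (real n * (pi - t)) = sin (real n * pi - real n * t)" by (simp add: algebra_simps)
  also have "\<dots> = - ((-1) ^ n * sin (real n * t))" by (simp add: sin_diff sin_npi cos_npi)
  finally show ?thesis by (simp add: sn_def)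
qed

lemma sn_derivs:
  "(sn n has_vector_derivative of_nat n * of_real (cos (real n * x))) (at x within A)"
  "((\<lambda>x. complex_of_real (cos (real n * x))) has_vector_derivative - (of_nat n * sn n x)) (at x within A)"
proof -
  have sc: "sn n = (\<lambda>x. sin (of_nat n * of_real x))" "(\<lambda>x. complex_of_real (cos (real n * x))) = (\<lambda>x. cos (of_nat n * of_real x))"
    by (auto simp: sn_def simp flip: sin_of_real cos_of_real)
  have "((\<lambda>z. sin (of_nat n * z)) has_field_derivative of_nat n * cos (of_nat n * of_real x)) (at (complex_of_real x))"
    by (auto intro!: derivative_eq_intros)
  from has_vector_derivative_real_field[OF this, of A]
  show "(sn n has_vector_derivative of_nat n * of_real (cos (real n * x))) (at x within A)"
    using fun_cong[OF sc(2), of x] by (simp add: sc(1))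
  have "((\<lambda>z. cos (of_nat n * z)) has_field_derivative - (of_nat n * sin (of_nat n * of_real x))) (at (complex_of_real x))"
    by (auto intro!: derivative_eq_intros)
  from has_vector_derivative_real_field[OF this, of A]
  show "((\<lambda>x. complex_of_real (cos (real n * x))) has_vector_derivative - (of_nat n * sn n x)) (at x within A)"
    unfolding sc .
qed

lemma integral_sn_square:
  assumes "n > 0"
  shows "((\<lambda>x. sn n x * sn n x) has_integral of_real (pi / 2)) {0..pi}"
proof -
  have "((\<lambda>x. (sin (real n * x))\<^sup>2) has_integral
      (pi / 2 - sin (2 * real n * pi) / (4 * real n)) - (0 / 2 - sin (2 * real n * 0) / (4 * real n))) {0..pi}"
  proof (rule fundamental_theorem_of_calculus)
    fix x :: real
    have "((\<lambda>x. x / 2 - sin (2 * real n * x) / (4 * real n)) has_real_derivative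
        1 / 2 - cos (2 * real n * x) * (2 * real n) / (4 * real n)) (at x within {0..pi})"
      using assms by (auto intro!: derivative_eq_intros)
    moreover have "1 / 2 - cos (2 * real n * x) * (2 * real n) / (4 * real n) = (sin (real n * x))\<^sup>2"
      using assms cos_double_sin[of "real n * x"] by (simp add: field_simps)
    ultimately show "((\<lambda>x. x / 2 - sin (2 * real n * x) / (4 * real n)) has_vector_derivative (sin (real n * x))\<^sup>2) (at x within {0..pi})"
      by (simp add: has_real_derivative_iff_has_vector_derivative)
  qed simp
  moreover have "sin (2 * real n * pi) = 0" using sin_npi[of "2 * n"] by simp
  ultimately have "((\<lambda>x. (sin (real n * x))\<^sup>2) has_integral pi / 2) {0..pi}" by simp
  hence "((\<lambda>x. complex_of_real ((sin (real n * x))\<^sup>2)) has_integral of_real (pi / 2)) {0..pi}"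
    by (rule has_integral_of_real)
  thus ?thesis by (simp add: sn_def power2_eq_square)
qed

text \<open>\<open>volt n h / n\<close> solves \<open>y'' + n^2 y = h\<close> with zero Cauchy data
  at \<open>0\<close>; leaving out the factor \<open>1 / n\<close> makes the bound on the operator
  independent of \<open>n\<close>.\<close>

definition volt :: "nat \<Rightarrow> (real \<Rightarrow> complex) \<Rightarrow> real \<Rightarrow> complex" where
  "volt n h x = integral {0..x} (\<lambda>t. sn n (x - t) * h t)"

lemma volt_bound:
  assumes "continuous_on {0..pi} h" "\<And>t. t \<in> {0..pi} \<Longrightarrow> cmod (h t) \<le> H" "x \<in> {0..pi}"
  shows "cmod (volt n h x) \<le> pi * H"
proof -
  have H0: "H \<ge> 0" using assms(2)[of 0] norm_ge_zero[of "h 0"] by (auto simp del: norm_ge_zero)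
  have "cmod (volt n h x) \<le> H * (x - 0)" unfolding volt_def
  proof (rule integral_bound)
    show "continuous_on {0..x} (\<lambda>t. sn n (x - t) * h t)"
      using assms(3) by (intro continuous_intros continuous_on_subset[OF assms(1)]) auto
    fix t assume "t \<in> {0..x}"
    hence "cmod (h t) \<le> H" using assms(2,3) by auto
    hence "cmod (sn n (x - t)) * cmod (h t) \<le> 1 * H" by (intro mult_mono norm_sn_le) auto
    thus "cmod (sn n (x - t) * h t) \<le> H" by (simp add: norm_mult)
  qed (use assms in auto)
  also have "\<dots> \<le> H * pi" using assms(3) H0 by (intro mult_left_mono) auto
  finally show ?thesis by (simp add: mult.commute)
qed

lemma volt_diff:
  assumes "continuous_on {0..pi} h" "continuous_on {0..pi} k" "x \<in> {0..pi}"
  shows "volt n h x - volt n k x = volt n (\<lambda>t. h t - k t) x"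
proof -
  have "(\<lambda>t. sn n (x - t) * h t) integrable_on {0..x}" "(\<lambda>t. sn n (x - t) * k t) integrable_on {0..x}"
    using assms(3) by (auto intro!: integrable_continuous_real continuous_intros continuous_on_subset[OF assms(1)] continuous_on_subset[OF assms(2)])
  thus ?thesis unfolding volt_def by (simp add: integral_diff[symmetric] right_diff_distrib)
qed

text \<open>The addition formula for the sine moves \<open>x\<close> out of the integrand, so the
  fundamental theorem applies to two fixed integrals; \<open>sin^2 + cos^2 = 1\<close> then produces
  the term \<open>n h\<close>.\<close>

lemma volt_derivs:
  assumes h: "continuous_on {0..pi} h"
  obtains U1 where "\<And>x. x \<in> {0..pi} \<Longrightarrow> (volt n h has_vector_derivative U1 x) (at x within {0..pi})"
    "\<And>x. x \<in> {0..pi} \<Longrightarrow> (U1 has_vector_derivative (of_nat n * h x - (of_nat n)\<^sup>2 * volt n h x)) (at x within {0..pi})"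
proof -
  define c where "c x = complex_of_real (cos (real n * x))" for x
  define A where "A x = integral {0..x} (\<lambda>t. c t * h t)" for x
  define B where "B x = integral {0..x} (\<lambda>t. sn n t * h t)" for x
  have cc: "continuous_on {0..pi} (\<lambda>t. c t * h t)" "continuous_on {0..pi} (\<lambda>t. sn n t * h t)"
    unfolding c_def by (intro continuous_intros h)+
  have vol: "volt n h x = sn n x * A x - c x * B x" if x: "x \<in> {0..pi}" for x
  proof -
    have sub: "{0..x} \<subseteq> {0..pi}" using x by auto
    have i: "(\<lambda>t. c t * h t) integrable_on {0..x}" "(\<lambda>t. sn n t * h t) integrable_on {0..x}"
      using continuous_on_subset[OF cc(1) sub] continuous_on_subset[OF cc(2) sub]
      by (auto intro: integrable_continuous_real)
    have "sn n (x - t) * h t = sn n x * (c t * h t) - c x * (sn n t * h t)" for t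
    proof -
      have "sn n (x - t) = sn n x * c t - c x * sn n t"
        unfolding sn_def c_def by (simp add: right_diff_distrib sin_diff)
      thus ?thesis by (simp only:) (simp add: algebra_simps)
    qed
    thus ?thesis unfolding volt_def A_def B_def using i
      by (simp add: integral_diff integrable_on_mult_right)
  qed
  have dA: "(A has_vector_derivative c x * h x) (at x within {0..pi})" if "x \<in> {0..pi}" for x
    unfolding A_def by (rule integral_has_vector_derivative[OF cc(1) that])
  have dB: "(B has_vector_derivative sn n x * h x) (at x within {0..pi})" if "x \<in> {0..pi}" for x
    unfolding B_def by (rule integral_has_vector_derivative[OF cc(2) that])
  note dsn = sn_derivs(1)[of n, folded c_def]
  note dc = sn_derivs(2)[of n, folded c_def]
  define U1 where "U1 x = of_nat n * (c x * A x + sn n x * B x)" for x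
  have pyth: "sn n x * sn n x + c x * c x = 1" for x
    unfolding sn_def c_def by (simp flip: of_real_mult of_real_add) (simp flip: power2_eq_square)
  show ?thesis
  proof (rule that[of U1])
    fix x assume x: "x \<in> {0..pi}"
    have "((\<lambda>x. sn n x * A x - c x * B x) has_vector_derivative
        (sn n x * (c x * h x) + of_nat n * c x * A x) - (c x * (sn n x * h x) + - (of_nat n * sn n x) * B x)) (at x within {0..pi})"
      by (intro has_vector_derivative_diff has_vector_derivative_mult dA dB dc dsn x)
    moreover have "(sn n x * (c x * h x) + of_nat n * c x * A x) - (c x * (sn n x * h x) + - (of_nat n * sn n x) * B x) = U1 x"
      by (simp add: U1_def algebra_simps)
    ultimately have "((\<lambda>x. sn n x * A x - c x * B x) has_vector_derivative U1 x) (at x within {0..pi})" by simp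
    thus "(volt n h has_vector_derivative U1 x) (at x within {0..pi})"
      by (rule has_vector_derivative_transform[OF x, rotated]) (rule vol)
    have "(U1 has_vector_derivative of_nat n * ((c x * (c x * h x) + - (of_nat n * sn n x) * A x) +
        (sn n x * (sn n x * h x) + of_nat n * c x * B x))) (at x within {0..pi})"
      unfolding U1_def
      by (intro has_vector_derivative_add has_vector_derivative_mult_right has_vector_derivative_mult dA dB dc dsn x)
    moreover have "of_nat n * ((c x * (c x * h x) + - (of_nat n * sn n x) * A x) +
        (sn n x * (sn n x * h x) + of_nat n * c x * B x)) = of_nat n * ((sn n x * sn n x + c x * c x) * h x) - (of_nat n)\<^sup>2 * volt n h x"
      by (simp add: vol[OF x] power2_eq_square algebra_simps)
    ultimately show "(U1 has_vector_derivative (of_nat n * h x - (of_nat n)\<^sup>2 * volt n h x)) (at x within {0..pi})"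
      by (simp add: pyth)
  qed
qed

lemma volt_pi:
  "volt n h pi = - ((-1) ^ n) * integral {0..pi} (\<lambda>t. sn n t * h t)"
  unfolding volt_def sn_pi_minus mult.assoc by (rule integral_mult_right)

definition dnum :: "(real \<Rightarrow> complex) \<Rightarrow> nat \<Rightarrow> (real \<Rightarrow> complex) \<Rightarrow> complex" where
  "dnum v n w = integral {0..pi} (\<lambda>t. sn n t * (v t * w t))"

definition dden :: "nat \<Rightarrow> (real \<Rightarrow> complex) \<Rightarrow> complex" where
  "dden n w = integral {0..pi} (\<lambda>t. sn n t * w t)"

text \<open>Variation of constants around \<open>sn n\<close>; the spectral shift \<open>dnum / dden\<close> is the one for which
  the image vanishes at \<open>pi\<close>.\<close>

definition dmap :: "(real \<Rightarrow> complex) \<Rightarrow> nat \<Rightarrow> (real \<Rightarrow> complex) \<Rightarrow> real \<Rightarrow> complex" where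
  "dmap v n w x = sn n x + volt n (\<lambda>t. (v t - dnum v n w / dden n w) * w t) x / of_nat n"

text \<open>The radius \<open>1 / 4\<close> keeps \<open>dden\<close> away from zero: it is
  \<open>pi / 2\<close> at \<open>sn n\<close> and changes by at most \<open>pi / 4\<close>.\<close>

definition near_sn :: "nat \<Rightarrow> (real \<Rightarrow> complex) \<Rightarrow> bool" where
  "near_sn n w \<longleftrightarrow> continuous_on {0..pi} w \<and> (\<forall>x\<in>{0..pi}. cmod (w x - sn n x) \<le> 1 / 4)"

context
  fixes v :: "real \<Rightarrow> complex" and B :: real and n :: nat
  assumes v: "continuous_on {0..pi} v" "\<forall>x\<in>{0..pi}. cmod (v x) \<le> B"
    and n: "n > 0" "real n \<ge> 72 * pi * B"
begin

lemma B_nonneg: "B \<ge> 0"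
  using bspec[OF v(2), of 0] norm_ge_zero[of "v 0"] by (auto simp del: norm_ge_zero)

lemma integral_bound_pi:
  assumes "continuous_on {0..pi} f" "\<And>t. t \<in> {0..pi} \<Longrightarrow> cmod (f t) \<le> H"
  shows "cmod (integral {0..pi} (\<lambda>t. sn n t * f t)) \<le> pi * H"
proof -
  have "cmod (integral {0..pi} (\<lambda>t. sn n t * f t)) \<le> H * (pi - 0)"
  proof (rule integral_bound)
    show "continuous_on {0..pi} (\<lambda>t. sn n t * f t)" by (intro continuous_intros assms)
    fix t assume "t \<in> {0..pi}"
    hence "cmod (sn n t) * cmod (f t) \<le> 1 * H" using assms(2) by (intro mult_mono norm_sn_le) auto
    thus "cmod (sn n t * f t) \<le> H" by (simp add: norm_mult)
  qed auto
  thus ?thesis by (simp add: mult.commute)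
qed

lemma integral_sn_diff:
  assumes "continuous_on {0..pi} f" "continuous_on {0..pi} g"
  shows "integral {0..pi} (\<lambda>t. sn n t * f t) - integral {0..pi} (\<lambda>t. sn n t * g t) =
    integral {0..pi} (\<lambda>t. sn n t * (f t - g t))"
proof -
  have "(\<lambda>t. sn n t * f t) integrable_on {0..pi}" "(\<lambda>t. sn n t * g t) integrable_on {0..pi}"
    using assms by (auto intro!: integrable_continuous_real continuous_intros)
  thus ?thesis by (simp add: integral_diff[symmetric] right_diff_distrib)
qed

lemma near_sn_facts:
  assumes "near_sn n w"
  shows "continuous_on {0..pi} w" "\<And>x. x \<in> {0..pi} \<Longrightarrow> cmod (w x) \<le> 5 / 4"
    "cmod (dden n w) \<ge> pi / 4" "cmod (dnum v n w / dden n w) \<le> 5 * B"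
proof -
  show c: "continuous_on {0..pi} w" using assms by (simp add: near_sn_def)
  show b: "cmod (w x) \<le> 5 / 4" if "x \<in> {0..pi}" for x
  proof -
    have "cmod (w x - sn n x) \<le> 1/4" using assms that by (auto simp: near_sn_def)
    thus ?thesis using norm_triangle_ineq[of "w x - sn n x" "sn n x"] norm_sn_le[of n x] by simp
  qed
  have s: "integral {0..pi} (\<lambda>t. sn n t * sn n t) = of_real (pi / 2)"
    by (rule integral_unique[OF integral_sn_square[OF n(1)]])
  have cs: "continuous_on {0..pi} (sn n)" using continuous_on_sn[OF continuous_on_id] .
  have "cmod (dden n w - of_real (pi / 2)) \<le> pi * (1/4)"
    unfolding dden_def s[symmetric] integral_sn_diff[OF c cs]
    using assms by (intro integral_bound_pi continuous_intros c) (auto simp: near_sn_def)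
  moreover have "cmod (of_real (pi / 2)) = pi / 2" by (simp only: norm_of_real) simp
  ultimately show den: "cmod (dden n w) \<ge> pi / 4"
    using norm_triangle_ineq2[of "of_real (pi / 2)" "of_real (pi / 2) - dden n w"] by (simp add: norm_minus_commute)
  have "cmod (dnum v n w) \<le> pi * (B * (5/4))"
    unfolding dnum_def
  proof (intro integral_bound_pi continuous_intros c v(1))
    fix t assume "t \<in> {0..pi}"
    thus "cmod (v t * w t) \<le> B * (5/4)"
      unfolding norm_mult using v b B_nonneg by (intro mult_mono) (auto dest: bspec)
  qed
  also have "\<dots> = 5 * B * (pi / 4)" by simp
  also have "\<dots> \<le> 5 * B * cmod (dden n w)" using den B_nonneg by (intro mult_left_mono) auto
  finally have *: "cmod (dnum v n w) \<le> 5 * B * cmod (dden n w)" .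
  have "cmod (dden n w) > 0" using den pi_gt_zero by linarith
  thus "cmod (dnum v n w / dden n w) \<le> 5 * B" using * by (simp add: norm_divide pos_divide_le_eq)
qed

lemma dmap_near:
  assumes "near_sn n w" "x \<in> {0..pi}"
  shows "cmod (dmap v n w x - sn n x) \<le> 15 / 2 * pi * B / real n"
proof -
  note w = near_sn_facts[OF assms(1)]
  have "cmod (volt n (\<lambda>t. (v t - dnum v n w / dden n w) * w t) x) \<le> pi * ((6 * B) * (5/4))"
  proof (intro volt_bound continuous_intros v(1) w(1) assms(2))
    fix t assume t: "t \<in> {0..pi}"
    have "cmod (v t - dnum v n w / dden n w) \<le> 6 * B"
      using norm_triangle_ineq4[of "v t" "dnum v n w / dden n w"] v(2)[rule_format, OF t] w(4) by linarith
    thus "cmod ((v t - dnum v n w / dden n w) * w t) \<le> (6 * B) * (5/4)"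
      unfolding norm_mult using w(2)[OF t] B_nonneg by (intro mult_mono) auto
  qed
  hence "cmod (volt n (\<lambda>t. (v t - dnum v n w / dden n w) * w t) x) / real n \<le> (15 / 2 * pi * B) / real n"
    by (intro divide_right_mono) auto
  thus ?thesis by (simp add: dmap_def norm_divide)
qed

lemma continuous_on_dmap:
  assumes "near_sn n w"
  shows "continuous_on {0..pi} (dmap v n w)"
proof -
  have h: "continuous_on {0..pi} (\<lambda>t. (v t - dnum v n w / dden n w) * w t)"
    by (intro continuous_intros v(1) near_sn_facts(1)[OF assms])
  obtain U1 where "\<And>x. x \<in> {0..pi} \<Longrightarrow> (volt n (\<lambda>t. (v t - dnum v n w / dden n w) * w t) has_vector_derivative U1 x) (at x within {0..pi})"
    using volt_derivs[OF h, of n] by metis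
  hence "continuous_on {0..pi} (volt n (\<lambda>t. (v t - dnum v n w / dden n w) * w t))"
    by (rule continuous_on_vector_derivative)
  thus ?thesis unfolding dmap_def[abs_def] using n(1) by (intro continuous_intros) auto
qed

lemma near_sn_dmap:
  assumes "near_sn n w"
  shows "near_sn n (dmap v n w)"
  unfolding near_sn_def
proof (intro conjI ballI continuous_on_dmap assms)
  fix x assume "x \<in> {0..pi}"
  have "15 / 2 * pi * B \<le> 1/4 * real n" using n B_nonneg by (auto intro: order_trans[OF _ n(2)])
  hence "15 / 2 * pi * B / real n \<le> 1/4" using n(1) by (simp add: divide_le_eq)
  thus "cmod (dmap v n w x - sn n x) \<le> 1/4" using dmap_near[OF assms \<open>x \<in> {0..pi}\<close>] by linarith
qed

text \<open>The spectral shift varies with \<open>w\<close> as well. Writing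
  \<open>(Z - Z') * dden n w\<close> as the change of \<open>dnum\<close> minus \<open>Z'\<close>
  times the change of \<open>dden\<close> bounds its variation by \<open>24 B \<delta>\<close>. With
  \<open>|v - Z'| \<le> 6 B\<close> and \<open>|w| \<le> 5 / 4\<close> the integrand then changes by
  at most \<open>6 B \<delta> + 30 B \<delta>\<close>.\<close>

lemma dmap_contraction:
  assumes w: "near_sn n w" "near_sn n w'" and \<delta>: "\<And>t. t \<in> {0..pi} \<Longrightarrow> cmod (w t - w' t) \<le> \<delta>" and x: "x \<in> {0..pi}"
  shows "cmod (dmap v n w x - dmap v n w' x) \<le> \<delta> / 2"
proof -
  note w1 = near_sn_facts[OF w(1)] and w2 = near_sn_facts[OF w(2)]
  have \<delta>0: "\<delta> \<ge> 0" using \<delta>[of 0] norm_ge_zero[of "w 0 - w' 0"] by (auto simp del: norm_ge_zero)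
  define Z Z' where "Z = dnum v n w / dden n w" and "Z' = dnum v n w' / dden n w'"
  have d0: "cmod (dden n w) > 0" "cmod (dden n w') > 0" using w1(3) w2(3) pi_gt_zero by linarith+
  have num: "cmod (dnum v n w - dnum v n w') \<le> pi * (B * \<delta>)"
  proof -
    have c: "continuous_on {0..pi} (\<lambda>t. v t * w t)" "continuous_on {0..pi} (\<lambda>t. v t * w' t)"
      by (intro continuous_intros v(1) w1(1) w2(1))+
    show ?thesis unfolding dnum_def integral_sn_diff[OF c]
    proof (intro integral_bound_pi continuous_on_diff c)
      fix t assume t: "t \<in> {0..pi}"
      show "cmod (v t * w t - v t * w' t) \<le> B * \<delta>"
        unfolding right_diff_distrib[symmetric] norm_mult using v(2)[rule_format, OF t] \<delta>[OF t] B_nonneg by (intro mult_mono) auto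
    qed
  qed
  have den: "cmod (dden n w - dden n w') \<le> pi * \<delta>"
    unfolding dden_def integral_sn_diff[OF w1(1) w2(1)]
    by (intro integral_bound_pi continuous_on_diff w1(1) w2(1) \<delta>)
  have "(Z - Z') * dden n w = (dnum v n w - dnum v n w') - Z' * (dden n w - dden n w')"
  proof -
    have "dnum v n w = Z * dden n w" "dnum v n w' = Z' * dden n w'" using d0 by (auto simp: Z_def Z'_def)
    thus ?thesis by (simp add: algebra_simps)
  qed
  hence "cmod (Z - Z') * cmod (dden n w) = cmod ((dnum v n w - dnum v n w') - Z' * (dden n w - dden n w'))"
    by (simp only: norm_mult[symmetric])
  also have "\<dots> \<le> cmod (dnum v n w - dnum v n w') + cmod (Z' * (dden n w - dden n w'))"
    by (rule norm_triangle_ineq4)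
  also have "\<dots> \<le> pi * (B * \<delta>) + 5 * B * (pi * \<delta>)"
    unfolding norm_mult[of Z'] using w2(4) B_nonneg
    by (intro add_mono num mult_mono den) (auto simp: Z'_def)
  also have "\<dots> = 24 * B * \<delta> * (pi / 4)" by simp
  also have "\<dots> \<le> 24 * B * \<delta> * cmod (dden n w)" using w1(3) B_nonneg \<delta>0 by (intro mult_left_mono) auto
  finally have ZZ: "cmod (Z - Z') \<le> 24 * B * \<delta>" by (rule mult_right_le_imp_le) (rule d0)
  have c: "continuous_on {0..pi} (\<lambda>t. (v t - Z) * w t)" "continuous_on {0..pi} (\<lambda>t. (v t - Z') * w' t)"
    by (intro continuous_intros v(1) w1(1) w2(1))+
  have "cmod (volt n (\<lambda>t. (v t - Z) * w t) x - volt n (\<lambda>t. (v t - Z') * w' t) x) \<le> pi * (36 * B * \<delta>)"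
    unfolding volt_diff[OF c x]
  proof (intro volt_bound continuous_on_diff c x)
    fix t assume t: "t \<in> {0..pi}"
    have "(v t - Z) * w t - (v t - Z') * w' t = (v t - Z') * (w t - w' t) - (Z - Z') * w t"
      by (simp add: algebra_simps)
    also have "cmod \<dots> \<le> cmod (v t - Z') * cmod (w t - w' t) + cmod (Z - Z') * cmod (w t)"
      by (metis norm_mult norm_triangle_ineq4)
    also have "\<dots> \<le> (6 * B) * \<delta> + (24 * B * \<delta>) * (5/4)"
    proof (intro add_mono mult_mono)
      show "cmod (v t - Z') \<le> 6 * B"
        using norm_triangle_ineq4[of "v t" Z'] v(2)[rule_format, OF t] w2(4) unfolding Z'_def by linarith
    qed (use \<delta>[OF t] ZZ w1(2)[OF t] \<delta>0 B_nonneg in auto)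
    finally show "cmod ((v t - Z) * w t - (v t - Z') * w' t) \<le> 36 * B * \<delta>" by simp
  qed
  hence "cmod (volt n (\<lambda>t. (v t - Z) * w t) x - volt n (\<lambda>t. (v t - Z') * w' t) x) / real n \<le> (36 * pi * B) * \<delta> / real n"
    by (intro divide_right_mono) (auto simp: mult_ac)
  \<comment> \<open>The requirement \<open>n \<ge> 72 pi B\<close> is made for this step: it turns
    \<open>36 pi B / n\<close> into the contraction factor 1/2.\<close>
  also have "\<dots> \<le> (real n / 2) * \<delta> / real n"
    using n(2) \<delta>0 by (intro divide_right_mono mult_right_mono) auto
  also have "\<dots> = \<delta> / 2" using n(1) by simp
  finally have "cmod (volt n (\<lambda>t. (v t - Z) * w t) x - volt n (\<lambda>t. (v t - Z') * w' t) x) / real n \<le> \<delta> / 2" .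
  moreover have "dmap v n w x - dmap v n w' x =
    (volt n (\<lambda>t. (v t - Z) * w t) x - volt n (\<lambda>t. (v t - Z') * w' t) x) / of_nat n"
    by (simp add: dmap_def Z_def Z'_def diff_divide_distrib)
  ultimately show ?thesis by (simp add: norm_divide)
qed

lemma dmap_fixpoint_unique:
  assumes w: "near_sn n w" "near_sn n w'" and fp: "\<And>x. x \<in> {0..pi} \<Longrightarrow> dmap v n w x = w x"
     "\<And>x. x \<in> {0..pi} \<Longrightarrow> dmap v n w' x = w' x" and x: "x \<in> {0..pi}"
  shows "w x = w' x"
proof -
  have "continuous_on {0..pi} (\<lambda>x. cmod (w x - w' x))"
    by (intro continuous_intros near_sn_facts(1) w)
  then obtain x0 where x0: "x0 \<in> {0..pi}" "\<And>x. x \<in> {0..pi} \<Longrightarrow> cmod (w x - w' x) \<le> cmod (w x0 - w' x0)"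
    using continuous_attains_sup[of "{0..pi}" "\<lambda>x. cmod (w x - w' x)"] by auto
  have "cmod (w x0 - w' x0) \<le> cmod (w x0 - w' x0) / 2"
    using dmap_contraction[OF w x0(2) x0(1)] fp x0(1) by simp
  hence "cmod (w x0 - w' x0) = 0" using norm_ge_zero[of "w x0 - w' x0"] by linarith
  thus ?thesis using x0(2)[OF x] by simp
qed

text \<open>Banach's theorem is applied in the complete space of bounded continuous functions on the
  line; composition with \<open>clamp\<close> extends a function on \<open>[0, pi]\<close> to such a
  function without changing its values or its sup norm.\<close>

lemma dmap_fixpoint_exists:
  "\<exists>w. near_sn n w \<and> (\<forall>x\<in>{0..pi}. dmap v n w x = w x)"
proof -
  let ?cl = "\<lambda>x. clamp 0 pi (x::real)"
  have cl: "?cl x \<in> {0..pi}" for x using clamp_in_interval[of 0 pi x] by simp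
  have cl_id: "?cl x = x" if "x \<in> {0..pi}" for x using that by (simp add: clamp_cancel_cbox)
  have ext: "(\<lambda>x. f (?cl x)) \<in> bcontfun" if "continuous_on {0..pi} f" for f :: "real \<Rightarrow> complex"
  proof -
    have "continuous_on UNIV (\<lambda>x. f (?cl x))"
      using that by (intro clamp_continuous_on) auto
    moreover have "bounded (range (\<lambda>x. f (?cl x)))"
    proof (rule bounded_subset)
      show "bounded (f ` {0..pi})" using that by (intro compact_imp_bounded compact_continuous_image) auto
      show "range (\<lambda>x. f (?cl x)) \<subseteq> f ` {0..pi}" using cl by auto
    qed
    ultimately show ?thesis by (simp add: bcontfun_def)
  qed
  define s where "s = Bcontfun (\<lambda>x. sn n (?cl x))"
  have cs: "continuous_on {0..pi} (sn n)" using continuous_on_sn[OF continuous_on_id] .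
  have s: "apply_bcontfun s x = sn n (?cl x)" for x
    unfolding s_def by (subst Bcontfun_inverse[OF ext[OF cs]]) simp
  define F where "F u = Bcontfun (\<lambda>x. dmap v n (apply_bcontfun u) (?cl x))" for u
  have innear: "near_sn n (apply_bcontfun u)" if "u \<in> cball s (1/4)" for u
    unfolding near_sn_def
  proof (intro conjI ballI)
    fix x assume "x \<in> {0..pi}"
    thus "cmod (apply_bcontfun u x - sn n x) \<le> 1/4"
      using dist_bounded[of s x u] that by (simp add: s cl_id dist_norm norm_minus_commute)
  next
    show "continuous_on {0..pi} (apply_bcontfun u)"
      using apply_bcontfun[of u] by (auto simp: bcontfun_def intro: continuous_on_subset)
  qed
  have F: "apply_bcontfun (F u) x = dmap v n (apply_bcontfun u) (?cl x)" if "u \<in> cball s (1/4)" for u x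
    unfolding F_def by (subst Bcontfun_inverse[OF ext[OF continuous_on_dmap[OF innear[OF that]]]]) simp
  have "\<exists>!u\<in>cball s (1/4). F u = u"
  proof (rule Banach_fix[of _ "1/2"])
    show "complete (cball s (1/4))" by (simp add: complete_eq_closed)
    show "cball s (1/4) \<noteq> {}" by simp
    show "F ` cball s (1/4) \<subseteq> cball s (1/4)"
    proof
      fix f assume "f \<in> F ` cball s (1/4)"
      then obtain u where u: "u \<in> cball s (1/4)" "f = F u" by auto
      have "dist s f \<le> 1/4"
      proof (rule dist_bound)
        fix x show "dist (apply_bcontfun s x) (apply_bcontfun f x) \<le> 1/4"
          using near_sn_dmap[OF innear[OF u(1)]] cl[of x]
          by (auto simp: u(2) F[OF u(1)] s dist_norm norm_minus_commute near_sn_def)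
      qed
      thus "f \<in> cball s (1/4)" by simp
    qed
    fix u u' assume u: "u \<in> cball s (1/4)" "u' \<in> cball s (1/4)"
    show "dist (F u) (F u') \<le> 1/2 * dist u u'"
    proof (rule dist_bound)
      fix x
      have "cmod (dmap v n (apply_bcontfun u) (?cl x) - dmap v n (apply_bcontfun u') (?cl x)) \<le> dist u u' / 2"
        using dist_bounded[of u _ u'] by (intro dmap_contraction innear u cl) (simp add: dist_norm)
      thus "dist (apply_bcontfun (F u) x) (apply_bcontfun (F u') x) \<le> 1/2 * dist u u'"
        by (simp add: F[OF u(1)] F[OF u(2)] dist_norm)
    qed
  qed auto
  then obtain u where u: "u \<in> cball s (1/4)" "F u = u" by blast
  have "dmap v n (apply_bcontfun u) x = apply_bcontfun u x" if "x \<in> {0..pi}" for x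
    using F[OF u(1), of x] that by (simp add: u(2) cl_id)
  thus ?thesis using innear[OF u(1)] by blast
qed

end

text \<open>Differentiating the fixed point equation twice gives the differential equation. The
  condition at \<open>pi\<close> holds because \<open>Z\<close> makes the integral of
  \<open>sn n * (v - Z) * w\<close> vanish, and this integral is \<open>volt\<close> at
  \<open>pi\<close> up to sign.\<close>

lemma dmap_fixpoint_eigen:
  fixes v :: "real \<Rightarrow> complex"
  assumes v: "continuous_on {0..pi} v" "\<forall>x\<in>{0..pi}. cmod (v x) \<le> B"
    and n: "n > 0" "real n \<ge> 72 * pi * B"
    and w: "near_sn n w" and fp: "\<And>x. x \<in> {0..pi} \<Longrightarrow> dmap v n w x = w x"
  defines "y \<equiv> (\<lambda>x. if x \<in> {0..pi} then w x else 0)"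
  defines "Z \<equiv> dnum v n w / dden n w"
  shows "y \<in> hill_dom Dirichlet" "hill_op v y = (\<lambda>x. ((of_nat n)\<^sup>2 + Z) * y x)" "y \<noteq> (\<lambda>_. 0)"
proof -
  note wf = near_sn_facts[OF v n w]
  define h where "h t = (v t - Z) * w t" for t
  have h: "continuous_on {0..pi} h" unfolding h_def by (intro continuous_intros v wf(1))
  have wx: "w x = sn n x + volt n h x / of_nat n" if "x \<in> {0..pi}" for x
    using fp[OF that] by (simp add: dmap_def h_def[abs_def] Z_def)
  obtain U1 where U: "\<And>x. x \<in> {0..pi} \<Longrightarrow> (volt n h has_vector_derivative U1 x) (at x within {0..pi})"
    "\<And>x. x \<in> {0..pi} \<Longrightarrow> (U1 has_vector_derivative (of_nat n * h x - (of_nat n)\<^sup>2 * volt n h x)) (at x within {0..pi})"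
    using volt_derivs[OF h] by blast
  define y1 where "y1 x = of_nat n * of_real (cos (real n * x)) + (1 / of_nat n) * U1 x" for x
  define y2 where "y2 x = of_nat n * (- (of_nat n * sn n x)) + (1 / of_nat n) * (of_nat n * h x - (of_nat n)\<^sup>2 * volt n h x)" for x
  have d1: "(y has_vector_derivative y1 x) (at x within {0..pi})" if "x \<in> {0..pi}" for x
  proof -
    have "((\<lambda>x. sn n x + (1 / of_nat n) * volt n h x) has_vector_derivative y1 x) (at x within {0..pi})"
      unfolding y1_def by (intro has_vector_derivative_add has_vector_derivative_mult_right U sn_derivs that)
    thus ?thesis by (rule has_vector_derivative_transform[OF that, rotated]) (simp add: y_def wx)
  qed
  have d2: "(y1 has_vector_derivative y2 x) (at x within {0..pi})" if "x \<in> {0..pi}" for x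
    unfolding y1_def y2_def
    by (intro has_vector_derivative_add has_vector_derivative_mult_right U sn_derivs that)
  have y2: "y2 x = (v x - ((of_nat n)\<^sup>2 + Z)) * y x" if "x \<in> {0..pi}" for x
  proof -
    have "y2 x = h x - (of_nat n)\<^sup>2 * (sn n x + volt n h x / of_nat n)"
      using n(1) by (simp add: y2_def field_simps power2_eq_square)
    also have "\<dots> = h x - (of_nat n)\<^sup>2 * w x" using wx[OF that] by simp
    finally show ?thesis using that by (simp add: h_def y_def algebra_simps)
  qed
  have cy: "continuous_on {0..pi} y" by (rule continuous_on_eq[OF wf(1)]) (simp add: y_def)
  have "continuous_on {0..pi} (\<lambda>x. (v x - ((of_nat n)\<^sup>2 + Z)) * y x)" by (intro continuous_intros v cy)
  hence cy2: "continuous_on {0..pi} y2" by (rule continuous_on_eq) (simp add: y2)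
  have y0: "y x = 0" if "x \<notin> {0..pi}" for x using that by (auto simp: y_def)
  note C2 = C2_0piI[OF d1 d2 cy2 y0]
  have "volt n h 0 = 0" by (simp add: volt_def)
  hence b0: "y 0 = 0" using wx[of 0] by (simp add: y_def sn_0)
  have dd: "dden n w \<noteq> 0" using wf(3) pi_gt_zero by force
  have i: "(\<lambda>t. sn n t * (v t * w t)) integrable_on {0..pi}" "(\<lambda>t. sn n t * w t) integrable_on {0..pi}"
    by (intro integrable_continuous_real continuous_intros v wf(1))+
  have "integral {0..pi} (\<lambda>t. sn n t * h t) = integral {0..pi} (\<lambda>t. sn n t * (v t * w t) - Z * (sn n t * w t))"
    by (rule arg_cong[where f = "integral {0..pi}"]) (auto simp: h_def algebra_simps)
  also have "\<dots> = dnum v n w - Z * dden n w"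
    using i by (simp add: integral_diff integrable_on_mult_right dnum_def dden_def)
  also have "\<dots> = 0" using dd by (simp add: Z_def)
  finally have "volt n h pi = 0" by (simp add: volt_pi)
  moreover have "sn n pi = 0" by (simp add: sn_def sin_npi)
  ultimately have bpi: "y pi = 0" using wx[of pi] by (simp add: y_def)
  have "y \<in> C2_0pi" by (rule C2(1))
  thus "y \<in> hill_dom Dirichlet" using b0 bpi by (simp add: hill_dom_def)
  show "hill_op v y = (\<lambda>x. ((of_nat n)\<^sup>2 + Z) * y x)"
  proof
    fix x show "hill_op v y x = ((of_nat n)\<^sup>2 + Z) * y x"
    proof (cases "x \<in> {0..pi}")
      case True
      have "deriv_0pi (deriv_0pi y) x = y2 x" by (rule C2(3)[OF _ _ _ True])
      thus ?thesis using y2[OF True] by (simp add: hill_op_def algebra_simps)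
    next
      case False
      thus ?thesis using y0[OF False] by (auto simp: hill_op_def deriv_0pi_def)
    qed
  qed
  show "y \<noteq> (\<lambda>_. 0)"
  proof
    assume yz: "y = (\<lambda>_. 0)"
    have w0: "w x = 0" if "x \<in> {0..pi}" for x 
    proof -
      have "w x = y x" using that by (simp add: y_def)
      thus ?thesis by (simp add: yz)
    qed
    have "dden n w = integral {0..pi} (\<lambda>_. 0)" unfolding dden_def by (rule integral_cong) (simp add: w0)
    hence "dden n w = 0" by simp
    thus False using dd by simp
  qed
qed

text \<open>Green's identity against \<open>sn n\<close>, which satisfies the same boundary
  conditions, shows that the shift of any eigenfunction is the quotient built into
  \<open>dmap\<close>; this is what makes a normalised eigenfunction a fixed point.\<close>

lemma Dirichlet_pairing:
  fixes v :: "real \<Rightarrow> complex"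
  assumes v: "continuous_on {0..pi} v" and y: "y \<in> hill_dom Dirichlet" "hill_op v y = (\<lambda>x. ((of_nat n)\<^sup>2 + z) * y x)"
  shows "z * dden n y = dnum v n y"
proof -
  note D = Dirichlet_eigenD[OF y] and C = C2_0piD[OF Dirichlet_eigenD(3)[OF y]]
  have "((\<lambda>x. deriv_0pi (deriv_0pi y) x * sn n x - y x * (of_nat n * (- (of_nat n * sn n x)))) has_integral
     (deriv_0pi y pi * sn n pi - y pi * (of_nat n * of_real (cos (real n * pi)))) -
     (deriv_0pi y 0 * sn n 0 - y 0 * (of_nat n * of_real (cos (real n * 0))))) {0..pi}"
    by (intro Green_identity C sn_derivs has_vector_derivative_mult_right)
  moreover have "sn n pi = 0" "sn n 0 = 0" by (simp_all add: sn_def sin_npi)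
  ultimately have I1: "((\<lambda>x. deriv_0pi (deriv_0pi y) x * sn n x - y x * (of_nat n * (- (of_nat n * sn n x)))) has_integral 0) {0..pi}"
    using D(1,2) by simp
  have I2: "deriv_0pi (deriv_0pi y) x * sn n x - y x * (of_nat n * (- (of_nat n * sn n x))) =
      sn n x * (v x * y x) - z * (sn n x * y x)" if "x \<in> {0..pi}" for x
    unfolding D(4)[OF that] by (simp add: algebra_simps power2_eq_square)
  have I3: "((\<lambda>x. sn n x * (v x * y x) - z * (sn n x * y x)) has_integral 0) {0..pi}"
    by (rule has_integral_eq[OF I2 I1])
  have "((\<lambda>x. sn n x * (v x * y x) - z * (sn n x * y x)) has_integral dnum v n y - z * dden n y) {0..pi}"
    unfolding dnum_def dden_def
    by (intro has_integral_diff has_integral_mult_right integrable_integral integrable_continuous_real continuous_intros v C(3))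
  from has_integral_unique[OF I3 this] show ?thesis by simp
qed

text \<open>Eigenfunctions with eigenvalue in the disc, normalised by \<open>y' 0 = n\<close>, are fixed points of
  the same contraction as the one used to construct an eigenfunction.\<close>

theorem Dirichlet_eigenvalue_in_disc:
  fixes v :: "real \<Rightarrow> complex"
  assumes v: "continuous_on {0..pi} v" "\<forall>x\<in>{0..pi}. cmod (v x) \<le> B"
    and n: "real n \<ge> 1 + 30000 * B"
  shows "\<exists>z w. cmod z \<le> 5 * B \<and> hill_mu v n = (of_nat n)\<^sup>2 + z \<and> w \<in> hill_dom Dirichlet \<and>
     hill_op v w = (\<lambda>x. ((of_nat n)\<^sup>2 + z) * w x) \<and>
     (\<forall>x\<in>{0..pi}. cmod (w x - sn n x) \<le> 30 * B / real n)"
proof -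
  have B: "B \<ge> 0" using bspec[OF v(2), of 0] norm_ge_zero[of "v 0"] by (auto simp del: norm_ge_zero)
  have piB: "pi * B \<le> 4 * B" using B pi_less_4 by (intro mult_right_mono) auto
  have n1: "n > 0" "real n \<ge> 72 * pi * B" "real n \<ge> 1 + 12 * pi * B" using n piB B by (auto intro!: Nat.gr0I)
  obtain w where w: "near_sn n w" "\<And>x. x \<in> {0..pi} \<Longrightarrow> dmap v n w x = w x"
    using dmap_fixpoint_exists[OF v n1(1,2)] by blast
  define Z where "Z = dnum v n w / dden n w"
  define y where "y = (\<lambda>x. if x \<in> {0..pi} then w x else 0)"
  have y: "y \<in> hill_dom Dirichlet" "hill_op v y = (\<lambda>x. ((of_nat n)\<^sup>2 + Z) * y x)" "y \<noteq> (\<lambda>_. 0)"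
    unfolding y_def Z_def by (rule dmap_fixpoint_eigen[OF v n1(1,2) w]; assumption)+
  have Z: "cmod Z \<le> 5 * B" unfolding Z_def by (rule near_sn_facts(4)[OF v n1(1,2) w(1)])
  have Zd: "(of_nat n)\<^sup>2 + Z \<in> hill_disc n" using Z n B by (simp add: hill_disc_def)
  have uniq: "l = (of_nat n)\<^sup>2 + Z" if l: "l \<in> hill_disc n" "hill_eigenvalue Dirichlet v l" for l
  proof -
    define z where "z = l - (of_nat n)\<^sup>2"
    have lz: "l = (of_nat n)\<^sup>2 + z" by (simp add: z_def)
    have z: "cmod z < real n / 4" using l(1) by (simp add: hill_disc_def z_def)
    obtain g where g: "g \<in> hill_dom Dirichlet" "g \<noteq> (\<lambda>_. 0)" "hill_op v g = (\<lambda>x. ((of_nat n)\<^sup>2 + z) * g x)"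
      using l(2) unfolding hill_eigenvalue_def lz by blast
    note loc = Dirichlet_localization[OF v B n1(3) z g(1,3,2)]
    note D = Dirichlet_eigenD[OF g(1,3)] and C = C2_0piD[OF Dirichlet_eigenD(3)[OF g(1,3)]]
    define k where "k = of_nat n / deriv_0pi g 0"
    have k: "k \<noteq> 0" using loc(2) n1(1) by (simp add: k_def)
    define u where "u x = k * g x" for x
    have ux: "u x = sn n x + volt n (\<lambda>t. (v t - z) * u t) x / of_nat n" if x: "x \<in> {0..pi}" for x
    proof -
      have "((\<lambda>t. sin (of_nat n * of_real (x - t)) * ((v t - z) * g t)) has_integral
        (of_nat n * g x - deriv_0pi g 0 * sin (of_nat n * of_real x))) {0..x}"
        by (rule variation_of_constants[OF C(1,2) _ D(1) x]) (use D(4) in \<open>auto simp: algebra_simps\<close>)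
      from has_integral_mult_right[OF this, of k]
      have "((\<lambda>t. k * (sin (of_nat n * of_real (x - t)) * ((v t - z) * g t))) has_integral
        k * (of_nat n * g x - deriv_0pi g 0 * sin (of_nat n * of_real x))) {0..x}" .
      moreover have sn_eq: "sn n t = sin (of_nat n * of_real t)" for t by (simp add: sn_def flip: sin_of_real)
      ultimately have "volt n (\<lambda>t. (v t - z) * u t) x = k * (of_nat n * g x - deriv_0pi g 0 * sn n x)"
        unfolding volt_def by (intro integral_unique) (simp add: u_def mult_ac sn_eq)
      also have "\<dots> = of_nat n * (u x - sn n x)" using loc(2) by (simp add: k_def u_def field_simps)
      finally show ?thesis using n1(1) by (simp add: field_simps)
    qed
    have u6: "cmod (u x) \<le> 6" if "x \<in> {0..pi}" for x
      using loc(3)[OF that] loc(2) by (simp add: u_def k_def norm_mult norm_divide field_simps)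
    have cu: "continuous_on {0..pi} u" unfolding u_def by (intro continuous_intros C(3))
    have near: "near_sn n u" unfolding near_sn_def
    proof (intro conjI ballI cu)
      fix x assume x: "x \<in> {0..pi}"
      have "cmod (volt n (\<lambda>t. (v t - z) * u t) x) \<le> pi * ((271 * B) * 6)"
      proof (intro volt_bound continuous_intros v(1) cu x)
        fix t assume t: "t \<in> {0..pi}"
        have "cmod (v t - z) \<le> 271 * B" using norm_triangle_ineq4[of "v t" z] v(2)[rule_format, OF t] loc(1) by linarith
        thus "cmod ((v t - z) * u t) \<le> (271 * B) * 6"
          unfolding norm_mult using u6[OF t] B by (intro mult_mono) auto
      qed
      \<comment> \<open>The size of the constant 30000 is decided here: with \<open>pi < 4\<close>
        the left side is at most \<open>6504 B\<close>, so \<open>n \<ge> 26016 B\<close> is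
        enough.\<close>
      also have "\<dots> \<le> 1/4 * real n" using n piB B by simp
      finally show "cmod (u x - sn n x) \<le> 1/4" using n1(1) ux[OF x] by (simp add: norm_divide divide_le_eq)
    qed
    have pair: "z * dden n u = dnum v n u"
    proof -
      have "z * dden n g = dnum v n g" by (rule Dirichlet_pairing[OF v(1) g(1,3)])
      moreover have "dden n u = k * dden n g"
      proof -
        have "dden n u = integral {0..pi} (\<lambda>t. k * (sn n t * g t))"
          unfolding dden_def u_def by (rule arg_cong[where f = "integral {0..pi}"]) (auto simp: mult_ac)
        thus ?thesis by (simp add: dden_def)
      qed
      moreover have "dnum v n u = k * dnum v n g"
      proof -
        have "dnum v n u = integral {0..pi} (\<lambda>t. k * (sn n t * (v t * g t)))"
          unfolding dnum_def u_def by (rule arg_cong[where f = "integral {0..pi}"]) (auto simp: mult_ac)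
        thus ?thesis by (simp add: dnum_def)
      qed
      ultimately show ?thesis by (simp add: mult.left_commute)
    qed
    have "dden n u \<noteq> 0" using near_sn_facts(3)[OF v n1(1,2) near] pi_gt_zero by force
    hence zu: "dnum v n u / dden n u = z" using pair by (simp add: field_simps)
    have fpu: "dmap v n u x = u x" if "x \<in> {0..pi}" for x using ux[OF that] by (simp add: dmap_def zu)
    have uw: "u x = w x" if "x \<in> {0..pi}" for x
      by (rule dmap_fixpoint_unique[OF v n1(1,2) near w(1) fpu w(2) that])
    have "dnum v n u = dnum v n w" "dden n u = dden n w"
      unfolding dnum_def dden_def by (auto intro!: integral_cong simp: uw)
    thus ?thesis using zu by (simp add: lz Z_def)
  qed
  have "hill_mu v n = (of_nat n)\<^sup>2 + Z"
    unfolding hill_mu_def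
  proof (rule the_equality)
    show "(of_nat n)\<^sup>2 + Z \<in> hill_disc n \<and> hill_eigenvalue Dirichlet v ((of_nat n)\<^sup>2 + Z)"
      unfolding hill_eigenvalue_def by (intro conjI bexI[of _ y]) (rule Zd y)+
  qed (use uniq in blast)
  moreover have "cmod (y x - sn n x) \<le> 30 * B / real n" if x: "x \<in> {0..pi}" for x
  proof -
    have "cmod (y x - sn n x) \<le> 15 / 2 * pi * B / real n"
      using dmap_near[OF v n1(1,2) w(1) x] w(2)[OF x] x by (simp add: y_def)
    also have "\<dots> \<le> 30 * B / real n" using piB by (intro divide_right_mono) (auto simp: mult.commute)
    finally show ?thesis .
  qed
  ultimately show ?thesis using Z y(1,2) by (intro exI[of _ Z] exI[of _ y] conjI ballI)
qed

section \<open>Matrix entries of the reduced problem\<close>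

text \<open>With \<open>soln\<close> this is the basis of the bounded solutions dual to evaluation
  at \<open>0\<close> and \<open>n\<close>. The choice is well defined once
  \<open>n \<ge> 2\<close>, \<open>2 (|a| + |b|) \<le> n\<close> and
  \<open>|z| \<le> n\<close>.\<close>

definition sol0 :: "complex \<Rightarrow> complex \<Rightarrow> nat \<Rightarrow> nat \<Rightarrow> nat \<Rightarrow> complex \<Rightarrow> int \<Rightarrow> complex" where
  "sol0 a b R S n z = (SOME u. red_sol a b R S n z (\<lambda>_. 0) u \<and> u 0 = 1 \<and> u (int n) = 0)"

definition soln :: "complex \<Rightarrow> complex \<Rightarrow> nat \<Rightarrow> nat \<Rightarrow> nat \<Rightarrow> complex \<Rightarrow> int \<Rightarrow> complex" where
  "soln a b R S n z = (SOME u. red_sol a b R S n z (\<lambda>_. 0) u \<and> u 0 = 0 \<and> u (int n) = 1)"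

lemma hill_V_reflect: "hill_V b a S R (\<lambda>j. u (int n - j)) j = hill_V a b R S u (int n - j)"
  by (simp add: hill_V_def algebra_simps)

lemma hill_V_linear:
  "hill_V a b R S (\<lambda>j. c * u j + e * w j) j = c * hill_V a b R S u j + e * hill_V a b R S w j"
  by (simp add: hill_V_def algebra_simps)

text \<open>Since the gap is invariant under the reflection of \<open>j\<close> to
  \<open>n - j\<close>, exchanging \<open>a\<close> with \<open>b\<close> and \<open>R\<close> with
  \<open>S\<close> is a symmetry. Every bound for \<open>sol0\<close> thereby becomes one for
  \<open>soln\<close>, with \<open>K'\<close> in place of \<open>K\<close>.\<close>

lemma red_sol_reflect:
  assumes "red_sol a b R S n z f u"
  shows "red_sol b a S R n z (\<lambda>j. f (int n - j)) (\<lambda>j. u (int n - j))"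
  unfolding red_sol_def
proof (intro conjI allI impI)
  have "range (\<lambda>j. u (int n - j)) \<subseteq> range u" by auto
  thus "bounded (range (\<lambda>j. u (int n - j)))" using assms bounded_subset unfolding red_sol_def by blast
  fix j assume "j \<noteq> 0" "j \<noteq> int n"
  hence "(of_int (gap n (int n - j)) + z) * u (int n - j) = hill_V a b R S u (int n - j) + f (int n - j)"
    using assms by (simp add: red_sol_def)
  thus "(of_int (gap n j) + z) * u (int n - j) = hill_V b a S R (\<lambda>j. u (int n - j)) j + f (int n - j)"
    by (simp add: gap_reflect hill_V_reflect)
qed

lemma bounded_red_sol: "red_sol a b R S n z f u \<Longrightarrow> bounded (range u)"
  by (simp add: red_sol_def)

context
  fixes a b :: complex and R S n :: nat
  assumes n: "n \<ge> 2" "2 * (cmod a + cmod b) \<le> real n"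
begin

lemma sol0:
  assumes "cmod z \<le> real n"
  shows "red_sol a b R S n z (\<lambda>_. 0) (sol0 a b R S n z)" "sol0 a b R S n z 0 = 1" "sol0 a b R S n z (int n) = 0"
  using someI_ex[OF red_sol_exists[OF n(1) assms n(2), of "\<lambda>_. 0" R S 1 0]]
  unfolding sol0_def by auto

lemma soln:
  assumes "cmod z \<le> real n"
  shows "red_sol a b R S n z (\<lambda>_. 0) (soln a b R S n z)" "soln a b R S n z 0 = 0" "soln a b R S n z (int n) = 1"
  using someI_ex[OF red_sol_exists[OF n(1) assms n(2), of "\<lambda>_. 0" R S 0 1]]
  unfolding soln_def by auto

lemma red_sol_unique:
  assumes "red_sol a b R S n z f u" "red_sol a b R S n z f w" "u 0 = w 0" "u (int n) = w (int n)" "cmod z \<le> real n"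
  shows "u j = w j"
proof -
  have "red_sol a b R S n z (\<lambda>_. 0) (\<lambda>j. 1 * u j + (-1) * w j)"
    using red_sol_add[OF assms(1,2), of 1 "-1"] by simp
  from red_sol_zero[OF this _ _ n(1) assms(5) n(2)] show ?thesis using assms(3,4) by simp
qed

lemma red_sol_decomp:
  assumes u: "red_sol a b R S n z (\<lambda>_. 0) u" and z: "cmod z \<le> real n"
  shows "u j = u 0 * sol0 a b R S n z j + u (int n) * soln a b R S n z j"
proof -
  have "red_sol a b R S n z (\<lambda>_. 0) (\<lambda>j. u 0 * sol0 a b R S n z j + u (int n) * soln a b R S n z j)"
    using red_sol_add[OF sol0(1)[OF z] soln(1)[OF z]] by simp
  thus ?thesis by (rule red_sol_unique[OF u _ _ _ z]) (simp_all add: sol0[OF z] soln[OF z])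
qed

text \<open>The comparison principle requires zero resonant values, so these are split off as
  \<open>c\<close> and moved into the source; the constant \<open>1\<close> is then a supersolution.
  Inserting this bound into the recurrence once more gains the factor one over the gap.\<close>

lemma red_sol_bound:
  assumes u: "red_sol a b R S n z (\<lambda>_. 0) u" and u0: "cmod (u 0) \<le> 1" "cmod (u (int n)) \<le> 1" and z: "cmod z \<le> real n"
  shows "cmod (u j) \<le> 1"
    and "j \<noteq> 0 \<Longrightarrow> j \<noteq> int n \<Longrightarrow> cmod (u j) \<le> 2 * (cmod a + cmod b) * (1 / \<bar>real_of_int (gap n j)\<bar>)"
proof -
  define c where "c j = (if j = 0 \<or> j = int n then u j else 0)" for j
  have c1: "cmod (c j) \<le> 1" for j using u0 by (auto simp: c_def)
  define h where "h j = u j - c j" for j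
  have V_le: "cmod (hill_V a b R S w j) \<le> cmod a + cmod b" if "\<And>j. cmod (w j) \<le> 1" for w j
  proof -
    have "cmod (hill_V a b R S w j) \<le> cmod a * cmod (w (j + int R)) + cmod b * cmod (w (j - int S))"
      unfolding hill_V_def by (simp flip: norm_mult add: norm_triangle_ineq)
    also have "\<dots> \<le> cmod a * 1 + cmod b * 1" by (intro add_mono mult_left_mono that) auto
    finally show ?thesis by simp
  qed
  have sol: "red_sol a b R S n z (\<lambda>j. hill_V a b R S c j) h"
    unfolding red_sol_def
  proof (intro conjI allI impI)
    obtain B where "\<And>j. cmod (u j) \<le> B" using bounded_red_sol[OF u] by (auto simp: bounded_iff)
    hence "cmod (h j) \<le> B + 1" for j unfolding h_def using c1 by (meson add_mono norm_triangle_le_diff)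
    thus "bounded (range h)" by (auto simp: bounded_iff)
    fix j assume j: "j \<noteq> 0" "j \<noteq> int n"
    have "hill_V a b R S u j = hill_V a b R S h j + hill_V a b R S c j"
      by (simp add: hill_V_def h_def algebra_simps)
    moreover have "h j = u j" using j by (simp add: h_def c_def)
    ultimately show "(of_int (gap n j) + z) * h j = hill_V a b R S h j + hill_V a b R S c j"
      using u j by (simp add: red_sol_def)
  qed
  have "cmod (h j) \<le> 1" for j
  proof (rule red_sol_comparison[OF sol _ _ n(1) z n(2)])
    fix j assume "j \<noteq> 0" "j \<noteq> int n"
    hence "real n \<le> cmod (of_int (gap n j) + z)" using gap_plus_ge(2)[OF n(1) _ _ z] by simp
    thus "cmod a * 1 + cmod b * 1 + cmod (hill_V a b R S c j) \<le> cmod (of_int (gap n j) + z) * 1"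
      using V_le[of c j] c1 n(2) by simp
  qed (auto simp: h_def c_def)
  note h1 = this
  have u1: "cmod (u j) \<le> 1" for j
  proof (cases "j = 0 \<or> j = int n")
    case False
    hence "h j = u j" by (simp add: h_def c_def)
    thus ?thesis using h1[of j] by simp
  qed (use u0 in auto)
  thus "cmod (u j) \<le> 1" .
  assume j: "j \<noteq> 0" "j \<noteq> int n"
  have g: "\<bar>real_of_int (gap n j)\<bar> / 2 \<le> cmod (of_int (gap n j) + z)" using gap_plus_ge(1)[OF n(1) j z] .
  have gpos: "\<bar>real_of_int (gap n j)\<bar> > 0" using j by (auto simp: gap_def)
  have "\<bar>real_of_int (gap n j)\<bar> / 2 * cmod (u j) \<le> cmod (of_int (gap n j) + z) * cmod (u j)"
    using g by (intro mult_right_mono) auto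
  also have "\<dots> = cmod (hill_V a b R S u j)" using u j by (simp add: red_sol_def flip: norm_mult)
  also have "\<dots> \<le> cmod a + cmod b" by (rule V_le[OF u1])
  finally show "cmod (u j) \<le> 2 * (cmod a + cmod b) * (1 / \<bar>real_of_int (gap n j)\<bar>)"
    using gpos by (simp add: field_simps)
qed

lemma norm_hill_V_sol:
  assumes "cmod z \<le> real n"
  shows "cmod (hill_V a b R S (sol0 a b R S n z) j) \<le> cmod a + cmod b"
    "cmod (hill_V a b R S (soln a b R S n z) j) \<le> cmod a + cmod b"
proof -
  have V_le: "cmod (hill_V a b R S w j) \<le> cmod a + cmod b" if "\<And>j. cmod (w j) \<le> 1" for w j
  proof -
    have "cmod (hill_V a b R S w j) \<le> cmod a * cmod (w (j + int R)) + cmod b * cmod (w (j - int S))"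
      unfolding hill_V_def by (simp flip: norm_mult add: norm_triangle_ineq)
    also have "\<dots> \<le> cmod a * 1 + cmod b * 1" by (intro add_mono mult_left_mono that) auto
    finally show ?thesis by simp
  qed
  show "cmod (hill_V a b R S (sol0 a b R S n z) j) \<le> cmod a + cmod b"
    by (rule V_le, rule red_sol_bound(1)[OF sol0(1)[OF assms]]) (use sol0[OF assms] assms in auto)
  show "cmod (hill_V a b R S (soln a b R S n z) j) \<le> cmod a + cmod b"
    by (rule V_le, rule red_sol_bound(1)[OF soln(1)[OF assms]]) (use soln[OF assms] assms in auto)
qed

text \<open>Rewritten at the parameter \<open>z\<close>, the recurrence for the solution at
  \<open>w\<close> has source \<open>z - w\<close> times that solution. The resulting identity of
  resolvent type is exact and takes the place of differentiation in \<open>z\<close>.\<close>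

lemma sol0_diff:
  assumes z: "cmod z \<le> real n" "cmod w \<le> real n"
    and k: "red_sol a b R S n z (sol0 a b R S n w) k" "k 0 = 0" "k (int n) = 0"
  shows "sol0 a b R S n z j - sol0 a b R S n w j = - (z - w) * k j"
proof -
  let ?u = "sol0 a b R S n z" and ?w = "sol0 a b R S n w"
  have src: "(\<lambda>j. 1 * ((z - w) * ?w j) + - (z - w) * ?w j) = (\<lambda>j. 0)" by (auto simp: algebra_simps)
  have "red_sol a b R S n z (\<lambda>j. (z - w) * ?w j) ?w"
    using sol0(1)[OF z(2)] unfolding red_sol_def by (auto simp: algebra_simps)
  from red_sol_add[OF this k(1), of 1 "- (z - w)", unfolded src]
  have "red_sol a b R S n z (\<lambda>j. 0) (\<lambda>j. 1 * ?w j + - (z - w) * k j)" .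
  hence "?u j = 1 * ?w j + - (z - w) * k j"
    by (rule red_sol_unique[OF sol0(1)[OF z(1)] _ _ _ z(1)]) (simp_all add: sol0[OF z(1)] sol0[OF z(2)] k)
  thus ?thesis by simp
qed

end

lemma soln_reflect:
  assumes n: "n \<ge> 2" "2 * (cmod a + cmod b) \<le> real n" and z: "cmod z \<le> real n"
  shows "soln a b R S n z j = sol0 b a S R n z (int n - j)"
proof -
  have n': "2 * (cmod b + cmod a) \<le> real n" using n(2) by simp
  note s = sol0[OF n(1) n' z, where R = S and S = R]
  have "red_sol a b R S n z (\<lambda>_. 0) (\<lambda>j. sol0 b a S R n z (int n - j))"
    using red_sol_reflect[OF s(1)] by simp
  thus ?thesis by (rule red_sol_unique[OF n soln(1)[OF n z] _ _ _ z]) (simp_all add: soln[OF n z] s)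
qed

text \<open>The solutions \<open>k\<close> in the last clause play the role of the derivative of the entries in \<open>z\<close>.\<close>

definition entry_bounds ::
  "complex \<Rightarrow> complex \<Rightarrow> nat \<Rightarrow> nat \<Rightarrow> nat \<Rightarrow> real \<Rightarrow> real \<Rightarrow> complex \<Rightarrow> bool" where
  "entry_bounds a b R S n Z e K \<longleftrightarrow> (\<forall>z. cmod z \<le> Z \<longrightarrow>
     cmod (hill_V a b R S (sol0 a b R S n z) 0) \<le> e \<and>
     cmod (hill_V a b R S (sol0 a b R S n z) (int n) - K) \<le> e * cmod K \<and>
     (\<forall>w. cmod w \<le> Z \<longrightarrow>
        cmod (hill_V a b R S (sol0 a b R S n z) 0 - hill_V a b R S (sol0 a b R S n w) 0) \<le> e * cmod (z - w) \<and>
        cmod (hill_V a b R S (sol0 a b R S n z) (int n) - hill_V a b R S (sol0 a b R S n w) (int n)) \<le> e * cmod K * cmod (z - w)) \<and>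
     (\<forall>k. red_sol a b R S n z (sol0 a b R S n z) k \<longrightarrow> k 0 = 0 \<longrightarrow> k (int n) = 0 \<longrightarrow>
        cmod (hill_V a b R S k 0) \<le> e \<and> cmod (hill_V a b R S k (int n)) \<le> e * cmod K))"

text \<open>The Lipschitz bounds come from the difference formula: the solution \<open>k\<close> has
  the recurrence of \<open>z\<close> but a source belonging to \<open>w\<close>, and the chain
  estimates for \<open>k\<close> are uniform in both parameters.\<close>

lemma eventually_entry_bounds:
  assumes b: "b \<noteq> 0" and RS: "R > 0" "S > 0" and Z0: "Z \<ge> 0" and e: "e > 0"
  shows "\<forall>\<^sub>F M in sequentially. entry_bounds a b R S (S * M) Z e (hill_K b S M)"
proof -
  have ev: "\<forall>\<^sub>F M in sequentially. real M \<ge> 2 + Z + 2 * (cmod a + cmod b)"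
    using filterlim_real_sequentially by (auto simp: filterlim_at_top)
  show ?thesis using ev left_solution_bounds[OF b RS Z0 e, of a]
  proof eventually_elim
    case (elim M)
    define n where "n = S * M"
    define K where "K = hill_K b S M"
    have "real M * 1 \<le> real M * real S" using RS by (intro mult_left_mono) auto
    hence nM: "real n \<ge> real M" by (simp add: n_def mult.commute)
    have "real n \<ge> 2" using nM elim(1) Z0 norm_ge_zero[of a] norm_ge_zero[of b] by (smt (verit))
    hence n2: "n \<ge> 2" by simp
    have n3: "2 * (cmod a + cmod b) \<le> real n" using nM elim(1) Z0 by (smt (verit))
    have n4: "Z \<le> real n" using nM elim(1) norm_ge_zero[of a] norm_ge_zero[of b] by (smt (verit))
    note n = n2 n3 n4
    note L = elim(2)[rule_format, folded n_def, folded K_def]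
    show ?case unfolding entry_bounds_def n_def[symmetric] K_def[symmetric]
    proof (intro allI impI conjI)
      fix z assume z: "cmod z \<le> Z"
      have zn: "cmod z \<le> real n" using z n by simp
      note s = sol0[OF n(1,2) zn, where R = R and S = S]
      show "cmod (hill_V a b R S (sol0 a b R S n z) 0) \<le> e"
        "cmod (hill_V a b R S (sol0 a b R S n z) (int n) - K) \<le> e * cmod K" using L[OF z s] by auto
      show "cmod (hill_V a b R S k 0) \<le> e" "cmod (hill_V a b R S k (int n)) \<le> e * cmod K"
        if "red_sol a b R S n z (sol0 a b R S n z) k" "k 0 = 0" "k (int n) = 0" for k
        using L[OF z s] z that by auto
      fix w assume w: "cmod w \<le> Z"
      have wn: "cmod w \<le> real n" using w n by simp
      note sw = sol0[OF n(1,2) wn, where R = R and S = S]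
      obtain k where k: "red_sol a b R S n z (sol0 a b R S n w) k" "k 0 = 0" "k (int n) = 0"
        using red_sol_exists[OF n(1) zn n(2) bounded_red_sol[OF sw(1)]] by blast
      have kb: "cmod (hill_V a b R S k 0) \<le> e" "cmod (hill_V a b R S k (int n)) \<le> e * cmod K"
        using L[OF w sw] z k by auto
      have V: "hill_V a b R S (sol0 a b R S n z) j - hill_V a b R S (sol0 a b R S n w) j = - (z - w) * hill_V a b R S k j" for j
      proof -
        have "sol0 a b R S n z j = sol0 a b R S n w j + - (z - w) * k j" for j
          using sol0_diff[OF n(1,2) zn wn k, of j] by (simp add: algebra_simps)
        hence "sol0 a b R S n z = (\<lambda>j. 1 * sol0 a b R S n w j + - (z - w) * k j)" by auto
        hence "hill_V a b R S (sol0 a b R S n z) j =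
            1 * hill_V a b R S (sol0 a b R S n w) j + - (z - w) * hill_V a b R S k j"
          by (simp only: hill_V_linear)
        thus ?thesis by simp
      qed
      show "cmod (hill_V a b R S (sol0 a b R S n z) 0 - hill_V a b R S (sol0 a b R S n w) 0) \<le> e * cmod (z - w)"
        unfolding V norm_mult norm_minus_cancel using kb(1) by (subst mult.commute) (intro mult_right_mono, auto)
      show "cmod (hill_V a b R S (sol0 a b R S n z) (int n) - hill_V a b R S (sol0 a b R S n w) (int n)) \<le> e * cmod K * cmod (z - w)"
        unfolding V norm_mult norm_minus_cancel using kb(2) by (subst mult.commute) (intro mult_right_mono, auto)
    qed
  qed
qed

text \<open>The two branches of the square root of the product of the off-diagonal entries turn the
  characteristic equation into two contractions.\<close>

lemma perturbed_quadratic_roots: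
  fixes \<alpha> p q :: "complex \<Rightarrow> complex" and P Q \<kappa> :: complex and e Z :: real
  assumes e: "0 < e" "e \<le> 1 / 100" and Z: "Z \<ge> 1" and PQ: "P \<noteq> 0" "Q \<noteq> 0"
    and \<kappa>: "\<kappa>\<^sup>2 = P * Q" "cmod \<kappa> \<le> 1 / 2"
    and \<alpha>: "\<And>z. cmod z \<le> Z \<Longrightarrow> cmod (\<alpha> z) \<le> e"
      "\<And>z w. cmod z \<le> Z \<Longrightarrow> cmod w \<le> Z \<Longrightarrow> cmod (\<alpha> z - \<alpha> w) \<le> e * cmod (z - w)"
    and p: "\<And>z. cmod z \<le> Z \<Longrightarrow> cmod (p z - P) \<le> e * cmod P"
      "\<And>z w. cmod z \<le> Z \<Longrightarrow> cmod w \<le> Z \<Longrightarrow> cmod (p z - p w) \<le> e * cmod P * cmod (z - w)"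
    and q: "\<And>z. cmod z \<le> Z \<Longrightarrow> cmod (q z - Q) \<le> e * cmod Q"
      "\<And>z w. cmod z \<le> Z \<Longrightarrow> cmod w \<le> Z \<Longrightarrow> cmod (q z - q w) \<le> e * cmod Q * cmod (z - w)"
  shows "\<exists>z1 z2. cmod z1 \<le> Z \<and> cmod z2 \<le> Z \<and> z1 \<noteq> z2 \<and>
     (\<forall>z. cmod z \<le> Z \<longrightarrow> (\<alpha> z - z)\<^sup>2 = p z * q z \<longleftrightarrow> z = z1 \<or> z = z2) \<and>
     cmod (z1 - z2 - 2 * \<kappa>) \<le> 9 * e * cmod \<kappa>"
proof -
  define D where "D = cball (0::complex) Z"
  have D: "z \<in> D \<longleftrightarrow> cmod z \<le> Z" for z by (simp add: D_def)
  have rel: "cmod (f z / F - 1) \<le> e \<and> (\<forall>w\<in>D. cmod (f z / F - f w / F) \<le> e * cmod (z - w))"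
    if F: "F \<noteq> 0" and f: "\<And>z. cmod z \<le> Z \<Longrightarrow> cmod (f z - F) \<le> e * cmod F"
      "\<And>z w. cmod z \<le> Z \<Longrightarrow> cmod w \<le> Z \<Longrightarrow> cmod (f z - f w) \<le> e * cmod F * cmod (z - w)"
      and z: "z \<in> D" for f F z
  proof (intro conjI ballI)
    have "f z / F - 1 = (f z - F) / F" using F by (simp add: field_simps)
    thus "cmod (f z / F - 1) \<le> e" using f(1)[of z] z F by (simp add: D norm_divide divide_le_eq)
    fix w assume w: "w \<in> D"
    have "f z / F - f w / F = (f z - f w) / F" by (simp add: diff_divide_distrib)
    thus "cmod (f z / F - f w / F) \<le> e * cmod (z - w)"
      using f(2)[of z w] z w F by (simp add: D norm_divide divide_le_eq mult_ac)
  qed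
  \<comment> \<open>Division by the leading terms makes the errors relative: \<open>p'\<close> and
    \<open>q'\<close> are close to \<open>1\<close> with Lipschitz constant \<open>e\<close>,
    however small \<open>P\<close> and \<open>Q\<close> are.\<close>
  define p' q' where "p' z = p z / P" and "q' z = q z / Q" for z
  have p': "cmod (p' z - 1) \<le> e" "w \<in> D \<Longrightarrow> cmod (p' z - p' w) \<le> e * cmod (z - w)"
    and q': "cmod (q' z - 1) \<le> e" "w \<in> D \<Longrightarrow> cmod (q' z - q' w) \<le> e * cmod (z - w)" if "z \<in> D" for z w
    using rel[OF PQ(1) p that] rel[OF PQ(2) q that] by (auto simp: p'_def q'_def)
  have pq1: "cmod (p' z) \<le> 1 + e" "cmod (q' z) \<le> 1 + e" if "z \<in> D" for z
    using p'(1)[OF that] q'(1)[OF that] norm_triangle_ineq[of "p' z - 1" 1] norm_triangle_ineq[of "q' z - 1" 1] by auto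
  define g where "g z = p' z * q' z" for z
  have e1: "1 + e \<le> 3/2" using e by simp
  have g1: "cmod (g z - 1) \<le> 3 * e" if z: "z \<in> D" for z
  proof -
    have "g z - 1 = (p' z - 1) * q' z + (q' z - 1)" by (simp add: g_def algebra_simps)
    also have "cmod \<dots> \<le> e * (3/2) + e"
    proof (intro order_trans[OF norm_triangle_ineq] add_mono)
      have "cmod (q' z) \<le> 3/2" using pq1(2)[OF z] e1 by linarith
      thus "cmod ((p' z - 1) * q' z) \<le> e * (3/2)"
        unfolding norm_mult using p'(1)[OF z] e by (intro mult_mono) auto
    qed (rule q'(1)[OF z])
    finally show ?thesis using e by simp
  qed
  have g2: "cmod (g z - g w) \<le> 3 * e * cmod (z - w)" if z: "z \<in> D" "w \<in> D" for z w
  proof -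
    have "g z - g w = (p' z - p' w) * q' z + p' w * (q' z - q' w)" by (simp add: g_def algebra_simps)
    also have "cmod \<dots> \<le> cmod (p' z - p' w) * cmod (q' z) + cmod (p' w) * cmod (q' z - q' w)"
      by (rule order_trans[OF norm_triangle_ineq]) (simp add: norm_mult)
    also have "\<dots> \<le> (e * cmod (z - w)) * (3/2) + (3/2) * (e * cmod (z - w))"
    proof (intro add_mono mult_mono)
      show "cmod (q' z) \<le> 3/2" "cmod (p' w) \<le> 3/2" using pq1(2)[OF z(1)] pq1(1)[OF z(2)] e1 by linarith+
    qed (use p'(2)[OF z] q'(2)[OF z] e in auto)
    finally show ?thesis by simp
  qed
  \<comment> \<open>Since \<open>g\<close> stays near \<open>1\<close>, the principal branch stays
    near \<open>1\<close> too, and its Lipschitz bound follows from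
    \<open>(s z - s w) (s z + s w) = g z - g w\<close>. The square root of \<open>P * Q\<close>
    enters separately as the constant \<open>\<kappa>\<close>.\<close>
  define s where "s z = csqrt (g z)" for z
  have s2: "s z * s z = g z" for z unfolding s_def by (simp flip: power2_eq_square)
  have s1: "cmod (s z - 1) \<le> 3 * e" if z: "z \<in> D" for z
  proof -
    have "Re (s z) \<ge> 0" using csqrt_principal[of "g z"] by (auto simp: s_def)
    hence "cmod (s z + 1) \<ge> 1" using complex_Re_le_cmod[of "s z + 1"] by simp
    hence "cmod (s z - 1) * 1 \<le> cmod (s z - 1) * cmod (s z + 1)" by (intro mult_left_mono) auto
    also have "\<dots> = cmod (g z - 1)" by (simp flip: norm_mult) (simp add: algebra_simps s2)
    finally show ?thesis using g1[OF z] by simp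
  qed
  have s_le: "cmod (s z) \<le> 2" if z: "z \<in> D" for z
    using s1[OF z] norm_triangle_ineq[of "s z - 1" 1] e by simp
  have sL: "cmod (s z - s w) \<le> 3 * e * cmod (z - w)" if z: "z \<in> D" "w \<in> D" for z w
  proof -
    have "Re (s z) \<ge> 1/2" "Re (s w) \<ge> 1/2"
      using s1[OF z(1)] s1[OF z(2)] e abs_Re_le_cmod[of "s z - 1"] abs_Re_le_cmod[of "s w - 1"] by auto
    hence "cmod (s z + s w) \<ge> 1" using complex_Re_le_cmod[of "s z + s w"] by simp
    hence "cmod (s z - s w) * 1 \<le> cmod (s z - s w) * cmod (s z + s w)" by (intro mult_left_mono) auto
    also have "\<dots> = cmod (g z - g w)" by (simp flip: norm_mult) (simp add: algebra_simps s2)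
    finally show ?thesis using g2[OF z] by simp
  qed
  \<comment> \<open>The values \<open>\<sigma> = 1\<close> and \<open>\<sigma> = -1\<close> give the
    two branches of the characteristic equation.\<close>
  have ex: "\<exists>!z\<in>D. \<alpha> z + \<sigma> * (\<kappa> * s z) = z" if \<sigma>: "cmod \<sigma> = 1" for \<sigma>
  proof (rule Banach_fix[of _ "1/2"])
    show "complete D" by (simp add: D_def complete_eq_closed)
    show "D \<noteq> {}" using Z by (auto simp: D_def)
    show "(\<lambda>z. \<alpha> z + \<sigma> * (\<kappa> * s z)) ` D \<subseteq> D"
    proof safe
      fix z assume z: "z \<in> D"
      have "cmod (s z) \<le> 1 + 3 * e" using s1[OF z] norm_triangle_ineq[of "s z - 1" 1] by simp
      hence "cmod (\<sigma> * (\<kappa> * s z)) \<le> 1/2 * (1 + 3 * e)"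
        unfolding norm_mult \<sigma> mult_1 using \<kappa>(2) by (intro mult_mono) auto
      moreover have "cmod (\<alpha> z) \<le> e" using \<alpha>(1) z D by auto
      ultimately have "cmod (\<alpha> z + \<sigma> * (\<kappa> * s z)) \<le> e + 1/2 * (1 + 3 * e)"
        by (intro order_trans[OF norm_triangle_ineq] add_mono)
      also have "\<dots> \<le> Z" using e Z by argo
      finally show "\<alpha> z + \<sigma> * (\<kappa> * s z) \<in> D" by (simp add: D)
    qed
    fix z w assume zw: "z \<in> D" "w \<in> D"
    have "(\<alpha> z + \<sigma> * (\<kappa> * s z)) - (\<alpha> w + \<sigma> * (\<kappa> * s w)) = (\<alpha> z - \<alpha> w) + \<sigma> * (\<kappa> * (s z - s w))"
      by (simp add: algebra_simps)
    also have "cmod \<dots> \<le> cmod (\<alpha> z - \<alpha> w) + cmod \<kappa> * cmod (s z - s w)"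
      using \<sigma> by (intro order_trans[OF norm_triangle_ineq]) (simp add: norm_mult)
    also have "\<dots> \<le> e * cmod (z - w) + 1/2 * (3 * e * cmod (z - w))"
      using \<alpha>(2) zw D \<kappa>(2) sL[OF zw] by (intro add_mono mult_mono) auto
    also have "\<dots> = (5/2 * e) * cmod (z - w)" by simp
    also have "\<dots> \<le> 1/2 * cmod (z - w)" using e by (intro mult_right_mono) auto
    finally show "dist (\<alpha> z + \<sigma> * (\<kappa> * s z)) (\<alpha> w + \<sigma> * (\<kappa> * s w)) \<le> 1/2 * dist z w"
      by (simp add: dist_norm)
  qed auto
  note E1 = ex[OF norm_one]
  define z1 where "z1 = (THE z. z \<in> D \<and> \<alpha> z + 1 * (\<kappa> * s z) = z)"
  have z1: "z1 \<in> D" "\<alpha> z1 + 1 * (\<kappa> * s z1) = z1"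
    unfolding z1_def by (rule conjunct1[OF theI'[OF E1]], rule conjunct2[OF theI'[OF E1]])
  have u1: "z = z1" if "z \<in> D" "\<alpha> z + 1 * (\<kappa> * s z) = z" for z
    unfolding z1_def by (rule the1_equality[OF E1, symmetric]) (intro conjI that)
  have norm_m1: "cmod (-1) = 1" by simp
  note E2 = ex[OF norm_m1]
  define z2 where "z2 = (THE z. z \<in> D \<and> \<alpha> z + (-1) * (\<kappa> * s z) = z)"
  have z2: "z2 \<in> D" "\<alpha> z2 + (-1) * (\<kappa> * s z2) = z2"
    unfolding z2_def by (rule conjunct1[OF theI'[OF E2]], rule conjunct2[OF theI'[OF E2]])
  have u2: "z = z2" if "z \<in> D" "\<alpha> z + (-1) * (\<kappa> * s z) = z" for z
    unfolding z2_def by (rule the1_equality[OF E2, symmetric]) (intro conjI that)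
  have sq: "(\<kappa> * s z)\<^sup>2 = p z * q z" for z
  proof -
    have "(\<kappa> * s z)\<^sup>2 = \<kappa>\<^sup>2 * (s z * s z)" by (simp add: power2_eq_square mult_ac)
    also have "\<dots> = p z * q z" unfolding s2 g_def p'_def q'_def \<kappa>(1) using PQ by simp
    finally show ?thesis .
  qed
  have iff: "(\<alpha> z - z)\<^sup>2 = p z * q z \<longleftrightarrow> z = z1 \<or> z = z2" if z: "z \<in> D" for z
  proof -
    have "(\<alpha> z - z)\<^sup>2 = p z * q z \<longleftrightarrow> \<alpha> z - z = \<kappa> * s z \<or> \<alpha> z - z = - (\<kappa> * s z)"
      unfolding sq[symmetric] by (rule power2_eq_iff)
    also have "\<dots> \<longleftrightarrow> \<alpha> z + (-1) * (\<kappa> * s z) = z \<or> \<alpha> z + 1 * (\<kappa> * s z) = z"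
      by (auto simp: algebra_simps)
    also have "\<dots> \<longleftrightarrow> z = z1 \<or> z = z2"
    proof
      assume "z = z1 \<or> z = z2"
      thus "\<alpha> z + (-1) * (\<kappa> * s z) = z \<or> \<alpha> z + 1 * (\<kappa> * s z) = z"
        by (elim disjE) (simp only: z1(2) z2(2) simp_thms)+
    qed (use u1[OF z] u2[OF z] in argo)
    finally show ?thesis .
  qed
  have k0: "cmod \<kappa> > 0" using \<kappa>(1) PQ by auto
  define d where "d = cmod (z1 - z2)"
  \<comment> \<open>The difference of the \<open>\<alpha>\<close> terms costs \<open>e d\<close>
    with \<open>d \<le> 3 |\<kappa>|\<close>, the two deviations of \<open>s\<close> from
    \<open>1\<close> cost \<open>6 e |\<kappa>|\<close>; together this is the factor 9.\<close>
  have "z1 - z2 - 2 * \<kappa> = (\<alpha> z1 - \<alpha> z2) + \<kappa> * ((s z1 - 1) + (s z2 - 1))"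
    using z1(2) z2(2) by (simp add: algebra_simps)
  also have "cmod \<dots> \<le> cmod (\<alpha> z1 - \<alpha> z2) + cmod \<kappa> * (cmod (s z1 - 1) + cmod (s z2 - 1))"
    unfolding norm_mult[of \<kappa>, symmetric]
    by (intro order_trans[OF norm_triangle_ineq] add_mono order_refl order_trans[OF eq_refl[OF norm_mult] mult_left_mono] norm_triangle_ineq norm_ge_zero)
  also have "\<dots> \<le> e * d + cmod \<kappa> * (3 * e + 3 * e)"
    using \<alpha>(2)[of z1 z2] z1(1) z2(1) s1 by (intro add_mono mult_left_mono) (auto simp: D d_def)
  finally have A: "cmod (z1 - z2 - 2 * \<kappa>) \<le> e * d + 6 * e * cmod \<kappa>" by (simp add: mult_ac)
  have "d \<le> cmod (z1 - z2 - 2 * \<kappa>) + 2 * cmod \<kappa>"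
    unfolding d_def using norm_triangle_ineq[of "z1 - z2 - 2 * \<kappa>" "2 * \<kappa>"] by (simp add: norm_mult)
  hence "d \<le> e * d + (6 * e + 2) * cmod \<kappa>" using A by (simp add: algebra_simps)
  moreover have "e * d \<le> 1/100 * d" using e by (intro mult_right_mono) (auto simp: d_def)
  moreover have "(6 * e + 2) * cmod \<kappa> \<le> (6 * (1/100) + 2) * cmod \<kappa>" using e by (intro mult_right_mono) auto
  ultimately have "d \<le> 3 * cmod \<kappa>" using k0 by argo
  hence "e * d \<le> e * (3 * cmod \<kappa>)" using e by (intro mult_left_mono) auto
  hence B: "cmod (z1 - z2 - 2 * \<kappa>) \<le> 9 * e * cmod \<kappa>" using A by simp
  have "z1 \<noteq> z2"
  proof
    assume "z1 = z2"
    hence "2 * cmod \<kappa> \<le> 9 * e * cmod \<kappa>" using B by (simp add: norm_mult)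
    also have "\<dots> \<le> 9/100 * cmod \<kappa>" using e by (intro mult_right_mono) auto
    finally show False using k0 by argo
  qed
  thus ?thesis using iff B z1(1) z2(1) unfolding D by blast
qed

section \<open>Multiplicities of (anti)periodic eigenvalues\<close>

lemma Green_hill_op:
  assumes y: "y \<in> C2_0pi" and g: "g \<in> C2_0pi"
  shows "((\<lambda>x. (hill_op v y x - l * y x) * g x - y x * (hill_op v g x - l * g x)) has_integral
     (deriv_0pi y 0 * g 0 - y 0 * deriv_0pi g 0) - (deriv_0pi y pi * g pi - y pi * deriv_0pi g pi)) {0..pi}"
proof -
  note Y = C2_0piD[OF y] and G = C2_0piD[OF g]
  have I: "((\<lambda>x. deriv_0pi (deriv_0pi y) x * g x - y x * deriv_0pi (deriv_0pi g) x) has_integral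
     (deriv_0pi y pi * g pi - y pi * deriv_0pi g pi) - (deriv_0pi y 0 * g 0 - y 0 * deriv_0pi g 0)) {0..pi}"
    by (rule Green_identity) (rule Y G; assumption)+
  have e: "(hill_op v y x - l * y x) * g x - y x * (hill_op v g x - l * g x) =
     - (deriv_0pi (deriv_0pi y) x * g x - y x * deriv_0pi (deriv_0pi g) x)" for x
    by (simp add: hill_op_def algebra_simps)
  show ?thesis unfolding e using has_integral_neg[OF I] by (simp only: minus_diff_eq)
qed

lemma hill_domD:
  "y \<in> hill_dom (parity_bdry n) \<Longrightarrow> y \<in> C2_0pi"
  "y \<in> hill_dom (parity_bdry n) \<Longrightarrow> y pi = (-1) ^ n * y 0"
  "y \<in> hill_dom (parity_bdry n) \<Longrightarrow> deriv_0pi y pi = (-1) ^ n * deriv_0pi y 0"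
  by (auto simp: hill_dom_def parity_bdry_iff)

lemma sign_sq: "(-1) ^ n * w * ((-1) ^ n * w') = w * (w' :: complex)"
  by (cases "even n") auto

lemma integral_hmode_fc:
  assumes "continuous_on {0..pi} y"
  shows "((\<lambda>x. hmode n j x * y x) has_integral of_real pi * fc n y (int n - j)) {0..pi}"
  using fc_integrable[OF assms, of n j] by (simp add: fc_def has_integral_integral mult.commute)

text \<open>Green's identity makes the reduced matrix symmetric under the reflection of the indices.\<close>

lemma diagonal_entries_eq:
  assumes n: "n \<ge> 2" "2 * (cmod a + cmod b) \<le> real n" and z: "cmod z \<le> real n"
  shows "hill_V a b R S (soln a b R S n z) (int n) = hill_V a b R S (sol0 a b R S n z) 0"
proof -
  let ?u = "sol0 a b R S n z" and ?w = "soln a b R S n z"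
  note u = sol0[OF n z, where R = R and S = S] and w = soln[OF n z, where R = R and S = S]
  define y where "y = (\<lambda>x. if x \<in> {0..pi} then hsum n ?u x else 0)"
  define g where "g = (\<lambda>x. if x \<in> {0..pi} then hsum n ?w x else 0)"
  have n0: "n > 0" using n by simp
  have ueq: "\<forall>j. j \<noteq> 0 \<longrightarrow> j \<noteq> int n \<longrightarrow> (of_int (gap n j) + z) * ?u j = hill_V a b R S ?u j"
    "\<forall>j. j \<noteq> 0 \<longrightarrow> j \<noteq> int n \<longrightarrow> (of_int (gap n j) + z) * ?w j = hill_V a b R S ?w j"
    using u(1) w(1) by (simp_all add: red_sol_def)
  have Y: "y \<in> hill_dom (parity_bdry n)"
    "\<And>x. x \<in> {0..pi} \<Longrightarrow> hill_op (two_term_potential a b R S) y x - ((of_nat n)\<^sup>2 + z) * y x =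
      (hill_V a b R S ?u 0 - z * ?u 0) * hmode n 0 x + (hill_V a b R S ?u (int n) - z * ?u (int n)) * hmode n (int n) x"
    "\<And>j. fc n y j = ?u j"
    unfolding y_def
    by (rule hsum_solution(1)[OF red_sol_rapid[OF u(1) n(1) z] ueq(1) n0], erule hsum_solution(2)[OF red_sol_rapid[OF u(1) n(1) z] ueq(1) n0],
        rule hsum_solution(3)[OF red_sol_rapid[OF u(1) n(1) z] ueq(1) n0])
  have G: "g \<in> hill_dom (parity_bdry n)"
    "\<And>x. x \<in> {0..pi} \<Longrightarrow> hill_op (two_term_potential a b R S) g x - ((of_nat n)\<^sup>2 + z) * g x =
      (hill_V a b R S ?w 0 - z * ?w 0) * hmode n 0 x + (hill_V a b R S ?w (int n) - z * ?w (int n)) * hmode n (int n) x"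
    "\<And>j. fc n g j = ?w j"
    unfolding g_def
    by (rule hsum_solution(1)[OF red_sol_rapid[OF w(1) n(1) z] ueq(2) n0], erule hsum_solution(2)[OF red_sol_rapid[OF w(1) n(1) z] ueq(2) n0],
        rule hsum_solution(3)[OF red_sol_rapid[OF w(1) n(1) z] ueq(2) n0])
  note Yc = C2_0piD(3)[OF hill_domD(1)[OF Y(1)]] and Gc = C2_0piD(3)[OF hill_domD(1)[OF G(1)]]
  let ?A = "hill_V a b R S ?u 0 - z" and ?P = "hill_V a b R S ?u (int n)"
  let ?Q = "hill_V a b R S ?w 0" and ?A' = "hill_V a b R S ?w (int n) - z"
  have "((\<lambda>x. (hill_op (two_term_potential a b R S) y x - ((of_nat n)\<^sup>2 + z) * y x) * g x - y x * (hill_op (two_term_potential a b R S) g x - ((of_nat n)\<^sup>2 + z) * g x)) has_integral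
     (deriv_0pi y 0 * g 0 - y 0 * deriv_0pi g 0) - (deriv_0pi y pi * g pi - y pi * deriv_0pi g pi)) {0..pi}"
    by (rule Green_hill_op[OF hill_domD(1)[OF Y(1)] hill_domD(1)[OF G(1)]])
  \<comment> \<open>Both functions carry the same sign \<open>(-1)^n\<close> at \<open>pi\<close>,
    and its square is \<open>1\<close>, so the boundary terms at the two ends agree.\<close>
  moreover have "(deriv_0pi y 0 * g 0 - y 0 * deriv_0pi g 0) - (deriv_0pi y pi * g pi - y pi * deriv_0pi g pi) = 0"
    unfolding hill_domD(2,3)[OF Y(1)] hill_domD(2,3)[OF G(1)] sign_sq by simp
  ultimately have I1: "((\<lambda>x. (hill_op (two_term_potential a b R S) y x - ((of_nat n)\<^sup>2 + z) * y x) * g x - y x * (hill_op (two_term_potential a b R S) g x - ((of_nat n)\<^sup>2 + z) * g x)) has_integral 0) {0..pi}"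
    by simp
  have I2: "((\<lambda>x. ?A * (hmode n 0 x * g x) + ?P * (hmode n (int n) x * g x) - (?Q * (hmode n 0 x * y x) + ?A' * (hmode n (int n) x * y x))) has_integral 0) {0..pi}"
  proof (rule has_integral_eq[OF _ I1])
    fix x assume x: "x \<in> {0..pi}"
    show "(hill_op (two_term_potential a b R S) y x - ((of_nat n)\<^sup>2 + z) * y x) * g x - y x * (hill_op (two_term_potential a b R S) g x - ((of_nat n)\<^sup>2 + z) * g x) =
      ?A * (hmode n 0 x * g x) + ?P * (hmode n (int n) x * g x) - (?Q * (hmode n 0 x * y x) + ?A' * (hmode n (int n) x * y x))"
      unfolding Y(2)[OF x] G(2)[OF x] u(2,3) w(2,3) by (simp add: algebra_simps)
  qed
  \<comment> \<open>Pairing with the mode \<open>j\<close> picks out the coefficient at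
    \<open>n - j\<close>. The resonant coefficients are \<open>0\<close> or \<open>1\<close>, and
    only the two diagonal entries survive.\<close>
  have "((\<lambda>x. ?A * (hmode n 0 x * g x) + ?P * (hmode n (int n) x * g x) - (?Q * (hmode n 0 x * y x) + ?A' * (hmode n (int n) x * y x))) has_integral
    ?A * (of_real pi * fc n g (int n - 0)) + ?P * (of_real pi * fc n g (int n - int n)) -
    (?Q * (of_real pi * fc n y (int n - 0)) + ?A' * (of_real pi * fc n y (int n - int n)))) {0..pi}"
    by (intro has_integral_diff has_integral_add has_integral_mult_right integral_hmode_fc Yc Gc)
  from has_integral_unique[OF this I2] show ?thesis unfolding Y(3) G(3) using u w by simp
qed

lemma fc_resolvent:
  assumes y: "y \<in> hill_dom (parity_bdry n)"
    and f: "\<And>x. x \<in> {0..pi} \<Longrightarrow> hill_op (two_term_potential a b R S) y x - ((of_nat n)\<^sup>2 + z) * y x = f x"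
  shows "(of_int (gap n j) + z) * fc n y j = hill_V a b R S (fc n y) j - fc n f j"
proof -
  have "fc n f j = fc n (\<lambda>x. hill_op (two_term_potential a b R S) y x - ((of_nat n)\<^sup>2 + z) * y x) j"
    unfolding fc_def by (rule arg_cong[where f = "\<lambda>i. i / of_real pi"], rule integral_cong) (simp add: f)
  thus ?thesis using fc_hill_op[OF y, of a b R S z j] by (simp add: algebra_simps)
qed

lemma zero_if_fc_zero:
  assumes y: "y \<in> hill_dom (parity_bdry n)" and "\<And>j. fc n y j = 0"
  shows "y = (\<lambda>_. 0)"
proof
  fix x show "y x = 0"
    using fc_complete[OF C2_0piD(3)[OF hill_domD(1)[OF y]] hill_domD(2)[OF y] assms(2), of x]
      C2_0piD(6)[OF hill_domD(1)[OF y], of x] by (cases "x \<in> {0..pi}") auto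
qed

lemma fc_zero: "fc n (\<lambda>_. 0) j = 0" by (simp add: fc_def)

lemma hill_ker_1:
  "y \<in> hill_ker bc v l (Suc 0) \<longleftrightarrow> y \<in> hill_dom bc \<and> (\<forall>x. hill_op v y x - l * y x = 0)"
  by (auto simp: fun_eq_iff)

lemma hill_dom_outside:
  assumes "y \<in> hill_dom bc" "x \<notin> {0..pi}"
  shows "hill_op v y x - l * y x = 0"
proof -
  have "y x = 0" using assms C2_0piD(6)[of y x] by (auto simp: hill_dom_def)
  thus ?thesis using assms(2) by (auto simp: hill_op_def deriv_0pi_def)
qed

context
  fixes a b :: complex and R S n :: nat and z :: complex
  assumes n: "n \<ge> 2" "2 * (cmod a + cmod b) \<le> real n" and z: "cmod z \<le> real n"
begin

private definition "u0 = sol0 a b R S n z"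
private definition "un = soln a b R S n z"
private definition "A = hill_V a b R S u0 0"
private definition "P = hill_V a b R S u0 (int n)"
private definition "Q = hill_V a b R S un 0"

private lemma A': "hill_V a b R S un (int n) = A"
  unfolding A_def u0_def un_def by (rule diagonal_entries_eq[OF n z])

private lemmas u0 = sol0[OF n z, where R = R and S = S, folded u0_def]
private lemmas un = soln[OF n z, where R = R and S = S, folded un_def]

private lemma V_decomp:
  assumes "red_sol a b R S n z (\<lambda>_. 0) c"
  shows "hill_V a b R S c 0 = c 0 * A + c (int n) * Q" "hill_V a b R S c (int n) = c 0 * P + c (int n) * A"
proof -
  have "c = (\<lambda>j. c 0 * u0 j + c (int n) * un j)"
    unfolding u0_def un_def by (rule ext, rule red_sol_decomp[OF n assms z])
  from arg_cong[OF this, of "\<lambda>w. hill_V a b R S w _"]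
  have "hill_V a b R S c j = c 0 * hill_V a b R S u0 j + c (int n) * hill_V a b R S un j" for j
    unfolding hill_V_linear .
  thus "hill_V a b R S c 0 = c 0 * A + c (int n) * Q" "hill_V a b R S c (int n) = c 0 * P + c (int n) * A"
    using A' by (simp_all add: A_def P_def Q_def)
qed

text \<open>The nonresonant Fourier coefficients of a kernel function are determined by the two
  resonant ones, which form a null vector of the matrix with diagonal \<open>A - z\<close> and
  off-diagonal entries \<open>Q\<close> and \<open>P\<close>.\<close>

private lemma kernel_coeffs:
  assumes y: "y \<in> hill_dom (parity_bdry n)" "\<And>x. hill_op (two_term_potential a b R S) y x - ((of_nat n)\<^sup>2 + z) * y x = 0"
  shows "red_sol a b R S n z (\<lambda>_. 0) (fc n y)"
    "(A - z) * fc n y 0 + Q * fc n y (int n) = 0"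
    "P * fc n y 0 + (A - z) * fc n y (int n) = 0"
    "fc n y 0 = 0 \<Longrightarrow> fc n y (int n) = 0 \<Longrightarrow> y = (\<lambda>_. 0)"
proof -
  have eq: "(of_int (gap n j) + z) * fc n y j = hill_V a b R S (fc n y) j" for j
    using fc_resolvent[OF y(1), of a b R S z "\<lambda>_. 0" j] y(2) by (simp add: fc_zero)
  show rs: "red_sol a b R S n z (\<lambda>_. 0) (fc n y)"
    using bounded_fc[OF C2_0piD(3)[OF hill_domD(1)[OF y(1)]]] eq by (simp add: red_sol_def)
  show "(A - z) * fc n y 0 + Q * fc n y (int n) = 0" "P * fc n y 0 + (A - z) * fc n y (int n) = 0"
    using eq[of 0] eq[of "int n"] V_decomp[OF rs] by (simp_all add: gap_def algebra_simps)
  assume "fc n y 0 = 0" "fc n y (int n) = 0"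
  hence "fc n y j = 0" for j using red_sol_zero[OF rs _ _ n(1) z n(2)] by simp
  thus "y = (\<lambda>_. 0)" by (rule zero_if_fc_zero[OF y(1)])
qed

text \<open>The vector \<open>(Q, - (A - z))\<close> is annihilated by the first row identically and
  by the second row because the determinant vanishes.\<close>

private lemma kernel_exists:
  assumes PQ: "P \<noteq> 0" "Q \<noteq> 0" and det: "(A - z)\<^sup>2 = P * Q"
  shows "\<exists>y. y \<in> hill_ker (parity_bdry n) (two_term_potential a b R S) ((of_nat n)\<^sup>2 + z) (Suc 0) \<and> fc n y 0 = Q \<and> fc n y (int n) = - (A - z)"
proof -
  define c where "c j = Q * u0 j + (- (A - z)) * un j" for j
  have rs: "red_sol a b R S n z (\<lambda>_. 0) c"
    using red_sol_add[OF u0(1) un(1), of Q "- (A - z)"] by (simp add: c_def[abs_def])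
  have c: "c 0 = Q" "c (int n) = - (A - z)" by (simp_all add: c_def u0 un)
  define y where "y = (\<lambda>x. if x \<in> {0..pi} then hsum n c x else 0)"
  have ceq: "\<forall>j. j \<noteq> 0 \<longrightarrow> j \<noteq> int n \<longrightarrow> (of_int (gap n j) + z) * c j = hill_V a b R S c j"
    using rs by (simp add: red_sol_def)
  have n0: "n > 0" using n by simp
  have Y: "y \<in> hill_dom (parity_bdry n)"
    "\<And>x. x \<in> {0..pi} \<Longrightarrow> hill_op (two_term_potential a b R S) y x - ((of_nat n)\<^sup>2 + z) * y x =
      (hill_V a b R S c 0 - z * c 0) * hmode n 0 x + (hill_V a b R S c (int n) - z * c (int n)) * hmode n (int n) x"
    "\<And>j. fc n y j = c j"
    unfolding y_def
    by (rule hsum_solution(1)[OF red_sol_rapid[OF rs n(1) z] ceq n0], erule hsum_solution(2)[OF red_sol_rapid[OF rs n(1) z] ceq n0],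
        rule hsum_solution(3)[OF red_sol_rapid[OF rs n(1) z] ceq n0])
  have "hill_V a b R S c 0 - z * c 0 = 0" "hill_V a b R S c (int n) - z * c (int n) = 0"
    using det unfolding V_decomp[OF rs] c by (simp_all add: power2_eq_square algebra_simps)
  hence "hill_op (two_term_potential a b R S) y x - ((of_nat n)\<^sup>2 + z) * y x = 0" for x
    using Y(2)[of x] hill_dom_outside[OF Y(1), of x] by (cases "x \<in> {0..pi}") auto
  hence yk: "y \<in> hill_ker (parity_bdry n) (two_term_potential a b R S) ((of_nat n)\<^sup>2 + z) (Suc 0)"
    unfolding hill_ker_1 using Y(1) by simp
  have y0: "fc n y 0 = Q" by (rule trans[OF Y(3) c(1)])
  have yn: "fc n y (int n) = - (A - z)" by (rule trans[OF Y(3) c(2)])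
  show ?thesis by (rule exI[of _ y], rule conjI[OF yk conjI[OF y0 yn]])
qed

text \<open>Multiplying the resonant system by its adjugate matrix shows that both resonant
  coefficients vanish; a trivial kernel then makes the kernels of all powers trivial.\<close>

lemma hill_mult_not_root:
  assumes "(hill_V a b R S (sol0 a b R S n z) 0 - z)\<^sup>2 \<noteq>
    hill_V a b R S (sol0 a b R S n z) (int n) * hill_V a b R S (soln a b R S n z) 0"
  shows "hill_mult (parity_bdry n) (two_term_potential a b R S) ((of_nat n)\<^sup>2 + z) = 0"
proof -
  let ?ker = "hill_ker (parity_bdry n) (two_term_potential a b R S) ((of_nat n)\<^sup>2 + z)"
  have det: "(A - z)\<^sup>2 - P * Q \<noteq> 0" using assms by (simp add: A_def P_def Q_def u0_def un_def)
  have zero: "y = (\<lambda>_. 0)" if "y \<in> ?ker (Suc 0)" for y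
  proof -
    have y: "y \<in> hill_dom (parity_bdry n)" "\<And>x. hill_op (two_term_potential a b R S) y x - ((of_nat n)\<^sup>2 + z) * y x = 0"
      using that unfolding hill_ker_1 by auto
    note K = kernel_coeffs[OF y]
    have "((A - z)\<^sup>2 - P * Q) * fc n y 0 = (A - z) * ((A - z) * fc n y 0 + Q * fc n y (int n)) - Q * (P * fc n y 0 + (A - z) * fc n y (int n))"
      "((A - z)\<^sup>2 - P * Q) * fc n y (int n) = (A - z) * (P * fc n y 0 + (A - z) * fc n y (int n)) - P * ((A - z) * fc n y 0 + Q * fc n y (int n))"
      by (simp_all add: power2_eq_square algebra_simps)
    hence "fc n y 0 = 0" "fc n y (int n) = 0" using det unfolding K(2,3) by simp_all
    thus ?thesis by (rule K(4))
  qed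
  have sub: "?ker k \<subseteq> {\<lambda>_. 0}" for k
  proof (induction k)
    case (Suc k)
    show ?case
    proof
      fix y assume "y \<in> ?ker (Suc k)"
      hence yd: "y \<in> hill_dom (parity_bdry n)" and f: "(\<lambda>x. hill_op (two_term_potential a b R S) y x - ((of_nat n)\<^sup>2 + z) * y x) \<in> ?ker k"
        by auto
      have "(\<lambda>x. hill_op (two_term_potential a b R S) y x - ((of_nat n)\<^sup>2 + z) * y x) = (\<lambda>_. 0)"
        using subsetD[OF Suc f] by (rule singletonD)
      from fun_cong[OF this] have "y \<in> ?ker (Suc 0)" unfolding hill_ker_1 by (intro conjI allI yd)
      from zero[OF this] show "y \<in> {\<lambda>_. 0}" by (simp only: singleton_iff)
    qed
  qed simp
  have "(\<Union>k. ?ker k) \<subseteq> {0}" unfolding zero_fun_def by (rule UN_least) (rule sub)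
  hence "cfun.dim (\<Union>k. ?ker k) = 0"
    by (intro cfun.dim_unique[of "{}"]) (simp_all add: cfun.independent_empty)
  thus ?thesis by (simp add: hill_mult_def)
qed

text \<open>Besides the kernel being one-dimensional, a Jordan chain has to be excluded. If
  \<open>L - (n^2 + z)\<close> maps \<open>g\<close> to \<open>t y1\<close>, the resonant
  coefficients of \<open>g\<close> satisfy an inhomogeneous system with singular matrix, and its
  solvability condition is \<open>t\<close> times the difference excluded by \<open>nondeg\<close>.
  As \<open>k\<close> and \<open>l\<close> are formally minus the \<open>z\<close>-derivatives of
  \<open>sol0\<close> and \<open>soln\<close>, this difference is \<open>- (A - z)\<close> times the
  derivative of \<open>(A - z)^2 - P Q\<close>: a simple root gives a simple eigenvalue.\<close>

lemma hill_mult_simple_root: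
  assumes PQ0: "hill_V a b R S (sol0 a b R S n z) (int n) \<noteq> 0" "hill_V a b R S (soln a b R S n z) 0 \<noteq> 0"
    and det0: "(hill_V a b R S (sol0 a b R S n z) 0 - z)\<^sup>2 =
    hill_V a b R S (sol0 a b R S n z) (int n) * hill_V a b R S (soln a b R S n z) 0"
    and nondeg: "\<And>k l. red_sol a b R S n z (sol0 a b R S n z) k \<Longrightarrow> k 0 = 0 \<Longrightarrow> k (int n) = 0 \<Longrightarrow>
      red_sol a b R S n z (soln a b R S n z) l \<Longrightarrow> l 0 = 0 \<Longrightarrow> l (int n) = 0 \<Longrightarrow>
      hill_V a b R S (sol0 a b R S n z) (int n) * hill_V a b R S (soln a b R S n z) 0 * (2 + hill_V a b R S k 0 + hill_V a b R S l (int n)) \<noteq>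
      (hill_V a b R S (sol0 a b R S n z) 0 - z) * (hill_V a b R S (sol0 a b R S n z) (int n) * hill_V a b R S l 0 + hill_V a b R S (soln a b R S n z) 0 * hill_V a b R S k (int n))"
  shows "hill_mult (parity_bdry n) (two_term_potential a b R S) ((of_nat n)\<^sup>2 + z) = 1"
proof -
  let ?ker = "hill_ker (parity_bdry n) (two_term_potential a b R S) ((of_nat n)\<^sup>2 + z)"
  have PQ: "P \<noteq> 0" "Q \<noteq> 0" and det: "(A - z)\<^sup>2 = P * Q"
    using PQ0 det0 by (simp_all add: A_def P_def Q_def u0_def un_def)
  obtain k where k: "red_sol a b R S n z u0 k" "k 0 = 0" "k (int n) = 0"
    using red_sol_exists[OF n(1) z n(2) bounded_red_sol[OF u0(1)]] by blast
  obtain l where l: "red_sol a b R S n z un l" "l 0 = 0" "l (int n) = 0"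
    using red_sol_exists[OF n(1) z n(2) bounded_red_sol[OF un(1)]] by blast
  have nd: "P * Q * (2 + hill_V a b R S k 0 + hill_V a b R S l (int n)) \<noteq>
      (A - z) * (P * hill_V a b R S l 0 + Q * hill_V a b R S k (int n))"
    using nondeg[of k l] k l by (simp add: A_def P_def Q_def u0_def un_def)
  obtain y1 where y1: "y1 \<in> ?ker (Suc 0)" "fc n y1 0 = Q" "fc n y1 (int n) = - (A - z)"
    using kernel_exists[OF PQ det] by blast
  have y1d: "y1 \<in> hill_dom (parity_bdry n)" "\<And>x. hill_op (two_term_potential a b R S) y1 x - ((of_nat n)\<^sup>2 + z) * y1 x = 0"
    using y1(1) unfolding hill_ker_1 by auto
  have y1_ne: "y1 \<noteq> (\<lambda>_. 0)" using y1(2) PQ by (auto simp: fc_zero)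
  \<comment> \<open>As \<open>Q\<close> is nonzero, the coefficient at \<open>0\<close> determines
    the one at \<open>n\<close> through the first row, and these two determine all others.\<close>
  have one_dim: "\<exists>t. y = (\<lambda>x. t * y1 x) \<and> fc n y 0 = t * Q \<and> fc n y (int n) = t * (- (A - z))" if y: "y \<in> ?ker (Suc 0)" for y
  proof -
    have yd: "y \<in> hill_dom (parity_bdry n)" "\<And>x. hill_op (two_term_potential a b R S) y x - ((of_nat n)\<^sup>2 + z) * y x = 0"
      using y unfolding hill_ker_1 by auto
    note K = kernel_coeffs[OF yd] and K1 = kernel_coeffs[OF y1d]
    define t where "t = fc n y 0 / Q"
    have t0: "fc n y 0 = t * Q" using PQ by (simp add: t_def)
    have "Q * fc n y (int n) = Q * (t * (- (A - z)))" using K(2) unfolding t0 by (simp add: algebra_simps eq_neg_iff_add_eq_0)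
    hence tn: "fc n y (int n) = t * (- (A - z))" using PQ by simp
    have c: "continuous_on {0..pi} y" "continuous_on {0..pi} y1"
      using C2_0piD(3)[OF hill_domD(1)[OF yd(1)]] C2_0piD(3)[OF hill_domD(1)[OF y1d(1)]] by auto
    have f: "fc n (\<lambda>x. y x - t * y1 x) j = fc n y j - t * fc n y1 j" for j by (rule fc_diff_scale[OF c])
    have "fc n y j = t * fc n y1 j" for j
    proof -
      have "red_sol a b R S n z (\<lambda>_. 0) (\<lambda>j. t * fc n y1 j + 0 * fc n y1 j)"
        using red_sol_add[OF K1(1) K1(1), of t 0] by simp
      hence "fc n y j = t * fc n y1 j + 0 * fc n y1 j"
        by (rule red_sol_unique[OF n K(1) _ _ _ z]) (simp_all add: t0 tn y1)
      thus ?thesis by simp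
    qed
    hence "fc n (\<lambda>x. y x - t * y1 x) j = 0" for j by (simp add: f)
    hence "y x - t * y1 x = 0" if "x \<in> {0..pi}" for x
      using fc_complete[of "\<lambda>x. y x - t * y1 x" n x] c that hill_domD(2)[OF yd(1)] hill_domD(2)[OF y1d(1)]
      by (simp add: continuous_intros algebra_simps)
    moreover have "y x - t * y1 x = 0" if "x \<notin> {0..pi}" for x
      using C2_0piD(6)[OF hill_domD(1)[OF yd(1)] that] C2_0piD(6)[OF hill_domD(1)[OF y1d(1)] that] by simp
    ultimately have "y x = t * y1 x" for x by (cases "x \<in> {0..pi}") auto
    thus ?thesis using t0 tn by blast
  qed
  have step: "g \<in> ?ker (Suc 0)" if g: "g \<in> hill_dom (parity_bdry n)" and f: "(\<lambda>x. hill_op (two_term_potential a b R S) g x - ((of_nat n)\<^sup>2 + z) * g x) \<in> ?ker (Suc 0)" for g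
  proof -
    define f where "f = (\<lambda>x. hill_op (two_term_potential a b R S) g x - ((of_nat n)\<^sup>2 + z) * g x)"
    have fk: "f \<in> ?ker (Suc 0)" using f by (simp add: f_def)
    obtain t where t: "f = (\<lambda>x. t * y1 x)" "fc n f 0 = t * Q" "fc n f (int n) = t * (- (A - z))"
      using one_dim[OF fk] by blast
    have frs: "red_sol a b R S n z (\<lambda>_. 0) (fc n f)"
      using fk kernel_coeffs(1)[of f] unfolding hill_ker_1 by blast
    define p where "p = fc n f"
    define q where "q = fc n g"
    have qeq: "(of_int (gap n j) + z) * q j = hill_V a b R S q j - p j" for j
      unfolding q_def p_def by (rule fc_resolvent[OF g]) (simp add: f_def)
    have p_dec: "p j = p 0 * u0 j + p (int n) * un j" for j
      unfolding p_def u0_def un_def by (rule red_sol_decomp[OF n frs z])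
    have pfun: "(\<lambda>j. p 0 * u0 j + p (int n) * un j) = p" by (rule ext) (rule p_dec[symmetric])
    \<comment> \<open>The sequence \<open>q\<close> is the homogeneous solution with the same
      resonant values, minus the response \<open>m\<close> to the source \<open>p\<close>.\<close>
    define h where "h j = q 0 * u0 j + q (int n) * un j" for j
    define m where "m j = p 0 * k j + p (int n) * l j" for j
    have hs: "red_sol a b R S n z (\<lambda>j. q 0 * 0 + q (int n) * 0) h"
      unfolding h_def[abs_def] by (rule red_sol_add[OF u0(1) un(1)])
    have ms: "red_sol a b R S n z p m"
    proof -
      have "red_sol a b R S n z (\<lambda>j. p 0 * u0 j + p (int n) * un j) m"
        unfolding m_def[abs_def] by (rule red_sol_add[OF k(1) l(1)])
      thus ?thesis unfolding pfun .
    qed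
    have hm: "red_sol a b R S n z (\<lambda>j. - p j) (\<lambda>j. 1 * h j + (-1) * m j)"
      using red_sol_add[OF hs ms, of 1 "-1"] by simp
    have qs: "red_sol a b R S n z (\<lambda>j. - p j) q"
      using bounded_fc[OF C2_0piD(3)[OF hill_domD(1)[OF g]]] qeq by (simp add: red_sol_def q_def)
    have "q j = 1 * h j + (-1) * m j" for j
      by (rule red_sol_unique[OF n qs hm _ _ z]) (simp_all add: h_def m_def u0 un k l)
    hence "hill_V a b R S q j = 1 * hill_V a b R S h j + (-1) * hill_V a b R S m j" for j
      by (subst hill_V_linear[symmetric]) (simp add: hill_V_def)
    moreover have "hill_V a b R S h j = q 0 * hill_V a b R S u0 j + q (int n) * hill_V a b R S un j" for j
      unfolding h_def[abs_def] by (rule hill_V_linear)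
    moreover have "hill_V a b R S m j = p 0 * hill_V a b R S k j + p (int n) * hill_V a b R S l j" for j
      unfolding m_def[abs_def] by (rule hill_V_linear)
    ultimately have Vq: "hill_V a b R S q j = q 0 * hill_V a b R S u0 j + q (int n) * hill_V a b R S un j -
       (p 0 * hill_V a b R S k j + p (int n) * hill_V a b R S l j)" for j by simp
    let ?k0 = "hill_V a b R S k 0" and ?kn = "hill_V a b R S k (int n)" and ?l0 = "hill_V a b R S l 0" and ?ln = "hill_V a b R S l (int n)"
    have p0n: "p 0 = t * Q" "p (int n) = t * (- (A - z))" using t by (simp_all add: p_def)
    define w where "w = A - z"
    have e0: "w * q 0 + Q * q (int n) = t * Q * (1 + ?k0) - t * w * ?l0"
      using qeq[of 0] unfolding Vq p0n by (simp add: w_def gap_def A_def[symmetric] Q_def[symmetric] algebra_simps)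
    have en: "P * q 0 + w * q (int n) = t * Q * ?kn - t * w * (1 + ?ln)"
      using qeq[of "int n"] unfolding Vq p0n A' by (simp add: w_def gap_def P_def[symmetric] algebra_simps)
    have w2: "w * w = P * Q" using det by (simp add: w_def power2_eq_square)
    \<comment> \<open>By \<open>w * w = P * Q\<close> the two rows are dependent, so this
      combination eliminates both unknown values of \<open>q\<close> and leaves a condition on
      \<open>t\<close> alone.\<close>
    have "P * (w * q 0 + Q * q (int n)) - w * (P * q 0 + w * q (int n)) = (P * Q - w * w) * q (int n)"
      by (simp add: algebra_simps)
    hence "P * (t * Q * (1 + ?k0) - t * w * ?l0) - w * (t * Q * ?kn - t * w * (1 + ?ln)) = 0"
      unfolding e0 en w2 by simp
    moreover have "P * (t * Q * (1 + ?k0) - t * w * ?l0) - w * (t * Q * ?kn - t * w * (1 + ?ln)) =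
        t * (P * Q * (1 + ?k0) + (w * w) * (1 + ?ln) - w * (P * ?l0 + Q * ?kn))"
      by (simp add: algebra_simps)
    ultimately have "t * (P * Q * (2 + ?k0 + ?ln) - w * (P * ?l0 + Q * ?kn)) = 0"
      unfolding w2 by (simp add: algebra_simps)
    hence "t = 0" using nd by (simp add: w_def)
    hence "f x = 0" for x by (simp add: t(1))
    thus ?thesis unfolding hill_ker_1 using g by (simp add: f_def)
  qed
  have zero_in: "(\<lambda>_. 0) \<in> ?ker (Suc 0)"
  proof -
    have z0: "(\<lambda>_. 0::complex) \<in> C2_0pi"
      by (rule C2_0piI(1)[of _ "\<lambda>_. 0" "\<lambda>_. 0"]) (auto intro: derivative_intros)
    have d0: "deriv_0pi (\<lambda>_. 0) x = 0" for x
      using deriv_0pi_eq[of x "\<lambda>_. 0" 0] by (cases "x \<in> {0..pi}") (auto simp: deriv_0pi_def)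
    hence "deriv_0pi (\<lambda>_. 0) = (\<lambda>_. 0)" by auto
    thus ?thesis unfolding hill_ker_1 by (simp add: hill_dom_def parity_bdry_iff z0 hill_op_def)
  qed
  have sub: "?ker m \<subseteq> ?ker (Suc 0)" for m
  proof (induction m)
    case 0
    show ?case unfolding hill_ker.simps(1) using zero_in by (simp only: insert_subset empty_subsetI simp_thms)
  next
    case (Suc m)
    show ?case
    proof
      fix g assume "g \<in> ?ker (Suc m)"
      hence gd: "g \<in> hill_dom (parity_bdry n)" and f: "(\<lambda>x. hill_op (two_term_potential a b R S) g x - ((of_nat n)\<^sup>2 + z) * g x) \<in> ?ker m" by auto
      show "g \<in> ?ker (Suc 0)" by (rule step[OF gd subsetD[OF Suc f]])
    qed
  qed
  have un_eq: "(\<Union>m. ?ker m) = ?ker (Suc 0)"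
    by (intro antisym UN_least sub UN_upper) (rule UNIV_I)
  have "cfun.dim (?ker (Suc 0)) = 1"
  proof (rule cfun.dim_unique[of "{y1}"])
    show "{y1} \<subseteq> ?ker (Suc 0)" using y1(1) by simp
    show "?ker (Suc 0) \<subseteq> cfun.span {y1}"
    proof
      fix y assume "y \<in> ?ker (Suc 0)"
      then obtain t where "y = (\<lambda>x. t * y1 x)" using one_dim by blast
      thus "y \<in> cfun.span {y1}" by (simp add: cfun.span_scale cfun.span_base)
    qed
    show "cfun.independent {y1}" using y1_ne by (simp add: cfun.dependent_single zero_fun_def)
  qed simp
  thus ?thesis unfolding hill_mult_def un_eq .
qed

end

section \<open>The resonant equation for Dirichlet eigenvalues\<close>

text \<open>All modes equal \<open>1\<close> at \<open>0\<close>, so the value there is the sum of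
  the coefficients; the nonresonant ones are bounded by inverse gaps, whose sum is small.\<close>

lemma hsum_at_0:
  assumes n: "n \<ge> 2" "2 * (cmod a + cmod b) \<le> real n" and z: "cmod z \<le> real n"
    and u: "red_sol a b R S n z (\<lambda>_. 0) u" "cmod (u 0) \<le> 1" "cmod (u (int n)) \<le> 1"
    and T: "\<And>A. finite A \<Longrightarrow> 0 \<notin> A \<Longrightarrow> int n \<notin> A \<Longrightarrow> (\<Sum>j\<in>A. 1 / \<bar>real_of_int (gap n j)\<bar>) \<le> t"
  shows "cmod (hsum n u 0 - (u 0 + u (int n))) \<le> 2 * (cmod a + cmod b) * t"
proof -
  have s: "(\<lambda>j. cmod (u j)) summable_on UNIV"
    using rapid_summable[OF red_sol_rapid[OF u(1) n(1) z], of "\<lambda>_. 1" 1] by simp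
  have hs: "(u has_sum hsum n u 0) UNIV"
    using hsum_has_sum[OF s, of n 0] by (simp add: hmode_0)
  have lim: "((\<lambda>X. cmod (sum u X - (u 0 + u (int n)))) \<longlongrightarrow> cmod (hsum n u 0 - (u 0 + u (int n)))) (finite_subsets_at_top UNIV)"
    using hs unfolding has_sum_def by (intro tendsto_intros)
  have "eventually (\<lambda>X. cmod (sum u X - (u 0 + u (int n))) \<le> 2 * (cmod a + cmod b) * t) (finite_subsets_at_top UNIV)"
    unfolding eventually_finite_subsets_at_top
  proof (intro exI[of _ "{0, int n}"] conjI allI impI)
    fix X assume X: "finite X \<and> {0, int n} \<subseteq> X \<and> X \<subseteq> UNIV"
    have "sum u X = sum u {0, int n} + sum u (X - {0, int n})"
      using X by (metis add.commute sum.subset_diff)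
    hence "sum u X - (u 0 + u (int n)) = sum u (X - {0, int n})" using n by simp
    also have "cmod \<dots> \<le> (\<Sum>j\<in>X - {0, int n}. 2 * (cmod a + cmod b) * (1 / \<bar>real_of_int (gap n j)\<bar>))"
      by (rule sum_norm_le, rule red_sol_bound(2)[OF n u z]) auto
    also have "\<dots> = 2 * (cmod a + cmod b) * (\<Sum>j\<in>X - {0, int n}. 1 / \<bar>real_of_int (gap n j)\<bar>)"
      by (simp only: sum_distrib_left)
    also have "\<dots> \<le> 2 * (cmod a + cmod b) * t" using X by (intro mult_left_mono T) auto
    finally show "cmod (sum u X - (u 0 + u (int n))) \<le> 2 * (cmod a + cmod b) * t" .
  qed auto
  thus ?thesis by (rule tendsto_upperbound[OF lim]) simp
qed

lemma sn_hmode: "sn n x = (hmode n (int n) x - hmode n 0 x) / (2 * \<i>)"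
proof -
  have "hmode n (int n) x = exp (\<i> * (of_nat n * of_real x))" "hmode n 0 x = exp (- (\<i> * (of_nat n * of_real x)))"
    unfolding hmode_def by (simp_all add: algebra_simps)
  moreover have "sn n x = sin (of_nat n * of_real x)" by (simp add: sn_def flip: sin_of_real)
  ultimately show ?thesis by (simp add: sin_exp_eq)
qed

lemma integral_hmode_sn:
  assumes "n > 0"
  shows "((\<lambda>x. hmode n (int n) x * sn n x) has_integral \<i> * of_real pi / 2) {0..pi}"
    "((\<lambda>x. hmode n 0 x * sn n x) has_integral - (\<i> * of_real pi / 2)) {0..pi}"
proof -
  have "(1 / c) * (h * k - h * l) = h * ((k - l) / c)" for c h k l :: complex
    by (simp add: right_diff_distrib diff_divide_distrib)
  note eq = this[of "2 * \<i>"]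
  have i: "((\<lambda>x. hmode n (int n) x * hmode n (int n) x) has_integral 0) {0..pi}"
    "((\<lambda>x. hmode n (int n) x * hmode n 0 x) has_integral of_real pi) {0..pi}"
    "((\<lambda>x. hmode n 0 x * hmode n (int n) x) has_integral of_real pi) {0..pi}"
    "((\<lambda>x. hmode n 0 x * hmode n 0 x) has_integral 0) {0..pi}"
    using assms has_integral_hmode_mult[of n "int n" 0] has_integral_hmode_mult[of n "int n" "int n"]
      has_integral_hmode_mult[of n 0 0] has_integral_hmode_mult[of n 0 "int n"] by simp_all
  have "((\<lambda>x. (1 / (2 * \<i>)) * (hmode n (int n) x * hmode n (int n) x - hmode n (int n) x * hmode n 0 x)) has_integral (1 / (2 * \<i>)) * (0 - of_real pi)) {0..pi}"
    by (intro has_integral_mult_right has_integral_diff i)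
  moreover have "(1 / (2 * \<i>)) * (0 - of_real pi) = \<i> * of_real pi / 2" by (simp add: field_simps)
  ultimately show "((\<lambda>x. hmode n (int n) x * sn n x) has_integral \<i> * of_real pi / 2) {0..pi}"
    unfolding sn_hmode eq by (simp only:)
  have "((\<lambda>x. (1 / (2 * \<i>)) * (hmode n 0 x * hmode n (int n) x - hmode n 0 x * hmode n 0 x)) has_integral (1 / (2 * \<i>)) * (of_real pi - 0)) {0..pi}"
    by (intro has_integral_mult_right has_integral_diff i)
  moreover have "(1 / (2 * \<i>)) * (of_real pi - 0) = - (\<i> * of_real pi / 2)" by (simp add: field_simps)
  ultimately show "((\<lambda>x. hmode n 0 x * sn n x) has_integral - (\<i> * of_real pi / 2)) {0..pi}"
    unfolding sn_hmode eq by (simp only:)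
qed

lemma integral_hmode_near_sn:
  assumes n: "n > 0" and w: "continuous_on {0..pi} w" "\<forall>x\<in>{0..pi}. cmod (w x - sn n x) \<le> \<eta>"
  shows "cmod (integral {0..pi} (\<lambda>x. hmode n (int n) x * w x) - \<i> * of_real pi / 2) \<le> pi * \<eta>"
    "cmod (integral {0..pi} (\<lambda>x. hmode n 0 x * w x) + \<i> * of_real pi / 2) \<le> pi * \<eta>"
proof -
  have \<eta>: "\<eta> \<ge> 0" using bspec[OF w(2), of 0] norm_ge_zero[of "w 0 - sn n 0"] by (auto simp del: norm_ge_zero)
  have gen: "cmod (integral {0..pi} (\<lambda>x. hmode n j x * w x) - I) \<le> pi * \<eta>"
    if I: "((\<lambda>x. hmode n j x * sn n x) has_integral I) {0..pi}" for j I
  proof -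
    have "(\<lambda>x. hmode n j x * w x) integrable_on {0..pi}"
      by (intro integrable_continuous_real continuous_intros w)
    from has_integral_diff[OF integrable_integral[OF this] I]
    have "((\<lambda>x. hmode n j x * (w x - sn n x)) has_integral integral {0..pi} (\<lambda>x. hmode n j x * w x) - I) {0..pi}"
      by (simp only: right_diff_distrib)
    hence "cmod (integral {0..pi} (\<lambda>x. hmode n j x * w x) - I) \<le> \<eta> * measure lborel {0..pi}"
      by (rule has_integral_bound_real[OF \<eta> finite.emptyI]) (use w(2) in \<open>simp add: norm_mult norm_hmode\<close>)
    thus ?thesis by (simp add: mult.commute)
  qed
  show "cmod (integral {0..pi} (\<lambda>x. hmode n (int n) x * w x) - \<i> * of_real pi / 2) \<le> pi * \<eta>"
    by (rule gen[OF integral_hmode_sn(1)[OF n]])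
  show "cmod (integral {0..pi} (\<lambda>x. hmode n 0 x * w x) + \<i> * of_real pi / 2) \<le> pi * \<eta>"
    using gen[OF integral_hmode_sn(2)[OF n]] by simp
qed

text \<open>Pairing a Dirichlet eigenfunction with the two reduced solutions and eliminating the unknown
  boundary term.\<close>

lemma Dirichlet_resonant_equation:
  assumes n: "n \<ge> 2" "2 * (cmod a + cmod b) \<le> real n" and z: "cmod z \<le> real n"
    and w: "w \<in> hill_dom Dirichlet" "hill_op (two_term_potential a b R S) w = (\<lambda>x. ((of_nat n)\<^sup>2 + z) * w x)"
  defines "u \<equiv> sol0 a b R S n z" and "u' \<equiv> soln a b R S n z"
  defines "I0 \<equiv> integral {0..pi} (\<lambda>x. hmode n 0 x * w x)" and "In \<equiv> integral {0..pi} (\<lambda>x. hmode n (int n) x * w x)"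
  shows "(hill_V a b R S u 0 - z) * (I0 * hsum n u' 0 - In * hsum n u 0) +
    hill_V a b R S u (int n) * In * hsum n u' 0 - hill_V a b R S u' 0 * I0 * hsum n u 0 = 0"
proof -
  note wd = Dirichlet_eigenD[OF w]
  note wc = C2_0piD(3)[OF wd(3)]
  have ucfs: "red_sol a b R S n z (\<lambda>_. 0) u" "u 0 = 1" "u (int n) = 0"
    "red_sol a b R S n z (\<lambda>_. 0) u'" "u' 0 = 0" "u' (int n) = 1"
    unfolding u_def u'_def by (rule sol0[OF n z] soln[OF n z])+
  have n0: "n > 0" using n by simp
  \<comment> \<open>Every reduced solution satisfies \<open>y pi = (-1)^n y 0\<close>, so the
    boundary term of Green's identity is \<open>y 0\<close> times the same unknown number for all of
    them. Two solutions suffice to eliminate it.\<close>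
  define \<tau> where "\<tau> = (-1) ^ n * deriv_0pi w pi - deriv_0pi w 0"
  have gen: "(hill_V a b R S c 0 - z * c 0) * I0 + (hill_V a b R S c (int n) - z * c (int n)) * In = hsum n c 0 * \<tau>"
    if c: "red_sol a b R S n z (\<lambda>_. 0) c" for c
  proof -
    define y where "y = (\<lambda>x. if x \<in> {0..pi} then hsum n c x else 0)"
    have ceq: "\<forall>j. j \<noteq> 0 \<longrightarrow> j \<noteq> int n \<longrightarrow> (of_int (gap n j) + z) * c j = hill_V a b R S c j"
      using c by (simp add: red_sol_def)
    note hs = hsum_solution[OF red_sol_rapid[OF c n(1) z] ceq n0]
    have Y1: "y \<in> hill_dom (parity_bdry n)" unfolding y_def by (rule hs(1))
    have Y2: "hill_op (two_term_potential a b R S) y x - ((of_nat n)\<^sup>2 + z) * y x =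
        (hill_V a b R S c 0 - z * c 0) * hmode n 0 x + (hill_V a b R S c (int n) - z * c (int n)) * hmode n (int n) x"
      if "x \<in> {0..pi}" for x unfolding y_def by (rule hs(2)[OF that])
    have y0: "y 0 = hsum n c 0" by (simp add: y_def)
    have I1: "((\<lambda>x. (hill_op (two_term_potential a b R S) y x - ((of_nat n)\<^sup>2 + z) * y x) * w x - y x * (hill_op (two_term_potential a b R S) w x - ((of_nat n)\<^sup>2 + z) * w x)) has_integral
      (deriv_0pi y 0 * w 0 - y 0 * deriv_0pi w 0) - (deriv_0pi y pi * w pi - y pi * deriv_0pi w pi)) {0..pi}"
      by (rule Green_hill_op[OF hill_domD(1)[OF Y1] wd(3)])
    have bt: "(deriv_0pi y 0 * w 0 - y 0 * deriv_0pi w 0) - (deriv_0pi y pi * w pi - y pi * deriv_0pi w pi) = hsum n c 0 * \<tau>"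
      unfolding wd(1,2) hill_domD(2)[OF Y1] \<tau>_def y0 by (simp add: algebra_simps)
    have I2: "((\<lambda>x. (hill_V a b R S c 0 - z * c 0) * (hmode n 0 x * w x) + (hill_V a b R S c (int n) - z * c (int n)) * (hmode n (int n) x * w x)) has_integral hsum n c 0 * \<tau>) {0..pi}"
    proof (rule has_integral_eq[OF _ I1[unfolded bt]])
      fix x assume x: "x \<in> {0..pi}"
      have "hill_op (two_term_potential a b R S) w x - ((of_nat n)\<^sup>2 + z) * w x = 0" by (simp add: w(2))
      thus "(hill_op (two_term_potential a b R S) y x - ((of_nat n)\<^sup>2 + z) * y x) * w x - y x * (hill_op (two_term_potential a b R S) w x - ((of_nat n)\<^sup>2 + z) * w x) =
        (hill_V a b R S c 0 - z * c 0) * (hmode n 0 x * w x) + (hill_V a b R S c (int n) - z * c (int n)) * (hmode n (int n) x * w x)"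
        unfolding Y2[OF x] by (simp add: algebra_simps)
    qed
    have "((\<lambda>x. (hill_V a b R S c 0 - z * c 0) * (hmode n 0 x * w x) + (hill_V a b R S c (int n) - z * c (int n)) * (hmode n (int n) x * w x)) has_integral
       (hill_V a b R S c 0 - z * c 0) * I0 + (hill_V a b R S c (int n) - z * c (int n)) * In) {0..pi}"
      unfolding I0_def In_def
      by (intro has_integral_add has_integral_mult_right integrable_integral integrable_continuous_real continuous_intros wc)
    from has_integral_unique[OF this I2] show ?thesis .
  qed
  have "hill_V a b R S u' (int n) = hill_V a b R S u 0"
    unfolding u_def u'_def by (rule diagonal_entries_eq[OF n z])
  hence e1: "(hill_V a b R S u 0 - z) * I0 + hill_V a b R S u (int n) * In = hsum n u 0 * \<tau>"
    and e2: "hill_V a b R S u' 0 * I0 + (hill_V a b R S u 0 - z) * In = hsum n u' 0 * \<tau>"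
    using gen[OF ucfs(1)] gen[OF ucfs(4)] by (simp_all add: ucfs)
  have "(hill_V a b R S u 0 - z) * (I0 * hsum n u' 0 - In * hsum n u 0) +
    hill_V a b R S u (int n) * In * hsum n u' 0 - hill_V a b R S u' 0 * I0 * hsum n u 0 =
    ((hill_V a b R S u 0 - z) * I0 + hill_V a b R S u (int n) * In) * hsum n u' 0 -
    (hill_V a b R S u' 0 * I0 + (hill_V a b R S u 0 - z) * In) * hsum n u 0"
    by (simp add: algebra_simps)
  also have "\<dots> = 0" unfolding e1 e2 by simp
  finally show ?thesis .
qed

text \<open>For \<open>\<eta> = 0\<close> one has \<open>In = - I0 = c\<close> with
  \<open>c = \<i> pi / 2\<close> and \<open>s0 = sN = 1\<close>, and the equation reads
  \<open>c (P + Q - 2 D) = 0\<close>. Otherwise each product of two perturbed factors is off by a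
  relative error of at most \<open>4 \<eta>\<close>, and the resulting \<open>12 \<eta>\<close> is
  halved with \<open>2 D\<close>.\<close>

lemma resonant_equation_estimate:
  fixes D P Q I0 In s0 sN :: complex and \<eta> :: real
  assumes eq: "D * (I0 * sN - In * s0) + P * In * sN - Q * I0 * s0 = 0"
    and \<eta>: "0 \<le> \<eta>" "100 * \<eta> \<le> 1" and s: "cmod (s0 - 1) \<le> \<eta>" "cmod (sN - 1) \<le> \<eta>"
    and I: "cmod (In - \<i> * of_real pi / 2) \<le> pi * \<eta>" "cmod (I0 + \<i> * of_real pi / 2) \<le> pi * \<eta>"
  shows "cmod (D - (P + Q) / 2) \<le> 6 * \<eta> * (cmod P + cmod Q)"
proof -
  define c where "c = \<i> * of_real pi / 2"
  have c: "c \<noteq> 0" "cmod c = pi / 2" by (auto simp: c_def norm_mult norm_divide)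
  define x y where "x = (In / c) * sN - 1" and "y = (- I0 / c) * s0 - 1"
  have bound: "cmod (J / c * t - 1) \<le> 4 * \<eta>" if J: "cmod (J - c) \<le> pi * \<eta>" and t: "cmod (t - 1) \<le> \<eta>" for J t
  proof -
    have "J / c - 1 = (J - c) / c" using c by (simp add: field_simps)
    hence j: "cmod (J / c - 1) \<le> 2 * \<eta>" using J c by (simp add: norm_divide divide_le_eq mult_ac)
    have "r * t - 1 = (r - 1) + (t - 1) + (r - 1) * (t - 1)" for r by (simp add: algebra_simps)
    hence "J / c * t - 1 = (J / c - 1) + (t - 1) + (J / c - 1) * (t - 1)" .
    also have "cmod \<dots> \<le> 2 * \<eta> + \<eta> + (2 * \<eta>) * \<eta>"
      unfolding norm_mult[symmetric]
    proof (intro order_trans[OF norm_triangle_ineq] add_mono j t)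
      show "cmod ((J / c - 1) * (t - 1)) \<le> (2 * \<eta>) * \<eta>"
        unfolding norm_mult using j t \<eta> by (intro mult_mono) auto
    qed
    also have "(2 * \<eta>) * \<eta> \<le> \<eta>" using \<eta> mult_left_mono[of "2 * \<eta>" 1 \<eta>] by simp
    finally show ?thesis by simp
  qed
  have x: "cmod x \<le> 4 * \<eta>" unfolding x_def by (rule bound) (use I s in \<open>auto simp: c_def\<close>)
  have "cmod (- I0 - c) = cmod (I0 + c)" by (metis minus_add_distrib norm_minus_cancel uminus_add_conv_diff add.commute diff_minus_eq_add minus_diff_eq)
  hence y: "cmod y \<le> 4 * \<eta>" unfolding y_def using I s by (intro bound) (auto simp: c_def)
  have s1: "In * sN = c * (1 + x)" using c by (simp add: x_def)
  have s2: "I0 * s0 = - c * (1 + y)" using c by (simp add: y_def)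
  have ID: "\<exists>x' y'. cmod x' \<le> 4 * \<eta> \<and> cmod y' \<le> 4 * \<eta> \<and> I0 * sN = - c * (1 + x') \<and> In * s0 = c * (1 + y')"
  proof (intro exI conjI)
    have "cmod (- I0 - c) = cmod (I0 + c)" by (metis minus_add_distrib norm_minus_cancel uminus_add_conv_diff add.commute diff_minus_eq_add minus_diff_eq)
    thus "cmod ((- I0) / c * sN - 1) \<le> 4 * \<eta>" using I s by (intro bound) (auto simp: c_def)
    show "cmod (In / c * s0 - 1) \<le> 4 * \<eta>" by (rule bound) (use I s in \<open>auto simp: c_def\<close>)
    show "I0 * sN = - c * (1 + ((- I0) / c * sN - 1))" "In * s0 = c * (1 + (In / c * s0 - 1))" using c by simp_all
  qed
  then obtain x' y' where xy': "cmod x' \<le> 4 * \<eta>" "cmod y' \<le> 4 * \<eta>" "I0 * sN = - c * (1 + x')" "In * s0 = c * (1 + y')" by blast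
  have "c * (- D * (2 + x' + y') + P * (1 + x) + Q * (1 + y)) = 0"
  proof -
    have "D * (I0 * sN - In * s0) + P * In * sN - Q * I0 * s0 = D * (I0 * sN - In * s0) + P * (In * sN) - Q * (I0 * s0)" by (simp add: algebra_simps)
    also have "\<dots> = c * (- D * (2 + x' + y') + P * (1 + x) + Q * (1 + y))" unfolding xy' s1 s2 by (simp add: algebra_simps)
    finally show ?thesis using eq by simp
  qed
  hence "- D * (2 + x' + y') + P * (1 + x) + Q * (1 + y) = 0" using c(1) unfolding mult_eq_0_iff by blast
  hence "2 * D - (P + Q) = P * x + Q * y - D * (x' + y')" by (simp add: algebra_simps)
  hence "cmod (2 * D - (P + Q)) \<le> cmod (P * x) + cmod (Q * y) + cmod (D * (x' + y'))"
    by (metis add_mono norm_triangle_le_diff norm_triangle_ineq order_refl)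
  also have "\<dots> \<le> cmod P * (4 * \<eta>) + cmod Q * (4 * \<eta>) + cmod D * (8 * \<eta>)"
    unfolding norm_mult using x y xy'(1,2) norm_triangle_ineq[of x' y'] by (intro add_mono mult_left_mono) auto
  finally have A: "cmod (2 * D - (P + Q)) \<le> 4 * \<eta> * (cmod P + cmod Q) + 8 * \<eta> * cmod D" by (simp add: algebra_simps)
  have "2 * cmod D \<le> cmod (2 * D - (P + Q)) + (cmod P + cmod Q)"
    using norm_triangle_ineq[of "2 * D - (P + Q)" "P + Q"] norm_triangle_ineq[of P Q] by (simp add: norm_mult)
  moreover have "4 * \<eta> * (cmod P + cmod Q) \<le> 4 / 100 * (cmod P + cmod Q)" using \<eta> by (intro mult_right_mono) auto
  moreover have "8 * \<eta> * cmod D \<le> 8 / 100 * cmod D" using \<eta> by (intro mult_right_mono) auto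
  moreover have "cmod P + cmod Q \<ge> 0" by simp
  ultimately have "cmod D \<le> cmod P + cmod Q" using A by argo
  hence "8 * \<eta> * cmod D \<le> 8 * \<eta> * (cmod P + cmod Q)" using \<eta> by (intro mult_left_mono) auto
  with A have "cmod (2 * D - (P + Q)) \<le> 12 * \<eta> * (cmod P + cmod Q)" by argo
  moreover have "cmod (D - (P + Q) / 2) = cmod (2 * D - (P + Q)) / 2"
  proof -
    have "D - (P + Q) / 2 = (2 * D - (P + Q)) / 2" by (simp add: diff_divide_distrib)
    thus ?thesis by (simp only: norm_divide norm_numeral)
  qed
  ultimately show ?thesis by argo
qed

section \<open>Eigenvalue estimates\<close>

lemma lex_le_antisym: "lex_le z w \<Longrightarrow> lex_le w z \<Longrightarrow> z = w"
  by (auto simp: lex_le_def complex_eq_iff)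

lemma lex_le_total: "lex_le z w \<or> lex_le w z"
  by (auto simp: lex_le_def)

text \<open>The multiplicities on the disc determine the multiset of the two eigenvalues, and the
  lexicographic order determines the pair. The disjunction avoids deciding which of the two values
  is the larger.\<close>

lemma hill_lambda_eqI:
  assumes d: "l1 \<in> hill_disc n" "l2 \<in> hill_disc n"
    and m: "\<forall>z \<in> hill_disc n. hill_mult (parity_bdry n) v z = count {#l1, l2#} z"
  shows "(hill_lambda_minus v n = l1 \<and> hill_lambda_plus v n = l2) \<or>
    (hill_lambda_minus v n = l2 \<and> hill_lambda_plus v n = l1)"
proof -
  have main: "hill_lambda_minus v n = l \<and> hill_lambda_plus v n = u"
    if d: "l \<in> hill_disc n" "u \<in> hill_disc n" and m: "\<forall>z \<in> hill_disc n. hill_mult (parity_bdry n) v z = count {#l, u#} z"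
      and le: "lex_le l u" for l u
  proof -
    have ep: "eig_pair v n l u" using d m le by (simp add: eig_pair_def)
    have uniq: "l' = l \<and> u' = u" if e: "eig_pair v n l' u'" for l' u'
    proof -
      have "{#l', u'#} = {#l, u#}"
      proof (rule multiset_eqI)
        fix z show "count {#l', u'#} z = count {#l, u#} z"
        proof (cases "z \<in> hill_disc n")
          case True
          thus ?thesis using m e by (simp add: eig_pair_def)
        next
          case False
          thus ?thesis using d e by (auto simp: eig_pair_def)
        qed
      qed
      hence "(l' = l \<and> u' = u) \<or> (l' = u \<and> u' = l)" by (auto simp: add_eq_conv_ex)
      moreover have "lex_le l' u'" using e by (simp add: eig_pair_def)
      ultimately show ?thesis using le lex_le_antisym by blast
    qed
    have "hill_lambda_minus v n = l" unfolding hill_lambda_minus_def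
      by (rule the_equality) (use ep uniq in blast)+
    moreover have "hill_lambda_plus v n = u" unfolding hill_lambda_plus_def
      by (rule the_equality) (use ep uniq in blast)+
    ultimately show ?thesis by simp
  qed
  show ?thesis
  proof (cases "lex_le l1 l2")
    case True
    thus ?thesis using main[OF d m] by simp
  next
    case False
    have "{#l2, l1#} = {#l1, l2#}" by (rule add_mset_commute)
    thus ?thesis using main[OF d(2,1)] m False lex_le_total[of l1 l2] by (simp only: simp_thms)
  qed
qed

lemma norm_potential_le: "cmod (two_term_potential a b R S x) \<le> cmod a + cmod b"
proof -
  have "cmod (exp (- 2 * of_nat R * \<i> * of_real x)) = 1" "cmod (exp (2 * of_nat S * \<i> * of_real x)) = 1"
    by (simp_all add: norm_exp_eq_Re)
  hence "cmod (a * exp (- 2 * of_nat R * \<i> * of_real x)) \<le> cmod a" "cmod (b * exp (2 * of_nat S * \<i> * of_real x)) \<le> cmod b"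
    by (simp_all add: norm_mult)
  thus ?thesis unfolding two_term_potential_def by (rule order_trans[OF norm_triangle_ineq add_mono])
qed

text \<open>\<open>K\<close> and \<open>K'\<close> are the leading terms of the two off-diagonal entries, \<open>e\<close> is the relative error.\<close>

lemma eigenvalue_estimates:
  fixes a b :: complex and R S n :: nat and K K' :: complex and e Z T :: real
  defines "B \<equiv> cmod a + cmod b"
  assumes e: "0 < e" "e \<le> 1 / 100" and Z: "Z = 1 + 5 * B"
    and T: "\<And>A. finite A \<Longrightarrow> 0 \<notin> A \<Longrightarrow> int n \<notin> A \<Longrightarrow> (\<Sum>j\<in>A. 1 / \<bar>real_of_int (gap n j)\<bar>) \<le> T"
    and n: "real n \<ge> 2 + 30000 * B" "Z < real n / 4" "30 * B / real n \<le> e" "2 * B * T \<le> e"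
    and bd: "entry_bounds a b R S n Z e K" "entry_bounds b a S R n Z e K'"
    and K: "K \<noteq> 0" "K' \<noteq> 0" "cmod K \<le> 1 / 2" "cmod K' \<le> 1 / 2"
  defines "v \<equiv> two_term_potential a b R S"
  shows "\<exists>\<kappa>. \<kappa>\<^sup>2 = K * K' \<and> cmod (hill_gamma v n - 2 * \<kappa>) \<le> 9 * e * cmod \<kappa> \<and>
    cmod (hill_mu v n - hill_lambda_plus v n + (K + K') / 2) \<le> 10 * e * (cmod K + cmod K') + 3 * cmod \<kappa> \<and>
    cmod (hill_mu v n - hill_lambda_minus v n + (K + K') / 2) \<le> 10 * e * (cmod K + cmod K') + 3 * cmod \<kappa>"
proof -
  have B0: "B \<ge> 0" by (simp add: B_def)
  have "real n \<ge> 2" using n(1) B0 by argo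
  hence n2: "n \<ge> 2" by simp
  have nB: "2 * (cmod a + cmod b) \<le> real n" using n(1) B0 unfolding B_def by argo
  have nB': "2 * (cmod b + cmod a) \<le> real n" using nB by argo
  \<comment> \<open>The radius \<open>Z\<close> has to contain the Dirichlet shift, at most
    \<open>5 B\<close>, and every root of the characteristic equation, at most \<open>2 B\<close>,
    and to be at least \<open>1\<close> for the contractions.\<close>
  have Z1: "Z \<ge> 1" "2 * B \<le> Z" "5 * B \<le> Z" using Z B0 by simp_all
  have Zn: "Z \<le> real n" using n(2) Z1 by argo
  have zn: "cmod z \<le> real n" if "cmod z \<le> Z" for z using that Zn by linarith
  define A where "A z = hill_V a b R S (sol0 a b R S n z) 0" for z
  define P where "P z = hill_V a b R S (sol0 a b R S n z) (int n)" for z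
  define Q where "Q z = hill_V a b R S (soln a b R S n z) 0" for z
  have Qr: "Q z = hill_V b a S R (sol0 b a S R n z) (int n)" if "cmod z \<le> real n" for z
  proof -
    have "soln a b R S n z = (\<lambda>j. sol0 b a S R n z (int n - j))"
      by (rule ext) (rule soln_reflect[OF n2 nB that])
    thus ?thesis unfolding Q_def by (simp only: hill_V_reflect) simp
  qed
  have bA: "cmod (A z) \<le> e" "cmod (P z - K) \<le> e * cmod K" "cmod (Q z - K') \<le> e * cmod K'" if "cmod z \<le> Z" for z
    using bd that zn[OF that] by (auto simp: entry_bounds_def A_def P_def Qr)
  have LA: "cmod (A z - A w) \<le> e * cmod (z - w)" "cmod (P z - P w) \<le> e * cmod K * cmod (z - w)"
    "cmod (Q z - Q w) \<le> e * cmod K' * cmod (z - w)" if "cmod z \<le> Z" "cmod w \<le> Z" for z w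
    using bd that zn[OF that(1)] zn[OF that(2)] by (auto simp: entry_bounds_def A_def P_def Qr)
  define \<kappa> where "\<kappa> = csqrt (K * K')"
  have \<kappa>2: "\<kappa>\<^sup>2 = K * K'" by (simp add: \<kappa>_def)
  have \<kappa>n: "(cmod \<kappa>)\<^sup>2 = cmod K * cmod K'" by (metis \<kappa>2 norm_mult norm_power)
  have \<kappa>h: "cmod \<kappa> \<le> 1 / 2"
  proof (rule power2_le_imp_le)
    have "cmod K * cmod K' \<le> 1/2 * (1/2)" using K by (intro mult_mono) auto
    thus "(cmod \<kappa>)\<^sup>2 \<le> (1/2)\<^sup>2" unfolding \<kappa>n by (simp add: power2_eq_square)
  qed simp
  obtain z1 z2 where z12: "cmod z1 \<le> Z" "cmod z2 \<le> Z" "z1 \<noteq> z2"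
    and roots: "\<And>z. cmod z \<le> Z \<Longrightarrow> (A z - z)\<^sup>2 = P z * Q z \<longleftrightarrow> z = z1 \<or> z = z2"
    and diff: "cmod (z1 - z2 - 2 * \<kappa>) \<le> 9 * e * cmod \<kappa>"
    using perturbed_quadratic_roots[OF e Z1(1) K(1,2) \<kappa>2 \<kappa>h bA(1) LA(1) bA(2) LA(2) bA(3) LA(3)] by metis
  have PQ_ge: "cmod K \<le> 2 * cmod (P z)" "cmod K' \<le> 2 * cmod (Q z)" "P z \<noteq> 0" "Q z \<noteq> 0"
    and PQ_le: "cmod (P z) \<le> 2 * cmod K" "cmod (Q z) \<le> 2 * cmod K'" if z: "cmod z \<le> Z" for z
  proof -
    have h: "cmod L \<le> 2 * cmod f \<and> f \<noteq> 0 \<and> cmod f \<le> 2 * cmod L" if "cmod (f - L) \<le> e * cmod L" "L \<noteq> 0" for f L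
    proof -
      have "e * cmod L \<le> 1/100 * cmod L" using e by (intro mult_right_mono) auto
      moreover have "cmod L \<le> cmod f + cmod (f - L)" "cmod f \<le> cmod L + cmod (f - L)"
        using norm_triangle_ineq4[of f "f - L"] norm_triangle_ineq[of L "f - L"] by simp_all
      moreover have "cmod L > 0" using that(2) by simp
      ultimately have "cmod L \<le> 2 * cmod f" "cmod f > 0" "cmod f \<le> 2 * cmod L" using that(1) by argo+
      thus ?thesis by auto
    qed
    show "cmod K \<le> 2 * cmod (P z)" "cmod K' \<le> 2 * cmod (Q z)" "P z \<noteq> 0" "Q z \<noteq> 0"
      "cmod (P z) \<le> 2 * cmod K" "cmod (Q z) \<le> 2 * cmod K'"
      using h[OF bA(2)[OF z] K(1)] h[OF bA(3)[OF z] K(2)] by auto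
  qed
  have root_small: "cmod (A z - z) \<le> 2 * cmod \<kappa>" if z: "cmod z \<le> Z" "(A z - z)\<^sup>2 = P z * Q z" for z
  proof (rule power2_le_imp_le)
    have "(cmod (A z - z))\<^sup>2 = cmod (P z) * cmod (Q z)" by (metis z(2) norm_mult norm_power)
    also have "\<dots> \<le> (2 * cmod K) * (2 * cmod K')" using PQ_le[OF z(1)] by (intro mult_mono) auto
    finally show "(cmod (A z - z))\<^sup>2 \<le> (2 * cmod \<kappa>)\<^sup>2" by (simp add: power_mult_distrib \<kappa>n)
  qed simp
  have simple: "hill_mult (parity_bdry n) v ((of_nat n)\<^sup>2 + z) = 1" if z: "cmod z \<le> Z" "(A z - z)\<^sup>2 = P z * Q z" for z
    unfolding v_def
  proof (rule hill_mult_simple_root[OF n2 nB zn[OF z(1)]])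
    show "hill_V a b R S (sol0 a b R S n z) (int n) \<noteq> 0" "hill_V a b R S (soln a b R S n z) 0 \<noteq> 0"
      using PQ_ge(3,4)[OF z(1)] by (simp_all add: P_def Q_def)
    show "(hill_V a b R S (sol0 a b R S n z) 0 - z)\<^sup>2 =
      hill_V a b R S (sol0 a b R S n z) (int n) * hill_V a b R S (soln a b R S n z) 0"
      using z(2) by (simp add: A_def P_def Q_def)
    fix k l assume k: "red_sol a b R S n z (sol0 a b R S n z) k" "k 0 = 0" "k (int n) = 0"
      and l: "red_sol a b R S n z (soln a b R S n z) l" "l 0 = 0" "l (int n) = 0"
    have kb: "cmod (hill_V a b R S k 0) \<le> e" "cmod (hill_V a b R S k (int n)) \<le> e * cmod K"
      using bd(1) z(1) k unfolding entry_bounds_def by blast+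
    \<comment> \<open>Reflection turns the response to \<open>soln\<close> into a response to the
      \<open>sol0\<close> of the exchanged data, where the second family of entry bounds
      applies.\<close>
    define l' where "l' j = l (int n - j)" for j
    have "red_sol b a S R n z (\<lambda>j. soln a b R S n z (int n - j)) l'"
      unfolding l'_def[abs_def] by (rule red_sol_reflect[OF l(1)])
    moreover have "(\<lambda>j. soln a b R S n z (int n - j)) = sol0 b a S R n z"
      by (rule ext) (simp add: soln_reflect[OF n2 nB zn[OF z(1)]])
    ultimately have l'r: "red_sol b a S R n z (sol0 b a S R n z) l'" by simp
    have "l' 0 = 0" "l' (int n) = 0" using l by (simp_all add: l'_def)
    hence "cmod (hill_V b a S R l' 0) \<le> e" "cmod (hill_V b a S R l' (int n)) \<le> e * cmod K'"
      using bd(2) z(1) l'r unfolding entry_bounds_def by blast+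
    hence lb: "cmod (hill_V a b R S l (int n)) \<le> e" "cmod (hill_V a b R S l 0) \<le> e * cmod K'"
      unfolding l'_def[abs_def] hill_V_reflect by simp_all
    show "hill_V a b R S (sol0 a b R S n z) (int n) * hill_V a b R S (soln a b R S n z) 0 * (2 + hill_V a b R S k 0 + hill_V a b R S l (int n)) \<noteq>
      (hill_V a b R S (sol0 a b R S n z) 0 - z) * (hill_V a b R S (sol0 a b R S n z) (int n) * hill_V a b R S l 0 + hill_V a b R S (soln a b R S n z) 0 * hill_V a b R S k (int n))"
      unfolding P_def[symmetric] Q_def[symmetric] A_def[symmetric]
    proof
      assume eq: "P z * Q z * (2 + hill_V a b R S k 0 + hill_V a b R S l (int n)) =
        (A z - z) * (P z * hill_V a b R S l 0 + Q z * hill_V a b R S k (int n))"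
      define pq where "pq = cmod (P z) * cmod (Q z)"
      have pq: "pq > 0" using PQ_ge(3,4)[OF z(1)] by (simp add: pq_def)
      \<comment> \<open>The left side has modulus at least \<open>|P z| |Q z|\<close>. The right
        side has at most \<open>4 e\<close> times that, because \<open>|A z - z| \<le> 1\<close> and
        \<open>K\<close>, \<open>K'\<close> are at most twice \<open>|P z|\<close>,
        \<open>|Q z|\<close> in modulus.\<close>
      have "cmod (2 + hill_V a b R S k 0 + hill_V a b R S l (int n)) \<ge> 1"
      proof -
        have "2 = (2 + hill_V a b R S k 0 + hill_V a b R S l (int n)) - hill_V a b R S k 0 - hill_V a b R S l (int n)" by simp
        hence "cmod 2 \<le> cmod (2 + hill_V a b R S k 0 + hill_V a b R S l (int n)) + cmod (hill_V a b R S k 0) + cmod (hill_V a b R S l (int n))"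
          by (metis add_mono norm_triangle_le_diff order_refl)
        thus ?thesis using kb(1) lb(1) e by simp
      qed
      hence "pq * 1 \<le> pq * cmod (2 + hill_V a b R S k 0 + hill_V a b R S l (int n))" using pq by (intro mult_left_mono) auto
      also have "\<dots> = cmod (A z - z) * cmod (P z * hill_V a b R S l 0 + Q z * hill_V a b R S k (int n))"
        using arg_cong[OF eq, of cmod] by (simp add: norm_mult pq_def)
      also have "\<dots> \<le> 1 * (cmod (P z) * (e * cmod K') + cmod (Q z) * (e * cmod K))"
      proof (intro mult_mono)
        show "cmod (A z - z) \<le> 1" using root_small[OF z] \<kappa>h by simp
        show "cmod (P z * hill_V a b R S l 0 + Q z * hill_V a b R S k (int n)) \<le> cmod (P z) * (e * cmod K') + cmod (Q z) * (e * cmod K)"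
          using lb(2) kb(2) by (intro order_trans[OF norm_triangle_ineq] add_mono) (auto simp: norm_mult intro!: mult_left_mono)
      qed auto
      also have "\<dots> \<le> 1 * (cmod (P z) * (e * (2 * cmod (Q z))) + cmod (Q z) * (e * (2 * cmod (P z))))"
        using PQ_ge(1,2)[OF z(1)] e by (intro mult_left_mono add_mono) auto
      also have "\<dots> = 4 * e * pq" by (simp add: pq_def)
      also have "\<dots> \<le> 4 / 100 * pq" using e pq by (intro mult_right_mono) auto
      finally show False using pq by argo
    qed
  qed
  have disc: "(of_nat n)\<^sup>2 + z \<in> hill_disc n" if "cmod z \<le> Z" for z
    using that n(2) by (simp add: hill_disc_def)
  define l1 l2 where "l1 = (of_nat n)\<^sup>2 + z1" and "l2 = (of_nat n)\<^sup>2 + z2"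
  have mult: "hill_mult (parity_bdry n) v l = count {#l1, l2#} l" if l: "l \<in> hill_disc n" for l
  proof -
    define z where "z = l - (of_nat n)\<^sup>2"
    have lz: "l = (of_nat n)\<^sup>2 + z" by (simp add: z_def)
    have zc: "cmod z \<le> real n" using l by (simp add: hill_disc_def z_def)
    show ?thesis
    proof (cases "(A z - z)\<^sup>2 = P z * Q z")
      case False
      have "hill_mult (parity_bdry n) v l = 0"
        unfolding lz v_def by (rule hill_mult_not_root[OF n2 nB zc]) (use False in \<open>simp add: A_def P_def Q_def\<close>)
      moreover have "z \<noteq> z1" "z \<noteq> z2" using False roots z12 by auto
      ultimately show ?thesis by (simp add: lz l1_def l2_def)
    next
      case True
      \<comment> \<open>For a general \<open>z\<close> in the disc only \<open>|z| \<le> n\<close>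
        is known. The crude bound \<open>B\<close> for all entries already forces a root into
        \<open>|z| \<le> 2 B\<close>, where the fine estimates hold.\<close>
      have b: "cmod (A z) \<le> B" "cmod (P z) \<le> B" "cmod (Q z) \<le> B"
        unfolding A_def P_def Q_def B_def by (rule norm_hill_V_sol[OF n2 nB zc])+
      have "(cmod (A z - z))\<^sup>2 = cmod (P z) * cmod (Q z)" by (metis True norm_mult norm_power)
      also have "\<dots> \<le> B\<^sup>2" unfolding power2_eq_square using b B0 by (intro mult_mono) auto
      finally have "cmod (A z - z) \<le> B" by (rule power2_le_imp_le) (rule B0)
      hence "cmod z \<le> 2 * B" using b(1) norm_triangle_ineq4[of "A z" "A z - z"] by simp
      hence zZ: "cmod z \<le> Z" using Z1 by linarith
      have "z = z1 \<or> z = z2" using roots[OF zZ] True by simp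
      moreover have "hill_mult (parity_bdry n) v l = 1" unfolding lz by (rule simple[OF zZ True])
      ultimately show ?thesis using z12(3) by (auto simp: lz l1_def l2_def)
    qed
  qed
  have lam: "(hill_lambda_minus v n = l1 \<and> hill_lambda_plus v n = l2) \<or> (hill_lambda_minus v n = l2 \<and> hill_lambda_plus v n = l1)"
    by (rule hill_lambda_eqI) (use disc z12 mult in \<open>auto simp: l1_def l2_def\<close>)
  have vB: "continuous_on {0..pi} v" "\<forall>x\<in>{0..pi}. cmod (v x) \<le> B"
    unfolding v_def B_def by (auto intro!: continuous_intros norm_potential_le)
  have n3: "real n \<ge> 1 + 30000 * B" using n(1) by argo
  obtain \<zeta> w where \<zeta>: "cmod \<zeta> \<le> 5 * B" "hill_mu v n = (of_nat n)\<^sup>2 + \<zeta>"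
    and w: "w \<in> hill_dom Dirichlet" "hill_op v w = (\<lambda>x. ((of_nat n)\<^sup>2 + \<zeta>) * w x)"
      "\<forall>x\<in>{0..pi}. cmod (w x - sn n x) \<le> 30 * B / real n"
    using Dirichlet_eigenvalue_in_disc[OF vB n3] by blast
  have \<zeta>Z: "cmod \<zeta> \<le> Z" using \<zeta>(1) Z1 by linarith
  note \<zeta>n = zn[OF \<zeta>Z]
  have w3: "\<forall>x\<in>{0..pi}. cmod (w x - sn n x) \<le> e" using w(3) n(3) by (meson order_trans)
  have wc: "continuous_on {0..pi} w" using w(1) by (auto simp: hill_dom_def intro: C2_0piD(3))
  have n0: "n > 0" using n2 by simp
  have h0: "cmod (hsum n (sol0 a b R S n \<zeta>) 0 - 1) \<le> e"
  proof -
    note c = sol0[OF n2 nB \<zeta>n, where R = R and S = S]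
    have "cmod (hsum n (sol0 a b R S n \<zeta>) 0 - (sol0 a b R S n \<zeta> 0 + sol0 a b R S n \<zeta> (int n))) \<le> 2 * (cmod a + cmod b) * T"
      by (rule hsum_at_0[OF n2 nB \<zeta>n c(1) _ _ T]) (simp_all add: c)
    also have "\<dots> \<le> e" using n(4) by (simp only: B_def)
    finally show ?thesis by (simp add: c)
  qed
  have hn: "cmod (hsum n (soln a b R S n \<zeta>) 0 - 1) \<le> e"
  proof -
    note c = soln[OF n2 nB \<zeta>n, where R = R and S = S]
    have "cmod (hsum n (soln a b R S n \<zeta>) 0 - (soln a b R S n \<zeta> 0 + soln a b R S n \<zeta> (int n))) \<le> 2 * (cmod a + cmod b) * T"
      by (rule hsum_at_0[OF n2 nB \<zeta>n c(1) _ _ T]) (simp_all add: c)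
    also have "\<dots> \<le> e" using n(4) by (simp only: B_def)
    finally show ?thesis by (simp add: c)
  qed
  have est: "cmod ((A \<zeta> - \<zeta>) - (P \<zeta> + Q \<zeta>) / 2) \<le> 6 * e * (cmod (P \<zeta>) + cmod (Q \<zeta>))"
  proof (rule resonant_equation_estimate[OF _ _ _ h0 hn integral_hmode_near_sn[OF n0 wc w3]])
    show "(A \<zeta> - \<zeta>) * (integral {0..pi} (\<lambda>x. hmode n 0 x * w x) * hsum n (soln a b R S n \<zeta>) 0 -
        integral {0..pi} (\<lambda>x. hmode n (int n) x * w x) * hsum n (sol0 a b R S n \<zeta>) 0) +
      P \<zeta> * integral {0..pi} (\<lambda>x. hmode n (int n) x * w x) * hsum n (soln a b R S n \<zeta>) 0 -
      Q \<zeta> * integral {0..pi} (\<lambda>x. hmode n 0 x * w x) * hsum n (sol0 a b R S n \<zeta>) 0 = 0"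
      unfolding A_def P_def Q_def
      by (rule Dirichlet_resonant_equation[OF n2 nB \<zeta>n w(1) w(2)[unfolded v_def]])
  qed (use e in auto)
  define s where "s = cmod K + cmod K'"
  have s0: "s \<ge> 0" by (simp add: s_def)
  have est2: "cmod ((A \<zeta> - \<zeta>) - (K + K') / 2) \<le> 8 * e * s"
  proof -
    have PK: "cmod (P \<zeta> - K) \<le> e * cmod K" "cmod (Q \<zeta> - K') \<le> e * cmod K'" using bA[OF \<zeta>Z] by auto
    have "cmod (P \<zeta>) \<le> (1 + e) * cmod K" "cmod (Q \<zeta>) \<le> (1 + e) * cmod K'"
      using PK norm_triangle_ineq[of K "P \<zeta> - K"] norm_triangle_ineq[of K' "Q \<zeta> - K'"] by (simp_all add: distrib_right)
    hence "cmod (P \<zeta>) + cmod (Q \<zeta>) \<le> (1 + e) * s" by (simp add: s_def distrib_left)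
    also have "\<dots> \<le> 101/100 * s" using e s0 by (intro mult_right_mono) auto
    finally have "6 * e * (cmod (P \<zeta>) + cmod (Q \<zeta>)) \<le> 6 * e * (101/100 * s)" using e by (intro mult_left_mono) auto
    moreover have "(A \<zeta> - \<zeta>) - (K + K') / 2 = ((A \<zeta> - \<zeta>) - (P \<zeta> + Q \<zeta>) / 2) + (P \<zeta> - K) / 2 + (Q \<zeta> - K') / 2"
      by (simp add: add_divide_distrib diff_divide_distrib)
    hence "cmod ((A \<zeta> - \<zeta>) - (K + K') / 2) \<le> cmod ((A \<zeta> - \<zeta>) - (P \<zeta> + Q \<zeta>) / 2) + cmod (P \<zeta> - K) / 2 + cmod (Q \<zeta> - K') / 2"
      by (simp only: norm_divide[symmetric] norm_numeral[symmetric, where 'a = complex]) (intro order_trans[OF norm_triangle_ineq] add_mono order_refl)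
    moreover have "e * s = e * cmod K + e * cmod K'" by (simp add: s_def distrib_left)
    moreover have "e * s \<ge> 0" using e s0 by simp
    ultimately show ?thesis using est PK by argo
  qed
  \<comment> \<open>The diagonal entry enters only through \<open>A \<zeta> - A z\<close>, at most
    \<open>e |\<zeta> - z|\<close>, so it drops out even though it may be large compared with
    \<open>K + K'\<close>.\<close>
  have final: "cmod (hill_mu v n - ((of_nat n)\<^sup>2 + z) + (K + K') / 2) \<le> 10 * e * s + 3 * cmod \<kappa>"
    if z: "cmod z \<le> Z" "(A z - z)\<^sup>2 = P z * Q z" for z
  proof -
    define X where "X = \<zeta> - z"
    have "X + (K + K') / 2 = (A \<zeta> - A z) - ((A \<zeta> - \<zeta>) - (K + K') / 2) + (A z - z)"
      by (simp add: X_def)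
    hence "cmod (X + (K + K') / 2) \<le> cmod (A \<zeta> - A z) + cmod ((A \<zeta> - \<zeta>) - (K + K') / 2) + cmod (A z - z)"
      by (simp only:) (intro order_trans[OF norm_triangle_ineq] add_mono norm_triangle_ineq4 order_refl)
    hence 1: "cmod (X + (K + K') / 2) \<le> e * cmod X + 8 * e * s + 2 * cmod \<kappa>"
      using LA(1)[OF \<zeta>Z z(1)] est2 root_small[OF z] by (simp add: X_def)
    have "cmod X \<le> cmod (X + (K + K') / 2) + cmod ((K + K') / 2)"
      using norm_triangle_ineq4[of "X + (K + K') / 2" "(K + K') / 2"] by simp
    moreover have "cmod ((K + K') / 2) \<le> s / 2"
      using norm_triangle_ineq[of K K'] by (simp add: s_def norm_divide)
    moreover have "e * cmod X \<le> 1/100 * cmod X" using e by (intro mult_right_mono) auto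
    moreover have "8 * e * s \<le> 8/100 * s" using e s0 by (intro mult_right_mono) auto
    moreover have "cmod X \<ge> 0" "cmod \<kappa> \<ge> 0" by auto
    ultimately have "cmod X \<le> s + 3 * cmod \<kappa>" using 1 s0 by argo
    hence "e * cmod X \<le> e * (s + 3 * cmod \<kappa>)" using e by (intro mult_left_mono) auto
    also have "\<dots> = e * s + 3 * (e * cmod \<kappa>)" by (simp add: distrib_left)
    finally have "e * cmod X \<le> e * s + 3 * (e * cmod \<kappa>)" .
    moreover have "e * cmod \<kappa> \<le> 1/100 * cmod \<kappa>" using e by (intro mult_right_mono) auto
    moreover have "e * s \<ge> 0" using e s0 by simp
    moreover have "cmod \<kappa> \<ge> 0" by simp
    ultimately have "cmod (X + (K + K') / 2) \<le> 10 * e * s + 3 * cmod \<kappa>" using 1 by argo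
    thus ?thesis by (simp add: \<zeta>(2) X_def)
  qed
  have f1: "cmod (hill_mu v n - l1 + (K + K') / 2) \<le> 10 * e * s + 3 * cmod \<kappa>"
    unfolding l1_def by (rule final) (use z12 roots in auto)
  have f2: "cmod (hill_mu v n - l2 + (K + K') / 2) \<le> 10 * e * s + 3 * cmod \<kappa>"
    unfolding l2_def by (rule final) (use z12 roots in auto)
  \<comment> \<open>Exchanging the roles of the two roots replaces \<open>\<kappa>\<close> by
    \<open>- \<kappa>\<close>, which is why the conclusion only asserts some square root of
    \<open>K * K'\<close>.\<close>
  from lam show ?thesis
  proof
    assume h: "hill_lambda_minus v n = l1 \<and> hill_lambda_plus v n = l2"
    have "hill_gamma v n - 2 * (- \<kappa>) = - (z1 - z2 - 2 * \<kappa>)" using h by (simp add: hill_gamma_def l1_def l2_def)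
    hence "cmod (hill_gamma v n - 2 * (- \<kappa>)) \<le> 9 * e * cmod (- \<kappa>)" using diff by (simp only: norm_minus_cancel)
    thus ?thesis using h f1 f2 \<kappa>2 by (intro exI[of _ "- \<kappa>"]) (simp add: s_def)
  next
    assume h: "hill_lambda_minus v n = l2 \<and> hill_lambda_plus v n = l1"
    have "hill_gamma v n - 2 * \<kappa> = z1 - z2 - 2 * \<kappa>" using h by (simp add: hill_gamma_def l1_def l2_def)
    hence "cmod (hill_gamma v n - 2 * \<kappa>) \<le> 9 * e * cmod \<kappa>" using diff by simp
    thus ?thesis using h f1 f2 \<kappa>2 by (intro exI[of _ \<kappa>]) (simp add: s_def)
  qed
qed

section \<open>Asymptotics\<close>

lemma hill_K_nonzero: "b \<noteq> 0 \<Longrightarrow> S > 0 \<Longrightarrow> hill_K b S M \<noteq> 0"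
  by (simp add: hill_K_def)

lemma norm_hill_K: "cmod (hill_K b S M) = cmod b ^ M / ((4 * (real S)\<^sup>2) ^ (M - 1) * (fact (M - 1))\<^sup>2)"
  by (simp add: hill_K_def norm_divide norm_mult norm_power)

lemma power_over_fact_LIMSEQ: "(\<lambda>n. x ^ n / fact n) \<longlonglongrightarrow> (0::real)"
  using summable_LIMSEQ_zero[OF summable_exp[of x]] by (simp add: field_simps)

lemma hill_K_LIMSEQ:
  assumes "S > 0"
  shows "(\<lambda>M. cmod (hill_K b S M)) \<longlonglongrightarrow> 0"
proof (rule tendsto_sandwich[of "\<lambda>_. 0" _ _ "\<lambda>M. cmod b * (cmod b ^ (M - 1) / fact (M - 1))"])
  show "\<forall>\<^sub>F M in sequentially. 0 \<le> cmod (hill_K b S M)" by simp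
  show "\<forall>\<^sub>F M in sequentially. cmod (hill_K b S M) \<le> cmod b * (cmod b ^ (M - 1) / fact (M - 1))"
    using eventually_gt_at_top[of 0]
  proof eventually_elim
    case (elim M)
    have S1: "1 \<le> 4 * (real S)\<^sup>2"
    proof -
      have "1 \<le> real S ^ 2" using assms by (intro one_le_power) simp
      thus ?thesis by simp
    qed
    have f1: "1 \<le> (fact (M - 1) :: real)" by (rule fact_ge_1)
    have "1 * fact (M - 1) \<le> (4 * (real S)\<^sup>2) ^ (M - 1) * (fact (M - 1))\<^sup>2"
      unfolding power2_eq_square[of "fact (M - 1) :: real"] using one_le_power[OF S1, of "M - 1"] f1
      by (intro mult_mono) (auto simp: mult_le_cancel_left1)
    hence X: "cmod b ^ M / ((4 * (real S)\<^sup>2) ^ (M - 1) * (fact (M - 1))\<^sup>2) \<le> cmod b ^ M / fact (M - 1)"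
      by (intro divide_left_mono) (auto intro!: mult_pos_pos simp: assms)
    have Y: "cmod b ^ M / fact (M - 1) = cmod b * (cmod b ^ (M - 1) / fact (M - 1))"
      using elim by (cases M) auto
    show ?case unfolding norm_hill_K using X unfolding Y .
  qed
  have "(\<lambda>M. cmod b ^ (M - 1) / fact (M - 1)) \<longlonglongrightarrow> (0::real)"
    by (rule filterlim_compose[OF power_over_fact_LIMSEQ filterlim_minus_const_nat_at_top])
  thus "(\<lambda>M. cmod b * (cmod b ^ (M - 1) / fact (M - 1))) \<longlonglongrightarrow> 0"
    using tendsto_mult_right_zero by blast
qed simp

text \<open>The entry with the longer chain is superexponentially smaller, because of the factorials.\<close>

lemma hill_K_dominated:
  assumes ab: "b \<noteq> 0" and RS: "R > 0" "S > 0" and rs: "0 < r" "r < s" and c: "c > 0"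
  shows "\<forall>\<^sub>F m in sequentially. cmod (hill_K a R (s * m)) \<le> c * cmod (hill_K b S (r * m))"
proof -
  define x y where "x = 4 * (real S)\<^sup>2" and "y = 4 * (real R)\<^sup>2"
  have xy: "x > 0" "y > 0" using RS by (auto simp: x_def y_def)
  \<comment> \<open>\<open>q\<close> is the exponential rate of the quotient of the two moduli with
    the factorials left out.\<close>
  define q where "q = cmod a ^ s * x ^ r / (cmod b ^ r * y ^ s)"
  have q0: "q \<ge> 0" using xy by (simp add: q_def)
  have "(\<lambda>m. (y / x) * (q ^ m / fact m)) \<longlonglongrightarrow> (y / x) * 0"
    by (intro tendsto_mult tendsto_const power_over_fact_LIMSEQ)
  hence "\<forall>\<^sub>F m in sequentially. (y / x) * (q ^ m / fact m) < c"
    using c by (intro order_tendstoD(2)) auto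
  thus ?thesis using eventually_gt_at_top[of 0]
  proof eventually_elim
    case (elim m)
    have rm: "r * m > 0" "s * m > 0" using rs elim by auto
    \<comment> \<open>From \<open>r < s\<close> the longer chain has at least \<open>m\<close> more
      steps, so its factorial contains an extra \<open>fact m\<close>, which outgrows
      \<open>q ^ m\<close>.\<close>
    have le: "r * m - 1 + m \<le> s * m - 1"
    proof -
      have "(r + 1) * m \<le> s * m" using rs by (intro mult_right_mono) auto
      hence "r * m + m \<le> s * m" by (simp add: algebra_simps)
      thus ?thesis using rm by linarith
    qed
    have "(fact (r * m - 1) * fact m :: nat) \<le> fact (r * m - 1 + m)"
      by (rule dvd_imp_le[OF fact_fact_dvd_fact]) simp
    also have "\<dots> \<le> fact (s * m - 1)" by (rule fact_mono[OF le])
    finally have "real (fact (r * m - 1) * fact m) \<le> real (fact (s * m - 1))" by (simp only: of_nat_le_iff)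
    hence f: "fact (r * m - 1) * fact m \<le> (fact (s * m - 1) :: real)" by simp
    have "(fact (r * m - 1))\<^sup>2 * fact m \<le> ((fact (r * m - 1) * fact m)\<^sup>2 :: real)"
    proof -
      have "(fact m :: real) * 1 \<le> fact m * fact m" by (intro mult_left_mono fact_ge_1) auto
      hence "(fact (r * m - 1))\<^sup>2 * (fact m :: real) \<le> (fact (r * m - 1))\<^sup>2 * (fact m * fact m)"
        by (intro mult_left_mono) auto
      thus ?thesis by (simp only: power_mult_distrib power2_eq_square[of "fact m"])
    qed
    also have "\<dots> \<le> (fact (s * m - 1) :: real)\<^sup>2" using f by (intro power_mono) auto
    finally have f2: "(fact (r * m - 1))\<^sup>2 * fact m \<le> (fact (s * m - 1) :: real)\<^sup>2" .
    have b0: "cmod b > 0" using ab by simp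
    have px: "x ^ (r * m) = x * x ^ (r * m - 1)" "y ^ (s * m) = y * y ^ (s * m - 1)"
      using rm by (simp_all flip: power_Suc)
    have "cmod (hill_K a R (s * m)) = cmod a ^ (s * m) / (y ^ (s * m - 1) * (fact (s * m - 1))\<^sup>2)"
      by (simp add: norm_hill_K y_def)
    also have "\<dots> \<le> cmod a ^ (s * m) / (y ^ (s * m - 1) * ((fact (r * m - 1))\<^sup>2 * fact m))"
      using f2 xy by (intro divide_left_mono mult_left_mono) (auto intro!: mult_pos_pos)
    also have "\<dots> = (y / x) * (q ^ m / fact m) * (cmod b ^ (r * m) / (x ^ (r * m - 1) * (fact (r * m - 1))\<^sup>2))"
    proof -
      have "q ^ m = cmod a ^ (s * m) * x ^ (r * m) / (cmod b ^ (r * m) * y ^ (s * m))"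
        by (simp add: q_def power_divide power_mult_distrib power_mult)
      thus ?thesis unfolding px using xy b0 by (simp add: field_simps)
    qed
    also have "\<dots> \<le> c * (cmod b ^ (r * m) / (x ^ (r * m - 1) * (fact (r * m - 1))\<^sup>2))"
      using elim(1) xy by (intro mult_right_mono) auto
    also have "\<dots> = c * cmod (hill_K b S (r * m))" by (simp add: norm_hill_K x_def)
    finally show ?case .
  qed
qed

lemma asymp_equiv_relative_error:
  fixes f g :: "nat \<Rightarrow> complex"
  assumes C: "C > 0" and "\<And>e. 0 < e \<Longrightarrow> e \<le> 1 / 100 \<Longrightarrow> \<forall>\<^sub>F m in sequentially. cmod (f m - g m) \<le> C * e * cmod (g m)"
  shows "f \<sim>[sequentially] g"
proof (rule smallo_imp_asymp_equiv)
  show "(\<lambda>m. f m - g m) \<in> o[sequentially](g)"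
  proof (rule landau_o.smallI)
    fix c :: real assume c: "c > 0"
    define e where "e = min (1 / 100) (c / C)"
    have e: "0 < e" using c C by (simp add: e_def)
    have e': "e \<le> 1 / 100" unfolding e_def by (rule min.cobounded1)
    have "C * e \<le> C * (c / C)" using C by (intro mult_left_mono) (auto simp: e_def)
    hence "C * e \<le> c" using C by simp
    thus "\<forall>\<^sub>F m in sequentially. cmod (f m - g m) \<le> c * cmod (g m)"
      using assms(2)[OF e e'] by (elim eventually_mono) (rule order_trans, assumption, intro mult_right_mono norm_ge_zero)
  qed
qed

text \<open>The hypothesis prevents cancellation: \<open>|p + q|^2\<close> is at least
  \<open>(|p| - |q|)^2 = |p|^2 + |q|^2 - 2 |p| |q|\<close>, and the difference of
  \<open>|p|^2\<close> and \<open>|q|^2\<close> has at least that modulus too. For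
  \<open>e \<le> 1 / 100\<close> this is at least 98 percent of the sum of squares, more than the
  half that is claimed.\<close>

lemma square_sum_lower:
  fixes p q :: complex
  assumes e: "e \<le> 1 / 100" and pq: "cmod p * cmod q \<le> e * ((cmod p)\<^sup>2 + (cmod q)\<^sup>2)"
  shows "(cmod p)\<^sup>2 + (cmod q)\<^sup>2 \<le> 2 * cmod ((p + q)\<^sup>2)"
    and "(cmod p)\<^sup>2 + (cmod q)\<^sup>2 \<le> 2 * cmod (p\<^sup>2 + q\<^sup>2)"
proof -
  define x y where "x = cmod p" and "y = cmod q"
  have xy: "x \<ge> 0" "y \<ge> 0" by (auto simp: x_def y_def)
  have h: "x * y \<le> 1 / 100 * (x\<^sup>2 + y\<^sup>2)"
  proof -
    have "e * (x\<^sup>2 + y\<^sup>2) \<le> 1 / 100 * (x\<^sup>2 + y\<^sup>2)" using e by (intro mult_right_mono) auto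
    thus ?thesis using pq unfolding x_def y_def by (rule order_trans[rotated])
  qed
  have "\<bar>x - y\<bar> \<le> cmod (p + q)"
    using norm_triangle_ineq3[of p "- q"] by (simp add: x_def y_def)
  hence "\<bar>x - y\<bar>\<^sup>2 \<le> (cmod (p + q))\<^sup>2" by (intro power_mono) auto
  moreover have "\<bar>x - y\<bar>\<^sup>2 = x\<^sup>2 + y\<^sup>2 - 2 * (x * y)" by (simp add: power2_diff)
  ultimately have "x\<^sup>2 + y\<^sup>2 - 2 * (x * y) \<le> cmod ((p + q)\<^sup>2)" by (simp only: norm_power)
  thus "(cmod p)\<^sup>2 + (cmod q)\<^sup>2 \<le> 2 * cmod ((p + q)\<^sup>2)"
    unfolding x_def[symmetric] y_def[symmetric] using h norm_ge_zero[of "(p + q)\<^sup>2"] norm_ge_zero[of "p\<^sup>2 + q\<^sup>2"] by argo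
  have "\<bar>x\<^sup>2 - y\<^sup>2\<bar> \<le> cmod (p\<^sup>2 + q\<^sup>2)"
    using norm_triangle_ineq3[of "p\<^sup>2" "- (q\<^sup>2)"] by (simp add: x_def y_def norm_power)
  moreover have "x\<^sup>2 + y\<^sup>2 - 2 * (x * y) \<le> \<bar>x\<^sup>2 - y\<^sup>2\<bar>"
  proof (cases "x \<le> y")
    case True
    hence "x * x \<le> x * y" using xy by (intro mult_left_mono) auto
    moreover have "x * x \<le> y * y" using True xy by (intro mult_mono) auto
    ultimately show ?thesis by (simp add: power2_eq_square)
  next
    case False
    hence "y * y \<le> x * y" using xy by (intro mult_right_mono) auto
    moreover have "y * y \<le> x * x" using False xy by (intro mult_mono) auto
    ultimately show ?thesis by (simp add: power2_eq_square)
  qed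
  ultimately show "(cmod p)\<^sup>2 + (cmod q)\<^sup>2 \<le> 2 * cmod (p\<^sup>2 + q\<^sup>2)"
    unfolding x_def[symmetric] y_def[symmetric] using h norm_ge_zero[of "(p + q)\<^sup>2"] norm_ge_zero[of "p\<^sup>2 + q\<^sup>2"] by argo
qed

lemma eventually_eigenvalue_estimates:
  fixes a b :: complex and R S d r s :: nat
  assumes ab: "a \<noteq> 0" "b \<noteq> 0" and pos: "d > 0" "r > 0" "s > 0" and RS: "R = d * r" "S = d * s"
    and e: "0 < e" "e \<le> 1 / 100"
  defines "v \<equiv> two_term_potential a b R S"
  shows "\<forall>\<^sub>F m in sequentially. \<exists>\<kappa>. \<kappa>\<^sup>2 = hill_K b S (r * m) * hill_K a R (s * m) \<and>
    cmod (hill_gamma v (m * d * s * r) - 2 * \<kappa>) \<le> 9 * e * cmod \<kappa> \<and>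
    cmod (hill_mu v (m * d * s * r) - hill_lambda_plus v (m * d * s * r) + (hill_K b S (r * m) + hill_K a R (s * m)) / 2) \<le>
      10 * e * (cmod (hill_K b S (r * m)) + cmod (hill_K a R (s * m))) + 3 * cmod \<kappa> \<and>
    cmod (hill_mu v (m * d * s * r) - hill_lambda_minus v (m * d * s * r) + (hill_K b S (r * m) + hill_K a R (s * m)) / 2) \<le>
      10 * e * (cmod (hill_K b S (r * m)) + cmod (hill_K a R (s * m))) + 3 * cmod \<kappa>"
proof -
  have RS0: "R > 0" "S > 0" using pos RS by auto
  define B where "B = cmod a + cmod b"
  have B0: "B \<ge> 0" by (simp add: B_def)
  obtain T where T: "T > 0" "\<And>n A. n \<ge> 1 \<Longrightarrow> finite A \<Longrightarrow> 0 \<notin> A \<Longrightarrow> int n \<notin> A \<Longrightarrow>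
     (\<Sum>j\<in>A. 1 / \<bar>real_of_int (gap n j)\<bar>) \<le> T / sqrt (real n)"
    using sum_inverse_gap_bound by blast
  have sub: "filterlim (\<lambda>m. k * m) sequentially sequentially" if "k > 0" for k :: nat
    using that by (intro filterlim_subseq) (auto simp: strict_mono_def)
  define N where "N m = m * d * s * r" for m
  \<comment> \<open>The same \<open>n\<close> is covered by \<open>r m\<close> steps of length
    \<open>S\<close> and by \<open>s m\<close> steps of length \<open>R\<close>; these are the
    lengths of the two chains.\<close>
  have N1: "S * (r * m) = N m" "R * (s * m) = N m" for m by (simp_all add: N_def RS)
  have Nlim: "filterlim (\<lambda>m. real (N m)) at_top sequentially"
  proof -
    have "filterlim (\<lambda>m. N m) sequentially sequentially"
      using sub[of "d * s * r"] pos by (simp add: N_def[abs_def] mult_ac)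
    thus ?thesis by (rule filterlim_compose[OF filterlim_real_sequentially])
  qed
  have Z0: "1 + 5 * B \<ge> 0" using B0 by simp
  have e1: "\<forall>\<^sub>F m in sequentially. entry_bounds a b R S (N m) (1 + 5 * B) e (hill_K b S (r * m))"
    using eventually_compose_filterlim[OF eventually_entry_bounds[OF ab(2) RS0 Z0 e(1), of a] sub[OF pos(2)]]
    by (simp only: N1)
  have e2: "\<forall>\<^sub>F m in sequentially. entry_bounds b a S R (N m) (1 + 5 * B) e (hill_K a R (s * m))"
    using eventually_compose_filterlim[OF eventually_entry_bounds[OF ab(1) RS0(2,1) Z0 e(1), of b] sub[OF pos(3)]]
    by (simp only: N1)
  have e3: "\<forall>\<^sub>F m in sequentially. cmod (hill_K b S (r * m)) < 1 / 2"
    using filterlim_compose[OF hill_K_LIMSEQ[OF RS0(2)] sub[OF pos(2)]] by (rule order_tendstoD) simp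
  have e4: "\<forall>\<^sub>F m in sequentially. cmod (hill_K a R (s * m)) < 1 / 2"
    using filterlim_compose[OF hill_K_LIMSEQ[OF RS0(1)] sub[OF pos(3)]] by (rule order_tendstoD) simp
  have e5: "\<forall>\<^sub>F m in sequentially. 2 + 30000 * B \<le> real (N m)" "\<forall>\<^sub>F m in sequentially. 4 * (1 + 5 * B) + 1 \<le> real (N m)"
    using Nlim by (auto simp: filterlim_at_top)
  have "(\<lambda>m. 30 * B / real (N m)) \<longlonglongrightarrow> 0"
    by (intro tendsto_divide_0[OF tendsto_const] filterlim_at_top_imp_at_infinity Nlim)
  hence e6: "\<forall>\<^sub>F m in sequentially. 30 * B / real (N m) < e" using e by (intro order_tendstoD)
  have "(\<lambda>m. 2 * B * (T / sqrt (real (N m)))) \<longlonglongrightarrow> 2 * B * 0"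
    by (intro tendsto_mult tendsto_const tendsto_divide_0[OF tendsto_const] filterlim_at_top_imp_at_infinity
        filterlim_compose[OF sqrt_at_top Nlim])
  hence e7: "\<forall>\<^sub>F m in sequentially. 2 * B * (T / sqrt (real (N m))) < e" using e by (intro order_tendstoD) auto
  show ?thesis using e1 e2 e3 e4 e5 e6 e7
  proof eventually_elim
    case (elim m)
    have n1: "N m \<ge> 1"
    proof -
      have "real (N m) > 0" using elim(5) B0 by argo
      thus ?thesis by simp
    qed
    have zn: "1 + 5 * B < real (N m) / 4" using elim(6) by argo
    show ?case unfolding v_def N_def[symmetric]
      using eigenvalue_estimates[OF e, of "1 + 5 * B" a b "N m" "T / sqrt (real (N m))" R S "hill_K b S (r * m)" "hill_K a R (s * m)",
          folded B_def, OF refl T(2)[OF n1] elim(5) zn less_imp_le[OF elim(7)] less_imp_le[OF elim(8)] elim(1,2)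
          hill_K_nonzero[OF ab(2) RS0(2)] hill_K_nonzero[OF ab(1) RS0(1)] less_imp_le[OF elim(3)] less_imp_le[OF elim(4)]] .
  qed
qed

text \<open>Identifies the bracketed terms of the asymptotic formulas with square roots of the
  leading terms: the factor in front cancels one power in the denominator, which leaves the exponent
  \<open>M - 1\<close>.\<close>

lemma hill_K_root:
  fixes w :: complex
  assumes "M > 0" "S > 0" "w\<^sup>2 = b ^ M"
  shows "(2 * of_nat S * w / ((2 * of_nat S) ^ M * fact (M - 1)))\<^sup>2 = hill_K b S M"
    and "4 * (of_nat S)\<^sup>2 * b ^ M / ((4 * (of_nat S)\<^sup>2) ^ M * (fact (M - 1))\<^sup>2) = hill_K b S M"
proof -
  obtain k where k: "M = Suc k" using assms(1) by (cases M) auto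
  have x: "of_nat S \<noteq> (0 :: complex)" using assms by simp
  show E: "4 * (of_nat S)\<^sup>2 * b ^ M / ((4 * (of_nat S)\<^sup>2) ^ M * (fact (M - 1))\<^sup>2) = hill_K b S M"
    using x by (simp add: hill_K_def k)
  have "(2 * of_nat S * w / ((2 * of_nat S) ^ M * fact (M - 1)))\<^sup>2
      = (2 * of_nat S)\<^sup>2 * w\<^sup>2 / (((2 * of_nat S)\<^sup>2) ^ M * (fact (M - 1))\<^sup>2)"
    by (simp only: power_divide power_mult_distrib power_mult[symmetric] mult.commute[of M 2])
  also have "\<dots> = hill_K b S M" unfolding E[symmetric] assms(3) by (simp only: power_mult_distrib) simp
  finally show "(2 * of_nat S * w / ((2 * of_nat S) ^ M * fact (M - 1)))\<^sup>2 = hill_K b S M" .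
qed

text \<open>Domination is used with the constant \<open>e^2\<close>, since its square root
  \<open>e\<close> is what compares the moduli of \<open>p\<close> and \<open>q\<close>. Which of
  the two dominates depends on the order of \<open>r\<close> and \<open>s\<close>.\<close>

lemma eventually_product_small:
  fixes a b :: complex
  assumes ab: "a \<noteq> 0" "b \<noteq> 0" and RS: "R > 0" "S > 0" and rs: "r > 0" "s > 0" "r \<noteq> s" and e: "e > 0"
  shows "\<forall>\<^sub>F m in sequentially. \<forall>p q. p\<^sup>2 = hill_K b S (r * m) \<longrightarrow> q\<^sup>2 = hill_K a R (s * m) \<longrightarrow>
    cmod p * cmod q \<le> e * ((cmod p)\<^sup>2 + (cmod q)\<^sup>2)"
proof -
  have aux: "cmod p * cmod q \<le> e * (cmod p)\<^sup>2" if "(cmod q)\<^sup>2 \<le> e\<^sup>2 * (cmod p)\<^sup>2" for p q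
  proof -
    have "(cmod q)\<^sup>2 \<le> (e * cmod p)\<^sup>2" using that by (simp only: power_mult_distrib)
    hence "cmod q \<le> e * cmod p" by (rule power2_le_imp_le) (use e in auto)
    hence "cmod p * cmod q \<le> cmod p * (e * cmod p)" by (intro mult_left_mono) auto
    also have "\<dots> = e * (cmod p)\<^sup>2" by (simp only: power2_eq_square mult_ac)
    finally show ?thesis .
  qed
  have e2: "e\<^sup>2 > 0" using e by simp
  consider "r < s" | "s < r" using rs by linarith
  thus ?thesis
  proof cases
    case 1
    show ?thesis using hill_K_dominated[OF ab(2) RS rs(1) 1 e2, of a]
    proof eventually_elim
      case (elim m)
      show ?case
      proof (intro allI impI)
        fix p q assume "p\<^sup>2 = hill_K b S (r * m)" "q\<^sup>2 = hill_K a R (s * m)"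
        hence "(cmod q)\<^sup>2 \<le> e\<^sup>2 * (cmod p)\<^sup>2" using elim by (simp only: norm_power[symmetric])
        from aux[OF this] show "cmod p * cmod q \<le> e * ((cmod p)\<^sup>2 + (cmod q)\<^sup>2)"
          by (rule order_trans) (use e in \<open>intro mult_left_mono; simp\<close>)
      qed
    qed
  next
    case 2
    show ?thesis using hill_K_dominated[OF ab(1) RS(2,1) rs(2) 2 e2, of b]
    proof eventually_elim
      case (elim m)
      show ?case
      proof (intro allI impI)
        fix p q assume "p\<^sup>2 = hill_K b S (r * m)" "q\<^sup>2 = hill_K a R (s * m)"
        hence "(cmod p)\<^sup>2 \<le> e\<^sup>2 * (cmod q)\<^sup>2" using elim by (simp only: norm_power[symmetric])
        from aux[OF this] show "cmod p * cmod q \<le> e * ((cmod p)\<^sup>2 + (cmod q)\<^sup>2)"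
          unfolding mult.commute[of "cmod p" "cmod q"]
          by (rule order_trans) (use e in \<open>intro mult_left_mono; simp\<close>)
      qed
    qed
  qed
qed

text \<open>As \<open>\<kappa>\<close> is \<open>p q\<close> up to sign, its modulus is itself at
  most \<open>e\<close> times the sum of squares, and so is the cross term that separates
  \<open>(p + q)^2 / 2\<close> from \<open>(p^2 + q^2) / 2\<close>. The errors add up to 13, or 14
  with the cross term; the lower bound on the squares and the factor 1/2 multiply this by 4.\<close>

lemma root_deviation:
  fixes p q \<kappa> D :: complex
  assumes e: "0 < e" "e \<le> 1 / 100"
    and pq: "cmod p * cmod q \<le> e * ((cmod p)\<^sup>2 + (cmod q)\<^sup>2)"
    and k: "\<kappa>\<^sup>2 = p\<^sup>2 * q\<^sup>2"
    and D: "cmod (D + (p\<^sup>2 + q\<^sup>2) / 2) \<le> 10 * e * (cmod (p\<^sup>2) + cmod (q\<^sup>2)) + 3 * cmod \<kappa>"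
  shows "cmod (D - (- (1 / 2) * (p + q)\<^sup>2)) \<le> 56 * e * cmod (- (1 / 2) * (p + q)\<^sup>2)"
    and "cmod (D - (- (1 / 2) * (p\<^sup>2 + q\<^sup>2))) \<le> 56 * e * cmod (- (1 / 2) * (p\<^sup>2 + q\<^sup>2))"
proof -
  define S where "S = (cmod p)\<^sup>2 + (cmod q)\<^sup>2"
  have "\<kappa> = p * q \<or> \<kappa> = - (p * q)" using k by (simp only: power_mult_distrib[symmetric] power2_eq_iff)
  hence kn: "cmod \<kappa> = cmod p * cmod q" by (auto simp: norm_mult)
  have n: "cmod (p\<^sup>2) + cmod (q\<^sup>2) = S" by (simp add: S_def norm_power)
  have eS: "e * S \<ge> 0" using e by (simp add: S_def)
  have pq': "cmod (p * q) \<le> e * S" using pq by (simp only: norm_mult S_def)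
  have D': "cmod (D + (p\<^sup>2 + q\<^sup>2) / 2) \<le> 13 * (e * S)"
    using D pq unfolding n kn S_def[symmetric] by argo
  have E1: "D - (- (1 / 2) * (p + q)\<^sup>2) = (D + (p\<^sup>2 + q\<^sup>2) / 2) + p * q"
    by (simp add: power2_sum field_simps)
  have N1: "cmod (- (1 / 2) * (p + q)\<^sup>2) = cmod ((p + q)\<^sup>2) / 2" by (simp add: norm_mult)
  have N2: "cmod (- (1 / 2) * (p\<^sup>2 + q\<^sup>2)) = cmod (p\<^sup>2 + q\<^sup>2) / 2" by (simp add: norm_mult)
  have "cmod (D - (- (1 / 2) * (p + q)\<^sup>2)) \<le> 14 * (e * S)"
    unfolding E1 using norm_triangle_ineq[of "D + (p\<^sup>2 + q\<^sup>2) / 2" "p * q"] D' pq' by argo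
  moreover have "e * S \<le> e * (2 * cmod ((p + q)\<^sup>2))"
    using square_sum_lower(1)[OF e(2) pq] e unfolding S_def by (intro mult_left_mono) auto
  ultimately show "cmod (D - (- (1 / 2) * (p + q)\<^sup>2)) \<le> 56 * e * cmod (- (1 / 2) * (p + q)\<^sup>2)"
    unfolding N1 by argo
  have E2: "D - (- (1 / 2) * (p\<^sup>2 + q\<^sup>2)) = D + (p\<^sup>2 + q\<^sup>2) / 2" by simp
  have "e * S \<le> e * (2 * cmod (p\<^sup>2 + q\<^sup>2))"
    using square_sum_lower(2)[OF e(2) pq] e unfolding S_def by (intro mult_left_mono) auto
  thus "cmod (D - (- (1 / 2) * (p\<^sup>2 + q\<^sup>2))) \<le> 56 * e * cmod (- (1 / 2) * (p\<^sup>2 + q\<^sup>2))"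
    unfolding N2 E2 using D' eS by argo
qed

theorem theorem23:
  fixes a b :: complex and R S d r s :: nat and v :: "real \<Rightarrow> complex"
  assumes "a \<noteq> 0" and "b \<noteq> 0"
    and "R > 0" and "S > 0" and "R \<noteq> S"
    and "R = d * r" and "S = d * s" and "coprime r s"
    and v: "v = two_term_potential a b R S"
  shows
    "(\<exists>sqb sqa :: nat \<Rightarrow> complex.
        (\<forall>m. (sqb m)\<^sup>2 = b ^ (r * m) \<and> (sqa m)\<^sup>2 = a ^ (s * m)) \<and>
        (\<lambda>m. hill_gamma v (m * d * s * r)) \<sim>[sequentially]
          (\<lambda>m. 8 * of_nat s * of_nat r * (of_nat d)\<^sup>2 * sqb m * sqa m /
                ((2 * of_nat d) ^ ((r + s) * m) * of_nat s ^ (r * m) * of_nat r ^ (s * m) *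
                 fact (r * m - 1) * fact (s * m - 1))) \<and>
        (\<lambda>m. hill_mu v (m * d * s * r) - hill_lambda_plus v (m * d * s * r)) \<sim>[sequentially]
          (\<lambda>m. - (1 / 2) *
             (2 * of_nat s * of_nat d * sqb m / ((2 * of_nat s * of_nat d) ^ (r * m) * fact (r * m - 1))
            + 2 * of_nat r * of_nat d * sqa m / ((2 * of_nat r * of_nat d) ^ (s * m) * fact (s * m - 1)))\<^sup>2) \<and>
        (\<lambda>m. hill_mu v (m * d * s * r) - hill_lambda_minus v (m * d * s * r)) \<sim>[sequentially]
          (\<lambda>m. - (1 / 2) *
             (2 * of_nat s * of_nat d * sqb m / ((2 * of_nat s * of_nat d) ^ (r * m) * fact (r * m - 1))
            - 2 * of_nat r * of_nat d * sqa m / ((2 * of_nat r * of_nat d) ^ (s * m) * fact (s * m - 1)))\<^sup>2)) \<and>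
     (\<lambda>m. hill_mu v (m * d * s * r)
            - 1 / 2 * (hill_lambda_minus v (m * d * s * r) + hill_lambda_plus v (m * d * s * r)))
       \<sim>[sequentially]
       (\<lambda>m. - (1 / 2) *
          (4 * (of_nat s)\<^sup>2 * (of_nat d)\<^sup>2 * b ^ (r * m) /
             ((4 * (of_nat s)\<^sup>2 * (of_nat d)\<^sup>2) ^ (r * m) * (fact (r * m - 1))\<^sup>2)
         + 4 * (of_nat r)\<^sup>2 * (of_nat d)\<^sup>2 * a ^ (s * m) /
             ((4 * (of_nat r)\<^sup>2 * (of_nat d)\<^sup>2) ^ (s * m) * (fact (s * m - 1))\<^sup>2)))"
proof -
  note ab = assms(1,2) and RS0 = assms(3,4) and RS = assms(6,7)
  have pos: "d > 0" "r > 0" "s > 0" and rs: "r \<noteq> s" using RS0 RS assms(5) by auto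
  have oS: "2 * of_nat s * of_nat d = (2 * of_nat S :: complex)"
    and oR: "2 * of_nat r * of_nat d = (2 * of_nat R :: complex)"
    and oS2: "4 * (of_nat s)\<^sup>2 * (of_nat d)\<^sup>2 = (4 * (of_nat S)\<^sup>2 :: complex)"
    and oR2: "4 * (of_nat r)\<^sup>2 * (of_nat d)\<^sup>2 = (4 * (of_nat R)\<^sup>2 :: complex)"
    unfolding RS by (simp_all add: power_mult_distrib mult_ac)
  define N where "N m = m * d * s * r" for m
  define P where "P w m = 2 * of_nat S * w / ((2 * of_nat S) ^ (r * m) * fact (r * m - 1))" for w :: complex and m
  define Q where "Q w m = 2 * of_nat R * w / ((2 * of_nat R) ^ (s * m) * fact (s * m - 1))" for w :: complex and m
  define sqa where "sqa m = csqrt (a ^ (s * m))" for m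
  define sqb0 where "sqb0 m = csqrt (b ^ (r * m))" for m
  \<comment> \<open>The gap is close to \<open>2 \<kappa>\<close> for an unknown
    \<open>\<kappa>\<close> among \<open>p q\<close> and \<open>- (p q)\<close>, possibly varying
    with \<open>m\<close>. Comparing the two distances fixes the sign of one square root so that
    \<open>2 p q\<close> is the nearer candidate.\<close>
  define sqb where "sqb m = (if cmod (hill_gamma v (N m) - 2 * (P (sqb0 m) m * Q (sqa m) m))
      \<le> cmod (hill_gamma v (N m) + 2 * (P (sqb0 m) m * Q (sqa m) m)) then sqb0 m else - sqb0 m)" for m
  have sq: "(sqb m)\<^sup>2 = b ^ (r * m)" "(sqa m)\<^sup>2 = a ^ (s * m)" for m
    by (simp_all add: sqb_def sqb0_def sqa_def)
  define p q where "p m = P (sqb m) m" and "q m = Q (sqa m) m" for m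
  have sgn: "cmod (hill_gamma v (N m) - 2 * (p m * q m)) \<le> cmod (hill_gamma v (N m) - 2 * z)"
    if "z = p m * q m \<or> z = - (p m * q m)" for z m
    using that by (auto simp: p_def q_def sqb_def P_def)
  \<comment> \<open>At \<open>m = 0\<close> the subtraction in \<open>r * m - 1\<close> truncates
    and the identities fail, so they hold only eventually.\<close>
  have K: "(p m)\<^sup>2 = hill_K b S (r * m)" "(q m)\<^sup>2 = hill_K a R (s * m)"
    "4 * (of_nat S)\<^sup>2 * b ^ (r * m) / ((4 * (of_nat S)\<^sup>2) ^ (r * m) * (fact (r * m - 1))\<^sup>2) = (p m)\<^sup>2"
    "4 * (of_nat R)\<^sup>2 * a ^ (s * m) / ((4 * (of_nat R)\<^sup>2) ^ (s * m) * (fact (s * m - 1))\<^sup>2) = (q m)\<^sup>2"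
    if "m > 0" for m
  proof -
    have M: "r * m > 0" "s * m > 0" using that pos by auto
    note 1 = hill_K_root[OF M(1) RS0(2) sq(1)] and 2 = hill_K_root[OF M(2) RS0(1) sq(2)]
    show "(p m)\<^sup>2 = hill_K b S (r * m)" "(q m)\<^sup>2 = hill_K a R (s * m)"
      unfolding p_def q_def P_def Q_def by (rule 1(1), rule 2(1))
    thus "4 * (of_nat S)\<^sup>2 * b ^ (r * m) / ((4 * (of_nat S)\<^sup>2) ^ (r * m) * (fact (r * m - 1))\<^sup>2) = (p m)\<^sup>2"
      "4 * (of_nat R)\<^sup>2 * a ^ (s * m) / ((4 * (of_nat R)\<^sup>2) ^ (s * m) * (fact (s * m - 1))\<^sup>2) = (q m)\<^sup>2"
      by (simp_all only: 1(2) 2(2))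
  qed
  have tg: "8 * of_nat s * of_nat r * (of_nat d)\<^sup>2 * sqb m * sqa m /
      ((2 * of_nat d) ^ ((r + s) * m) * of_nat s ^ (r * m) * of_nat r ^ (s * m) *
        fact (r * m - 1) * fact (s * m - 1)) = 2 * (p m * q m)" for m
    unfolding p_def q_def P_def Q_def RS
    by (simp add: power_mult_distrib power_add distrib_left distrib_right power2_eq_square mult_ac)
  have main: "\<forall>\<^sub>F m in sequentially.
      cmod (hill_gamma v (N m) - 2 * (p m * q m)) \<le> 56 * e * cmod (2 * (p m * q m)) \<and>
      cmod (hill_mu v (N m) - hill_lambda_plus v (N m) - (- (1 / 2) * (p m + q m)\<^sup>2)) \<le> 56 * e * cmod (- (1 / 2) * (p m + q m)\<^sup>2) \<and>
      cmod (hill_mu v (N m) - hill_lambda_minus v (N m) - (- (1 / 2) * (p m - q m)\<^sup>2)) \<le> 56 * e * cmod (- (1 / 2) * (p m - q m)\<^sup>2) \<and>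
      cmod (hill_mu v (N m) - 1 / 2 * (hill_lambda_minus v (N m) + hill_lambda_plus v (N m)) - (- (1 / 2) * ((p m)\<^sup>2 + (q m)\<^sup>2)))
        \<le> 56 * e * cmod (- (1 / 2) * ((p m)\<^sup>2 + (q m)\<^sup>2))"
    if e: "0 < e" "e \<le> 1 / 100" for e
    using eventually_eigenvalue_estimates[OF ab pos RS e, folded v N_def]
      eventually_product_small[OF ab RS0 pos(2,3) rs e(1)] eventually_gt_at_top[of 0]
  proof eventually_elim
    case (elim m)
    define \<mu> u l where "\<mu> = hill_mu v (N m)" and "u = hill_lambda_plus v (N m)" and "l = hill_lambda_minus v (N m)"
    note Km = K(1,2)[OF elim(3)]
    from elim(1) obtain \<kappa> where \<kappa>: "\<kappa>\<^sup>2 = (p m)\<^sup>2 * (q m)\<^sup>2" "cmod (hill_gamma v (N m) - 2 * \<kappa>) \<le> 9 * e * cmod \<kappa>"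
      "cmod (\<mu> - u + ((p m)\<^sup>2 + (q m)\<^sup>2) / 2) \<le> 10 * e * (cmod ((p m)\<^sup>2) + cmod ((q m)\<^sup>2)) + 3 * cmod \<kappa>"
      "cmod (\<mu> - l + ((p m)\<^sup>2 + (q m)\<^sup>2) / 2) \<le> 10 * e * (cmod ((p m)\<^sup>2) + cmod ((q m)\<^sup>2)) + 3 * cmod \<kappa>"
      unfolding Km[symmetric] \<mu>_def u_def l_def by (elim exE conjE)
    have pq: "cmod (p m) * cmod (q m) \<le> e * ((cmod (p m))\<^sup>2 + (cmod (q m))\<^sup>2)" using elim(2) Km by blast
    have kk: "\<kappa> = p m * q m \<or> \<kappa> = - (p m * q m)" using \<kappa>(1) by (simp only: power_mult_distrib[symmetric] power2_eq_iff)
    hence kn: "cmod (2 * (p m * q m)) = 2 * cmod \<kappa>" by (auto simp: norm_mult)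
    have "e * cmod \<kappa> \<ge> 0" using e by simp
    hence 1: "cmod (hill_gamma v (N m) - 2 * (p m * q m)) \<le> 56 * e * cmod (2 * (p m * q m))"
      using sgn[OF kk] \<kappa>(2) unfolding kn by argo
    note 2 = root_deviation(1)[OF e pq \<kappa>(1) \<kappa>(3)]
    \<comment> \<open>The other sign is free, since the hypotheses of \<open>root_deviation\<close>
      involve \<open>q\<close> only through its square and its modulus.\<close>
    have 3: "cmod (\<mu> - l - (- (1 / 2) * (p m - q m)\<^sup>2)) \<le> 56 * e * cmod (- (1 / 2) * (p m - q m)\<^sup>2)"
      using root_deviation(1)[OF e, of "p m" "- q m" \<kappa> "\<mu> - l"] pq \<kappa>(1,4) by (simp only: norm_minus_cancel power2_minus add_uminus_conv_diff)
    define mid where "mid = \<mu> - 1 / 2 * (l + u)"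
    have avg: "mid + ((p m)\<^sup>2 + (q m)\<^sup>2) / 2
        = ((\<mu> - u + ((p m)\<^sup>2 + (q m)\<^sup>2) / 2) + (\<mu> - l + ((p m)\<^sup>2 + (q m)\<^sup>2) / 2)) / 2"
      by (simp add: mid_def field_simps)
    \<comment> \<open>The bounds for the two eigenvalues have the same form, so their average
      satisfies it as well.\<close>
    have "cmod (mid + ((p m)\<^sup>2 + (q m)\<^sup>2) / 2) \<le> 10 * e * (cmod ((p m)\<^sup>2) + cmod ((q m)\<^sup>2)) + 3 * cmod \<kappa>"
      unfolding avg norm_divide norm_numeral
      using norm_triangle_ineq[of "\<mu> - u + ((p m)\<^sup>2 + (q m)\<^sup>2) / 2" "\<mu> - l + ((p m)\<^sup>2 + (q m)\<^sup>2) / 2"] \<kappa>(3,4) by argo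
    note 4 = root_deviation(2)[OF e pq \<kappa>(1) this]
    show ?case using 1 2 3 4 unfolding mid_def \<mu>_def u_def l_def by (intro conjI)
  qed
  have g: "(\<lambda>m. hill_gamma v (N m)) \<sim>[sequentially] (\<lambda>m. 2 * (p m * q m))"
    by (rule asymp_equiv_relative_error[of 56]) (simp, rule eventually_mono[OF main], assumption+, elim conjE)
  have up: "(\<lambda>m. hill_mu v (N m) - hill_lambda_plus v (N m)) \<sim>[sequentially] (\<lambda>m. - (1 / 2) * (p m + q m)\<^sup>2)"
    by (rule asymp_equiv_relative_error[of 56]) (simp, rule eventually_mono[OF main], assumption+, elim conjE)
  have lo: "(\<lambda>m. hill_mu v (N m) - hill_lambda_minus v (N m)) \<sim>[sequentially] (\<lambda>m. - (1 / 2) * (p m - q m)\<^sup>2)"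
    by (rule asymp_equiv_relative_error[of 56]) (simp, rule eventually_mono[OF main], assumption+, elim conjE)
  have "(\<lambda>m. hill_mu v (N m) - 1 / 2 * (hill_lambda_minus v (N m) + hill_lambda_plus v (N m)))
      \<sim>[sequentially] (\<lambda>m. - (1 / 2) * ((p m)\<^sup>2 + (q m)\<^sup>2))"
    by (rule asymp_equiv_relative_error[of 56]) (simp, rule eventually_mono[OF main], assumption+, elim conjE)
  moreover have "(\<lambda>m. - (1 / 2) * ((p m)\<^sup>2 + (q m)\<^sup>2)) \<sim>[sequentially]
      (\<lambda>m. - (1 / 2) * (4 * (of_nat S)\<^sup>2 * b ^ (r * m) / ((4 * (of_nat S)\<^sup>2) ^ (r * m) * (fact (r * m - 1))\<^sup>2)
        + 4 * (of_nat R)\<^sup>2 * a ^ (s * m) / ((4 * (of_nat R)\<^sup>2) ^ (s * m) * (fact (s * m - 1))\<^sup>2)))"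
    by (rule asymp_equiv_refl_ev, rule eventually_mono[OF eventually_gt_at_top[of 0]]) (simp only: K(3,4))
  ultimately have mid: "(\<lambda>m. hill_mu v (N m) - 1 / 2 * (hill_lambda_minus v (N m) + hill_lambda_plus v (N m))) \<sim>[sequentially]
      (\<lambda>m. - (1 / 2) * (4 * (of_nat S)\<^sup>2 * b ^ (r * m) / ((4 * (of_nat S)\<^sup>2) ^ (r * m) * (fact (r * m - 1))\<^sup>2)
        + 4 * (of_nat R)\<^sup>2 * a ^ (s * m) / ((4 * (of_nat R)\<^sup>2) ^ (s * m) * (fact (s * m - 1))\<^sup>2)))"
    by (rule asymp_equiv_trans)
  show ?thesis unfolding oS oR oS2 oR2 N_def[symmetric]
  proof (rule conjI[OF _ mid], rule exI[of _ sqb], rule exI[of _ sqa], intro conjI)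
    show "\<forall>m. (sqb m)\<^sup>2 = b ^ (r * m) \<and> (sqa m)\<^sup>2 = a ^ (s * m)" using sq by (intro allI conjI)
    show "(\<lambda>m. hill_gamma v (N m)) \<sim>[sequentially]
          (\<lambda>m. 8 * of_nat s * of_nat r * (of_nat d)\<^sup>2 * sqb m * sqa m /
                ((2 * of_nat d) ^ ((r + s) * m) * of_nat s ^ (r * m) * of_nat r ^ (s * m) *
                 fact (r * m - 1) * fact (s * m - 1)))"
      unfolding tg by (rule g)
    show "(\<lambda>m. hill_mu v (N m) - hill_lambda_plus v (N m)) \<sim>[sequentially]
          (\<lambda>m. - (1 / 2) * (2 * of_nat S * sqb m / ((2 * of_nat S) ^ (r * m) * fact (r * m - 1))
            + 2 * of_nat R * sqa m / ((2 * of_nat R) ^ (s * m) * fact (s * m - 1)))\<^sup>2)"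
      using up unfolding p_def q_def P_def Q_def .
    show "(\<lambda>m. hill_mu v (N m) - hill_lambda_minus v (N m)) \<sim>[sequentially]
          (\<lambda>m. - (1 / 2) * (2 * of_nat S * sqb m / ((2 * of_nat S) ^ (r * m) * fact (r * m - 1))
            - 2 * of_nat R * sqa m / ((2 * of_nat R) ^ (s * m) * fact (s * m - 1)))\<^sup>2)"
      using lo unfolding p_def q_def P_def Q_def .
  qed
qed

end
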